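(* Let $\Lambda$ be a basic finite dimensional algebra over an algebraically closed field $K$ whose Jacobson radical $J$ satisfies $J^2=0$. Then the following conditions are equivalent: (1) $\Lambda$ has the dense orbit property. (2) For every dimension vector $\mathbf d$, any irreducible component of $\mathbf{Rep}_{\mathbf d}(\Lambda)$ which contains an indecomposable module has a dense orbit. (3) $\Lambda$ has finite representation type.
   Context: Write $\Lambda=KQ/I$ with $Q$ a finite quiver with $n$ vertices and arrow set $Q_1$, and $I$ an admissible ideal. For $\mathbf d=(d_1,\dots,d_n)$, $\mathbf{Rep}_{\mathbf d}(\Lambda)$ is the affine variety of tuples $(x_\alpha)_{\alpha\in Q_1}\in\prod_\alpha \operatorname{Hom}_K(K^{d_{\mathrm{start}(\alpha)}},K^{d_{\mathrm{end}(\alpha)}})$ satisfying all relations in $I$, with the conjugation action of $\operatorname{GL}(\mathbf d)=\prod_i\operatorname{GL}_{d_i}(K)$; orbits correspond to isomorphism classes of left $\Lambda$-modules with dimension vector $\mathbf d$. A subset contains a module if it contains a point corresponding to that module. "Orbit" means $\operatorname{GL}(\mathbf d)$-orbit. $\Lambda$ has the dense orbit property if, for every dimension vector $\mathbf d$, each irreducible component of $\mathbf{Rep}_{\mathbf d}(\Lambda)$ contains a dense $\operatorname{GL}(\mathbf d)$-orbit (equivalently, is the closure of a single orbit). Finite representation type means that there are only finitely many isomorphism classes of finite dimensional indecomposable left $\Lambda$-modules. *)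

theory Defs
  imports
    "HOL-Algebra.QuotRing"
    "HOL-Algebra.Ideal_Product"
    "HOL-Analysis.Abstract_Topology"
    "HOL-Computational_Algebra.Polynomial"
    "Graph_Theory.Arc_Walk"
    "Jordan_Normal_Form.Matrix"
begin

section \<open>Rings and left modules\<close>

text \<open>The locale \<^locale>\<open>module\<close> of HOL-Algebra requires a commutative ring of scalars, and
  \<^const>\<open>maximalideal\<close> concerns two-sided ideals; here are the one-sided notions over an arbitrary
  ring.\<close>

locale left_module = R?: ring R + M?: abelian_group M for R (structure) and M (structure) +
  assumes smult_closed: "\<lbrakk>a \<in> carrier R; x \<in> carrier M\<rbrakk> \<Longrightarrow> a \<odot>\<^bsub>M\<^esub> x \<in> carrier M"
    and smult_l_distr: "\<lbrakk>a \<in> carrier R; b \<in> carrier R; x \<in> carrier M\<rbrakk> \<Longrightarrow>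
      (a \<oplus> b) \<odot>\<^bsub>M\<^esub> x = a \<odot>\<^bsub>M\<^esub> x \<oplus>\<^bsub>M\<^esub> b \<odot>\<^bsub>M\<^esub> x"
    and smult_r_distr: "\<lbrakk>a \<in> carrier R; x \<in> carrier M; y \<in> carrier M\<rbrakk> \<Longrightarrow>
      a \<odot>\<^bsub>M\<^esub> (x \<oplus>\<^bsub>M\<^esub> y) = a \<odot>\<^bsub>M\<^esub> x \<oplus>\<^bsub>M\<^esub> a \<odot>\<^bsub>M\<^esub> y"
    and smult_assoc: "\<lbrakk>a \<in> carrier R; b \<in> carrier R; x \<in> carrier M\<rbrakk> \<Longrightarrow>
      (a \<otimes> b) \<odot>\<^bsub>M\<^esub> x = a \<odot>\<^bsub>M\<^esub> (b \<odot>\<^bsub>M\<^esub> x)"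
    and smult_one: "x \<in> carrier M \<Longrightarrow> \<one> \<odot>\<^bsub>M\<^esub> x = x"

definition left_ideal :: "'r set \<Rightarrow> ('r, 'm) ring_scheme \<Rightarrow> bool" where
  "left_ideal L R \<longleftrightarrow>
     subgroup L (add_monoid R) \<and> (\<forall>a\<in>carrier R. \<forall>x\<in>L. a \<otimes>\<^bsub>R\<^esub> x \<in> L)"

definition maximal_left_ideal :: "'r set \<Rightarrow> ('r, 'm) ring_scheme \<Rightarrow> bool" where
  "maximal_left_ideal L R \<longleftrightarrow> left_ideal L R \<and> L \<noteq> carrier R \<and>
     (\<forall>L'. left_ideal L' R \<and> L \<subseteq> L' \<longrightarrow> L' = L \<or> L' = carrier R)"

definition jacobson_radical :: "('r, 'm) ring_scheme \<Rightarrow> 'r set" where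
  "jacobson_radical R = carrier R \<inter> \<Inter>{L. maximal_left_ideal L R}"

definition indecomposable_module ::
  "('r, 'm) ring_scheme \<Rightarrow> ('r, 'w, 'n) module_scheme \<Rightarrow> bool" where
  "indecomposable_module R M \<longleftrightarrow> left_module R M \<and> carrier M \<noteq> {\<zero>\<^bsub>M\<^esub>} \<and>
     (\<forall>U V. submodule U R M \<and> submodule V R M \<and> U \<inter> V = {\<zero>\<^bsub>M\<^esub>} \<and> U <+>\<^bsub>M\<^esub> V = carrier M \<longrightarrow>
        U = {\<zero>\<^bsub>M\<^esub>} \<or> V = {\<zero>\<^bsub>M\<^esub>})"

definition module_iso ::
  "('r, 'm) ring_scheme \<Rightarrow> ('r, 'w, 'n) module_scheme \<Rightarrow> ('r, 'u, 'l) module_scheme \<Rightarrow> bool" where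
  "module_iso R M N \<longleftrightarrow> (\<exists>h. bij_betw h (carrier M) (carrier N) \<and>
     (\<forall>x\<in>carrier M. \<forall>y\<in>carrier M. h (x \<oplus>\<^bsub>M\<^esub> y) = h x \<oplus>\<^bsub>N\<^esub> h y) \<and>
     (\<forall>a\<in>carrier R. \<forall>x\<in>carrier M. h (a \<odot>\<^bsub>M\<^esub> x) = a \<odot>\<^bsub>N\<^esub> h x))"


section \<open>Path algebras and their admissible quotients\<close>

text \<open>A quiver is a directed multigraph. A path is a pair of its starting vertex and the list of
  its arrows in the order in which they are traversed; \<open>(u, [])\<close> is the path of length 0 at \<open>u\<close>.\<close>

type_synonym ('v, 'a) path = "'v \<times> 'a list"

definition walk_end :: "('v, 'a) pre_digraph \<Rightarrow> 'v \<Rightarrow> 'a list \<Rightarrow> 'v" where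
  "walk_end Q u p = last (pre_digraph.awalk_verts Q u p)"

definition paths :: "('v, 'a) pre_digraph \<Rightarrow> ('v, 'a) path set" where
  "paths Q = {(u, p). \<exists>v. pre_digraph.awalk Q u p v}"

text \<open>Elements are the finitely supported coefficient functions on paths. The product \<open>f g\<close> of
  paths means first \<open>g\<close>, then \<open>f\<close>, which is the convention for which representations are left
  modules.\<close>

definition path_algebra :: "('v, 'a) pre_digraph \<Rightarrow> (('v, 'a) path \<Rightarrow> 'k::field) ring" where
  "path_algebra Q =
    \<lparr> carrier = {f. finite {\<pi>. f \<pi> \<noteq> 0} \<and> {\<pi>. f \<pi> \<noteq> 0} \<subseteq> paths Q},
      monoid.mult = (\<lambda>f g. \<lambda>(u, p). \<Sum>k\<le>length p.
                f (walk_end Q u (take k p), drop k p) * g (u, take k p)),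
      one = (\<lambda>(u, p). if u \<in> verts Q \<and> p = [] then 1 else 0),
      zero = (\<lambda>_. 0),
      add = (\<lambda>f g \<pi>. f \<pi> + g \<pi>) \<rparr>"

lemma walk_end_Nil: "walk_end Q u [] = u"
  by (simp add: walk_end_def pre_digraph.awalk_verts.simps)

lemma walk_end_Cons: "walk_end Q u (\<alpha> # p) = walk_end Q (head Q \<alpha>) p"
  by (simp add: walk_end_def pre_digraph.awalk_verts.simps pre_digraph.awalk_verts_non_Nil)

lemma walk_end_append: "walk_end Q u (p @ q) = walk_end Q (walk_end Q u p) q"
  by (induction p arbitrary: u) (simp_all add: walk_end_Nil walk_end_Cons)

lemma paths_Nil: "wf_digraph Q \<Longrightarrow> (u, []) \<in> paths Q \<longleftrightarrow> u \<in> verts Q"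
  unfolding paths_def mem_Collect_eq case_prod_conv by (metis wf_digraph.awalk_Nil_iff)

lemma paths_Cons: "wf_digraph Q \<Longrightarrow>
  (u, \<alpha> # p) \<in> paths Q \<longleftrightarrow> \<alpha> \<in> arcs Q \<and> u = tail Q \<alpha> \<and> (head Q \<alpha>, p) \<in> paths Q"
  unfolding paths_def mem_Collect_eq case_prod_conv by (metis wf_digraph.awalk_Cons_iff)

lemma paths_start: "(u, p) \<in> paths Q \<Longrightarrow> u \<in> verts Q"
  by (auto simp: paths_def pre_digraph.awalk_def)

lemma paths_append:
  assumes "wf_digraph Q"
  shows "(u, p @ q) \<in> paths Q \<longleftrightarrow> (u, p) \<in> paths Q \<and> (walk_end Q u p, q) \<in> paths Q"
  by (induction p arbitrary: u)
    (auto simp: paths_Nil[OF assms] paths_Cons[OF assms] walk_end_Nil walk_end_Cons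
      dest: paths_start)

lemma path_algebra_mult_closed:
  assumes "wf_digraph Q" "f \<in> carrier (path_algebra Q)" "g \<in> carrier (path_algebra Q)"
  shows "f \<otimes>\<^bsub>path_algebra Q\<^esub> g \<in> carrier (path_algebra Q)"
proof -
  let ?h = "f \<otimes>\<^bsub>path_algebra Q\<^esub> g"
  let ?A = "{\<pi>. f \<pi> \<noteq> 0}" and ?B = "{\<pi>. g \<pi> \<noteq> 0}"
  have fin: "finite ?A" "finite ?B" and sub: "?A \<subseteq> paths Q" "?B \<subseteq> paths Q"
    using assms(2,3) by (simp_all add: path_algebra_def)
  have *: "\<exists>q r. p = q @ r \<and> (u, q) \<in> ?B \<and> (walk_end Q u q, r) \<in> ?A" if "?h (u, p) \<noteq> 0" for u p
  proof -
    from that have "(\<Sum>k\<le>length p. f (walk_end Q u (take k p), drop k p) * g (u, take k p)) \<noteq> 0"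
      by (simp add: path_algebra_def)
    then obtain k where "f (walk_end Q u (take k p), drop k p) * g (u, take k p) \<noteq> 0"
      by (rule sum.not_neutral_contains_not_neutral)
    then show ?thesis by (intro exI[of _ "take k p"] exI[of _ "drop k p"]) auto
  qed
  have "{\<pi>. ?h \<pi> \<noteq> 0} \<subseteq> (\<lambda>(a, b). (fst b, snd b @ snd a)) ` (?A \<times> ?B)"
  proof
    fix \<pi> assume "\<pi> \<in> {\<pi>. ?h \<pi> \<noteq> 0}"
    then obtain u p where "\<pi> = (u, p)" "?h (u, p) \<noteq> 0" by (cases \<pi>) simp
    with *[OF this(2)] show "\<pi> \<in> (\<lambda>(a, b). (fst b, snd b @ snd a)) ` (?A \<times> ?B)" by force
  qed
  then have 1: "finite {\<pi>. ?h \<pi> \<noteq> 0}" using fin by (meson finite_SigmaI finite_imageI finite_subset)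
  have 2: "{\<pi>. ?h \<pi> \<noteq> 0} \<subseteq> paths Q"
  proof
    fix \<pi> assume "\<pi> \<in> {\<pi>. ?h \<pi> \<noteq> 0}"
    then obtain u p where up: "\<pi> = (u, p)" "?h (u, p) \<noteq> 0" by (cases \<pi>) simp
    obtain q r where "p = q @ r" "(u, q) \<in> ?B" "(walk_end Q u q, r) \<in> ?A" using *[OF up(2)] by blast
    then show "\<pi> \<in> paths Q" using sub up(1) paths_append[OF assms(1)] by blast
  qed
  from 1 2 show ?thesis by (simp add: path_algebra_def)
qed

lemma path_algebra_mult_assoc:
  "(f \<otimes>\<^bsub>path_algebra Q\<^esub> g) \<otimes>\<^bsub>path_algebra Q\<^esub> h = f \<otimes>\<^bsub>path_algebra Q\<^esub> (g \<otimes>\<^bsub>path_algebra Q\<^esub> h)"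
proof
  fix \<pi> :: "('a, 'b) path"
  obtain u p where \<pi>: "\<pi> = (u, p)" by (cases \<pi>)
  let ?F = "\<lambda>j k. f (walk_end Q u (take k p), drop k p)
    * g (walk_end Q u (take j p), drop j (take k p)) * h (u, take j p)"
  have "((f \<otimes>\<^bsub>path_algebra Q\<^esub> g) \<otimes>\<^bsub>path_algebra Q\<^esub> h) \<pi> =
      (\<Sum>j\<le>length p. \<Sum>i\<le>length p - j. ?F j (i + j))"
    unfolding \<pi> path_algebra_def
    by (simp add: sum_distrib_right walk_end_append[symmetric] take_add[symmetric]
        drop_take add.commute)
  also have "\<dots> = (\<Sum>j\<le>length p. \<Sum>k=j..length p. ?F j k)"
  proof (rule sum.cong[OF refl])
    fix j assume "j \<in> {..length p}"
    then show "(\<Sum>i\<le>length p - j. ?F j (i + j)) = (\<Sum>k=j..length p. ?F j k)"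
      by (intro sum.reindex_bij_witness[of _ "\<lambda>k. k - j" "\<lambda>i. i + j"]) auto
  qed
  also have "\<dots> = (\<Sum>k\<le>length p. \<Sum>j\<le>k. ?F j k)"
    unfolding sum.Sigma[OF finite_atMost ballI[OF finite_atLeastAtMost]]
      sum.Sigma[OF finite_atMost ballI[OF finite_atMost]]
    by (rule sum.reindex_bij_witness[of _ "\<lambda>(a, b). (b, a)" "\<lambda>(a, b). (b, a)"]) auto
  also have "\<dots> = (f \<otimes>\<^bsub>path_algebra Q\<^esub> (g \<otimes>\<^bsub>path_algebra Q\<^esub> h)) \<pi>"
    unfolding \<pi> path_algebra_def
    by (auto simp: sum_distrib_left mult.assoc min_absorb2 intro!: sum.cong)
  finally show "((f \<otimes>\<^bsub>path_algebra Q\<^esub> g) \<otimes>\<^bsub>path_algebra Q\<^esub> h) \<pi> =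
    (f \<otimes>\<^bsub>path_algebra Q\<^esub> (g \<otimes>\<^bsub>path_algebra Q\<^esub> h)) \<pi>" .
qed

lemma ring_path_algebra:
  assumes "fin_digraph Q"
  shows "ring (path_algebra Q :: (('v, 'a) path \<Rightarrow> 'k::field) ring)" (is "ring ?A")
proof (rule ringI)
  interpret fin_digraph Q by fact
  show "abelian_group ?A"
  proof (rule abelian_groupI)
    fix f g assume fg: "f \<in> carrier ?A" "g \<in> carrier ?A"
    have "{\<pi>. f \<pi> + g \<pi> \<noteq> 0} \<subseteq> {\<pi>. f \<pi> \<noteq> 0} \<union> {\<pi>. g \<pi> \<noteq> 0}" by auto
    moreover have "finite ({\<pi>. f \<pi> \<noteq> 0} \<union> {\<pi>. g \<pi> \<noteq> 0})"
      and "{\<pi>. f \<pi> \<noteq> 0} \<union> {\<pi>. g \<pi> \<noteq> 0} \<subseteq> paths Q"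
      using fg by (auto simp: path_algebra_def)
    ultimately have "finite {\<pi>. f \<pi> + g \<pi> \<noteq> 0} \<and> {\<pi>. f \<pi> + g \<pi> \<noteq> 0} \<subseteq> paths Q"
      by (meson finite_subset subset_trans)
    then show "f \<oplus>\<^bsub>?A\<^esub> g \<in> carrier ?A" by (simp add: path_algebra_def)
  next
    fix f assume f: "f \<in> carrier ?A"
    show "\<exists>g\<in>carrier ?A. g \<oplus>\<^bsub>?A\<^esub> f = \<zero>\<^bsub>?A\<^esub>"
      by (rule bexI[of _ "\<lambda>\<pi>. - f \<pi>"]) (use f in \<open>auto simp: path_algebra_def\<close>)
  qed (auto simp: path_algebra_def add.assoc add.commute)
  show "Group.monoid ?A"
  proof (rule monoidI)
    have "{\<pi>. \<one>\<^bsub>?A\<^esub> \<pi> \<noteq> 0} = (\<lambda>u. (u, [])) ` verts Q"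
      by (auto simp: path_algebra_def split: if_splits)
    moreover have "\<dots> \<subseteq> paths Q" using paths_Nil[OF wf_digraph_axioms] by auto
    ultimately show "\<one>\<^bsub>?A\<^esub> \<in> carrier ?A"
      using finite_verts by (simp add: path_algebra_def)
  next
    fix f assume f: "f \<in> carrier ?A"
    have path: "(u, p) \<in> paths Q" if "f (u, p) \<noteq> 0" for u p
      using f that by (auto simp: path_algebra_def)
    have one: "\<one>\<^bsub>?A\<^esub> (v, q) = (if v \<in> verts Q \<and> q = [] then 1 else 0)" for v q
      by (simp add: path_algebra_def)
    have end_verts: "walk_end Q u p \<in> verts Q" if "(u, p) \<in> paths Q" for u p
      using that paths_append[OF wf_digraph_axioms, of u p "[]"]
      by (simp add: paths_Nil[OF wf_digraph_axioms])
    show "\<one>\<^bsub>?A\<^esub> \<otimes>\<^bsub>?A\<^esub> f = f"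
    proof
      fix \<pi> :: "('v, 'a) path" obtain u p where \<pi>: "\<pi> = (u, p)" by (cases \<pi>)
      have "(\<one>\<^bsub>?A\<^esub> \<otimes>\<^bsub>?A\<^esub> f) \<pi> =
          (\<Sum>k\<le>length p. \<one>\<^bsub>?A\<^esub> (walk_end Q u (take k p), drop k p) * f (u, take k p))"
        by (simp add: \<pi> path_algebra_def)
      also have "\<dots> = (\<Sum>k\<in>{length p}. f (u, p))"
        by (rule sum.mono_neutral_cong_right) (use path end_verts in \<open>auto simp: one\<close>)
      finally show "(\<one>\<^bsub>?A\<^esub> \<otimes>\<^bsub>?A\<^esub> f) \<pi> = f \<pi>" by (simp add: \<pi>)
    qed
    show "f \<otimes>\<^bsub>?A\<^esub> \<one>\<^bsub>?A\<^esub> = f"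
    proof
      fix \<pi> :: "('v, 'a) path" obtain u p where \<pi>: "\<pi> = (u, p)" by (cases \<pi>)
      have "(f \<otimes>\<^bsub>?A\<^esub> \<one>\<^bsub>?A\<^esub>) \<pi> =
          (\<Sum>k\<le>length p. f (walk_end Q u (take k p), drop k p) * \<one>\<^bsub>?A\<^esub> (u, take k p))"
        by (simp add: \<pi> path_algebra_def)
      also have "\<dots> = (\<Sum>k\<in>{0::nat}. f (u, p))"
      proof (rule sum.mono_neutral_cong_right)
        show "f (walk_end Q u (take k p), drop k p) * \<one>\<^bsub>?A\<^esub> (u, take k p) = f (u, p)"
          if "k \<in> {0}" for k :: nat
          using that paths_start[OF path, of u p] by (auto simp: one walk_end_Nil)
      qed (auto simp: one)
      finally show "(f \<otimes>\<^bsub>?A\<^esub> \<one>\<^bsub>?A\<^esub>) \<pi> = f \<pi>" by (simp add: \<pi>)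
    qed
  qed (use path_algebra_mult_closed[OF wf_digraph_axioms] path_algebra_mult_assoc in \<open>auto\<close>)
qed (auto simp: path_algebra_def distrib_left distrib_right sum.distrib)

text \<open>The \<open>m\<close>-th power of the ideal generated by the arrows has the paths of length at least \<open>m\<close>
  as a basis.\<close>

definition arrow_ideal_power ::
  "('v, 'a) pre_digraph \<Rightarrow> nat \<Rightarrow> (('v, 'a) path \<Rightarrow> 'k::field) set" where
  "arrow_ideal_power Q m =
     {f \<in> carrier (path_algebra Q). \<forall>u p. f (u, p) \<noteq> 0 \<longrightarrow> m \<le> length p}"

definition admissible_ideal ::
  "('v, 'a) pre_digraph \<Rightarrow> (('v, 'a) path \<Rightarrow> 'k::field) set \<Rightarrow> bool" where
  "admissible_ideal Q I \<longleftrightarrow> ideal I (path_algebra Q) \<and> I \<subseteq> arrow_ideal_power Q 2 \<and>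
     (\<exists>m\<ge>2. arrow_ideal_power Q m \<subseteq> I)"

definition quiver_algebra ::
  "('v, 'a) pre_digraph \<Rightarrow> (('v, 'a) path \<Rightarrow> 'k::field) set \<Rightarrow> (('v, 'a) path \<Rightarrow> 'k) set ring" where
  "quiver_algebra Q I = path_algebra Q Quot I"

definition quiver_algebra_scalar ::
  "('v, 'a) pre_digraph \<Rightarrow> (('v, 'a) path \<Rightarrow> 'k::field) set \<Rightarrow> 'k \<Rightarrow> (('v, 'a) path \<Rightarrow> 'k) set" where
  "quiver_algebra_scalar Q I c = I +>\<^bsub>path_algebra Q\<^esub> (\<lambda>\<pi>. c * \<one>\<^bsub>path_algebra Q\<^esub> \<pi>)"

text \<open>Finite dimensionality refers to the action of the field through its image in the algebra.\<close>

definition finite_dim_module ::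
  "('v, 'a) pre_digraph \<Rightarrow> (('v, 'a) path \<Rightarrow> 'k::field) set
    \<Rightarrow> ((('v, 'a) path \<Rightarrow> 'k) set, 'w, 'n) module_scheme \<Rightarrow> bool" where
  "finite_dim_module Q I M \<longleftrightarrow> left_module (quiver_algebra Q I) M \<and>
     (\<exists>B. finite B \<and> B \<subseteq> carrier M \<and>
        (\<forall>w\<in>carrier M. \<exists>c. w = (\<Oplus>\<^bsub>M\<^esub>b\<in>B. quiver_algebra_scalar Q I (c b) \<odot>\<^bsub>M\<^esub> b)))"

text \<open>Isomorphism classes are formed among modules whose carrier is a subset of the type of vectors
  over \<open>K\<close>. This is no restriction: every finite dimensional module is isomorphic to one on \<open>K\<^sup>m\<close>.\<close>

definition finite_dim_indecomposables ::
  "('v, 'a) pre_digraph \<Rightarrow> (('v, 'a) path \<Rightarrow> 'k::field) set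
    \<Rightarrow> ((('v, 'a) path \<Rightarrow> 'k) set, 'k vec) module set" where
  "finite_dim_indecomposables Q I =
     {M. finite_dim_module Q I M \<and> indecomposable_module (quiver_algebra Q I) M}"

definition finite_representation_type ::
  "('v, 'a) pre_digraph \<Rightarrow> (('v, 'a) path \<Rightarrow> 'k::field) set \<Rightarrow> bool" where
  "finite_representation_type Q I \<longleftrightarrow>
     finite (finite_dim_indecomposables Q I //
       {(M, N). M \<in> finite_dim_indecomposables Q I \<and> N \<in> finite_dim_indecomposables Q I \<and>
          module_iso (quiver_algebra Q I) M N})"


section \<open>Representation varieties\<close>

text \<open>Only the values of a dimension vector on the vertices of the quiver, and the values of a
  tuple of matrices on its arrows, are relevant; the latter are extensional functions.\<close>

definition rep_space ::
  "('v, 'a) pre_digraph \<Rightarrow> ('v \<Rightarrow> nat) \<Rightarrow> ('a \<Rightarrow> 'k::field mat) set" where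
  "rep_space Q d = (\<Pi>\<^sub>E \<alpha>\<in>arcs Q. carrier_mat (d (head Q \<alpha>)) (d (tail Q \<alpha>)))"

fun path_matrix ::
  "('v, 'a) pre_digraph \<Rightarrow> ('v \<Rightarrow> nat) \<Rightarrow> ('a \<Rightarrow> 'k::field mat) \<Rightarrow> 'v \<Rightarrow> 'a list \<Rightarrow> 'k mat" where
  "path_matrix Q d x u [] = 1\<^sub>m (d u)"
| "path_matrix Q d x u (\<alpha> # p) = path_matrix Q d x (head Q \<alpha>) p * x \<alpha>"

text \<open>The \<open>u\<close>-\<open>v\<close>-block of the action of a path algebra element \<open>f\<close>: the sum of \<open>f \<pi>\<close> times the
  matrix of \<open>\<pi>\<close> over the paths \<open>\<pi>\<close> from \<open>u\<close> to \<open>v\<close>.\<close>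

definition block_matrix ::
  "('v, 'a) pre_digraph \<Rightarrow> ('v \<Rightarrow> nat) \<Rightarrow> ('a \<Rightarrow> 'k::field mat) \<Rightarrow> (('v, 'a) path \<Rightarrow> 'k)
    \<Rightarrow> 'v \<Rightarrow> 'v \<Rightarrow> 'k mat" where
  "block_matrix Q d x f u v = mat (d v) (d u) (\<lambda>ij.
     \<Sum>p | pre_digraph.awalk Q u p v \<and> f (u, p) \<noteq> 0. f (u, p) * path_matrix Q d x u p $$ ij)"

definition Rep ::
  "('v, 'a) pre_digraph \<Rightarrow> (('v, 'a) path \<Rightarrow> 'k::field) set \<Rightarrow> ('v \<Rightarrow> nat)
    \<Rightarrow> ('a \<Rightarrow> 'k mat) set" where
  "Rep Q I d = {x \<in> rep_space Q d. \<forall>f\<in>I. \<forall>u\<in>verts Q. \<forall>v\<in>verts Q.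
     block_matrix Q d x f u v = 0\<^sub>m (d v) (d u)}"

text \<open>The module corresponding to a point \<open>x\<close>, with underlying space the direct sum over the
  vertices \<open>v\<close> of \<open>K\<^bsup>d v\<^esup>\<close>. For \<open>x \<in> Rep Q I d\<close> all representatives of a coset act in the
  same way. The multiplicative structure is a dummy, as \<^typ>\<open>('r, 'w) module\<close> extends
  \<^typ>\<open>'w ring\<close>.\<close>

definition path_algebra_action ::
  "('v, 'a) pre_digraph \<Rightarrow> ('v \<Rightarrow> nat) \<Rightarrow> ('a \<Rightarrow> 'k::field mat) \<Rightarrow> (('v, 'a) path \<Rightarrow> 'k)
    \<Rightarrow> ('v \<Rightarrow> 'k vec) \<Rightarrow> 'v \<Rightarrow> 'k vec" where
  "path_algebra_action Q d x f w = (\<lambda>v\<in>verts Q.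
     vec (d v) (\<lambda>i. \<Sum>u\<in>verts Q. (block_matrix Q d x f u v *\<^sub>v w u) $ i))"

definition rep_module ::
  "('v, 'a) pre_digraph \<Rightarrow> ('v \<Rightarrow> nat) \<Rightarrow> ('a \<Rightarrow> 'k::field mat)
    \<Rightarrow> ((('v, 'a) path \<Rightarrow> 'k) set, 'v \<Rightarrow> 'k vec) module" where
  "rep_module Q d x =
    \<lparr> carrier = (\<Pi>\<^sub>E v\<in>verts Q. carrier_vec (d v)),
      monoid.mult = (\<lambda>_ _. undefined),
      one = undefined,
      zero = (\<lambda>v\<in>verts Q. 0\<^sub>v (d v)),
      add = (\<lambda>w w'. \<lambda>v\<in>verts Q. w v + w' v),
      smult = (\<lambda>X w. the_elem ((\<lambda>f. path_algebra_action Q d x f w) ` X)) \<rparr>"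

definition GL :: "('v, 'a) pre_digraph \<Rightarrow> ('v \<Rightarrow> nat) \<Rightarrow> ('v \<Rightarrow> 'k::field mat) set" where
  "GL Q d = (\<Pi>\<^sub>E v\<in>verts Q. Units (ring_mat TYPE('k) (d v) ()))"

definition GL_action ::
  "('v, 'a) pre_digraph \<Rightarrow> ('v \<Rightarrow> nat) \<Rightarrow> ('v \<Rightarrow> 'k::field mat) \<Rightarrow> ('a \<Rightarrow> 'k mat)
    \<Rightarrow> 'a \<Rightarrow> 'k mat" where
  "GL_action Q d g x = (\<lambda>\<alpha>\<in>arcs Q.
     g (head Q \<alpha>) * x \<alpha> * inv\<^bsub>ring_mat TYPE('k) (d (tail Q \<alpha>)) ()\<^esub> g (tail Q \<alpha>))"

definition GL_orbit ::
  "('v, 'a) pre_digraph \<Rightarrow> ('v \<Rightarrow> nat) \<Rightarrow> ('a \<Rightarrow> 'k::field mat) \<Rightarrow> ('a \<Rightarrow> 'k mat) set" where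
  "GL_orbit Q d x = (\<lambda>g. GL_action Q d g x) ` GL Q d"


section \<open>The Zariski topology\<close>

text \<open>The polynomial functions in the matrix entries.\<close>

inductive_set rep_polys ::
  "('v, 'a) pre_digraph \<Rightarrow> ('v \<Rightarrow> nat) \<Rightarrow> (('a \<Rightarrow> 'k::field mat) \<Rightarrow> 'k) set"
  for Q d where
  const: "(\<lambda>x. c) \<in> rep_polys Q d"
| coord: "\<lbrakk>\<alpha> \<in> arcs Q; i < d (head Q \<alpha>); j < d (tail Q \<alpha>)\<rbrakk> \<Longrightarrow>
            (\<lambda>x. x \<alpha> $$ (i, j)) \<in> rep_polys Q d"
| plus: "\<lbrakk>f \<in> rep_polys Q d; g \<in> rep_polys Q d\<rbrakk> \<Longrightarrow> (\<lambda>x. f x + g x) \<in> rep_polys Q d"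
| times: "\<lbrakk>f \<in> rep_polys Q d; g \<in> rep_polys Q d\<rbrakk> \<Longrightarrow> (\<lambda>x. f x * g x) \<in> rep_polys Q d"

definition zariski ::
  "('v, 'a) pre_digraph \<Rightarrow> (('v, 'a) path \<Rightarrow> 'k::field) set \<Rightarrow> ('v \<Rightarrow> nat)
    \<Rightarrow> ('a \<Rightarrow> 'k mat) topology" where
  "zariski Q I d = topology (\<lambda>U. \<exists>F \<subseteq> rep_polys Q d. U = Rep Q I d - {x. \<forall>f\<in>F. f x = 0})"

lemma istopology_zariski:
  fixes I :: "(('v, 'a) path \<Rightarrow> 'k::field) set"
  shows "istopology (\<lambda>U. \<exists>F \<subseteq> rep_polys Q d. U = Rep Q I d - {x. \<forall>f\<in>F. f x = 0})"
proof -
  define P where "P U \<longleftrightarrow> (\<exists>F \<subseteq> rep_polys Q d. U = Rep Q I d - {x. \<forall>f\<in>F. f x = 0})" for U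
  have P_iff: "P U \<longleftrightarrow> U \<subseteq> Rep Q I d \<and>
      (\<forall>x\<in>U. \<exists>f\<in>rep_polys Q d. f x \<noteq> 0 \<and> (\<forall>y\<in>Rep Q I d. f y \<noteq> 0 \<longrightarrow> y \<in> U))"
    (is "_ \<longleftrightarrow> ?R U") for U
  proof
    assume "P U"
    then obtain F where "F \<subseteq> rep_polys Q d" "U = Rep Q I d - {x. \<forall>f\<in>F. f x = 0}"
      unfolding P_def by (elim exE conjE)
    then show "?R U" by auto
  next
    assume R: "?R U"
    define F where "F = {f \<in> rep_polys Q d. \<forall>y\<in>Rep Q I d. f y \<noteq> 0 \<longrightarrow> y \<in> U}"
    have "U = Rep Q I d - {x. \<forall>f\<in>F. f x = 0}"
      using R unfolding F_def by auto
    moreover have "F \<subseteq> rep_polys Q d" unfolding F_def by simp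
    ultimately show "P U" unfolding P_def by (intro exI[of _ F] conjI)
  qed
  have "P (S \<inter> T)" if "P S" "P T" for S T
  proof -
    have "\<exists>f\<in>rep_polys Q d. f x \<noteq> 0 \<and> (\<forall>y\<in>Rep Q I d. f y \<noteq> 0 \<longrightarrow> y \<in> S \<inter> T)"
      if x: "x \<in> S \<inter> T" for x
    proof -
      from \<open>P S\<close> x obtain f where f: "f \<in> rep_polys Q d" "f x \<noteq> 0"
        "\<forall>y\<in>Rep Q I d. f y \<noteq> 0 \<longrightarrow> y \<in> S" unfolding P_iff by (meson IntD1)
      from \<open>P T\<close> x obtain g where g: "g \<in> rep_polys Q d" "g x \<noteq> 0"
        "\<forall>y\<in>Rep Q I d. g y \<noteq> 0 \<longrightarrow> y \<in> T" unfolding P_iff by (meson IntD2)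
      show ?thesis
        by (rule bexI[OF _ rep_polys.times[OF f(1) g(1)]]) (use f g in simp)
    qed
    moreover have "S \<inter> T \<subseteq> Rep Q I d" using \<open>P S\<close> unfolding P_iff by (meson inf.coboundedI1)
    ultimately show ?thesis unfolding P_iff by simp
  qed
  moreover have "P (\<Union>\<K>)" if K: "\<forall>S\<in>\<K>. P S" for \<K>
  proof -
    have "\<Union>\<K> \<subseteq> Rep Q I d" using K unfolding P_iff by (meson Sup_least)
    moreover have "\<exists>f\<in>rep_polys Q d. f x \<noteq> 0 \<and> (\<forall>y\<in>Rep Q I d. f y \<noteq> 0 \<longrightarrow> y \<in> \<Union>\<K>)"
      if "x \<in> \<Union>\<K>" for x
    proof -
      from that obtain S where S: "S \<in> \<K>" "x \<in> S" by (rule UnionE)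
      then have "P S" using K by simp
      then obtain f where f: "f \<in> rep_polys Q d" "f x \<noteq> 0"
        "\<forall>y\<in>Rep Q I d. f y \<noteq> 0 \<longrightarrow> y \<in> S" using S(2) unfolding P_iff by meson
      show ?thesis by (rule bexI[OF _ f(1)]) (use f S(1) in auto)
    qed
    ultimately show ?thesis unfolding P_iff by simp
  qed
  ultimately have "istopology P" unfolding istopology_def by simp
  then show ?thesis unfolding P_def .
qed

lemma openin_zariski:
  "openin (zariski Q I d) U \<longleftrightarrow>
     (\<exists>F \<subseteq> rep_polys Q d. U = Rep Q I d - {x. \<forall>f\<in>F. f x = 0})"
  unfolding zariski_def topology_inverse'[OF istopology_zariski] ..

lemma topspace_zariski:
  fixes I :: "(('v, 'a) path \<Rightarrow> 'k::field) set"
  shows "topspace (zariski Q I d) = Rep Q I d"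
proof
  show "topspace (zariski Q I d) \<subseteq> Rep Q I d"
    using openin_topspace[of "zariski Q I d"] unfolding openin_zariski by auto
  let ?F = "{\<lambda>x. 1} :: (('a \<Rightarrow> 'k mat) \<Rightarrow> 'k) set"
  have "Rep Q I d = Rep Q I d - {x. \<forall>f\<in>?F. f x = 0}" by simp
  moreover have "?F \<subseteq> rep_polys Q d" by (simp add: rep_polys.const)
  ultimately have "openin (zariski Q I d) (Rep Q I d)"
    unfolding openin_zariski by (intro exI[of _ ?F] conjI)
  then show "Rep Q I d \<subseteq> topspace (zariski Q I d)" by (rule openin_subset)
qed

definition irreducible_in :: "'x topology \<Rightarrow> 'x set \<Rightarrow> bool" where
  "irreducible_in X S \<longleftrightarrow> S \<subseteq> topspace X \<and> S \<noteq> {} \<and>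
     (\<forall>A B. closedin X A \<and> closedin X B \<and> S \<subseteq> A \<union> B \<longrightarrow> S \<subseteq> A \<or> S \<subseteq> B)"

definition irreducible_components :: "'x topology \<Rightarrow> 'x set set" where
  "irreducible_components X =
     {C. irreducible_in X C \<and> (\<forall>D. irreducible_in X D \<and> C \<subseteq> D \<longrightarrow> D = C)}"

definition has_dense_orbit ::
  "('v, 'a) pre_digraph \<Rightarrow> (('v, 'a) path \<Rightarrow> 'k::field) set \<Rightarrow> ('v \<Rightarrow> nat)
    \<Rightarrow> ('a \<Rightarrow> 'k mat) set \<Rightarrow> bool" where
  "has_dense_orbit Q I d C \<longleftrightarrow> (\<exists>x\<in>C. GL_orbit Q d x \<subseteq> C \<and>
     (subtopology (zariski Q I d) C) closure_of (GL_orbit Q d x) = C)"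

definition dense_orbit_property ::
  "('v, 'a) pre_digraph \<Rightarrow> (('v, 'a) path \<Rightarrow> 'k::field) set \<Rightarrow> bool" where
  "dense_orbit_property Q I \<longleftrightarrow>
     (\<forall>d. \<forall>C\<in>irreducible_components (zariski Q I d). has_dense_orbit Q I d C)"

definition contains_indecomposable ::
  "('v, 'a) pre_digraph \<Rightarrow> (('v, 'a) path \<Rightarrow> 'k::field) set \<Rightarrow> ('v \<Rightarrow> nat)
    \<Rightarrow> ('a \<Rightarrow> 'k mat) set \<Rightarrow> bool" where
  "contains_indecomposable Q I d C \<longleftrightarrow>
     (\<exists>x\<in>C. indecomposable_module (quiver_algebra Q I) (rep_module Q d x))"

end

theory Submission
 imports Defs "HOL-Library.Function_Algebras" "Jordan_Normal_Form.Determinant"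
begin

text \<open>Radical square zero forces \<open>I\<close> to be the ideal of paths of length at least two, so a point of the
representation variety is a tuple of matrices in which the products for consecutive arrows vanish. Splitting
the space at each vertex into a socle part and a top part turns it into a representation of the
separated (bipartite) quiver, and this preserves indecomposability. Everything is governed by the Tits form
\<open>q\<close> of the separated quiver.

If \<open>q\<close> is not positive, take a minimal nonzero dimension vector with \<open>q \<le> 0\<close>. Counting parameters,
decomposable representations do not fill the representation space, so there is an indecomposable one. It lies in
a component that is the closure of the orbits of a block of representations, and there the same count (a
polynomial map into a space of larger dimension satisfies a polynomial relation) excludes a dense orbit. Hence
(2) implies that \<open>q\<close> is positive.

If \<open>q\<close> is positive, it takes the value 1 only finitely often, and reflection functors show that
indecomposables have \<open>q = 1\<close> and are determined by their dimension vectors; this is (3).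

Conversely, finitely many indecomposables leave only finitely many orbits in each variety, and then every
irreducible component is the closure of one of them; this is (1).\<close>

section \<open>Matrices over index sets\<close>

text \<open>The polar form of \<open>q\<close> explains both the minimality and the count:
  \<open>q(d1 + d2) = q(d1) + q(d2) + (d1, d2)\<close>, so \<open>q(d) \<le> 0\<close> with both
  summands at least 1 forces the mixed term to be at most -2, and this deficit is what the
  decomposable representations lack in parameters. Dimensions of varieties are replaced by counting
  monomials, so every set to be bounded is presented as the image of finitely many polynomial maps.
  To identify the component of the indecomposable, two ranks are used: it is onto at the sinks and
  injective at the sources, and in the closure of the block with socle \<open>s'\<close> these ranks
  are at most \<open>s' v\<close> and \<open>d v - s' v\<close>; both bounds together pin down the
  block. For positive \<open>q\<close> all sinks are reflected at once. The dimension vectors then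
  stay on one level of \<open>q\<close>, which is finite. If they stayed nonnegative for ever, one
  would recur, and the sum over the period would be a nonzero vector with \<open>q = 0\<close>. So
  reflecting must come to an end, which happens only at a representation of total dimension 1; two
  indecomposables of equal dimensions get there in parallel, and their isomorphism is carried
  back.\<close>

text \<open>Matrices are functions of two indices that vanish outside their index sets; this makes
  products associative and sums distributive without side conditions.\<close>

definition mats :: "'i set => 'j set => ('i => 'j => 'k::zero) set" where
 "mats R C = {A. ALL i j. A i j ~= 0 --> i : R & j : C}"

definition mmul :: "('i => 'l => 'k::comm_ring_1) => 'l set => ('l => 'j => 'k) => 'i => 'j => 'k"
  (\<open>(_ *[_] _)\<close> [70, 0, 71] 70) where
 "A *[S] B = (%i j. SUM k:S. A i k * B k j)"

definition idm :: "'i set => 'i => 'i => 'k::comm_ring_1" where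
 "idm S i j = (if i = j & i : S then 1 else 0)"

abbreviation nmul :: "('i => nat => 'k::comm_ring_1) => nat => (nat => 'j => 'k) => 'i => 'j => 'k"
  (\<open>(_ *{_} _)\<close> [70, 0, 71] 70) where
 "A *{n} B \<equiv> A *[{..<n}] B"

lemma mmul_assoc: "(A *[S] B) *[T] C = A *[S] (B *[T] C)"
proof (intro ext)
 fix i j
 have "((A *[S] B) *[T] C) i j = (SUM k:T. SUM l:S. A i l * B l k * C k j)"
  by (simp add: mmul_def sum_distrib_right)
 also have "... = (SUM l:S. SUM k:T. A i l * B l k * C k j)" by (rule sum.swap)
 finally show "((A *[S] B) *[T] C) i j = (A *[S] (B *[T] C)) i j"
  by (simp add: mmul_def sum_distrib_left mult.assoc)
qed

lemma mmul_add_left: "(A + B) *[S] C = A *[S] C + B *[S] C"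
 and mmul_add_right: "D *[S] (E + F) = D *[S] E + D *[S] F"
 and mmul_diff_left: "(A - B) *[S] C = A *[S] C - B *[S] C"
 and mmul_diff_right: "D *[S] (E - F) = D *[S] E - D *[S] F"
 by (auto simp: mmul_def fun_eq_iff algebra_simps sum.distrib sum_subtractf)

lemma mmul_zero [simp]: "0 *[S] A = 0" "B *[S] 0 = 0" "C *[{}] D = 0"
 by (simp_all add: mmul_def fun_eq_iff)

lemmas mmul_simps = mmul_assoc mmul_add_left mmul_add_right mmul_diff_left mmul_diff_right

lemma matsD: "A : mats R C ==> i \<notin> R \<or> j \<notin> C ==> A i j = 0"
 by (auto simp: mats_def)

lemma matsI: "(!!i j. i \<notin> R \<or> j \<notin> C ==> A i j = 0) ==> A : mats R C"
 unfolding mats_def by blast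

lemma mats_mmul [intro]: "A : mats R S ==> B : mats S' C ==> A *[T] B : mats R C"
 by (rule matsI) (auto simp: mmul_def matsD intro!: sum.neutral)

lemma mats_add [intro]:
 fixes A B :: "'i => 'j => 'k::comm_ring_1"
 shows "A : mats R C ==> B : mats R C ==> A + B : mats R C"
 by (rule matsI) (auto simp: matsD)

lemma mats_diff [intro]:
 fixes A B :: "'i => 'j => 'k::comm_ring_1"
 shows "A : mats R C ==> B : mats R C ==> A - B : mats R C"
 by (rule matsI) (auto simp: matsD)

lemma mats_zero [intro, simp]: "0 : mats R C"
 by (simp add: mats_def)

lemma mats_mono: "A : mats R C ==> R \<subseteq> R' ==> C \<subseteq> C' ==> A : mats R' C'"
 by (auto simp: mats_def)

lemma mats_idm [intro, simp]: "idm S : mats S S"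
 by (simp add: mats_def idm_def)

lemma mats_empty [simp]: "mats {} C = {0}" "mats R {} = {0}"
 by (auto simp: mats_def fun_eq_iff)

lemma idm_empty [simp]: "idm {} = 0"
 by (simp add: idm_def fun_eq_iff)

lemma idm_mmul: "finite R ==> A : mats R C ==> idm R *[R] A = A"
proof (intro ext)
 fix i j assume "finite R" "A : mats R C"
 then have "(idm R *[R] A) i j = (SUM k:R. if k = i then A i j else 0)"
  unfolding mmul_def idm_def by (intro sum.cong) auto
 with \<open>finite R\<close> \<open>A : mats R C\<close> show "(idm R *[R] A) i j = A i j"
  by (simp add: matsD)
qed

lemma mmul_idm: "finite C ==> A : mats R C ==> A *[C] idm C = A"
proof (intro ext)
 fix i j assume "finite C" "A : mats R C"
 then have "(A *[C] idm C) i j = (SUM k:C. if k = j then A i j else 0)"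
  unfolding mmul_def idm_def by (intro sum.cong) auto
 with \<open>finite C\<close> \<open>A : mats R C\<close> show "(A *[C] idm C) i j = A i j"
  by (simp add: matsD)
qed

lemma idm_mmul_idm: "finite R ==> idm R *[R] idm R = idm R"
 by (rule idm_mmul) auto

lemma mmul_insert: "finite C ==> c \<notin> C ==> A *[insert c C] B = A *[C] B + A *[{c}] B"
 by (simp add: mmul_def fun_eq_iff add.commute)

lemma mmul_disjoint:
 "A : mats R C ==> C \<inter> S = {} ==> A *[S] B = 0"
 "B' : mats C R ==> C \<inter> S = {} ==> A' *[S] B' = 0"
proof -
 assume C: "C \<inter> S = {}"
 { assume "A : mats R C"
  then have "A i k = 0" if "k : S" for i k using C that matsD[of A R C i k] by blast
  then show "A *[S] B = 0" by (simp add: mmul_def fun_eq_iff) }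
 { assume "B' : mats C R"
  then have "B' k j = 0" if "k : S" for j k using C that matsD[of B' C R k j] by blast
  then show "A' *[S] B' = 0" by (simp add: mmul_def fun_eq_iff) }
qed

lemma mmul_eq_superset:
 assumes "finite T" "S \<subseteq> T" "A : mats R S \<or> B : mats S C"
 shows "A *[T] B = A *[S] B"
 unfolding mmul_def fun_eq_iff
 by (intro allI sum.mono_neutral_right) (use assms in "auto simp: matsD")

definition transp :: "('i => 'j => 'k) => 'j => 'i => 'k" where
 "transp A i j = A j i"

lemma transp_transp [simp]: "transp (transp A) = A"
 by (simp add: transp_def fun_eq_iff)

lemma transp_mmul: "transp (A *[S] B) = transp B *[S] transp A"
 by (simp add: transp_def mmul_def fun_eq_iff mult.commute)

lemma transp_idm [simp]: "transp (idm S) = idm S"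
 by (auto simp: transp_def idm_def fun_eq_iff)

lemma transp_mats [simp]: "transp A : mats C R \<longleftrightarrow> A : mats R C"
 by (auto simp: transp_def mats_def)

section \<open>Linear algebra over a field: kernels, generalized inverses, split idempotents\<close>

lemma nontrivial_kernel:
 fixes M :: "'i => 'j => 'k::field"
 assumes "finite R" "finite C" "card R < card C"
 shows "EX c. (EX j:C. c j ~= 0) & (ALL i:R. (SUM j:C. M i j * c j) = 0)"
 using assms
proof (induction R arbitrary: M C)
 case empty
 then have "C ~= {}" by auto
 then show ?case by (intro exI[of _ "%_. 1"]) auto
next
 case (insert a R)
 show ?case
 proof (cases "ALL j:C. M a j = 0")
  case True
  from insert.IH[of C M] insert.prems insert.hyps obtain c where
   "EX j:C. c j ~= 0" "ALL i:R. (SUM j:C. M i j * c j) = 0" by auto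
  with True show ?thesis by (intro exI[of _ c]) auto
 next
  case False
  then obtain b where b: "b : C" "M a b ~= 0" by auto
  \<comment> \<open>Gaussian elimination: row \<open>a\<close> has the pivot \<open>M a b\<close>,
    and \<open>?N\<close> is the system left after solving that row for the unknown
    \<open>b\<close>.\<close>
  let ?C = "C - {b}" and ?N = "%i j. M i j - M i b * M a j / M a b"
  have "card R < card ?C" using insert.prems insert.hyps b(1) by simp
  from insert.IH[OF _ this, of ?N] insert.prems(1) obtain c where
   c: "EX j:?C. c j ~= 0" "!!i. i : R ==> (SUM j:?C. ?N i j * c j) = 0" by auto
  let ?t = "- (SUM j:?C. M a j * c j) / M a b"
  have *: "(SUM j:C. M i j * (c(b := ?t)) j) = M i b * ?t + (SUM j:?C. M i j * c j)" for i
   using insert.prems(1) b(1) by (subst sum.remove[OF _ b(1)]) (auto intro!: sum.cong)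
  have "(SUM j:C. M i j * (c(b := ?t)) j) = 0" if "i : insert a R" for i
  proof (cases "i = a")
   case True then show ?thesis unfolding * using b(2) by simp
  next
   case False
   then have "0 = (SUM j:?C. M i j * c j - M i b / M a b * (M a j * c j))"
    using that c(2)[of i] by (simp add: algebra_simps)
   also have "... = (SUM j:?C. M i j * c j) - M i b / M a b * (SUM j:?C. M a j * c j)"
    by (simp only: sum_subtractf sum_distrib_left)
   finally show ?thesis unfolding * by simp
  qed
  moreover have "EX j:C. (c(b := ?t)) j ~= 0" using c(1) by auto
  ultimately show ?thesis by blast
 qed
qed

text \<open>If \<open>S\<close> were larger, \<open>B\<close> would kill a nonzero vector
  \<open>c\<close>, and the identity \<open>A B\<close> would kill it as well. Ranks are never
  defined; equalities of dimensions come from applying this bound in both directions.\<close>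

lemma card_le_if_inverse:
 fixes A :: "'i => 'j => 'k::field"
 assumes fin: "finite S" "finite T" and AB: "A *[T] B = idm S"
 shows "card S \<le> card T"
proof (rule ccontr)
 assume "\<not> ?thesis"
 then obtain c where c: "EX j:S. c j ~= 0" "!!i. i : T ==> (SUM j:S. B i j * c j) = 0"
  using nontrivial_kernel[OF fin(2,1), of B] by auto
 \<comment> \<open>Vectors are matrices with the one-element column type \<open>unit\<close>, so
   that associativity of \<open>mmul\<close> applies to them.\<close>
 let ?c = "%j (_::unit). if j : S then c j else 0"
 have "B *[S] ?c = (%i _. SUM j:S. B i j * c j)" by (simp add: mmul_def)
 then have "A *[T] (B *[S] ?c) = 0" using c(2) by (simp add: mmul_def fun_eq_iff)
 then have "idm S *[S] ?c = 0" unfolding mmul_assoc[symmetric] AB .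
 moreover have "?c : mats S UNIV" by (auto simp: mats_def)
 ultimately have "?c = 0" using idm_mmul[OF fin(1)] by metis
 then show False using c(1) by (auto simp: fun_eq_iff split: if_splits)
qed

text \<open>Induction on the columns. The product \<open>M \<rho>\<close> is an idempotent with the
  column space of \<open>M\<close> as its image; it serves as the projection onto an image wherever
  a complement has to be chosen, and \<rho> becomes a right inverse when \<open>M\<close> is
  onto.\<close>

lemma generalized_inverse:
 fixes M :: "'i => 'j => 'k::field"
 assumes "finite C" "finite R" "M : mats R C"
 shows "\<exists>\<rho>\<in>mats C R. M *[C] (\<rho> *[R] M) = M"
 using assms(1,3)
proof (induction C arbitrary: M)
 case empty
 then have "M = 0" by simp
 then show ?case by (intro bexI[of _ 0]) (simp_all only: mmul_zero mats_zero)
next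
 case (insert c C)
 define M' where "M' = (%i j. if j = c then 0 else M i j)"
 define w where "w = (%i j. if j = c then M i j else 0)"
 have M: "M = M' + w" by (auto simp: fun_eq_iff M'_def w_def)
 have m0: "M' : mats R C" and u: "w : mats R {c}"
  using insert.prems by (auto simp: mats_def M'_def w_def)
 obtain \<rho> where \<rho>: "\<rho> : mats C R" "M' *[C] (\<rho> *[R] M') = M'" using insert.IH[OF m0] by blast
 have d: "A *[{c}] B = 0" if "A : mats X C" for A :: "'x => 'j => 'k" and B :: "'j => 'y => 'k" and X
  by (rule mmul_disjoint(1)[OF that]) (use insert.hyps in auto)
 have d': "A *[C] B = 0" if "A : mats X {c}" for A :: "'x => 'j => 'k" and B :: "'j => 'y => 'k" and X
  by (rule mmul_disjoint(1)[OF that]) (use insert.hyps in auto)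
 note ins = mmul_insert[OF insert.hyps]
 \<comment> \<open>The part of the new column outside the column space of \<open>M'\<close>,
   measured by the projection \<open>M' \<rho>\<close>. If it vanishes, the old \<rho> still
   works.\<close>
 let ?v = "w - M' *[C] (\<rho> *[R] w)"
 have v: "?v : mats R {c}" using m0 u \<rho>(1) by blast
 show ?case
 proof (cases "?v = 0")
  case True
  have "M *[insert c C] (\<rho> *[R] M) = M' *[C] (\<rho> *[R] (M' + w))"
   unfolding M[symmetric] mmul_assoc[symmetric] ins
  proof -
   have 1: "M *[C] \<rho> = M' *[C] \<rho>" by (subst (1) M) (simp only: mmul_add_left d'[OF u] add_0_right)
   have 2: "M *[{c}] \<rho> = 0" using mmul_disjoint(2)[OF \<rho>(1), of "{c}"] insert.hyps by simp
   show "(M *[C] \<rho> + M *[{c}] \<rho>) *[R] M = M' *[C] \<rho> *[R] M" unfolding 1 2 by simp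
  qed
  also have "... = M" using True by (simp add: mmul_add_right \<rho>(2) M)
  finally have "M *[insert c C] (\<rho> *[R] M) = M" .
  moreover have "\<rho> : mats (insert c C) R" using \<rho>(1) by (rule mats_mono) auto
  ultimately show ?thesis by blast
 next
  case False
  then obtain i where i: "?v i c ~= 0" using v by (force simp: mats_def fun_eq_iff)
  then have iR: "i : R" using v by (auto simp: mats_def)
  let ?e = "%j k. if j = c & k = i then 1 / ?v i c else 0"
  have e: "?e : mats {c} R" using iR by (auto simp: mats_def)
  \<comment> \<open>A functional that kills \<open>M'\<close> and takes the value 1 on the new
    column. Below, \<open>src\<close> is \<rho> applied after subtracting the component along
    \<open>w\<close> that this functional measures.\<close>
  let ?\<phi> = "?e - ?e *[R] (M' *[C] \<rho>)"
  have \<phi>: "?\<phi> : mats {c} R" using e m0 \<rho>(1) by blast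
  have \<phi>M: "?\<phi> *[R] M' = 0" by (simp only: mmul_simps \<rho>(2)) simp
  have "?\<phi> *[R] w = ?e *[R] ?v" by (simp only: mmul_simps)
  also have "... = idm {c}"
  proof (intro ext)
   fix a b
   have "(?e *[R] ?v) a b = (SUM k:R. if k = i then (if a = c then ?v i b / ?v i c else 0) else 0)"
    unfolding mmul_def by (intro sum.cong) auto
   also have "... = (if a = c then ?v i b / ?v i c else 0)" using iR assms(2) by (simp add: sum.delta)
   also have "... = idm {c} a b" using i matsD[OF v, of i b] by (auto simp: idm_def)
   finally show "(?e *[R] ?v) a b = idm {c} a b" .
  qed
  finally have \<phi>u: "?\<phi> *[R] w = idm {c}" .
  have "\<exists>\<phi>\<in>mats {c} R. \<phi> *[R] M' = 0 & \<phi> *[R] w = idm {c}"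
   using \<phi> \<phi>M \<phi>u by blast
  then obtain \<phi> where \<phi>: "\<phi> : mats {c} R" "\<phi> *[R] M' = 0" "\<phi> *[R] w = idm {c}" by blast
  define src where "src = \<rho> - \<rho> *[R] (w *[{c}] \<phi>)"
  have src: "src : mats C R" unfolding src_def using \<rho>(1) u \<phi>(1) by blast
  have uid: "w *[{c}] idm {c} = w" by (rule mmul_idm[OF _ u]) simp
  have srcM: "src *[R] M = \<rho> *[R] M'"
   by (subst M) (simp only: src_def mmul_simps \<phi>(2,3) uid, simp)
  have \<phi>M': "\<phi> *[R] M = idm {c}" by (subst M) (simp only: mmul_simps \<phi>(2,3), simp)
  have *: "A *[insert c C] ((src + \<phi>) *[R] M) = A *[C] (\<rho> *[R] M') + A *[{c}] idm {c}" for A :: "'i => 'j => 'k"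
  proof -
   have "A *[insert c C] (src + \<phi>) = A *[C] src + A *[{c}] \<phi>"
    using mmul_disjoint(2)[OF src, of "{c}" A] mmul_disjoint(2)[OF \<phi>(1), of C A] insert.hyps
    by (simp add: ins mmul_add_right)
   then show ?thesis unfolding mmul_assoc[symmetric]
    by (simp only: mmul_add_left) (simp only: mmul_assoc srcM \<phi>M')
  qed
  have "M *[insert c C] ((src + \<phi>) *[R] M) = M' + w"
   unfolding * by (subst (1 2) M) (simp only: mmul_add_left \<rho>(2) d'[OF u] d[OF m0] uid add_0_right add_0_left)
  then have "M *[insert c C] ((src + \<phi>) *[R] M) = M" by (simp only: M)
  moreover have "src + \<phi> : mats (insert c C) R"
   by (intro mats_add mats_mono[OF src] mats_mono[OF \<phi>(1)]) auto
  ultimately show ?thesis by blast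
 qed
qed

text \<open>A spanning set \<open>S\<close> of rows of least cardinality is independent. The matrix
  \<open>a\<close> that expresses all rows by those in \<open>S\<close> has unit rows at
  \<open>S\<close>; this normal form later saves parameters when decomposable representations are
  counted.\<close>

lemma row_basis:
 fixes A :: "'i => 'j => 'k::field"
 assumes "finite R" "A : mats R C"
 obtains S a where "S \<subseteq> R" "a : mats R S" "!!i k. i : S ==> a i k = idm S i k" "a *[S] A = A"
  "!!c k. (!!j. (SUM k:S. c k * A k j) = 0) ==> k : S ==> c k = 0"
proof -
 define P where "P S \<longleftrightarrow> S \<subseteq> R & (ALL i:R. EX c. ALL j. A i j = (SUM k:S. c k * A k j))" for S
 have "A i j = (SUM k:R. (if k = i then 1 else 0) * A k j)" if "i : R" for i j
 proof -
  have "(SUM k:R. (if k = i then 1 else 0) * A k j) = (SUM k:R. if k = i then A i j else 0)"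
   by (rule sum.cong) auto
  then show ?thesis using that assms(1) by simp
 qed
 then have "P R" unfolding P_def by (intro conjI ballI order_refl exI allI)
 then obtain S where S: "P S" "!!T. P T ==> card S \<le> card T"
  using exists_least_iff[of "%n. EX S. P S & card S = n"] by (metis not_le)
 have SR: "S \<subseteq> R" and finS: "finite S" using S(1) assms(1) by (auto simp: P_def intro: finite_subset)
 obtain c where c: "!!i j. i : R ==> A i j = (SUM k:S. c i k * A k j)"
  using S(1) unfolding P_def by metis
 define a where "a i k = (if i : S then idm S i k else if i : R & k : S then c i k else 0)" for i k
 have "a : mats R S" using SR by (auto simp: a_def mats_def idm_def)
 moreover have "(a *[S] A) i j = A i j" for i j
 proof (cases "i : S")
  case True
  have "(a *[S] A) i j = (SUM k:S. if k = i then A i j else 0)"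
   unfolding mmul_def a_def idm_def using True by (intro sum.cong) auto
  then show ?thesis using finS True by simp
 next
  case False
  then show ?thesis using c[of i j] matsD[OF assms(2), of i j]
   by (cases "i : R") (simp_all add: mmul_def a_def cong: sum.cong)
 qed
 moreover have "d k = 0" if d: "!!j. (SUM k:S. d k * A k j) = 0" and k: "k : S" for d k
 proof (rule ccontr)
  assume dk: "d k ~= 0"
  have Ak: "A k j = (SUM l:S-{k}. - (d l / d k) * A l j)" for j
  proof -
   have "d k * A k j = - (SUM l:S-{k}. d l * A l j)"
    using d[of j] sum.remove[OF finS k, of "%l. d l * A l j"] by (simp add: eq_neg_iff_add_eq_0)
   then have "A k j = - (SUM l:S-{k}. d l * A l j) / d k" using dk by (simp add: field_simps)
   then show ?thesis by (simp add: sum_divide_distrib sum_negf)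
  qed
  have "A i j = (SUM l:S-{k}. (c i l + c i k * - (d l / d k)) * A l j)" if "i : R" for i j
  proof -
   have "A i j = c i k * A k j + (SUM l:S-{k}. c i l * A l j)"
    using c[OF that, of j] sum.remove[OF finS k, of "%l. c i l * A l j"] by simp
   also have "c i k * A k j = (SUM l:S-{k}. c i k * - (d l / d k) * A l j)"
    unfolding Ak[of j] sum_distrib_left by (simp add: mult.assoc)
   finally show ?thesis by (simp only: distrib_right sum.distrib add.commute)
  qed
  then have "P (S - {k})" using SR unfolding P_def
   by (intro conjI ballI exI allI) auto
  from S(2)[OF this] k finS show False by (metis card_Diff1_less not_le)
 qed
 ultimately show thesis using that[of S a] SR by (auto simp: a_def fun_eq_iff)
qed

text \<open>Take \<open>b\<close> to be a row basis of \<open>P\<close>, so that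
  \<open>P = a b\<close>. From \<open>P P = P\<close> follows \<open>a (b a - 1) b = 0\<close>; the
  unit rows of \<open>a\<close> cancel it on the left, and the independence of the rows of
  \<open>b\<close> cancels \<open>b\<close> on the right.\<close>

lemma split_idempotent:
 fixes P :: "'i => 'i => 'k::field"
 assumes fin: "finite R" and P: "P : mats R R" "P *[R] P = P"
 obtains S a b where "S \<subseteq> R" "a : mats R S" "b : mats S R" "a *[S] b = P" "b *[R] a = idm S"
  "!!i k. i : S ==> a i k = idm S i k"
proof -
 from row_basis[OF fin P(1)] obtain S a where
  S: "S \<subseteq> R" "a : mats R S" and a: "!!i k. i : S ==> a i k = idm S i k" "a *[S] P = P"
  and ind: "!!c k. (!!j. (SUM k:S. c k * P k j) = 0) ==> k : S ==> c k = 0"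
  by blast
 have finS: "finite S" using S(1) fin by (rule finite_subset)
 define b where "b = (%i j. if i : S then P i j else 0)"
 have b: "b : mats S R" using P(1) by (auto simp: b_def mats_def)
 have ab: "a *[S] b = P" using a(2) by (simp add: mmul_def b_def cong: sum.cong)
 have "a *[S] ((b *[R] a - idm S) *[S] b) = 0"
  using P(2) by (simp add: mmul_simps ab idm_mmul[OF finS b] flip: mmul_assoc) (simp add: ab mmul_assoc)
 define D where "D = b *[R] a - idm S"
 have D: "D : mats S S" using b S(2) by (auto simp: D_def)
 have 0: "(D *[S] b) i j = 0" if i: "i : S" for i j
 proof -
  have "0 = (a *[S] (D *[S] b)) i j"
   using \<open>a *[S] ((b *[R] a - idm S) *[S] b) = 0\<close> by (simp add: D_def)
  also have "... = (idm S *[S] (D *[S] b)) i j" using a(1)[OF i] by (simp add: mmul_def)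
  also have "... = (D *[S] b) i j" using idm_mmul[OF finS mats_mmul[OF D b]] by simp
  finally show ?thesis by simp
 qed
 have "D i k = 0" for i k
 proof (cases "i : S & k : S")
  case True
  show ?thesis by (rule ind) (use 0[of i] True in "auto simp: mmul_def b_def cong: sum.cong")
 qed (use matsD[OF D] in auto)
 then have "b *[R] a = idm S" by (simp add: D_def fun_eq_iff)
 then show thesis using that[OF S(1,2) b ab _ a(1)] by blast
qed

corollary idempotent_factors:
 fixes P :: "'i => 'i => 'k::field"
 assumes "finite R" "P : mats R R" "P *[R] P = P"
 obtains S a b where "S \<subseteq> R" "a : mats R S" "b : mats S R" "a *[S] b = P" "b *[R] a = idm S"
 by (rule split_idempotent[OF assms]) (rule that)

text \<open>Transposed form: now the columns of \<open>b\<close> indexed by \<open>S\<close> are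
  unit vectors. At the sources it is the right-hand factor that has to be normalised.\<close>

lemma split_idempotent':
 fixes P :: "'i => 'i => 'k::field"
 assumes fin: "finite R" and P: "P : mats R R" "P *[R] P = P"
 obtains S a b where "S \<subseteq> R" "a : mats R S" "b : mats S R" "a *[S] b = P" "b *[R] a = idm S"
  "!!i k. i : S ==> b k i = idm S k i"
proof -
 have "transp P : mats R R" "transp P *[R] transp P = transp P"
  using P by (simp_all flip: transp_mmul)
 from split_idempotent[OF fin this] obtain S a b where
  *: "S \<subseteq> R" "a : mats R S" "b : mats S R" "a *[S] b = transp P" "b *[R] a = idm S"
   "!!i k. i : S ==> a i k = idm S i k" by blast
 show thesis
 proof (rule that[of S "transp b" "transp a"])
  show "transp b *[S] transp a = P" "transp a *[R] transp b = idm S"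
   using *(4,5) by (simp_all flip: transp_mmul)
 qed (use * in "auto simp: transp_def idm_def")
qed

text \<open>Index sets of splittings come out as arbitrary finite sets; relabelling along a
  bijection moves them to initial segments or intervals of the natural numbers, where the spaces of
  a representation live.\<close>

lemma reindex_splitting:
 assumes fin: "finite S" "finite S'" "card S' = card S"
  and ab: "a : mats R S" "b : mats S R" "b *[R] a = idm S"
 obtains a' b' where "a' : mats R S'" "b' : mats S' R" "a' *[S'] b' = a *[S] b" "b' *[R] a' = idm S'"
proof -
 obtain f where f: "bij_betw f S' S" using finite_same_card_bij[OF fin(2,1)] fin(3) by auto
 define a' where "a' = (%i k. if k : S' then a i (f k) else 0)"
 define b' where "b' = (%k i. if k : S' then b (f k) i else 0)"
 have fS: "f k : S" if "k : S'" for k using f that by (auto simp: bij_betw_def)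
 show thesis
 proof
  show "a' : mats R S'" "b' : mats S' R" using ab(1,2) fS by (auto simp: a'_def b'_def mats_def)
  show "a' *[S'] b' = a *[S] b"
   unfolding mmul_def fun_eq_iff
   using sum.reindex_bij_betw[OF f] by (auto simp: a'_def b'_def cong: sum.cong)
  have "(b' *[R] a') k l = (if k : S' & l : S' then (b *[R] a) (f k) (f l) else 0)" for k l
   by (auto simp: a'_def b'_def mmul_def)
  moreover have "f k = f l \<longleftrightarrow> k = l" if "k : S'" "l : S'" for k l
   using f that by (metis bij_betw_inv_into_left)
  ultimately show "b' *[R] a' = idm S'"
   unfolding ab(3) using fS by (intro ext) (simp add: idm_def)
 qed
qed

text \<open>Multiplying \<open>a b + a' b' = 1\<close> by \<open>b\<close> from the left and by
  \<open>a'\<close> from the right gives \<open>b a' = 0\<close>. The stacked matrices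
  \<open>?A\<close> and \<open>?B\<close> are then mutually inverse, so their index sets have the
  same size.\<close>

lemma complementary_splittings:
 fixes a :: "'i => 's => 'k::field" and a' :: "'i => 't => 'k"
 assumes fin: "finite R" "finite S" "finite S'"
  and ab: "a : mats R S" "b : mats S R" "b *[R] a = idm S"
  and ab': "a' : mats R S'" "b' : mats S' R" "b' *[R] a' = idm S'"
  and sum: "a *[S] b + a' *[S'] b' = idm R"
 shows "b *[R] a' = 0" "b' *[R] a = 0" "card S + card S' = card R"
proof -
 have gen: "b *[R] a' = 0"
  if "finite S" "finite S'" "a : mats R S" "b : mats S R" "b *[R] a = idm S" "a' : mats R S'"
   "b' *[R] a' = idm S'" "a *[S] b + a' *[S'] b' = idm R"
  for S :: "'p set" and S' :: "'q set" and a b a' b'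
 proof -
  have "b = b *[R] (a *[S] b + a' *[S'] b')" unfolding that(8) by (rule mmul_idm[OF fin(1) that(4), symmetric])
  also have "... = b + b *[R] (a' *[S'] b')"
   by (simp add: mmul_add_right that(5) idm_mmul[OF that(1,4)] flip: mmul_assoc)
  finally have 0: "b *[R] (a' *[S'] b') = 0" by simp
  have "0 = (b *[R] (a' *[S'] b')) *[R] a'" by (simp add: 0)
  also have "... = b *[R] a'" by (simp add: mmul_assoc that(7) mmul_idm[OF that(2,6)])
  finally show ?thesis by simp
 qed
 show ba': "b *[R] a' = 0" by (rule gen[OF fin(2,3) ab ab'(1,3) sum])
 show b'a: "b' *[R] a = 0" by (rule gen[OF fin(3,2) ab' ab(1,3)]) (use sum in "simp add: add.commute")
 let ?T = "S <+> S'"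
 let ?A = "%i. case_sum (a i) (a' i)" and ?B = "case_sum b b'"
 have T: "finite ?T" "card ?T = card S + card S'"
  using fin by (auto simp: card_Plus)
 have "?A *[?T] ?B = a *[S] b + a' *[S'] b'"
  using fin by (auto simp: mmul_def fun_eq_iff sum.Plus)
 then have "?A *[?T] ?B = idm R" using sum by (rule trans)
 then have "card R \<le> card ?T" by (rule card_le_if_inverse[OF fin(1) T(1)])
 moreover have "?B *[R] ?A = idm ?T"
 proof (intro ext)
  fix x y
  have *: "(SUM k:R. b i k * a k j) = idm S i j" "(SUM k:R. b' i' k * a' k j') = idm S' i' j'"
   "(SUM k:R. b i k * a' k j') = 0" "(SUM k:R. b' i' k * a k j) = 0" for i j i' j'
   using fun_cong[OF fun_cong[OF ab(3)]] fun_cong[OF fun_cong[OF ab'(3)]]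
    fun_cong[OF fun_cong[OF ba']] fun_cong[OF fun_cong[OF b'a]] by (simp_all add: mmul_def)
  show "(?B *[R] ?A) x y = idm ?T x y"
   by (cases x; cases y) (auto simp: mmul_def * idm_def)
 qed
 then have "card ?T \<le> card R" by (rule card_le_if_inverse[OF T(1) fin(1)])
 ultimately show "card S + card S' = card R" using T(2) by simp
qed

section \<open>Representations of bipartite quivers and reflections\<close>

text \<open>The separated quiver has two copies of the vertex set \<open>W\<close>, and every arrow \<open>ar\<close> runs from
  the source copy of \<open>src ar\<close> to the sink copy of \<open>tgt ar\<close>. The families \<open>T\<close> and \<open>S\<close> are the index
  sets of the spaces at the sources and the sinks.\<close>

definition bquiver :: "'v set => 'a set => ('a => 'v) => ('a => 'v) => bool" where
 "bquiver W E src tgt \<longleftrightarrow> finite W & finite E & src ` E \<subseteq> W & tgt ` E \<subseteq> W"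

definition brep :: "'v set => 'a set => ('a => 'v) => ('a => 'v) => ('v => nat set) => ('v => nat set)
  => ('a => nat => nat => 'k::field) => bool" where
 "brep W E src tgt T S y \<longleftrightarrow> (ALL v:W. finite (T v) & finite (S v)) &
   (ALL ar:E. y ar : mats (S (tgt ar)) (T (src ar)))"

definition bhom where
 "bhom W E src tgt T S y T' S' y' D A \<longleftrightarrow>
   (ALL v:W. D v : mats (T' v) (T v) & A v : mats (S' v) (S v)) &
   (ALL ar:E. A (tgt ar) *[S (tgt ar)] y ar = y' ar *[T' (src ar)] D (src ar))"

definition biso where
 "biso W E src tgt T S y T' S' y' \<longleftrightarrow> (EX D A D' A'.
   bhom W E src tgt T S y T' S' y' D A & bhom W E src tgt T' S' y' T S y D' A' &
   (ALL v:W. D' v *[T' v] D v = idm (T v) & D v *[T v] D' v = idm (T' v) &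
       A' v *[S' v] A v = idm (S v) & A v *[S v] A' v = idm (S' v)))"

text \<open>Direct sum decompositions are encoded by idempotent endomorphisms.\<close>

definition bindec where
 "bindec W E src tgt T S y \<longleftrightarrow> (EX v:W. T v ~= {} \<or> S v ~= {}) &
   (ALL D A. bhom W E src tgt T S y T S y D A &
    (ALL v:W. D v *[T v] D v = D v & A v *[S v] A v = A v) -->
    (ALL v:W. D v = 0 & A v = 0) \<or> (ALL v:W. D v = idm (T v) & A v = idm (S v)))"

text \<open>Surjectivity of the combined map into every sink, stated dually: no nonzero row vector
  on \<open>S v\<close> annihilates all matrices ending at \<open>v\<close>. When it fails, this
  form hands over a functional that splits off a summand, and transposing turns it into injectivity
  at the sources.\<close>

definition bsurj where
 "bsurj W E tgt S y \<longleftrightarrow> (ALL v:W. ALL r. (ALL i. i \<notin> S v --> r i = 0) &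
   (ALL ar:E. tgt ar = v --> (ALL j. (SUM i:S v. r i * y ar i j) = 0)) --> (ALL i. r i = 0))"

abbreviation binj where
 "binj W E src T y \<equiv> bsurj W E src T (%ar. transp (y ar))"

section \<open>Duality: transposition exchanges sources and sinks\<close>

lemma bquiver_op: "bquiver W E src tgt ==> bquiver W E tgt src"
 by (simp add: bquiver_def)

lemma idm_eq_0_iff [simp]: "idm X = (0 :: 'i => 'i => 'k::comm_ring_1) \<longleftrightarrow> X = {}"
 by (auto simp: idm_def fun_eq_iff split: if_splits)

lemma brep_transp: "brep W E src tgt T S y ==> brep W E tgt src S T (%ar. transp (y ar))"
 by (simp add: brep_def)

lemma bhom_transp:
 assumes "bhom W E tgt src S T (%ar. transp (y ar)) S T (%ar. transp (y ar)) A D"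
 shows "bhom W E src tgt T S y T S y (%v. transp (D v)) (%v. transp (A v))"
 unfolding bhom_def
proof (intro conjI ballI)
 fix ar assume "ar : E"
 then have "D (src ar) *[T (src ar)] transp (y ar) = transp (y ar) *[S (tgt ar)] A (tgt ar)"
  using assms by (simp add: bhom_def)
 from arg_cong[OF this, of transp]
 show "transp (A (tgt ar)) *[S (tgt ar)] y ar = y ar *[T (src ar)] transp (D (src ar))"
  by (simp add: transp_mmul)
qed (use assms in "auto simp: bhom_def")

lemma transp_eq_iff: "transp A = B \<longleftrightarrow> A = transp B"
 by (metis transp_transp)

lemma transp_0 [simp]: "transp 0 = 0"
 by (simp add: transp_def fun_eq_iff)

lemma bindec_transp:
 assumes "bindec W E src tgt T S y"
 shows "bindec W E tgt src S T (%ar. transp (y ar))"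
 unfolding bindec_def
proof (intro conjI allI impI)
 show "EX v:W. S v ~= {} \<or> T v ~= {}" using assms by (auto simp: bindec_def)
 fix A D
 assume *: "bhom W E tgt src S T (%ar. transp (y ar)) S T (%ar. transp (y ar)) A D &
  (ALL v:W. A v *[S v] A v = A v & D v *[T v] D v = D v)"
 have "ALL v:W. transp (D v) *[T v] transp (D v) = transp (D v) &
   transp (A v) *[S v] transp (A v) = transp (A v)"
  using * by (simp flip: transp_mmul)
 with bhom_transp[OF conjunct1[OF *]]
 have "(ALL v:W. transp (D v) = 0 & transp (A v) = 0) \<or>
   (ALL v:W. transp (D v) = idm (T v) & transp (A v) = idm (S v))"
  using assms unfolding bindec_def by blast
 then show "(ALL v:W. A v = 0 & D v = 0) \<or> (ALL v:W. A v = idm (S v) & D v = idm (T v))"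
  by (auto simp: transp_eq_iff)
qed

text \<open>A row vector \<open>r\<close> killing everything that arrives at \<open>v\<close> splits
  off a simple summand at the sink \<open>v\<close>. An indecomposable with such a summand is that
  simple one, of total dimension 1, which \<open>big\<close> excludes.\<close>

lemma bindec_surj:
 assumes rep: "brep W E src tgt T S (y :: 'a => nat => nat => 'k::field)" and "finite W"
  and ind: "bindec W E src tgt T S y"
  and big: "(SUM v:W. card (T v) + card (S v)) \<ge> 2"
 shows "bsurj W E tgt S y"
 unfolding bsurj_def
proof (intro ballI allI impI, rule ccontr, elim conjE)
 fix v r i0 assume v: "v : W" and r: "ALL i. i \<notin> S v --> r i = 0" "r i0 ~= 0"
  and ry: "ALL ar:E. tgt ar = v --> (ALL j. (SUM i:S v. r i * y ar i j) = 0)"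
 have i0: "i0 : S v" using r by auto
 have finS: "finite (S v)" using rep v by (auto simp: brep_def)
 \<comment> \<open>The projection of rank one onto the coordinate \<open>i0\<close> along the kernel
   of \<open>r\<close>. With 0 at all other places it is an idempotent endomorphism, since
   \<open>P\<close> kills the incoming matrices.\<close>
 define P where "P i j = (if i = i0 then r j / r i0 else 0)" for i j
 have P: "P : mats (S v) (S v)" using r i0 by (auto simp: P_def intro!: matsI)
 have "(P *[S v] P) i j = (SUM k:S v. if k = i0 then P i j else 0)" for i j
  unfolding mmul_def using r(2) by (intro sum.cong) (auto simp: P_def)
 then have PP: "P *[S v] P = P" using finS i0 by (simp add: fun_eq_iff)
 have Py: "P *[S v] y ar = 0" if "ar : E" "tgt ar = v" for ar
 proof (intro ext)
  fix i j
  have "(SUM k:S v. r k / r i0 * y ar k j) = (SUM k:S v. r k * y ar k j) / r i0"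
   by (simp add: sum_divide_distrib)
  then show "(P *[S v] y ar) i j = 0 i j" using ry that by (cases "i = i0") (simp_all add: mmul_def P_def)
 qed
 let ?A = "%u. if u = v then P else 0" and ?D = "%u. 0 :: nat => nat => 'k"
 have "bhom W E src tgt T S y T S y ?D ?A" using P Py by (auto simp: bhom_def)
 moreover have "ALL u:W. ?D u *[T u] ?D u = ?D u & ?A u *[S u] ?A u = ?A u"
  using PP by auto
 ultimately have "(ALL u:W. ?D u = 0 & ?A u = 0) \<or> (ALL u:W. ?D u = idm (T u) & ?A u = idm (S u))"
  using ind unfolding bindec_def by blast
 moreover have "P i0 i0 = 1" using r(2) by (simp add: P_def)
 then have "P ~= 0" by (metis zero_fun_apply zero_neq_one)
 ultimately have id: "!!u. u : W ==> ?D u = idm (T u) & ?A u = idm (S u)" using v by auto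
 have T: "T u = {}" if "u : W" for u using id[OF that] by (metis idm_eq_0_iff)
 have S: "S u = {}" if "u : W" "u ~= v" for u using id[OF that(1)] that(2) by (metis idm_eq_0_iff)
 have "P = idm (S v)" using id[OF v] by simp
 then have "P i i = 1" if "i : S v" for i using that by (simp add: idm_def)
 then have "S v \<subseteq> {i0}" unfolding P_def by (metis singletonI subsetI zero_neq_one)
 then have "card (S v) \<le> 1" using card_mono[of "{i0}" "S v"] by simp
 moreover have "(SUM u:W. card (T u) + card (S u)) = (SUM u:W. if u = v then card (S v) else 0)"
  by (intro sum.cong) (auto simp: T S)
 ultimately show False using big v assms(2) by simp
qed

lemma bindec_inj:
 assumes "brep W E src tgt T S (y :: 'a => nat => nat => 'k::field)" "finite W"
  and "bindec W E src tgt T S y" "(SUM v:W. card (T v) + card (S v)) \<ge> 2"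
 shows "binj W E src T y"
 using bindec_surj[OF brep_transp[OF assms(1)] assms(2) bindec_transp[OF assms(3)]] assms(4)
 by (simp add: add.commute)

text \<open>The arrows into a sink \<open>v\<close> are collected in one matrix \<open>gather E tgt y v\<close> with column index
  set \<open>in_index E src tgt T v\<close>, and the arrows out of a source of the opposite quiver in one matrix
  \<open>spread E tgt y v\<close>.\<close>

definition in_index :: "'a set => ('a => 'v) => ('a => 'v) => ('v => nat set) => 'v => ('a \<times> nat) set" where
 "in_index E src tgt T v = (SIGMA ar:{ar\<in>E. tgt ar = v}. T (src ar))"

definition gather where
 "gather E tgt y v i = (%(ar, j). if ar : E & tgt ar = v then y ar i j else 0)"

definition spread where
 "spread E tgt y v = (%(ar, j) k. if ar : E & tgt ar = v then y ar j k else 0)"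

definition diag_block where
 "diag_block E src tgt D v = (%(br, i) (ar, j). if br = ar & ar : E & tgt ar = v then D (src ar) i j else 0)"

lemma finite_in_index:
 assumes "bquiver W E src tgt" "ALL v:W. finite (T v)"
 shows "finite (in_index E src tgt T v)"
 using assms unfolding in_index_def bquiver_def by (intro finite_SigmaI) auto

lemma card_in_index:
 assumes "bquiver W E src tgt" "ALL v:W. finite (T v)"
 shows "card (in_index E src tgt T v) = (\<Sum>ar | ar : E & tgt ar = v. card (T (src ar)))"
 using assms unfolding in_index_def bquiver_def by (subst card_SigmaI) auto

lemma sum_in_index:
 assumes "bquiver W E src tgt" "ALL v:W. finite (T v)" "ar : E" "tgt ar = v"
  and "!!br l. br ~= ar ==> f (br, l) = (0::'k::comm_ring_1)"
 shows "(SUM p:in_index E src tgt T v. f p) = (SUM l:T (src ar). f (ar, l))"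
proof -
 have fin: "finite {ar\<in>E. tgt ar = v}" "ALL br:{ar\<in>E. tgt ar = v}. finite (T (src br))"
  using assms(1,2) by (auto simp: bquiver_def)
 have "(SUM p:in_index E src tgt T v. f p) = (\<Sum>br | br : E & tgt br = v. SUM l:T (src br). f (br, l))"
  unfolding in_index_def by (subst sum.Sigma[OF fin]) (simp add: case_prod_beta')
 also have "... = (\<Sum>br | br : E & tgt br = v. if br = ar then SUM l:T (src ar). f (ar, l) else 0)"
  using assms(5) by (intro sum.cong) auto
 also have "... = (SUM l:T (src ar). f (ar, l))" using fin(1) assms(3,4) by simp
 finally show ?thesis .
qed

lemma gather_mats:
 "brep W E src tgt T S y ==> gather E tgt y v : mats (S v) (in_index E src tgt T v)"
 by (fastforce simp: brep_def gather_def in_index_def mats_def split: if_splits)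

lemma spread_mats:
 "brep W E tgt src S' T y ==> spread E tgt y v : mats (in_index E src tgt T v) (S' v)"
 by (fastforce simp: brep_def spread_def in_index_def mats_def split: if_splits)

lemma diag_block_mats:
 "bquiver W E src tgt ==> ALL v:W. D v : mats (T' v) (T v) ==>
  diag_block E src tgt D v : mats (in_index E src tgt T' v) (in_index E src tgt T v)"
 by (fastforce simp: bquiver_def diag_block_def in_index_def image_subset_iff mats_def split: if_splits)

lemma mmul_gather: "(A *[S] gather E tgt y v) = gather E tgt (%ar. A *[S] y ar) v"
 by (auto simp: gather_def mmul_def fun_eq_iff)

lemma spread_mmul: "(spread E tgt y v *[S] A) = spread E tgt (%ar. y ar *[S] A) v"
 by (auto simp: spread_def mmul_def fun_eq_iff)

lemma gather_diag_block:
 fixes E :: "'a set" and D :: "'v => nat => nat => 'k::field" and y :: "'a => nat => nat => 'k"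
 assumes "bquiver W E src tgt" "ALL v:W. finite (T v)"
 shows "gather E tgt y v *[in_index E src tgt T v] diag_block E src tgt D v
  = gather E tgt (%ar. y ar *[T (src ar)] D (src ar)) v"
proof (intro ext)
 fix i :: nat and p :: "'a \<times> nat"
 obtain ar j where p: "p = (ar, j)" by force
 show "(gather E tgt y v *[in_index E src tgt T v] diag_block E src tgt D v) i p
  = gather E tgt (%ar. y ar *[T (src ar)] D (src ar)) v i p"
 proof (cases "ar : E & tgt ar = v")
  case True
  then show ?thesis unfolding p mmul_def
   by (subst sum_in_index[OF assms]) (auto simp: gather_def diag_block_def mmul_def)
 next
  case False
  then show ?thesis unfolding p mmul_def
   by (auto simp: gather_def diag_block_def intro!: sum.neutral)
 qed
qed

lemma diag_block_spread:
 fixes E :: "'a set" and D :: "'v => nat => nat => 'k::field" and y :: "'a => nat => nat => 'k"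
 assumes "bquiver W E src tgt" "ALL v:W. finite (T v)"
 shows "diag_block E src tgt D v *[in_index E src tgt T v] spread E tgt y v
  = spread E tgt (%ar. D (src ar) *[T (src ar)] y ar) v"
proof (intro ext)
 fix p :: "'a \<times> nat" and j :: nat
 obtain ar i where p: "p = (ar, i)" by force
 show "(diag_block E src tgt D v *[in_index E src tgt T v] spread E tgt y v) p j
  = spread E tgt (%ar. D (src ar) *[T (src ar)] y ar) v p j"
 proof (cases "ar : E & tgt ar = v")
  case True
  then show ?thesis unfolding p mmul_def
   by (subst sum_in_index[OF assms]) (auto simp: spread_def diag_block_def mmul_def)
 next
  case False
  then show ?thesis unfolding p mmul_def
   by (auto simp: spread_def diag_block_def intro!: sum.neutral)
 qed
qed

lemma gather_cong: "(!!ar. ar : E ==> tgt ar = v ==> y ar = y' ar) ==> gather E tgt y v = gather E tgt y' v"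
 and spread_cong: "(!!ar. ar : E ==> tgt ar = v ==> z ar = z' ar) ==> spread E tgt z v = spread E tgt z' v"
 by (auto simp: gather_def spread_def fun_eq_iff)

lemma gather_eqD: "gather E tgt y v = gather E tgt y' v ==> ar : E ==> tgt ar = v ==> y ar = y' ar"
proof (intro ext)
 fix i j assume "gather E tgt y v = gather E tgt y' v" "ar : E" "tgt ar = v"
 from fun_cong[OF fun_cong[OF this(1)], of i "(ar, j)"] this(2,3) show "y ar i j = y' ar i j"
  by (simp add: gather_def)
qed

text \<open>For a generalized inverse \<rho> of \<open>?M\<close> the rows of
  \<open>?M \<rho> - 1\<close> annihilate \<open>?M\<close>, hence all incoming matrices, so they
  vanish.\<close>

lemma bsurj_right_inverse:
 assumes "bquiver W E src tgt" and rep: "brep W E src tgt T S y" and "bsurj W E tgt S y" and v: "v : W"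
 obtains \<rho> where "\<rho> : mats (in_index E src tgt T v) (S v)"
  "gather E tgt y v *[in_index E src tgt T v] \<rho> = idm (S v)"
proof -
 let ?N = "in_index E src tgt T v" and ?M = "gather E tgt y v"
 have finT: "ALL v:W. finite (T v)" and finS: "finite (S v)" using rep v by (auto simp: brep_def)
 have fN: "finite ?N" by (rule finite_in_index[OF assms(1) finT])
 obtain \<rho> where \<rho>: "\<rho> : mats ?N (S v)" "?M *[?N] (\<rho> *[S v] ?M) = ?M"
  using generalized_inverse[OF fN finS gather_mats[OF rep]] by blast
 define r where "r = ?M *[?N] \<rho> - idm (S v)"
 have r: "r : mats (S v) (S v)" using gather_mats[OF rep, of v] \<rho>(1) unfolding r_def by blast
 have "r *[S v] ?M = 0"
  unfolding r_def by (simp add: mmul_simps \<rho>(2) idm_mmul[OF finS gather_mats[OF rep]])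
 then have *: "gather E tgt (%ar. r *[S v] y ar) v = gather E tgt (%_. 0) v"
  unfolding mmul_gather by (simp add: gather_def fun_eq_iff)
 have "r *[S v] y ar = 0" if "ar : E" "tgt ar = v" for ar
  using gather_eqD[OF * that] by simp
 then have "(SUM i:S v. r k i * y ar i j) = 0" if "ar : E" "tgt ar = v" for ar j k
  using that by (simp add: mmul_def fun_eq_iff)
 then have "r k i = 0" for k i
  using assms(3) v matsD[OF r] unfolding bsurj_def by blast
 then have "?M *[?N] \<rho> = idm (S v)" by (simp add: r_def fun_eq_iff)
 with \<rho>(1) that show thesis by blast
qed

text \<open>The reflection at all sinks at once, encoded by a split exact sequence
  \<open>0 -> S' v -> N -> S v -> 0\<close> at every vertex: \<open>M\<close> is the map onto the
  sink, \<kappa> the inclusion of its kernel, \<rho> a section and \<open>b\<close> a retraction.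
  The maps \<open>Y\<close> out of the kernels run along the reversed arrows, whence the exchanged
  \<open>tgt src\<close>.\<close>

definition reflects where
 "reflects W E src tgt T S y S' Y \<longleftrightarrow> brep W E tgt src S' T Y &
   (ALL v:W. \<exists>\<rho> b. let N = in_index E src tgt T v; M = gather E tgt y v; \<kappa> = spread E tgt Y v in
    \<rho> : mats N (S v) & b : mats (S' v) N & M *[N] \<rho> = idm (S v) & b *[N] \<kappa> = idm (S' v) &
    \<rho> *[S v] M + \<kappa> *[S' v] b = idm N)"

lemma reflectsE:
 assumes "reflects W E src tgt T S y S' Y" "v : W"
 obtains \<rho> b where "\<rho> : mats (in_index E src tgt T v) (S v)" "b : mats (S' v) (in_index E src tgt T v)"
  "gather E tgt y v *[in_index E src tgt T v] \<rho> = idm (S v)"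
  "b *[in_index E src tgt T v] spread E tgt Y v = idm (S' v)"
  "\<rho> *[S v] gather E tgt y v + spread E tgt Y v *[S' v] b = idm (in_index E src tgt T v)"
 using assms unfolding reflects_def Let_def by blast

text \<open>The idempotent \<open>1 - \<rho> M\<close> projects onto the kernel of \<open>M\<close>,
  and splitting it gives \<kappa> and \<open>b\<close>. The index set is renumbered to
  \<open>{..<n}\<close>, because the spaces of a \<open>brep\<close> are indexed by natural
  numbers.\<close>

lemma reflection_exists:
 assumes Q: "bquiver W E src tgt" and rep: "brep W E src tgt T S y" and surj: "bsurj W E tgt S y"
 obtains S' Y where "reflects W E src tgt T S y S' Y"
proof -
 let ?N = "in_index E src tgt T" and ?M = "gather E tgt y"
 have finT: "ALL v:W. finite (T v)" and finS: "!!v. v : W ==> finite (S v)"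
  using rep by (auto simp: brep_def)
 have "\<exists>n \<rho> \<kappa> b. \<rho> : mats (?N v) (S v) & \<kappa> : mats (?N v) {..<n::nat} & b : mats {..<n} (?N v) &
   ?M v *[?N v] \<rho> = idm (S v) & b *[?N v] \<kappa> = idm {..<n} & \<rho> *[S v] ?M v + \<kappa> *{n} b = idm (?N v)"
  if v: "v : W" for v
 proof -
  obtain \<rho> where \<rho>: "\<rho> : mats (?N v) (S v)" "?M v *[?N v] \<rho> = idm (S v)"
   using bsurj_right_inverse[OF assms v] by blast
  have fN: "finite (?N v)" by (rule finite_in_index[OF Q finT])
  define P where "P = idm (?N v) - \<rho> *[S v] ?M v"
  have rM: "\<rho> *[S v] ?M v : mats (?N v) (?N v)" using gather_mats[OF rep, of v] \<rho>(1) by blast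
  then have P: "P : mats (?N v) (?N v)" unfolding P_def by blast
  have "?M v *[?N v] (\<rho> *[S v] ?M v) = ?M v"
   unfolding mmul_assoc[symmetric] \<rho>(2) by (rule idm_mmul[OF finS[OF v] gather_mats[OF rep]])
  then have "P *[?N v] P = P"
   unfolding P_def by (simp add: mmul_simps idm_mmul_idm[OF fN] idm_mmul[OF fN rM]
    mmul_idm[OF fN gather_mats[OF rep]])
  then obtain X a b where X: "X \<subseteq> ?N v" "a : mats (?N v) X" "b : mats X (?N v)"
   "a *[X] b = P" "b *[?N v] a = idm X"
   by (rule idempotent_factors[OF fN P])
  have fX: "finite X" using X(1) fN by (rule finite_subset)
  obtain \<kappa> c where "\<kappa> : mats (?N v) {..<card X}" "c : mats {..<card X} (?N v)"
   "\<kappa> *{card X} c = a *[X] b" "c *[?N v] \<kappa> = idm {..<card X}"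
   using reindex_splitting[OF fX _ _ X(2,3,5), of "{..<card X}"] by auto
  then show ?thesis using \<rho> X(4)
   by (intro exI[of _ "card X"] exI[of _ \<rho>] exI[of _ \<kappa>] exI[of _ c]) (simp add: P_def)
 qed
 then obtain n \<rho> \<kappa> b where *: "!!v. v : W ==> \<rho> v : mats (?N v) (S v) & \<kappa> v : mats (?N v) {..<n v::nat} &
   b v : mats {..<n v} (?N v) & ?M v *[?N v] \<rho> v = idm (S v) & b v *[?N v] \<kappa> v = idm {..<n v} &
   \<rho> v *[S v] ?M v + \<kappa> v *{n v} b v = idm (?N v)"
  by metis
 define Y where "Y ar = (%j k. \<kappa> (tgt ar) (ar, j) k)" for ar
 have \<kappa>: "spread E tgt Y v = \<kappa> v" if "v : W" for v
 proof (intro ext)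
  fix p k
  have "\<kappa> v : mats (?N v) {..<n v}" using *[OF that] by blast
  then show "spread E tgt Y v p k = \<kappa> v p k"
   by (cases p) (auto simp: spread_def Y_def in_index_def matsD)
 qed
 have "brep W E tgt src (%v. {..<n v}) T Y"
  unfolding brep_def
 proof (intro conjI ballI)
  fix ar assume "ar : E"
  then have "\<kappa> (tgt ar) : mats (?N (tgt ar)) {..<n (tgt ar)}" using * Q by (auto simp: bquiver_def)
  then show "Y ar : mats (T (src ar)) {..<n (tgt ar)}"
   by (intro matsI) (auto simp: Y_def in_index_def matsD)
 qed (use finT in auto)
 then have "reflects W E src tgt T S y (%v. {..<n v}) Y"
  unfolding reflects_def Let_def using * \<kappa> by (intro conjI ballI; simp) blast
 then show thesis by (rule that)
qed

text \<open>The dimension formula of the split exact sequence; it makes dimension vectors change by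
  the reflection of the Tits form.\<close>

lemma reflects_card:
 assumes "bquiver W E src tgt" "brep W E src tgt T S y" "reflects W E src tgt T S y S' Y" "v : W"
 shows "card (S v) + card (S' v) = (\<Sum>ar | ar : E & tgt ar = v. card (T (src ar)))"
proof -
 have rep': "brep W E tgt src S' T Y" using assms(3) by (simp add: reflects_def)
 have fin: "ALL v:W. finite (T v)" "finite (S v)" "finite (S' v)"
  using assms(2,4) rep' by (auto simp: brep_def)
 obtain \<rho> b where *: "\<rho> : mats (in_index E src tgt T v) (S v)" "b : mats (S' v) (in_index E src tgt T v)"
  "gather E tgt y v *[in_index E src tgt T v] \<rho> = idm (S v)"
  "b *[in_index E src tgt T v] spread E tgt Y v = idm (S' v)"
  "\<rho> *[S v] gather E tgt y v + spread E tgt Y v *[S' v] b = idm (in_index E src tgt T v)"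
  by (rule reflectsE[OF assms(3,4)])
 show ?thesis
  using complementary_splittings(3)[OF finite_in_index[OF assms(1) fin(1)] fin(2,3) *(1)
    gather_mats[OF assms(2)] *(3) spread_mats[OF rep'] *(2,4,5)]
   card_in_index[OF assms(1) fin(1)] by simp
qed

text \<open>A morphism \<open>C\<close> of the kernels that is compatible with \<open>D\<close>
  makes \<open>D\<close> respect the exact sequences, so \<open>D\<close> induces a map of the
  cokernels. With the section \<rho> this map is \<open>M' D \<rho>\<close>.\<close>

lemma reflects_lift:
 assumes Q: "bquiver W E src tgt" and rep: "brep W E src tgt T S y" "brep W E src tgt T' S' y'"
  and R: "reflects W E src tgt T S y U Y" and R': "reflects W E src tgt T' S' y' U' Y'"
  and hom: "bhom W E tgt src U T Y U' T' Y' C D"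
 obtains A where "bhom W E src tgt T S y T' S' y' D A"
proof -
 let ?N = "in_index E src tgt T" and ?N' = "in_index E src tgt T'"
 let ?M = "gather E tgt y" and ?M' = "gather E tgt y'" and ?\<kappa> = "spread E tgt Y" and ?\<kappa>' = "spread E tgt Y'"
 let ?D = "diag_block E src tgt D"
 have repY: "brep W E tgt src U T Y" "brep W E tgt src U' T' Y'" using R R' by (simp_all add: reflects_def)
 have fin: "ALL v:W. finite (T v)" "ALL v:W. finite (T' v)" "ALL v:W. finite (S v) & finite (S' v) & finite (U v) & finite (U' v)"
  using rep repY by (auto simp: brep_def)
 have D: "ALL v:W. D v : mats (T' v) (T v)" using hom by (simp add: bhom_def)
 have "EX A. A : mats (S' v) (S v) & A *[S v] ?M v = ?M' v *[?N' v] ?D v" if v: "v : W" for v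
 proof -
  obtain \<rho> b where *: "\<rho> : mats (?N v) (S v)" "b : mats (U v) (?N v)" "?M v *[?N v] \<rho> = idm (S v)"
   "b *[?N v] ?\<kappa> v = idm (U v)" "\<rho> *[S v] ?M v + ?\<kappa> v *[U v] b = idm (?N v)"
   by (rule reflectsE[OF R v])
  obtain \<rho>' b' where **: "\<rho>' : mats (?N' v) (S' v)" "b' : mats (U' v) (?N' v)" "?M' v *[?N' v] \<rho>' = idm (S' v)"
   "b' *[?N' v] ?\<kappa>' v = idm (U' v)" "\<rho>' *[S' v] ?M' v + ?\<kappa>' v *[U' v] b' = idm (?N' v)"
   by (rule reflectsE[OF R' v])
  have M\<kappa>': "?M' v *[?N' v] ?\<kappa>' v = 0"
   by (rule complementary_splittings(1)[OF finite_in_index[OF Q fin(2)] _ _ **(1)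
     gather_mats[OF rep(2)] **(3) spread_mats[OF repY(2)] **(2,4,5)]) (use fin v in auto)
  have Dk: "?D v *[?N v] ?\<kappa> v = ?\<kappa>' v *[U' v] C v"
   unfolding diag_block_spread[OF Q fin(1)] spread_mmul
   by (rule spread_cong) (use hom in "auto simp: bhom_def")
  have Dm: "?D v : mats (?N' v) (?N v)" by (rule diag_block_mats[OF Q D])
  have "?M' v *[?N' v] ?D v = ?M' v *[?N' v] (?D v *[?N v] (\<rho> *[S v] ?M v + ?\<kappa> v *[U v] b))"
   unfolding *(5) by (simp add: mmul_idm[OF finite_in_index[OF Q fin(1)] Dm])
  also have "... = ?M' v *[?N' v] (?D v *[?N v] (\<rho> *[S v] ?M v))
    + ?M' v *[?N' v] ((?D v *[?N v] ?\<kappa> v) *[U v] b)" by (simp only: mmul_simps)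
  also have "?M' v *[?N' v] ((?D v *[?N v] ?\<kappa> v) *[U v] b) = (?M' v *[?N' v] ?\<kappa>' v) *[U' v] (C v *[U v] b)"
   unfolding Dk by (simp only: mmul_assoc)
  finally have "(?M' v *[?N' v] (?D v *[?N v] \<rho>)) *[S v] ?M v = ?M' v *[?N' v] ?D v"
   unfolding M\<kappa>' by (simp add: mmul_assoc)
  moreover have "?M' v *[?N' v] (?D v *[?N v] \<rho>) : mats (S' v) (S v)"
   using gather_mats[OF rep(2), of v] Dm *(1) by blast
  ultimately show ?thesis by blast
 qed
 then obtain A where A: "!!v. v : W ==> A v : mats (S' v) (S v)"
  "!!v. v : W ==> A v *[S v] ?M v = ?M' v *[?N' v] ?D v" by metis
 have "bhom W E src tgt T S y T' S' y' D A"
  unfolding bhom_def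
 proof (intro conjI ballI)
  fix ar assume ar: "ar : E"
  then have "tgt ar : W" using Q by (auto simp: bquiver_def)
  from A(2)[OF this] show "A (tgt ar) *[S (tgt ar)] y ar = y' ar *[T' (src ar)] D (src ar)"
   unfolding mmul_gather gather_diag_block[OF Q fin(2)] by (rule gather_eqD[OF _ ar refl])
 qed (use A(1) D in auto)
 then show thesis by (rule that)
qed

text \<open>The combined map into a sink has a right inverse, so the components at the sinks are
  determined by those at the sources.\<close>

lemma bhom_unique:
 assumes Q: "bquiver W E src tgt" and rep: "brep W E src tgt T S y" and R: "reflects W E src tgt T S y U Y"
  and h: "bhom W E src tgt T S y T' S' y' D A" and h': "bhom W E src tgt T S y T' S' y' D' A'"
  and eq: "!!v. v : W ==> D v = D' v" and v: "v : W"
 shows "A v = A' v"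
proof -
 let ?N = "in_index E src tgt T" and ?M = "gather E tgt y"
 obtain \<rho> b where \<rho>: "?M v *[?N v] \<rho> = idm (S v)" using reflectsE[OF R v] by metis
 have "A v *[S v] ?M v = A' v *[S v] ?M v"
  unfolding mmul_gather
 proof (rule gather_cong)
  fix ar assume "ar : E" "tgt ar = v"
  then show "A v *[S v] y ar = A' v *[S v] y ar"
   using h h' eq Q unfolding bhom_def bquiver_def by (metis image_subset_iff)
 qed
 then have "A v *[S v] (?M v *[?N v] \<rho>) = A' v *[S v] (?M v *[?N v] \<rho>)"
  by (simp flip: mmul_assoc)
 moreover have "finite (S v)" "A v : mats (S' v) (S v)" "A' v : mats (S' v) (S v)"
  using rep h h' v by (auto simp: brep_def bhom_def)
 ultimately show ?thesis unfolding \<rho> by (simp add: mmul_idm)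
qed

lemma bhom_comp:
 assumes "bhom W E src tgt T S y T' S' y' D A" "bhom W E src tgt T' S' y' T'' S'' y'' D' A'"
 shows "bhom W E src tgt T S y T'' S'' y'' (%v. D' v *[T' v] D v) (%v. A' v *[S' v] A v)"
 unfolding bhom_def
proof (intro conjI ballI)
 fix ar assume "ar : E"
 then have "A (tgt ar) *[S (tgt ar)] y ar = y' ar *[T' (src ar)] D (src ar)"
  "A' (tgt ar) *[S' (tgt ar)] y' ar = y'' ar *[T'' (src ar)] D' (src ar)"
  using assms by (auto simp: bhom_def)
 then show "(A' (tgt ar) *[S' (tgt ar)] A (tgt ar)) *[S (tgt ar)] y ar
   = y'' ar *[T'' (src ar)] (D' (src ar) *[T' (src ar)] D (src ar))"
  by (metis mmul_assoc)
qed (use assms in "auto simp: bhom_def")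

lemma bhom_idm:
 assumes "bquiver W E src tgt" "brep W E src tgt T S y"
 shows "bhom W E src tgt T S y T S y (%v. idm (T v)) (%v. idm (S v))"
proof -
 have "idm (S (tgt ar)) *[S (tgt ar)] y ar = y ar" "y ar *[T (src ar)] idm (T (src ar)) = y ar" if "ar : E" for ar
  using assms that
  by (auto simp: bquiver_def brep_def image_subset_iff intro!: idm_mmul mmul_idm)
 then show ?thesis by (auto simp: bhom_def)
qed

lemma bhom_zero: "bhom W E src tgt T S y T' S' y' (%v. 0) (%v. 0)"
 by (simp add: bhom_def)

text \<open>An idempotent endomorphism \<open>(C, D)\<close> of the reflection lifts to
  \<open>(D, A)\<close>. Uniqueness of lifts makes \<open>A\<close> idempotent, so the lift is
  trivial by indecomposability, and \<open>D\<close> determines \<open>C\<close> because the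
  inclusion of the kernel has a left inverse.\<close>

lemma reflects_bindec:
 assumes Q: "bquiver W E src tgt" and rep: "brep W E src tgt T S y"
  and R: "reflects W E src tgt T S y U Y" and ind: "bindec W E src tgt T S y"
 shows "bindec W E tgt src U T Y"
 unfolding bindec_def
proof (intro conjI allI impI)
 have repY: "brep W E tgt src U T Y" using R by (simp add: reflects_def)
 have fin: "ALL v:W. finite (T v)" "ALL v:W. finite (U v)" using rep repY by (auto simp: brep_def)
 \<comment> \<open>Were all \<open>T v\<close> empty, the surjections onto the sinks would start at
   zero spaces and all \<open>S v\<close> would be empty too.\<close>
 show "EX v:W. U v ~= {} \<or> T v ~= {}"
 proof (rule ccontr)
  assume T: "\<not> ?thesis"
  have "S v = {}" if v: "v : W" for v
  proof -
   obtain \<rho> b where \<rho>: "gather E tgt y v *[in_index E src tgt T v] \<rho> = idm (S v)"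
    using reflectsE[OF R v] by metis
   have "in_index E src tgt T v = {}" using T Q by (auto simp: in_index_def bquiver_def)
   then have "idm (S v) = (0 :: nat => nat => 'c)" using \<rho> by simp
   then show ?thesis by simp
  qed
  then show False using ind T by (auto simp: bindec_def)
 qed
 fix C D
 assume *: "bhom W E tgt src U T Y U T Y C D &
  (ALL v:W. C v *[U v] C v = C v & D v *[T v] D v = D v)"
 then have hom: "bhom W E tgt src U T Y U T Y C D" by blast
 obtain A where A: "bhom W E src tgt T S y T S y D A"
  using reflects_lift[OF Q rep rep R R hom] by blast
 have "A v *[S v] A v = A v" if "v : W" for v
  by (rule bhom_unique[OF Q rep R bhom_comp[OF A A] A _ that]) (use * in auto)
 then have cases: "(ALL v:W. D v = 0 & A v = 0) \<or> (ALL v:W. D v = idm (T v) & A v = idm (S v))"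
  using ind A * unfolding bindec_def by blast
 have C: "C v = C' v" if v: "v : W" and D: "!!u. u : W ==> D u = D' u"
  and h': "bhom W E tgt src U T Y U T Y C' D'" for v C' D'
 proof -
  obtain \<rho> b where b: "b *[in_index E src tgt T v] spread E tgt Y v = idm (U v)"
   using reflectsE[OF R v] by metis
  have "spread E tgt Y v *[U v] C v = spread E tgt Y v *[U v] C' v"
   unfolding spread_mmul
  proof (rule spread_cong)
   fix ar assume "ar : E" "tgt ar = v"
   then show "Y ar *[U v] C v = Y ar *[U v] C' v"
    using hom h' D Q unfolding bhom_def bquiver_def by (metis image_subset_iff)
  qed
  then have "idm (U v) *[U v] C v = idm (U v) *[U v] C' v"
   unfolding b[symmetric] mmul_assoc by simp
  moreover have "C v : mats (U v) (U v)" "C' v : mats (U v) (U v)"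
   using hom h' v by (auto simp: bhom_def)
  ultimately show ?thesis using fin(2) v by (simp add: idm_mmul)
 qed
 from cases show "(ALL v:W. C v = 0 & D v = 0) \<or> (ALL v:W. C v = idm (U v) & D v = idm (T v))"
 proof
  assume 0: "ALL v:W. D v = 0 & A v = 0"
  have "C v = 0" if "v : W" for v by (rule C[OF that _ bhom_zero]) (use 0 in auto)
  with 0 show ?thesis by auto
 next
  assume 1: "ALL v:W. D v = idm (T v) & A v = idm (S v)"
  have "C v = idm (U v)" if "v : W" for v
   by (rule C[OF that _ bhom_idm[OF bquiver_op[OF Q] repY]]) (use 1 in auto)
  with 1 show ?thesis by auto
 qed
qed

text \<open>Both directions of the isomorphism lift, and the composites of the lifts are identities
  by \<open>bhom_unique\<close>. This carries uniqueness back from the reflected representations to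
  the original ones.\<close>

lemma reflects_biso:
 assumes Q: "bquiver W E src tgt" and rep: "brep W E src tgt T S y" "brep W E src tgt T' S' y'"
  and R: "reflects W E src tgt T S y U Y" and R': "reflects W E src tgt T' S' y' U' Y'"
  and iso: "biso W E tgt src U T Y U' T' Y'"
 shows "biso W E src tgt T S y T' S' y'"
proof -
 from iso obtain C D C' D' where h: "bhom W E tgt src U T Y U' T' Y' C D" "bhom W E tgt src U' T' Y' U T Y C' D'"
  and inv: "ALL v:W. D' v *[T' v] D v = idm (T v) & D v *[T v] D' v = idm (T' v)"
  unfolding biso_def by blast
 obtain A where A: "bhom W E src tgt T S y T' S' y' D A" using reflects_lift[OF Q rep R R' h(1)] .
 obtain A' where A': "bhom W E src tgt T' S' y' T S y D' A'"
  using reflects_lift[OF Q rep(2,1) R' R h(2)] .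
 have "A' v *[S' v] A v = idm (S v)" if "v : W" for v
  by (rule bhom_unique[OF Q rep(1) R bhom_comp[OF A A'] bhom_idm[OF Q rep(1)] _ that]) (use inv in auto)
 moreover have "A v *[S v] A' v = idm (S' v)" if "v : W" for v
  by (rule bhom_unique[OF Q rep(2) R' bhom_comp[OF A' A] bhom_idm[OF Q rep(2)] _ that]) (use inv in auto)
 ultimately show ?thesis unfolding biso_def using A A' inv by blast
qed

section \<open>Positive Tits forms\<close>

text \<open>The Tits form of the separated quiver; on dimension vectors it is the dimension of the
  acting group minus that of the representation space.\<close>

definition bform :: "'v set => 'a set => ('a => 'v) => ('a => 'v) => ('v => int) => ('v => int) => int" where
 "bform W E src tgt t s = (SUM v:W. t v * t v + s v * s v) - (SUM ar:E. t (src ar) * s (tgt ar))"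

text \<open>Weak positivity, on nonnegative vectors only. As the mixed terms all have negative sign,
  passing to absolute values extends it to all integer vectors.\<close>

definition bpos where
 "bpos W E src tgt \<longleftrightarrow> (ALL t s. (ALL v:W. 0 \<le> t v & 0 \<le> s v) & (EX v:W. t v ~= 0 \<or> s v ~= 0) -->
   1 \<le> bform W E src tgt t s)"

lemma bform_op: "bform W E tgt src s t = bform W E src tgt t s"
 by (simp add: bform_def add.commute mult.commute)

lemma bform_cong:
 assumes "bquiver W E src tgt" "!!v. v : W ==> t v = t' v" "!!v. v : W ==> s v = s' v"
 shows "bform W E src tgt t s = bform W E src tgt t' s'"
proof -
 have "(SUM ar:E. t (src ar) * s (tgt ar)) = (SUM ar:E. t' (src ar) * s' (tgt ar))"
  using assms by (intro sum.cong) (auto simp: bquiver_def image_subset_iff)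
 then show ?thesis using assms(2,3) by (simp add: bform_def)
qed

lemma bpos_ge_1:
 assumes "bpos W E src tgt" "v : W" "t v ~= 0 \<or> s v ~= 0"
 shows "1 \<le> bform W E src tgt t s"
proof -
 have "1 \<le> bform W E src tgt (%v. \<bar>t v\<bar>) (%v. \<bar>s v\<bar>)"
  using assms(2,3) by (intro assms(1)[unfolded bpos_def, rule_format]) auto
 also have "... \<le> bform W E src tgt t s"
  unfolding bform_def
 proof (intro diff_mono sum_mono)
  show "t (src ar) * s (tgt ar) \<le> \<bar>t (src ar)\<bar> * \<bar>s (tgt ar)\<bar>" for ar
   unfolding abs_mult[symmetric] by (rule abs_ge_self)
 qed simp
 finally show ?thesis .
qed

lemma bpos_nonneg:
 assumes "bquiver W E src tgt" "bpos W E src tgt"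
 shows "0 \<le> bform W E src tgt t s"
proof (cases "EX v:W. t v ~= 0 \<or> s v ~= 0")
 case True
 then obtain v where "v : W" "t v ~= 0 \<or> s v ~= 0" by blast
 from bpos_ge_1[where t=t and s=s, OF assms(2) this] show ?thesis by simp
next
 case False
 then have "bform W E src tgt t s = bform W E src tgt (%_. 0) (%_. 0)" by (intro bform_cong[OF assms(1)]) auto
 then show ?thesis by (simp add: bform_def)
qed

lemma bform_scale: "bform W E src tgt (%v. c * t v) (%v. c * s v) = c * c * bform W E src tgt t s"
 by (simp add: bform_def right_diff_distrib sum_distrib_left algebra_simps)

lemma bform_parallelogram:
 "bform W E src tgt (%v. t v - t' v) (%v. s v - s' v) + bform W E src tgt (%v. t v + t' v) (%v. s v + s' v)
  = 2 * bform W E src tgt t s + 2 * bform W E src tgt t' s'"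
proof -
 have "(SUM v:W. (t v - t' v) * (t v - t' v) + (s v - s' v) * (s v - s' v)) +
   (SUM v:W. (t v + t' v) * (t v + t' v) + (s v + s' v) * (s v + s' v)) =
   2 * (SUM v:W. t v * t v + s v * s v) + 2 * (SUM v:W. t' v * t' v + s' v * s' v)"
  unfolding sum_distrib_left sum.distrib[symmetric] by (intro sum.cong) (auto simp: algebra_simps)
 moreover have "(SUM ar:E. (t (src ar) - t' (src ar)) * (s (tgt ar) - s' (tgt ar))) +
   (SUM ar:E. (t (src ar) + t' (src ar)) * (s (tgt ar) + s' (tgt ar))) =
   2 * (SUM ar:E. t (src ar) * s (tgt ar)) + 2 * (SUM ar:E. t' (src ar) * s' (tgt ar))"
  unfolding sum_distrib_left sum.distrib[symmetric] by (intro sum.cong) (auto simp: algebra_simps)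
 moreover have "a - b + (a' - b') = 2 * (x - z) + 2 * (x' - z')"
  if "a + a' = 2 * x + 2 * x'" "b + b' = 2 * z + 2 * z'" for a a' b b' x x' z z' :: int
  unfolding right_diff_distrib using that by linarith
 ultimately show ?thesis unfolding bform_def by blast
qed

text \<open>Two vectors on the same level that are congruent modulo \<open>m\<close> coincide if \<open>m\<^sup>2 > 4 c\<close>, because
  the form takes a value of at least \<open>m\<^sup>2\<close> on their difference.\<close>

lemma finite_bform_level:
 assumes Q: "bquiver W E src tgt" and pos: "bpos W E src tgt"
 shows "finite {(t, s). t : extensional W & s : extensional W & bform W E src tgt t s = c}" (is "finite ?L")
proof -
 define m :: int where "m = 4 * \<bar>c\<bar> + 1"
 have m: "m \<ge> 1" "m * m > 4 * c"
 proof -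
  show "m \<ge> 1" by (simp add: m_def)
  then have "m * 1 \<le> m * m" by (intro mult_left_mono) auto
  moreover have "4 * c < m" by (simp add: m_def)
  ultimately show "m * m > 4 * c" by linarith
 qed
 let ?r = "%(t, s). (\<lambda>v\<in>W. t v mod m, \<lambda>v\<in>W. s v mod m)"
 let ?F = "\<Pi>\<^sub>E v\<in>W. {0..<m}"
 have "finite (?F \<times> ?F)" using Q by (auto simp: bquiver_def intro!: finite_PiE)
 moreover have "?r ` ?L \<subseteq> ?F \<times> ?F" using m(1) by auto
 moreover have "inj_on ?r ?L"
 proof (rule inj_onI)
  fix p p' assume "p : ?L" "p' : ?L" and r: "?r p = ?r p'"
  then obtain t s t' s' where p: "p = (t, s)" "p' = (t', s')" and
   ext: "t : extensional W" "s : extensional W" "t' : extensional W" "s' : extensional W"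
   and c: "bform W E src tgt t s = c" "bform W E src tgt t' s' = c" by auto
  show "p = p'"
  proof (rule ccontr)
   assume "p ~= p'"
   then obtain v where v: "v : W" "t v ~= t' v \<or> s v ~= s' v"
    using extensionalityI[OF ext(1,3)] extensionalityI[OF ext(2,4)] unfolding p by blast
   let ?t = "%v. (t v - t' v) div m" and ?s = "%v. (s v - s' v) div m"
   have eq: "t u mod m = t' u mod m" "s u mod m = s' u mod m" if "u : W" for u
    using r that unfolding p by (auto simp: fun_eq_iff restrict_def split: if_splits; metis)+
   have dvd: "m dvd t u - t' u" "m dvd s u - s' u" if "u : W" for u
    using eq[OF that] by (simp_all add: mod_eq_dvd_iff)
   have tm: "t u - t' u = m * ?t u" and sm: "s u - s' u = m * ?s u" if "u : W" for u
    using dvd[OF that] by simp_all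
   have "?t v ~= 0 \<or> ?s v ~= 0" using v(2) tm[OF v(1)] sm[OF v(1)] by auto
   then have "1 \<le> bform W E src tgt ?t ?s" by (rule bpos_ge_1[OF pos v(1)])
   then have "m * m \<le> m * m * bform W E src tgt ?t ?s" using m(1) by simp
   also have "... = bform W E src tgt (%v. m * ?t v) (%v. m * ?s v)" by (simp only: bform_scale)
   also have "... = bform W E src tgt (%v. t v - t' v) (%v. s v - s' v)"
    by (rule bform_cong[OF Q]) (use tm sm in simp_all)
   \<comment> \<open>Parallelogram law: both vectors have the value \<open>c\<close>, and the form
     is nonnegative on their sum.\<close>
   also have "... \<le> 4 * c"
    using bform_parallelogram[of W E src tgt t t' s s'] c
     bpos_nonneg[OF Q pos, of "%v. t v + t' v" "%v. s v + s' v"] by linarith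
   finally show False using m(2) by simp
  qed
 qed
 ultimately show ?thesis by (meson finite_subset inj_on_finite)
qed

lemma sum_arrows_by_sink:
 assumes "bquiver W E src tgt"
 shows "(SUM ar:E. t (src ar) * s (tgt ar)) = (SUM v:W. s v * (\<Sum>ar | ar : E & tgt ar = v. t (src ar) :: int))"
proof -
 have "(SUM ar:E. t (src ar) * s (tgt ar)) = (SUM v:W. \<Sum>ar | ar : E & tgt ar = v. t (src ar) * s (tgt ar))"
  using assms by (intro sum.group[symmetric]) (auto simp: bquiver_def)
 also have "... = (SUM v:W. s v * (\<Sum>ar | ar : E & tgt ar = v. t (src ar)))"
  by (intro sum.cong) (auto simp: sum_distrib_left mult.commute intro!: sum.cong)
 finally show ?thesis .
qed

text \<open>In the variable \<open>s v\<close> alone the form is, up to a constant, a monic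
  quadratic polynomial whose linear coefficient is minus the sum over the arrows into
  \<open>v\<close>. Two values with exactly that sum give the same result: each contributes
  \<open>- s v * s' v\<close>.\<close>

lemma bform_reflect:
 assumes "bquiver W E src tgt" and s': "!!v. v : W ==> s' v + s v = (\<Sum>ar | ar : E & tgt ar = v. t (src ar))"
 shows "bform W E src tgt t s' = bform W E src tgt t s"
proof -
 have *: "bform W E src tgt t r = (SUM v:W. t v * t v - s v * s' v)" if "r = s \<or> r = s'" for r
  unfolding bform_def sum_arrows_by_sink[OF assms(1)] sum_subtractf[symmetric]
 proof (rule sum.cong[OF refl])
  fix v assume v: "v : W"
  show "t v * t v + r v * r v - r v * (\<Sum>ar | ar : E & tgt ar = v. t (src ar)) = t v * t v - s v * s' v"
   unfolding s'[OF v, symmetric] using that by (auto simp: algebra_simps)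
 qed
 show ?thesis using *[of s] *[of s'] by simp
qed

text \<open>The dimension vectors of the iterated reflections as one sequence: entry 0 is
  \<open>s\<close>, entry 1 is \<open>t\<close>, and each reflection replaces entry \<open>k\<close>
  by entry \<open>k + 2\<close>. After \<open>k\<close> reflections entry \<open>k\<close> belongs
  to the sinks and entry \<open>k + 1\<close> to the sources.\<close>

fun dimseq :: "'a set => ('a => 'v) => ('a => 'v) => ('v => int) => ('v => int) => nat => 'v => int" where
 "dimseq E src tgt t s 0 = s"
| "dimseq E src tgt t s (Suc k) = dimseq E tgt src (%v. (\<Sum>ar | ar : E & tgt ar = v. t (src ar)) - s v) t k"

lemma dimseq_rec:
 "dimseq E src tgt t s (Suc (Suc k)) v + dimseq E src tgt t s k v =
  (\<Sum>ar | ar : E & (if even k then tgt else src) ar = v. dimseq E src tgt t s (Suc k) ((if even k then src else tgt) ar))"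
proof (induction k arbitrary: src tgt t s)
 case (Suc k)
 have "dimseq E src tgt t s (Suc j) = dimseq E tgt src (%v. (\<Sum>ar | ar : E & tgt ar = v. t (src ar)) - s v) t j" for j
  by simp
 then show ?case using Suc.IH[of tgt src "%v. (\<Sum>ar | ar : E & tgt ar = v. t (src ar)) - s v" t]
  by (cases "even k") (simp_all only: even_Suc if_True if_False not_True_eq_False not_False_eq_True)
qed simp

lemma dimseq_cong:
 assumes "bquiver W E src tgt" "!!v. v : W ==> t v = t' v" "!!v. v : W ==> s v = s' v" "v : W"
 shows "dimseq E src tgt t s k v = dimseq E src tgt t' s' k v"
 using assms
proof (induction k arbitrary: src tgt t s t' s')
 case (Suc k)
 have "(\<Sum>ar | ar : E & tgt ar = u. t (src ar)) - s u = (\<Sum>ar | ar : E & tgt ar = u. t' (src ar)) - s' u" if "u : W" for u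
  using Suc.prems that by (auto simp: bquiver_def image_subset_iff intro!: sum.cong)
 then show ?case using Suc.IH[OF bquiver_op[OF Suc.prems(1)], of _ _ t t'] Suc.prems by simp
qed simp

text \<open>The form is constant along the sequence and its level is finite, so some pair of
  consecutive entries recurs. Summing over the period yields a vector fixed by both reflections, on
  which the form is zero; it is not the zero vector because all entries are nonnegative.\<close>

lemma no_infinite_dimension_sequence:
 fixes a :: "nat => 'v => int"
 assumes Q: "bquiver W E src tgt" and pos: "bpos W E src tgt"
  and nonneg: "!!k v. v : W ==> 0 \<le> a k v" and nonzero: "EX v:W. a 0 v ~= 0 \<or> a (Suc 0) v ~= 0"
  and rec: "!!k v. v : W ==> a (Suc (Suc k)) v + a k v =
   (\<Sum>ar | ar : E & (if even k then tgt else src) ar = v. a (Suc k) ((if even k then src else tgt) ar))"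
 shows False
proof -
 \<comment> \<open>In the fixed orientation, even entries live at the sinks and odd ones at the
   sources.\<close>
 define x where "x k = a (2 * k)" for k
 define z where "z k = a (Suc (2 * k))" for k
 have xz: "x (Suc k) v + x k v = (\<Sum>ar | ar : E & tgt ar = v. z k (src ar))"
  "z (Suc k) v + z k v = (\<Sum>ar | ar : E & src ar = v. x (Suc k) (tgt ar))" if "v : W" for k v
  using rec[OF that, of "2 * k"] rec[OF that, of "Suc (2 * k)"] by (simp_all add: x_def z_def)
 have x0: "0 \<le> x k v" and z0: "0 \<le> z k v" if "v : W" for k v
  using nonneg[OF that] by (simp_all add: x_def z_def)
 have const: "bform W E src tgt (z k) (x k) = bform W E src tgt (z 0) (x 0)" for k
 proof (induction k)
  case (Suc k)
  have "bform W E src tgt (z (Suc k)) (x (Suc k)) = bform W E tgt src (x (Suc k)) (z (Suc k))"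
   by (rule bform_op)
  also have "... = bform W E tgt src (x (Suc k)) (z k)"
   by (rule bform_reflect[OF bquiver_op[OF Q]]) (rule xz(2))
  also have "... = bform W E src tgt (z k) (x (Suc k))" by (rule bform_op)
  also have "... = bform W E src tgt (z k) (x k)" by (rule bform_reflect[OF Q]) (rule xz(1))
  finally show ?case using Suc.IH by simp
 qed simp
 have "1 \<le> bform W E src tgt (z 0) (x 0)"
  using nonzero bpos_ge_1[OF pos] by (auto simp: x_def z_def)
 let ?c = "bform W E src tgt (z 0) (x 0)"
 let ?p = "%k. (restrict (z k) W, restrict (x k) W)"
 have "range ?p \<subseteq> {(t, s). t : extensional W & s : extensional W & bform W E src tgt t s = ?c}"
 proof clarsimp
  fix k
  show "bform W E src tgt (restrict (z k) W) (restrict (x k) W) = ?c"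
   unfolding const[of k, symmetric] by (rule bform_cong[OF Q]) auto
 qed
 then have "finite (range ?p)" using finite_bform_level[OF Q pos] by (rule finite_subset)
 then have "\<not> inj ?p" using finite_imageD infinite_UNIV_nat by blast
 then obtain i' j' where "i' ~= j'" "?p i' = ?p j'" by (auto simp: inj_on_def)
 then obtain i j where ij: "i < j" "?p i = ?p j" by (metis linorder_neqE_nat)
 have per: "z i v = z j v" "x i v = x j v" if "v : W" for v
  using ij(2) that by (metis prod.inject restrict_apply')+
 \<comment> \<open>Sums over one period. Shifting the summation index by one changes nothing, so
   \<open>(A, B)\<close> satisfies the equations of a common fixed point of both
   reflections.\<close>
 define A where "A v = (\<Sum>k=i..<j. z k v)" for v
 define B where "B v = (\<Sum>k=i..<j. x k v)" for v
 have shift: "(\<Sum>k=i..<j. f (Suc k)) = (\<Sum>k=i..<j. f k)" if "f i = f j" for f :: "nat => int"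
  using sum_Suc_diff'[of i j f] ij(1) that by (simp add: sum_subtractf)
 have 2: "2 * B v = (\<Sum>ar | ar : E & tgt ar = v. A (src ar))" if "v : W" for v
 proof -
  have "2 * B v = (\<Sum>k=i..<j. x (Suc k) v + x k v)"
   using shift[of "%k. x k v"] per(2)[OF that] by (simp add: B_def sum.distrib)
  also have "... = (\<Sum>ar | ar : E & tgt ar = v. A (src ar))"
   unfolding xz(1)[OF that] A_def by (rule sum.swap)
  finally show ?thesis .
 qed
 have 3: "2 * A v = (\<Sum>ar | ar : E & src ar = v. B (tgt ar))" if "v : W" for v
 proof -
  have "2 * A v = (\<Sum>k=i..<j. z (Suc k) v + z k v)"
   using shift[of "%k. z k v"] per(1)[OF that] by (simp add: A_def sum.distrib)
  also have "... = (\<Sum>ar | ar : E & src ar = v. \<Sum>k=i..<j. x (Suc k) (tgt ar))"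
   unfolding xz(2)[OF that] by (rule sum.swap)
  also have "... = (\<Sum>ar | ar : E & src ar = v. B (tgt ar))"
   unfolding B_def
  proof (rule sum.cong[OF refl])
   fix ar assume "ar : {ar : E. src ar = v}"
   then have "tgt ar : W" using Q by (auto simp: bquiver_def)
   then show "(\<Sum>k=i..<j. x (Suc k) (tgt ar)) = (\<Sum>k=i..<j. x k (tgt ar))"
    by (intro shift per(2))
  qed
  finally show ?thesis .
 qed
 have "(SUM ar:E. A (src ar) * B (tgt ar)) = (SUM v:W. 2 * (B v * B v))"
  unfolding sum_arrows_by_sink[OF Q] by (intro sum.cong) (auto simp flip: 2)
 moreover have "(SUM ar:E. B (tgt ar) * A (src ar)) = (SUM v:W. 2 * (A v * A v))"
  unfolding sum_arrows_by_sink[OF bquiver_op[OF Q]] by (intro sum.cong) (auto simp flip: 3)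
 \<comment> \<open>The sum over the arrows equals both \<open>2 * B^2\<close> and
   \<open>2 * A^2\<close>, summed over the vertices, hence also the sum of
   \<open>A^2 + B^2\<close>.\<close>
 ultimately have "bform W E src tgt A B = 0"
  unfolding bform_def by (simp add: sum.distrib mult.commute flip: sum_distrib_left)
 moreover have "EX v:W. A v ~= 0 \<or> B v ~= 0"
 proof (rule ccontr)
  assume AB: "\<not> ?thesis"
  have "z i v = 0 & x i v = 0" if "v : W" for v
  proof -
   have "(\<Sum>k=i..<j. z k v) = 0" "(\<Sum>k=i..<j. x k v) = 0" using AB that by (auto simp: A_def B_def)
   then have "ALL k:{i..<j}. z k v = 0" "ALL k:{i..<j}. x k v = 0"
    using x0[OF that] z0[OF that] by (simp_all add: sum_nonneg_eq_0_iff)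
   then show ?thesis using ij(1) by simp
  qed
  then have "bform W E src tgt (z i) (x i) = bform W E src tgt (%_. 0) (%_. 0)"
   by (intro bform_cong[OF Q]) auto
  also have "... = 0" by (simp add: bform_def)
  finally show False using const[of i] \<open>1 \<le> ?c\<close> by simp
 qed
 ultimately show False using bpos_ge_1[OF pos] by (metis not_one_le_zero)
qed

section \<open>Uniqueness of indecomposables with given dimensions\<close>

lemma same_card_invertible:
 assumes "finite X" "finite Y" "card X = card Y"
 obtains P P' :: "nat => nat => 'k::field" where "P : mats Y X" "P' : mats X Y"
  "P' *[Y] P = idm X" "P *[X] P' = idm Y"
proof -
 have "idm X *[X] idm X = (idm X :: nat => nat => 'k)" by (rule idm_mmul_idm[OF assms(1)])
 then show thesis
  using reindex_splitting[OF assms(1,2) assms(3)[symmetric] mats_idm mats_idm, of thesis] that by metis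
qed

text \<open>The terminal case of the reflections: with at most one dimension in total, no arrow
  joins two nonzero spaces, so all matrices vanish and equal dimensions already give an
  isomorphism.\<close>

lemma bindec_simple:
 fixes y y' :: "'a => nat => nat => 'k::field"
 assumes Q: "bquiver W E src tgt" and rep: "brep W E src tgt T S y" "brep W E src tgt T' S' y'"
  and ne: "EX v:W. T v ~= {} \<or> S v ~= {}"
  and card: "!!v. v : W ==> card (T' v) = card (T v) & card (S' v) = card (S v)"
  and small: "(SUM v:W. card (T v) + card (S v)) \<le> 1"
 shows "biso W E src tgt T S y T' S' y' & bform W E src tgt (%v. int (card (T v))) (%v. int (card (S v))) = 1"
proof
 have fW: "finite W" using Q by (simp add: bquiver_def)
 have fin: "finite (T v)" "finite (S v)" "finite (T' v)" "finite (S' v)" if "v : W" for v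
  using rep that by (auto simp: brep_def)
 have le: "card (T v) + card (S v) \<le> 1" if "v : W" for v
  using member_le_sum[OF that, of "%v. card (T v) + card (S v)"] fW small by simp
 have le2: "card (T u) + card (S u) + (card (T v) + card (S v)) \<le> 1" if "u : W" "v : W" "u ~= v" for u v
 proof -
  have "(SUM w:{u, v}. card (T w) + card (S w)) \<le> (SUM v:W. card (T v) + card (S v))"
   using fW that by (intro sum_mono2) auto
  then show ?thesis using small that(3) by simp
 qed
 have zero: "card (T (src ar)) = 0 \<or> card (S (tgt ar)) = 0" if "ar : E" for ar
  using le[of "src ar"] le2[of "src ar" "tgt ar"] Q that unfolding bquiver_def image_subset_iff
  by (cases "src ar = tgt ar") fastforce+
 have E: "src ar : W" "tgt ar : W" if "ar : E" for ar using Q that by (auto simp: bquiver_def)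
 have y0: "y ar = 0" "y' ar = 0" if "ar : E" for ar
 proof -
  have "y ar : mats (S (tgt ar)) (T (src ar))" "y' ar : mats (S' (tgt ar)) (T' (src ar))"
   using rep that by (auto simp: brep_def)
  moreover have "T (src ar) = {} \<or> S (tgt ar) = {}" "T' (src ar) = {} \<or> S' (tgt ar) = {}"
   using zero[OF that] card[OF E(1)[OF that]] card[OF E(2)[OF that]] fin E that by auto
  ultimately show "y ar = 0" "y' ar = 0" by auto
 qed
 have "EX D D' A A'. D : mats (T' v) (T v) & D' : mats (T v) (T' v) & A : mats (S' v) (S v) & A' : mats (S v) (S' v) &
   D' *[T' v] D = idm (T v) & D *[T v] D' = (idm (T' v) :: nat => nat => 'k) &
   A' *[S' v] A = idm (S v) & A *[S v] A' = (idm (S' v) :: nat => nat => 'k)" if v: "v : W" for v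
 proof -
  obtain D D' :: "nat => nat => 'k" where "D : mats (T' v) (T v)" "D' : mats (T v) (T' v)"
   "D' *[T' v] D = idm (T v)" "D *[T v] D' = idm (T' v)"
   by (rule same_card_invertible[OF fin(1,3)[OF v]]) (use card[OF v] in auto)
  moreover obtain A A' :: "nat => nat => 'k" where "A : mats (S' v) (S v)" "A' : mats (S v) (S' v)"
   "A' *[S' v] A = idm (S v)" "A *[S v] A' = idm (S' v)"
   by (rule same_card_invertible[OF fin(2,4)[OF v]]) (use card[OF v] in auto)
  ultimately show ?thesis
   by - (intro exI[of _ D] exI[of _ D'] exI[of _ A] exI[of _ A'] conjI; assumption)
 qed
 then obtain D D' A A' where "!!v. v : W ==> D v : mats (T' v) (T v) & D' v : mats (T v) (T' v) &
   A v : mats (S' v) (S v) & A' v : mats (S v) (S' v) &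
   D' v *[T' v] D v = idm (T v) & D v *[T v] D' v = (idm (T' v) :: nat => nat => 'k) &
   A' v *[S' v] A v = idm (S v) & A v *[S v] A' v = (idm (S' v) :: nat => nat => 'k)"
  by metis
 then show "biso W E src tgt T S y T' S' y'"
  unfolding biso_def bhom_def
  by (intro exI[of _ D] exI[of _ A] exI[of _ D'] exI[of _ A']) (simp add: y0)
 have sq: "int n * int n = int n" if "n \<le> 1" for n :: nat using that by (cases n) auto
 obtain v where v: "v : W" "card (T v) + card (S v) ~= 0" using ne fin by auto
 have "(SUM v:W. card (T v) + card (S v)) ~= 0"
  using member_le_sum[OF v(1) _ fW, of "%v. card (T v) + card (S v)"] v(2) by linarith
 then have "(SUM v:W. card (T v) + card (S v)) = 1" using small by linarith
 then have "1 = int (SUM v:W. card (T v) + card (S v))" by simp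
 also have "... = (SUM v:W. int (card (T v)) + int (card (S v)))" by simp
 also have "... = (SUM v:W. int (card (T v)) * int (card (T v)) + int (card (S v)) * int (card (S v)))"
 proof (rule sum.cong[OF refl])
  fix v assume "v : W"
  then have "card (T v) \<le> 1" "card (S v) \<le> 1" using le[of v] by linarith+
  then show "int (card (T v)) + int (card (S v)) =
    int (card (T v)) * int (card (T v)) + int (card (S v)) * int (card (S v))"
   by (simp only: sq)
 qed
 also have "... = bform W E src tgt (%v. int (card (T v))) (%v. int (card (S v)))"
 proof -
  have "(SUM ar:E. int (card (T (src ar))) * int (card (S (tgt ar)))) = 0"
   using zero by (intro sum.neutral) auto
  then show ?thesis by (simp add: bform_def)
 qed
 finally show "bform W E src tgt (%v. int (card (T v))) (%v. int (card (S v))) = 1" by simp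
qed

text \<open>Induction on the position \<open>k\<close> of a negative entry. Two indecomposables of
  equal dimensions and total dimension at least 2 can both be reflected, and their dimensions move
  one step along \<open>dimseq\<close>, so that the negative entry comes one step nearer. At
  \<open>k = 0\<close> it would be a cardinality; hence the total dimension must drop to 1
  before.\<close>

lemma bindec_unique_aux:
 fixes y y' :: "'a => nat => nat => 'k::field"
 assumes "bquiver W E src tgt" "brep W E src tgt T S y" "brep W E src tgt T' S' y'"
  and "bindec W E src tgt T S y" "bindec W E src tgt T' S' y'"
  and "!!v. v : W ==> card (T' v) = card (T v) & card (S' v) = card (S v)"
  and "t = (%v. int (card (T v)))" "s = (%v. int (card (S v)))"
  and "EX v:W. dimseq E src tgt t s k v < 0"
 shows "biso W E src tgt T S y T' S' y' & bform W E src tgt t s = 1"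
 using assms
proof (induction k arbitrary: src tgt T S y T' S' y' t s)
 case 0
 then show ?case by auto
next
 case (Suc k)
 note Q = Suc.prems(1) and rep = Suc.prems(2,3) and ind = Suc.prems(4,5) and card = Suc.prems(6)
 have fW: "finite W" using Q by (simp add: bquiver_def)
 show ?case
 proof (cases "(SUM v:W. card (T v) + card (S v)) \<le> 1")
  case True
  moreover have "EX v:W. T v ~= {} \<or> S v ~= {}" using ind(1) by (simp add: bindec_def)
  ultimately show ?thesis unfolding Suc.prems(7,8) using bindec_simple[OF Q rep] card by blast
 next
  case False
  then have big: "(SUM v:W. card (T v) + card (S v)) \<ge> 2" by simp
  then have big': "(SUM v:W. card (T' v) + card (S' v)) \<ge> 2" using card by (simp cong: sum.cong)
  obtain U Y where R: "reflects W E src tgt T S y U Y"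
   using reflection_exists[OF Q rep(1) bindec_surj[OF rep(1) fW ind(1) big]] .
  obtain U' Y' where R': "reflects W E src tgt T' S' y' U' Y'"
   using reflection_exists[OF Q rep(2) bindec_surj[OF rep(2) fW ind(2) big']] .
  have repY: "brep W E tgt src U T Y" "brep W E tgt src U' T' Y'" using R R' by (simp_all add: reflects_def)
  have E: "src ar : W" if "ar : E" for ar using Q that by (auto simp: bquiver_def)
  have cU: "card (S v) + card (U v) = (\<Sum>ar | ar : E & tgt ar = v. card (T (src ar)))" if "v : W" for v
   by (rule reflects_card[OF Q rep(1) R that])
  have cU': "card (U' v) = card (U v)" if "v : W" for v
  proof -
   have "card (S' v) + card (U' v) = (\<Sum>ar | ar : E & tgt ar = v. card (T (src ar)))"
    unfolding reflects_card[OF Q rep(2) R' that] using card E by (intro sum.cong) auto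
   then show ?thesis using cU[OF that] card[OF that] by simp
  qed
  let ?u = "%v. int (card (U v))" and ?u' = "%v. (\<Sum>ar | ar : E & tgt ar = v. t (src ar)) - s v"
  have u: "?u v = ?u' v" if "v : W" for v
   using arg_cong[OF cU[OF that], of int] unfolding Suc.prems(7,8) by simp
  have dim: "dimseq E src tgt t s (Suc j) v = dimseq E tgt src ?u t j v" if "v : W" for j v
   using dimseq_cong[OF bquiver_op[OF Q], of ?u ?u' t t v j] u that by simp
  have "biso W E tgt src U T Y U' T' Y' & bform W E tgt src ?u t = 1"
  proof (rule Suc.IH[OF bquiver_op[OF Q] repY])
   show "bindec W E tgt src U T Y" "bindec W E tgt src U' T' Y'"
    using reflects_bindec[OF Q rep(1) R ind(1)] reflects_bindec[OF Q rep(2) R' ind(2)] .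
   show "EX v:W. dimseq E tgt src ?u t k v < 0" using Suc.prems(9) dim by metis
  qed (use card cU' Suc.prems(7) in auto)
  moreover have "bform W E src tgt t ?u = bform W E src tgt t s"
   by (rule bform_reflect[OF Q]) (use u in simp)
  ultimately show ?thesis using reflects_biso[OF Q rep R R'] by (simp add: bform_op)
 qed
qed

text \<open>Supplies the negative entry for the induction: a \<open>dimseq\<close> that stayed
  nonnegative would contradict \<open>no_infinite_dimension_sequence\<close>.\<close>

theorem bindec_unique:
 fixes y y' :: "'a => nat => nat => 'k::field"
 assumes Q: "bquiver W E src tgt" and pos: "bpos W E src tgt"
  and rep: "brep W E src tgt T S y" "brep W E src tgt T' S' y'"
  and ind: "bindec W E src tgt T S y" "bindec W E src tgt T' S' y'"
  and card: "!!v. v : W ==> card (T' v) = card (T v) & card (S' v) = card (S v)"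
 shows "biso W E src tgt T S y T' S' y' & bform W E src tgt (%v. int (card (T v))) (%v. int (card (S v))) = 1"
proof -
 let ?t = "%v. int (card (T v))" and ?s = "%v. int (card (S v))"
 let ?a = "dimseq E src tgt ?t ?s"
 have "EX k. EX v:W. ?a k v < 0"
 proof (rule ccontr)
  assume *: "\<not> ?thesis"
  have "EX v:W. ?a 0 v ~= 0 \<or> ?a (Suc 0) v ~= 0"
   using ind(1) rep(1) by (auto simp: bindec_def brep_def)
  moreover have "0 \<le> ?a k v" if "v : W" for k v using * that by (meson not_le)
  ultimately show False by (intro no_infinite_dimension_sequence[OF Q pos, of ?a] dimseq_rec) simp_all
 qed
 then show ?thesis using bindec_unique_aux[OF Q rep ind card refl refl] by blast
qed

section \<open>Polynomial functions and dimension counts\<close>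

inductive_set polyfun :: "'j set => (('j => 'k::field) => 'k) set" for J where
 const: "(%z. c) : polyfun J"
| coord: "j : J ==> (%z. z j) : polyfun J"
| plus: "f : polyfun J ==> g : polyfun J ==> (%z. f z + g z) : polyfun J"
| times: "f : polyfun J ==> g : polyfun J ==> (%z. f z * g z) : polyfun J"

lemma polyfun_sum: "(!!x. x : X ==> f x : polyfun J) ==> (%z. SUM x:X. f x z) : polyfun J"
 by (induction X rule: infinite_finite_induct) (auto intro: polyfun.intros)

lemma polyfun_prod: "(!!x. x : X ==> f x : polyfun J) ==> (%z. \<Prod>x\<in>X. f x z) : polyfun J"
 by (induction X rule: infinite_finite_induct) (auto intro: polyfun.intros)

lemma polyfun_power: "f : polyfun J ==> (%z. f z ^ n) : polyfun J"
 by (induction n) (auto intro: polyfun.intros)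

lemma polyfun_cong: "f : polyfun J ==> (!!j. j : J ==> z j = z' j) ==> f z = f z'"
 by (induction rule: polyfun.induct) auto

text \<open>Restricting to a line reduces questions of nonvanishing to one variable, where the
  finiteness of the set of roots decides.\<close>

lemma polyfun_line:
 "f : polyfun J ==> EX p. ALL x. f (%j. z j + x * (z' j - z j)) = poly p x"
proof (induction rule: polyfun.induct)
 case (const c)
 then show ?case by (intro exI[of _ "[:c:]"]) simp
next
 case (coord j)
 then show ?case by (intro exI[of _ "[:z j, z' j - z j:]"]) simp
next
 case (plus f g)
 then show ?case by (metis poly_add)
next
 case (times f g)
 then show ?case by (metis poly_mult)
qed

text \<open>If the field were finite, 1 plus the product of all \<open>X - a\<close> would be
  nonconstant and without a root.\<close>

lemma infinite_UNIV_alg_closed: "infinite (UNIV :: 'k::alg_closed_field set)"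
proof
 assume fin: "finite (UNIV :: 'k set)"
 let ?p = "1 + (\<Prod>a\<in>(UNIV :: 'k set). [:-a, 1:])"
 have deg: "degree (\<Prod>a\<in>(UNIV :: 'k set). [:-a, 1:]) = card (UNIV :: 'k set)"
  by (subst degree_prod_eq_sum_degree) auto
 moreover have "card (UNIV :: 'k set) > 0" using fin by (simp add: finite_UNIV_card_ge_0)
 ultimately have "degree ?p > 0" by (subst degree_add_eq_right) auto
 then obtain x where "poly ?p x = 0" using alg_closed_imp_poly_has_root by blast
 moreover have "poly (\<Prod>a\<in>(UNIV :: 'k set). [:-a, 1:]) x = 0"
  using fin by (auto simp: poly_prod)
 ultimately show False by simp
qed

lemma nonroot:
 fixes p :: "'k::field poly"
 assumes "infinite (UNIV :: 'k set)" "p ~= 0"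
 shows "EX x. poly p x ~= 0"
 using poly_roots_finite[OF assms(2)] assms(1) by (metis (mono_tags) UNIV_eq_I mem_Collect_eq)

text \<open>On the line through \<open>z\<close> and \<open>z'\<close> both functions restrict to
  nonzero polynomials, and their product has a non-root.\<close>

lemma polyfun_nonzero_times:
 fixes f g :: "('j => 'k::field) => 'k"
 assumes "infinite (UNIV :: 'k set)" "f : polyfun J" "g : polyfun J" "f z ~= 0" "g z' ~= 0"
 shows "EX z. f z * g z ~= 0"
proof -
 obtain p where p: "!!x. f (%j. z j + x * (z' j - z j)) = poly p x"
  using polyfun_line[OF assms(2)] by metis
 obtain q where q: "!!x. g (%j. z j + x * (z' j - z j)) = poly q x"
  using polyfun_line[OF assms(3)] by metis
 have "poly p 0 ~= 0" "poly q 1 ~= 0" using assms(4,5) p[of 0] q[of 1] by simp_all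
 then have "p * q ~= 0" by auto
 from nonroot[OF assms(1) this] p q show ?thesis by (metis poly_mult)
qed

section \<open>Counting monomials of bounded degree\<close>

definition mono_fun :: "'j set => ('j => nat) => ('j => 'k::field) => 'k" where
 "mono_fun J e z = (\<Prod>j\<in>J. z j ^ e j)"

text \<open>The degree is bounded in each variable separately, so the monomials are indexed by
  \<open>J \<rightarrow>\<^sub>E {..D}\<close> and there are \<open>(D + 1) ^ card J\<close> of
  them.\<close>

definition poly_space :: "'j set => nat => (('j => 'k::field) => 'k) set" where
 "poly_space J D = {f. EX c. f = (%z. SUM e:J \<rightarrow>\<^sub>E {..D}. c e * mono_fun J e z)}"

lemma poly_space_plus:
 "f : poly_space J D ==> g : poly_space J D ==> (%z. f z + g z) : poly_space J D"
 unfolding poly_space_def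
proof clarify
 fix c d
 show "EX b. (%z. (SUM e:J \<rightarrow>\<^sub>E {..D}. c e * mono_fun J e z) + (SUM e:J \<rightarrow>\<^sub>E {..D}. d e * mono_fun J e z))
  = (%z. SUM e:J \<rightarrow>\<^sub>E {..D}. b e * mono_fun J e z)"
  by (rule exI[of _ "%e. c e + d e"]) (simp add: distrib_right sum.distrib)
qed

lemma poly_space_scale: "f : poly_space J D ==> (%z. a * f z) : poly_space J D"
 unfolding poly_space_def
proof clarify
 fix c
 show "EX b. (%z. a * (SUM e:J \<rightarrow>\<^sub>E {..D}. c e * mono_fun J e z))
  = (%z. SUM e:J \<rightarrow>\<^sub>E {..D}. b e * mono_fun J e z)"
  by (rule exI[of _ "%e. a * c e"]) (simp add: sum_distrib_left mult.assoc)
qed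

lemma poly_space_monomial:
 assumes "finite J" "e : J \<rightarrow>\<^sub>E {..D}"
 shows "mono_fun J e : poly_space J D"
proof -
 have fin: "finite (J \<rightarrow>\<^sub>E {..D})" using assms(1) by (intro finite_PiE) auto
 have "mono_fun J e z = (SUM e':J \<rightarrow>\<^sub>E {..D}. (if e' = e then 1 else 0) * mono_fun J e' z)" for z :: "'a => 'b"
 proof -
  have "(SUM e':J \<rightarrow>\<^sub>E {..D}. (if e' = e then 1 else 0) * mono_fun J e' z)
    = (SUM e':J \<rightarrow>\<^sub>E {..D}. if e' = e then mono_fun J e z else 0)"
   by (intro sum.cong) auto
  then show ?thesis using fin assms(2) by simp
 qed
 then show ?thesis unfolding poly_space_def mem_Collect_eq
  by (intro exI[of _ "%e'. if e' = e then 1 else 0"] ext)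
qed

lemma poly_space_sum:
 assumes "finite J" "!!x. x : X ==> f x : poly_space J D"
 shows "(%z. SUM x:X. f x z) : poly_space J D"
proof -
 have "(%z. 0) : poly_space J D"
  unfolding poly_space_def mem_Collect_eq by (rule exI[of _ "%_. 0"]) simp
 with assms(2) show ?thesis
  by (induction X rule: infinite_finite_induct) (auto intro: poly_space_plus)
qed

lemma poly_space_combination:
 assumes "finite J" "!!e. e : X ==> f e : poly_space J D"
 shows "(%z. SUM e:X. c e * f e z) : poly_space J D"
 using assms by (intro poly_space_sum poly_space_scale) auto

lemma poly_space_mono:
 assumes "finite J" "D \<le> D'" "f : poly_space J D"
 shows "f : poly_space J D'"
proof -
 obtain c where "f = (%z. SUM e:J \<rightarrow>\<^sub>E {..D}. c e * mono_fun J e z)"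
  using assms(3) unfolding poly_space_def by blast
 moreover have "mono_fun J e : poly_space J D'" if "e : J \<rightarrow>\<^sub>E {..D}" for e
  using PiE_mono[of J "%_. {..D}" "%_. {..D'}"] that assms(1,2) by (intro poly_space_monomial) auto
 ultimately show ?thesis using poly_space_combination[OF assms(1)] by blast
qed

lemma poly_space_times:
 assumes "finite J" "f : poly_space J D" "g : poly_space J D'"
 shows "(%z. f z * g z) : poly_space J (D + D')"
proof -
 obtain c where c: "f = (%z. SUM e:J \<rightarrow>\<^sub>E {..D}. c e * mono_fun J e z)"
  using assms(2) unfolding poly_space_def by blast
 obtain d where d: "g = (%z. SUM e:J \<rightarrow>\<^sub>E {..D'}. d e * mono_fun J e z)"
  using assms(3) unfolding poly_space_def by blast
 have m: "(%z. mono_fun J e z * mono_fun J e' z) : poly_space J (D + D')"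
  if "e : J \<rightarrow>\<^sub>E {..D}" "e' : J \<rightarrow>\<^sub>E {..D'}" for e e'
 proof -
  have "(%z. mono_fun J e z * mono_fun J e' z) = mono_fun J (\<lambda>j\<in>J. e j + e' j)"
   by (auto simp: fun_eq_iff mono_fun_def power_add prod.distrib intro!: prod.cong)
  moreover have "(\<lambda>j\<in>J. e j + e' j) : J \<rightarrow>\<^sub>E {..D + D'}"
   using that by (intro restrict_PiE_iff[THEN iffD2] ballI) (force intro: add_mono simp: PiE_iff)
  ultimately show ?thesis using poly_space_monomial[OF assms(1)] by metis
 qed
 have "(%z. f z * g z) = (%z. SUM e:J \<rightarrow>\<^sub>E {..D}. c e * (SUM e':J \<rightarrow>\<^sub>E {..D'}. d e' * (mono_fun J e z * mono_fun J e' z)))"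
 proof
  fix z
  have "f z * g z = (SUM e:J \<rightarrow>\<^sub>E {..D}. SUM e':J \<rightarrow>\<^sub>E {..D'}. (c e * mono_fun J e z) * (d e' * mono_fun J e' z))"
   unfolding c d by (rule sum_product)
  then show "f z * g z = (SUM e:J \<rightarrow>\<^sub>E {..D}. c e * (SUM e':J \<rightarrow>\<^sub>E {..D'}. d e' * (mono_fun J e z * mono_fun J e' z)))"
   by (simp add: sum_distrib_left ac_simps)
 qed
 also have "... : poly_space J (D + D')"
  using m by (intro poly_space_combination[OF assms(1)])
 finally show ?thesis .
qed

lemma poly_space_const: "finite J ==> (%z. c) : poly_space J D"
proof -
 assume "finite J"
 from poly_space_scale[OF poly_space_monomial[OF this, of "\<lambda>j\<in>J. 0" D], of c]
 show ?thesis by (simp add: mono_fun_def restrict_PiE_iff cong: prod.cong)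
qed

lemma poly_space_power: "finite J ==> f : poly_space J D ==> (%z. f z ^ n) : poly_space J (n * D)"
 by (induction n) (auto intro: poly_space_const poly_space_times)

lemma poly_space_prod:
 assumes "finite J" "finite X" "!!x. x : X ==> f x : poly_space J D"
 shows "(%z. \<Prod>x\<in>X. f x z) : poly_space J (card X * D)"
 using assms(2,3) by (induction X rule: finite_induct) (auto intro: poly_space_const poly_space_times[OF assms(1)] assms(1))

lemma polyfun_poly_space:
 fixes f :: "('j => 'k::field) => 'k"
 assumes "finite J" "f : polyfun J"
 shows "EX D. f : poly_space J D"
 using assms(2)
proof (induction rule: polyfun.induct)
 case (const c)
 then show ?case using poly_space_const[OF assms(1)] by blast
next
 case (coord j)
 have "(%z :: 'j => 'k. z j) = mono_fun J (\<lambda>i\<in>J. if i = j then 1 else 0)"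
 proof
  fix z :: "'j => 'k"
  have "mono_fun J (\<lambda>i\<in>J. if i = j then 1 else 0) z = (\<Prod>i\<in>J. if i = j then z j else 1)"
   unfolding mono_fun_def by (intro prod.cong) auto
  then show "z j = mono_fun J (\<lambda>i\<in>J. if i = j then 1 else 0) z" using coord assms(1) by simp
 qed
 moreover have "(\<lambda>i\<in>J. if i = j then 1 else 0) : J \<rightarrow>\<^sub>E {..1::nat}" by auto
 ultimately show ?case using poly_space_monomial[OF assms(1)] by metis
next
 case (plus f g)
 then obtain D D' where "f : poly_space J D" "g : poly_space J D'" by blast
 then have "f : poly_space J (D + D')" "g : poly_space J (D + D')"
  by (auto intro: poly_space_mono[OF assms(1), rotated])
 then show ?case using poly_space_plus by blast
next
 case (times f g)
 then show ?case using poly_space_times[OF assms(1)] by blast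
qed

text \<open>Induction on the variables: for suitable values of the old ones the coefficient
  \<open>F k\<close> of some power of the new variable is nonzero, and the resulting polynomial in
  one variable has a non-root in the infinite field.\<close>

lemma polynomial_nonzero:
 fixes c :: "('i => nat) => 'k::field"
 assumes inf: "infinite (UNIV :: 'k set)" and "finite I" "e : I \<rightarrow>\<^sub>E {..D}" "c e ~= 0"
 shows "EX z. (SUM e:I \<rightarrow>\<^sub>E {..D}. c e * mono_fun I e z) ~= 0"
 using assms(2-4)
proof (induction I arbitrary: c e)
 case empty
 then show ?case by (simp add: mono_fun_def)
next
 case (insert i I)
 define F where "F k z = (SUM g:I \<rightarrow>\<^sub>E {..D}. c (g(i := k)) * mono_fun I g z)" for k z
 obtain k g where kg: "k \<le> D" "g : I \<rightarrow>\<^sub>E {..D}" "e = g(i := k)"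
  using insert.prems(1) by (auto simp: PiE_insert_eq)
 have "c (g(i := k)) ~= 0" unfolding kg(3)[symmetric] by (rule insert.prems(2))
 from insert.IH[OF kg(2), of "%g. c (g(i := k))", OF this]
 obtain z where z: "F k z ~= 0" by (auto simp: F_def)
 have *: "(SUM e:insert i I \<rightarrow>\<^sub>E {..D}. c e * mono_fun (insert i I) e (z(i := x))) = (\<Sum>k\<le>D. F k z * x ^ k)" for x
 proof -
  have "(SUM e:insert i I \<rightarrow>\<^sub>E {..D}. c e * mono_fun (insert i I) e (z(i := x)))
   = (\<Sum>(k, g)\<in>{..D} \<times> (I \<rightarrow>\<^sub>E {..D}). c (g(i := k)) * mono_fun (insert i I) (g(i := k)) (z(i := x)))"
   unfolding PiE_insert_eq by (subst sum.reindex[OF inj_combinator[OF insert.hyps(2)]]) (simp add: case_prod_beta')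
  also have "... = (\<Sum>k\<le>D. SUM g:I \<rightarrow>\<^sub>E {..D}. c (g(i := k)) * mono_fun (insert i I) (g(i := k)) (z(i := x)))"
   by (rule sum.cartesian_product[symmetric])
  also have "... = (\<Sum>k\<le>D. F k z * x ^ k)"
   unfolding F_def sum_distrib_right
  proof (intro sum.cong refl)
   fix k g
   have "(\<Prod>j\<in>I. (z(i := x)) j ^ (g(i := k)) j) = (\<Prod>j\<in>I. z j ^ g j)"
    using insert.hyps(2) by (intro prod.cong) auto
   then have "mono_fun (insert i I) (g(i := k)) (z(i := x)) = x ^ k * mono_fun I g z"
    unfolding mono_fun_def using insert.hyps by simp
   then show "c (g(i := k)) * mono_fun (insert i I) (g(i := k)) (z(i := x)) = c (g(i := k)) * mono_fun I g z * x ^ k"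
    by simp
  qed
  finally show ?thesis .
 qed
 let ?p = "\<Sum>k\<le>D. monom (F k z) k"
 have "coeff ?p k = F k z" using kg(1) by (simp add: coeff_sum)
 with z have "?p ~= 0" by auto
 from nonroot[OF inf this] obtain x where "poly ?p x ~= 0" by blast
 then have "(\<Sum>k\<le>D. F k z * x ^ k) ~= 0" by (simp add: poly_sum poly_monom)
 then show ?case unfolding *[of x, symmetric] by blast
qed

text \<open>A polynomial map from a space of smaller dimension satisfies a polynomial relation: for large
  \<open>D\<close> there are more monomials of degree at most \<open>D\<close> in the target coordinates than dimensions in
  the space of their pullbacks.\<close>

lemma polynomial_relation:
 fixes \<phi> :: "'i => ('j => 'k::field) => 'k"
 assumes inf: "infinite (UNIV :: 'k set)" and fin: "finite I" "finite J" and card: "card J < card I"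
  and \<phi>: "!!i. i : I ==> \<phi> i : polyfun J"
 shows "EX f:polyfun I. (EX z. f z ~= 0) & (ALL w. f (%i. \<phi> i w) = 0)"
proof -
 have "ALL i:I. EX D. \<phi> i : poly_space J D" using polyfun_poly_space[OF fin(2) \<phi>] by blast
 then obtain d where d: "!!i. i : I ==> \<phi> i : poly_space J (d i)" by metis
 define c where "c = sum d I"
 have \<phi>c: "\<phi> i : poly_space J c" if "i : I" for i
  using poly_space_mono[OF fin(2) _ d[OF that]] member_le_sum[OF that, of d] fin(1) by (simp add: c_def)
 define n where "n = card I"
 define m where "m = card J"
 \<comment> \<open>Chosen such that the monomials in the target coordinates win. The pullbacks have
   degree at most \<open>B\<close> in each variable, and \<open>(B + 1) ^ m \<le> ((n * c + 1) * (D
   + 1)) ^ m = D * (D + 1) ^ m < (D + 1) ^ Suc m\<close>.\<close>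
 define D where "D = (n * c + 1) ^ m"
 define B where "B = n * (D * c)"
 let ?X = "I \<rightarrow>\<^sub>E {..D}" and ?Y = "J \<rightarrow>\<^sub>E {..B}"
 have finXY: "finite ?X" "finite ?Y" using fin by (auto intro!: finite_PiE)
 have "card ?Y = (B + 1) ^ m" using fin(2) by (simp add: card_PiE m_def)
 also have "... \<le> ((n * c + 1) * (D + 1)) ^ m" by (intro power_mono) (auto simp: B_def algebra_simps)
 also have "... = D * (D + 1) ^ m" by (simp only: power_mult_distrib D_def[symmetric])
 also have "... < (D + 1) ^ Suc m" by simp
 also have "... \<le> (D + 1) ^ n" using card by (intro power_increasing) (auto simp: n_def m_def)
 also have "... = card ?X" using fin(1) by (simp add: card_PiE n_def)
 finally have lt: "card ?Y < card ?X" .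
 have "ALL e:?X. EX C. ALL w. (\<Prod>i\<in>I. \<phi> i w ^ e i) = (SUM b:?Y. C b * mono_fun J b w)"
 proof
  fix e assume e: "e : ?X"
  have "(%w. \<phi> i w ^ e i) : poly_space J (D * c)" if "i : I" for i
   by (rule poly_space_mono[OF fin(2) _ poly_space_power[OF fin(2) \<phi>c[OF that]]])
    (use e that in "auto simp: PiE_iff")
  from poly_space_prod[OF fin(2,1) this]
  show "EX C. ALL w. (\<Prod>i\<in>I. \<phi> i w ^ e i) = (SUM b:?Y. C b * mono_fun J b w)"
   unfolding poly_space_def B_def n_def by (auto simp: fun_eq_iff)
 qed
 from bchoice[OF this] obtain C where "ALL e:?X. ALL w. (\<Prod>i\<in>I. \<phi> i w ^ e i) = (SUM b:?Y. C e b * mono_fun J b w)" ..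
 note C = this[rule_format]
 \<comment> \<open>A linear dependence between the pullbacks of the monomials; its coefficients are
   those of the relation \<open>?f\<close>.\<close>
 obtain a where a: "EX e:?X. a e ~= 0" "ALL b:?Y. (SUM e:?X. C e b * a e) = 0"
  using nontrivial_kernel[OF finXY(2,1) lt, of "%b e. C e b"] by (elim exE conjE) (rule that)
 let ?f = "%z. SUM e:?X. a e * mono_fun I e z"
 have "?f : polyfun I"
  unfolding mono_fun_def by (intro polyfun_sum polyfun.times polyfun.const polyfun_prod polyfun_power polyfun.coord)
 moreover obtain e where "e : ?X" "a e ~= 0" using a(1) by blast
 from polynomial_nonzero[where c=a and e=e, OF inf fin(1) this] have "EX z. ?f z ~= 0" .
 moreover have "?f (%i. \<phi> i w) = 0" for w
 proof -
  have "?f (%i. \<phi> i w) = (SUM e:?X. SUM b:?Y. a e * (C e b * mono_fun J b w))"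
   by (intro sum.cong) (auto simp: mono_fun_def[of I] C sum_distrib_left)
  also have "... = (SUM b:?Y. SUM e:?X. a e * (C e b * mono_fun J b w))" by (rule sum.swap)
  also have "... = (SUM b:?Y. (SUM e:?X. C e b * a e) * mono_fun J b w)"
   by (simp add: sum_distrib_left sum_distrib_right ac_simps)
  also have "... = 0" using a(2) by simp
  finally show ?thesis .
 qed
 ultimately show ?thesis by (intro bexI[of _ ?f] conjI allI)
qed

text \<open>The product of the relations for the single maps, which is not the zero function because
  the field is infinite.\<close>

lemma polynomial_relation_family:
 fixes \<phi> :: "'x => 'i => ('j => 'k::field) => 'k"
 assumes inf: "infinite (UNIV :: 'k set)" and I: "finite I" and X: "finite X"
  and J: "!!x. x : X ==> finite (J x) & card (J x) < card I"
  and \<phi>: "!!x i. x : X ==> i : I ==> \<phi> x i : polyfun (J x)"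
 shows "EX f:polyfun I. (EX z. f z ~= 0) & (ALL x:X. ALL w. f (%i. \<phi> x i w) = 0)"
 using X J \<phi>
proof (induction X rule: finite_induct)
 case empty
 show ?case by (rule bexI[of _ "%_. 1"]) (auto intro: polyfun.const)
next
 case (insert x X)
 then obtain f where f: "f : polyfun I" "EX z. f z ~= 0" "ALL x:X. ALL w. f (%i. \<phi> x i w) = 0" by auto
 obtain g where g: "g : polyfun I" "EX z. g z ~= 0" "ALL w. g (%i. \<phi> x i w) = 0"
  using polynomial_relation[OF inf I, of "J x" "\<phi> x"] insert.prems by auto
 have "EX z. f z * g z ~= 0" using polyfun_nonzero_times[OF inf f(1) g(1)] f(2) g(2) by blast
 then show ?case using f(3) g(3) by (intro bexI[OF _ polyfun.times[OF f(1) g(1)]]) auto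
qed

section \<open>Consequences of a nonpositive Tits form\<close>

definition entries :: "'a set => ('a => 'v) => ('a => 'v) => ('v => nat set) => ('v => nat set) => ('a \<times> nat \<times> nat) set" where
 "entries E src tgt T S = (SIGMA ar:E. S (tgt ar) \<times> T (src ar))"

lemma entries_finite_card:
 assumes "bquiver W E src tgt" "ALL v:W. finite (T v) & finite (S v)"
 shows "finite (entries E src tgt T S)" "card (entries E src tgt T S) = (SUM ar:E. card (S (tgt ar)) * card (T (src ar)))"
 using assms unfolding entries_def bquiver_def image_subset_iff
 by (auto simp: card_SigmaI card_cartesian_product)

text \<open>Rescaling \<open>(a, b)\<close> to \<open>(a / c, c b)\<close> normalises one entry of \<open>a\<close>, which saves one parameter.\<close>

lemma orbit_relation:
 fixes W :: "'v set" and y :: "'a => nat => nat => 'k::field"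
 assumes inf: "infinite (UNIV :: 'k set)" and Q: "bquiver W E src tgt" and rep: "brep W E src tgt T S y"
  and ne: "EX v:W. T v ~= {} \<or> S v ~= {}"
  and q: "bform W E src tgt (%v. int (card (T v))) (%v. int (card (S v))) \<le> 0"
 shows "EX f:polyfun (entries E src tgt T S). (EX z. f z ~= 0) &
  (ALL a b. f (%(ar, i, j). (a (tgt ar) *[S (tgt ar)] (y ar *[T (src ar)] b (src ar))) i j) = 0)"
proof -
 have fin: "ALL v:W. finite (T v) & finite (S v)" and fW: "finite W"
  using rep Q by (auto simp: brep_def bquiver_def)
 let ?I = "entries E src tgt T S"
 \<comment> \<open>\<open>P\<close> and \<open>R\<close> are the positions in the matrices
   \<open>a\<close> (tag \<open>Inl\<close>, at the sinks) and \<open>b\<close> (tag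
   \<open>Inr\<close>, at the sources); together they are the coordinates of the group.\<close>
 define P :: "(('v + 'v) \<times> nat \<times> nat) set" where "P = (SIGMA x:Inl ` W. S (projl x) \<times> S (projl x))"
 define R :: "(('v + 'v) \<times> nat \<times> nat) set" where "R = (SIGMA x:Inr ` W. T (projr x) \<times> T (projr x))"
 have finP: "finite P" "finite R" using fin fW by (auto simp: P_def R_def)
 have cP: "card P = (SUM v:W. card (S v) * card (S v))"
  unfolding P_def using fin fW by (subst card_SigmaI) (auto simp: sum.reindex card_cartesian_product)
 have cR: "card R = (SUM v:W. card (T v) * card (T v))"
  unfolding R_def using fin fW by (subst card_SigmaI) (auto simp: sum.reindex card_cartesian_product)
 have "P \<inter> R = {}" by (auto simp: P_def R_def)
 then have cPR: "card (P \<union> R) = card P + card R" using finP by (intro card_Un_disjoint)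
 \<comment> \<open>This is \<open>q \<le> 0\<close>: the group has at most the dimension of the
   representation space. Fixing one entry will make the inequality strict.\<close>
 have "int (card (P \<union> R)) \<le> int (card ?I)"
  using q unfolding cPR cP cR entries_finite_card(2)[OF Q fin]
  by (simp add: bform_def sum.distrib mult.commute)
 then have le: "card (P \<union> R) \<le> card ?I" by simp
 have "P ~= {}"
 proof
  assume P: "P = {}"
  then have S: "S v = {}" if "v : W" for v using that by (force simp: P_def)
  then have "card ?I = 0" unfolding entries_finite_card(2)[OF Q fin]
   using Q by (auto simp: bquiver_def image_subset_iff)
  then have "R = {}" using le finP by auto
  then have "T v = {}" if "v : W" for v using that by (force simp: R_def)
  with S ne show False by auto
 qed
 \<comment> \<open>The entries of \<open>a y b\<close>, with the entry \<open>p\<close> of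
   \<open>a\<close> set to 1. Any nonzero entry may be the one to normalise, so there is one map for
   every position \<open>p\<close> in \<open>P\<close>.\<close>
 define \<phi> where "\<phi> p = (%(ar, i, j) w. SUM k:S (tgt ar). (if (Inl (tgt ar), i, k) = p then 1 else w (Inl (tgt ar), i, k)) *
   (SUM l:T (src ar). y ar k l * w (Inr (src ar), l, j)))" for p :: "('v + 'v) \<times> nat \<times> nat" and w :: "(('v + 'v) \<times> nat \<times> nat) => 'k"
 let ?J = "%p. P \<union> R - {p}"
 have "EX f:polyfun ?I. (EX z. f z ~= 0) & (ALL p:P. ALL w. f (%i. \<phi> p i w) = 0)"
 proof (rule polynomial_relation_family[OF inf entries_finite_card(1)[OF Q fin] finP(1)])
  fix p assume p: "p : P"
  show "finite (?J p) & card (?J p) < card ?I"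
   using finP p le card_Diff1_less[of "P \<union> R" p] by auto
  fix x assume "x : ?I"
  then obtain ar i j where x: "x = (ar, i, j)" "ar : E" "i : S (tgt ar)" "j : T (src ar)"
   by (auto simp: entries_def)
  have W: "tgt ar : W" "src ar : W" using Q x(2) by (auto simp: bquiver_def)
  have 1: "(%w. if (Inl (tgt ar), i, k) = p then 1 else w (Inl (tgt ar), i, k)) : polyfun (?J p)" if "k : S (tgt ar)" for k
   using that x W by (cases "(Inl (tgt ar), i, k) = p") (auto simp: P_def intro!: polyfun.const polyfun.coord)
  have 2: "(%w. w (Inr (src ar), l, j)) : polyfun (?J p)" if "l : T (src ar)" for l
   using that x W p by (auto simp: P_def R_def intro!: polyfun.coord)
  show "\<phi> p x : polyfun (?J p)"
   unfolding x(1) \<phi>_def prod.case by (intro polyfun_sum polyfun.times polyfun.const 1 2)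
 qed
 then obtain f where f: "f : polyfun ?I" "EX z. f z ~= 0" "!!p w. p : P ==> f (%i. \<phi> p i w) = 0" by blast
 have "f (%(ar, i, j). (a (tgt ar) *[S (tgt ar)] (y ar *[T (src ar)] b (src ar))) i j) = 0" for a b
 proof -
  have "EX p:P. EX w. ALL x:?I. (%(ar, i, j). (a (tgt ar) *[S (tgt ar)] (y ar *[T (src ar)] b (src ar))) i j) x = \<phi> p x w"
  proof (cases "EX v:W. EX i:S v. EX k:S v. a v i k ~= 0")
   \<comment> \<open>All entries of \<open>a\<close> on the index sets vanish, so the product is 0.
     It is attained at the parameter 0, where \<open>b\<close> vanishes and the normalised entry has
     no effect.\<close>
   case False
   obtain p where p: "p : P" using \<open>P ~= {}\<close> by blast
   have "(a (tgt ar) *[S (tgt ar)] (y ar *[T (src ar)] b (src ar))) i j = \<phi> p (ar, i, j) (%_. 0)"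
    if "ar : E" "i : S (tgt ar)" for ar i j
   proof -
    have "a (tgt ar) i k = 0" if "k : S (tgt ar)" for k
     using False that \<open>ar : E\<close> \<open>i : S (tgt ar)\<close> Q by (auto simp: bquiver_def)
    then show ?thesis by (simp add: mmul_def \<phi>_def)
   qed
   with p show ?thesis by (intro bexI[of _ p] exI[of _ "%_. 0"]) (auto simp: entries_def)
  next
   case True
   then obtain v i0 k0 where v: "v : W" "i0 : S v" "k0 : S v" "a v i0 k0 ~= 0" by blast
   let ?c = "a v i0 k0" and ?p = "(Inl v, i0, k0) :: ('v + 'v) \<times> nat \<times> nat"
   let ?w = "%(x, i, k). case x of Inl u => a u i k / ?c | Inr u => ?c * b u i k"
   have "(a (tgt ar) *[S (tgt ar)] (y ar *[T (src ar)] b (src ar))) i j = \<phi> ?p (ar, i, j) ?w" for ar i j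
   proof -
    have "\<phi> ?p (ar, i, j) ?w = (SUM k:S (tgt ar). a (tgt ar) i k / ?c * (SUM l:T (src ar). y ar k l * (?c * b (src ar) l j)))"
     unfolding \<phi>_def prod.case by (intro sum.cong refl arg_cong2[where f = "(*)"]) (use v(4) in auto)
    also have "... = (SUM k:S (tgt ar). a (tgt ar) i k * (SUM l:T (src ar). y ar k l * b (src ar) l j))"
    proof (rule sum.cong[OF refl])
     fix k
     have "(SUM l:T (src ar). y ar k l * (?c * b (src ar) l j)) = ?c * (SUM l:T (src ar). y ar k l * b (src ar) l j)"
      by (simp add: sum_distrib_left ac_simps)
     then show "a (tgt ar) i k / ?c * (SUM l:T (src ar). y ar k l * (?c * b (src ar) l j)) =
       a (tgt ar) i k * (SUM l:T (src ar). y ar k l * b (src ar) l j)" using v(4) by simp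
    qed
    finally show ?thesis by (simp add: mmul_def)
   qed
   moreover have "?p : P" using v by (force simp: P_def)
   ultimately show ?thesis by (intro bexI[of _ ?p] exI[of _ ?w]) auto
  qed
  then obtain p w where pw: "p : P"
   "ALL x:?I. (%(ar, i, j). (a (tgt ar) *[S (tgt ar)] (y ar *[T (src ar)] b (src ar))) i j) x = \<phi> p x w" by blast
  have "f (%(ar, i, j). (a (tgt ar) *[S (tgt ar)] (y ar *[T (src ar)] b (src ar))) i j) = f (%x. \<phi> p x w)"
   by (rule polyfun_cong[OF f(1)]) (use pw(2) in blast)
  then show ?thesis using f(3)[OF pw(1)] by simp
 qed
 with f(1,2) show ?thesis by blast
qed

text \<open>The summand of type \<open>(T', S')\<close> of a decomposable representation has the form \<open>a X b\<close>, where
  the rows of \<open>a\<close> in \<open>S'\<close> and the columns of \<open>b\<close> in \<open>T'\<close> may be taken to be unit vectors. The boolean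
  distinguishes the parameters of the two summands.\<close>

definition chart_params where
 "chart_params W E src tgt T S (c::bool) T' S' =
   (%(v, i, k). (c, Inl v, i, k)) ` (SIGMA v:W. (S v - S' v) \<times> S' v) \<union>
   ((%(v, l, j). (c, Inr (Inl v), l, j)) ` (SIGMA v:W. T' v \<times> (T v - T' v)) \<union>
   (%(ar, k, l). (c, Inr (Inr ar), k, l)) ` entries E src tgt T' S')"

definition chart_map where
 "chart_map src tgt (c::bool) T' S' = (%(ar, i, j) w. SUM k:S' (tgt ar).
   (if i : S' (tgt ar) then idm (S' (tgt ar)) i k else w (c, Inl (tgt ar), i, k)) *
   (SUM l:T' (src ar). w (c, Inr (Inr ar), k, l) *
    (if j : T' (src ar) then idm (T' (src ar)) l j else w (c, Inr (Inl (src ar)), l, j))))"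

lemma chart_map_polyfun:
 fixes T S :: "'v => nat set"
 assumes "bquiver W E src tgt" "x : entries E src tgt T S" "chart_params W E src tgt T S c T' S' \<subseteq> J"
 shows "chart_map src tgt c T' S' x : polyfun J"
proof -
 obtain ar i j where x: "x = (ar, i, j)" "ar : E" "i : S (tgt ar)" "j : T (src ar)"
  using assms(2) by (auto simp: entries_def)
 have W: "tgt ar : W" "src ar : W" using assms(1) x(2) by (auto simp: bquiver_def)
 have in_J: "p : J" if "p : chart_params W E src tgt T S c T' S'" for p using assms(3) that by blast
 have 1: "(%w. if i : S' (tgt ar) then idm (S' (tgt ar)) i k else w (c, Inl (tgt ar), i, k)) : polyfun J"
  if "k : S' (tgt ar)" for k
 proof (cases "i : S' (tgt ar)")
  case False
  then have "(c, Inl (tgt ar), i, k) : chart_params W E src tgt T S c T' S'"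
   unfolding chart_params_def using x W that
   by (intro UnI1 image_eqI[of _ _ "(tgt ar, i, k)"]) auto
  from polyfun.coord[OF in_J[OF this]] False show ?thesis by simp
 qed (simp add: polyfun.const)
 have 2: "(%w. if j : T' (src ar) then idm (T' (src ar)) l j else w (c, Inr (Inl (src ar)), l, j)) : polyfun J"
  if "l : T' (src ar)" for l
 proof (cases "j : T' (src ar)")
  case False
  then have "(c, Inr (Inl (src ar)), l, j) : chart_params W E src tgt T S c T' S'"
   unfolding chart_params_def using x W that
   by (intro UnI2[OF UnI1] image_eqI[of _ _ "(src ar, l, j)"]) auto
  from polyfun.coord[OF in_J[OF this]] False show ?thesis by simp
 qed (simp add: polyfun.const)
 have 3: "(%w. w (c, Inr (Inr ar), k, l)) : polyfun J" if "k : S' (tgt ar)" "l : T' (src ar)" for k l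
  unfolding chart_params_def using x that
  by (intro polyfun.coord in_J[unfolded chart_params_def] UnI2[OF UnI2] image_eqI[of _ _ "(ar, k, l)"])
   (auto simp: entries_def)
 show ?thesis unfolding x(1) chart_map_def prod.case by (intro polyfun_sum polyfun.times 1 2 3)
qed

text \<open>The first two sums are dimensions of Grassmannians, in which the image of
  \<open>a\<close> and the kernel of \<open>b\<close> vary at each vertex; the third is the
  dimension of the representation space of the summand.\<close>

lemma card_chart_params:
 fixes T S :: "'v => nat set"
 assumes Q: "bquiver W E src tgt" and fin: "ALL v:W. finite (T v) & finite (S v)"
  and sub: "ALL v:W. T' v \<subseteq> T v & S' v \<subseteq> S v"
 shows "finite (chart_params W E src tgt T S c T' S')"
  "card (chart_params W E src tgt T S c T' S') =
   (SUM v:W. (card (S v) - card (S' v)) * card (S' v)) + ((SUM v:W. card (T' v) * (card (T v) - card (T' v)))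
    + (SUM ar:E. card (S' (tgt ar)) * card (T' (src ar))))"
proof -
 have fW: "finite W" using Q by (simp add: bquiver_def)
 have fin': "ALL v:W. finite (T' v) & finite (S' v)" using fin sub by (meson finite_subset)
 let ?A = "SIGMA v:W. (S v - S' v) \<times> S' v" and ?B = "SIGMA v:W. T' v \<times> (T v - T' v)"
 let ?C = "entries E src tgt T' S'"
 let ?fA = "%(v, i, k). (c, Inl v, i, k)" and ?fB = "%(v, l, j). (c, Inr (Inl v), l, j)"
 let ?fC = "%(ar, k, l). (c, Inr (Inr ar), k, l)"
 have finABC: "finite ?A" "finite ?B" "finite ?C"
  using fin fin' fW entries_finite_card(1)[OF Q fin'] by auto
 have cA: "card ?A = (SUM v:W. (card (S v) - card (S' v)) * card (S' v))"
  using fin fin' fW sub by (subst card_SigmaI) (auto simp: card_cartesian_product card_Diff_subset)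
 have cB: "card ?B = (SUM v:W. card (T' v) * (card (T v) - card (T' v)))"
  using fin fin' fW sub by (subst card_SigmaI) (auto simp: card_cartesian_product card_Diff_subset)
 have inj: "inj_on ?fA ?A" "inj_on ?fB ?B" "inj_on ?fC ?C" by (auto simp: inj_on_def)
 have disj: "?fA ` ?A \<inter> (?fB ` ?B \<union> ?fC ` ?C) = {}" "?fB ` ?B \<inter> ?fC ` ?C = {}" by auto
 show "finite (chart_params W E src tgt T S c T' S')"
  unfolding chart_params_def using finABC by (intro finite_UnI finite_imageI)
 have "card (?fB ` ?B \<union> ?fC ` ?C) = card ?B + card ?C"
  using finABC by (subst card_Un_disjoint[OF _ _ disj(2)]) (auto simp: card_image[OF inj(2)] card_image[OF inj(3)])
 then have "card (chart_params W E src tgt T S c T' S') = card ?A + (card ?B + card ?C)"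
  unfolding chart_params_def using finABC
  by (subst card_Un_disjoint[OF _ _ disj(1)]) (auto simp: card_image[OF inj(1)])
 then show "card (chart_params W E src tgt T S c T' S') =
   (SUM v:W. (card (S v) - card (S' v)) * card (S' v)) + ((SUM v:W. card (T' v) * (card (T v) - card (T' v)))
    + (SUM ar:E. card (S' (tgt ar)) * card (T' (src ar))))"
  by (simp only: cA cB entries_finite_card(2)[OF Q fin'])
qed

lemma bform_add:
 "bform W E src tgt (%v. t v + t' v) (%v. s v + s' v) = bform W E src tgt t s + bform W E src tgt t' s'
  + 2 * (SUM v:W. t v * t' v + s v * s' v) - (SUM ar:E. t (src ar) * s' (tgt ar) + t' (src ar) * s (tgt ar))"
 by (simp add: bform_def sum.distrib sum_distrib_left algebra_simps)

text \<open>For summands of types 1 and 2 the charts use \<open>2 * ?x + ?z\<close> parameters in a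
  space of dimension \<open>?y + ?z\<close>, and \<open>bform_add\<close> reads
  \<open>q = q1 + q2 + 2 * ?x - ?y\<close>. With \<open>q \<le> 0\<close> and
  \<open>q1, q2 \<ge> 1\<close> this gives \<open>2 * ?x < ?y\<close>. So some polynomial vanishes
  at all decomposable representations but not everywhere, and a point where it does not vanish is
  indecomposable.\<close>

lemma exists_bindec:
 fixes W :: "'v set" and E :: "'a set" and T S :: "'v => nat set"
 assumes inf: "infinite (UNIV :: 'k::field set)" and Q: "bquiver W E src tgt"
  and fin: "ALL v:W. finite (T v) & finite (S v)" and ne: "EX v:W. T v ~= {} \<or> S v ~= {}"
  and q: "bform W E src tgt (%v. int (card (T v))) (%v. int (card (S v))) \<le> 0"
  and sub: "!!T' S'. ALL v:W. T' v \<subseteq> T v & S' v \<subseteq> S v ==> EX v:W. T' v ~= {} \<or> S' v ~= {} ==>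
   EX v:W. T' v ~= T v \<or> S' v ~= S v ==>
   1 \<le> bform W E src tgt (%v. int (card (T' v))) (%v. int (card (S' v)))"
 shows "\<exists>y :: 'a => nat => nat => 'k. brep W E src tgt T S y & bindec W E src tgt T S y"
proof -
 have fW: "finite W" using Q by (simp add: bquiver_def)
 let ?I = "entries E src tgt T S"
 let ?PT = "\<Pi>\<^sub>E v\<in>W. Pow (T v)" and ?PS = "\<Pi>\<^sub>E v\<in>W. Pow (S v)"
 \<comment> \<open>The possible types of a decomposition. The sizes of the subsets are complementary
   but the subsets themselves need not be, since the unit blocks of the two summands are chosen
   independently.\<close>
 define X where "X = {(T1, S1, T2, S2) : ?PT \<times> ?PS \<times> ?PT \<times> ?PS.
  (ALL v:W. card (T1 v) + card (T2 v) = card (T v) & card (S1 v) + card (S2 v) = card (S v)) &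
  (EX v:W. T1 v ~= {} \<or> S1 v ~= {}) & (EX v:W. T2 v ~= {} \<or> S2 v ~= {})}"
 have "finite (?PT \<times> ?PS \<times> ?PT \<times> ?PS)" using fW fin by (intro finite_cartesian_product finite_PiE) auto
 then have finX: "finite X" unfolding X_def by (rule rev_finite_subset) auto
 let ?\<phi> = "%(T1, S1, T2, S2) x (w :: bool \<times> ('v + 'v + 'a) \<times> nat \<times> nat => 'k).
  chart_map src tgt True T1 S1 x w + chart_map src tgt False T2 S2 x w"
 let ?J = "%(T1, S1, T2, S2). chart_params W E src tgt T S True T1 S1 \<union> chart_params W E src tgt T S False T2 S2"
 have "EX f:polyfun ?I. (EX z. f z ~= 0) & (ALL x:X. ALL w. f (%i. ?\<phi> x i w) = 0)"
 proof (rule polynomial_relation_family[OF inf entries_finite_card(1)[OF Q fin] finX])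
  fix x assume "x : X"
  then obtain T1 S1 T2 S2 where x: "x = (T1, S1, T2, S2)"
   and s1: "ALL v:W. T1 v \<subseteq> T v & S1 v \<subseteq> S v" and s2: "ALL v:W. T2 v \<subseteq> T v & S2 v \<subseteq> S v"
   and cT: "!!v. v : W ==> card (T v) = card (T1 v) + card (T2 v)"
   and cS: "!!v. v : W ==> card (S v) = card (S1 v) + card (S2 v)"
   and n1: "EX v:W. T1 v ~= {} \<or> S1 v ~= {}" and n2: "EX v:W. T2 v ~= {} \<or> S2 v ~= {}"
   unfolding X_def by (force simp: PiE_iff)
  have fin1: "ALL v:W. finite (T1 v) & finite (S1 v)" "ALL v:W. finite (T2 v) & finite (S2 v)"
   using fin s1 s2 by (meson finite_subset)+
  have "EX v:W. T1 v ~= T v \<or> S1 v ~= S v" "EX v:W. T2 v ~= T v \<or> S2 v ~= S v"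
   using n1 n2 cT cS fin1 by (metis add_cancel_right_right add_cancel_left_left card_0_eq add_cancel_right_left)+
  then have q1: "1 \<le> bform W E src tgt (%v. int (card (T1 v))) (%v. int (card (S1 v)))"
   and q2: "1 \<le> bform W E src tgt (%v. int (card (T2 v))) (%v. int (card (S2 v)))"
   using sub[OF s1 n1] sub[OF s2 n2] by auto
  let ?x = "SUM v:W. int (card (T1 v)) * int (card (T2 v)) + int (card (S1 v)) * int (card (S2 v))"
  let ?y = "SUM ar:E. int (card (T1 (src ar))) * int (card (S2 (tgt ar))) + int (card (T2 (src ar))) * int (card (S1 (tgt ar)))"
  let ?z = "SUM ar:E. int (card (S1 (tgt ar))) * int (card (T1 (src ar))) + int (card (S2 (tgt ar))) * int (card (T2 (src ar)))"
  have "bform W E src tgt (%v. int (card (T v))) (%v. int (card (S v))) =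
   bform W E src tgt (%v. int (card (T1 v)) + int (card (T2 v))) (%v. int (card (S1 v)) + int (card (S2 v)))"
   by (rule bform_cong[OF Q]) (simp_all add: cT cS)
  then have lt: "2 * ?x < ?y" using q q1 q2 unfolding bform_add by linarith
  have E: "src ar : W" "tgt ar : W" if "ar : E" for ar using Q that by (auto simp: bquiver_def)
  have "card ?I = (SUM ar:E. (card (S1 (tgt ar)) + card (S2 (tgt ar))) * (card (T1 (src ar)) + card (T2 (src ar))))"
   unfolding entries_finite_card(2)[OF Q fin] using E by (intro sum.cong) (auto simp: cT cS)
  then have cI: "int (card ?I) = ?y + ?z" by (simp add: sum.distrib algebra_simps)
  note c1 = card_chart_params[OF Q fin s1, of True] and c2 = card_chart_params[OF Q fin s2, of False]
  have "chart_params W E src tgt T S True T1 S1 \<inter> chart_params W E src tgt T S False T2 S2 = {}"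
   by (auto simp: chart_params_def)
  then have "card (?J x) = card (chart_params W E src tgt T S True T1 S1) + card (chart_params W E src tgt T S False T2 S2)"
   unfolding x using card_Un_disjoint[OF c1(1) c2(1)] by simp
  also have "... = (SUM v:W. card (S2 v) * card (S1 v)) + ((SUM v:W. card (T1 v) * card (T2 v)) + (SUM ar:E. card (S1 (tgt ar)) * card (T1 (src ar))))
   + ((SUM v:W. card (S1 v) * card (S2 v)) + ((SUM v:W. card (T2 v) * card (T1 v)) + (SUM ar:E. card (S2 (tgt ar)) * card (T2 (src ar)))))"
   unfolding c1(2) c2(2) by (simp add: cT cS)
  finally have "int (card (?J x)) = 2 * ?x + ?z" by (simp add: sum.distrib algebra_simps)
  then have "card (?J x) < card ?I" using lt cI by linarith
  moreover have "finite (?J x)" unfolding x using c1(1) c2(1) by simp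
  ultimately show "finite (?J x) & card (?J x) < card ?I" by blast
  fix i assume i: "i : ?I"
  show "?\<phi> x i : polyfun (?J x)"
   unfolding x prod.case by (intro polyfun.plus chart_map_polyfun[OF Q i]) auto
 qed
 then obtain f z where f: "f : polyfun ?I" "f z ~= 0" and f0: "!!x w. x : X ==> f (%i. ?\<phi> x i w) = 0" by blast
 define y where "y ar i j = (if (ar, i, j) : ?I then z (ar, i, j) else 0)" for ar i j
 have rep: "brep W E src tgt T S y" using fin by (auto simp: brep_def y_def entries_def mats_def)
 have "bindec W E src tgt T S y"
  unfolding bindec_def
 proof (intro conjI allI impI ne, rule ccontr)
  fix D A
  assume "bhom W E src tgt T S y T S y D A & (ALL v:W. D v *[T v] D v = D v & A v *[S v] A v = A v)"
  then have hom: "!!ar. ar : E ==> A (tgt ar) *[S (tgt ar)] y ar = y ar *[T (src ar)] D (src ar)"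
   and D: "!!v. v : W ==> D v : mats (T v) (T v)" "!!v. v : W ==> D v *[T v] D v = D v"
   and A: "!!v. v : W ==> A v : mats (S v) (S v)" "!!v. v : W ==> A v *[S v] A v = A v"
   by (auto simp: bhom_def)
  assume nt: "\<not> ((ALL v:W. D v = 0 & A v = 0) \<or> (ALL v:W. D v = idm (T v) & A v = idm (S v)))"
  have comp: "idm R - P : mats R R" "(idm R - P) *[R] (idm R - P) = idm R - P"
   if "finite R" "P : mats R R" "P *[R] P = P" for R and P :: "nat => nat => 'k"
   using that by (auto simp: mmul_simps idm_mmul mmul_idm idm_mmul_idm)
  have exS: "EX S' a b. S' \<subseteq> R & a : mats R S' & b : mats S' R & a *[S'] b = P & b *[R] a = idm S' &
    (ALL i k. i : S' --> a i k = idm S' i k)"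
   if "finite R" "P : mats R R" "P *[R] P = P" for R and P :: "nat => nat => 'k"
   by (rule split_idempotent[OF that]) blast
  have exT: "EX S' a b. S' \<subseteq> R & a : mats R S' & b : mats S' R & a *[S'] b = P & b *[R] a = idm S' &
    (ALL i k. i : S' --> b k i = idm S' k i)"
   if "finite R" "P : mats R R" "P *[R] P = P" for R and P :: "nat => nat => 'k"
   by (rule split_idempotent'[OF that]) blast
  have finv: "finite (T v)" "finite (S v)" if "v : W" for v using fin that by auto
  obtain S1 a1 b1 where 1: "!!v. v : W ==> S1 v \<subseteq> S v & a1 v : mats (S v) (S1 v) & b1 v : mats (S1 v) (S v) &
   a1 v *[S1 v] b1 v = A v & b1 v *[S v] a1 v = idm (S1 v) & (ALL i k. i : S1 v --> a1 v i k = idm (S1 v) i k)"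
   using exS[OF finv(2) A] by metis
  obtain S2 a2 b2 where 2: "!!v. v : W ==> S2 v \<subseteq> S v & a2 v : mats (S v) (S2 v) & b2 v : mats (S2 v) (S v) &
   a2 v *[S2 v] b2 v = idm (S v) - A v & b2 v *[S v] a2 v = idm (S2 v) & (ALL i k. i : S2 v --> a2 v i k = idm (S2 v) i k)"
   using exS[OF finv(2) comp[OF finv(2) A]] by metis
  obtain T1 c1 d1 where 3: "!!v. v : W ==> T1 v \<subseteq> T v & c1 v : mats (T v) (T1 v) & d1 v : mats (T1 v) (T v) &
   c1 v *[T1 v] d1 v = D v & d1 v *[T v] c1 v = idm (T1 v) & (ALL i k. i : T1 v --> d1 v k i = idm (T1 v) k i)"
   using exT[OF finv(1) D] by metis
  obtain T2 c2 d2 where 4: "!!v. v : W ==> T2 v \<subseteq> T v & c2 v : mats (T v) (T2 v) & d2 v : mats (T2 v) (T v) &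
   c2 v *[T2 v] d2 v = idm (T v) - D v & d2 v *[T v] c2 v = idm (T2 v) & (ALL i k. i : T2 v --> d2 v k i = idm (T2 v) k i)"
   using exT[OF finv(1) comp[OF finv(1) D]] by metis
  have cS: "card (S1 v) + card (S2 v) = card (S v)" if v: "v : W" for v
   by (rule complementary_splittings(3)[of "S v" "S1 v" "S2 v" "a1 v" "b1 v" "a2 v" "b2 v"])
    (use 1[OF v] 2[OF v] finv[OF v] in "auto intro: finite_subset")
  have cT: "card (T1 v) + card (T2 v) = card (T v)" if v: "v : W" for v
   by (rule complementary_splittings(3)[of "T v" "T1 v" "T2 v" "c1 v" "d1 v" "c2 v" "d2 v"])
    (use 3[OF v] 4[OF v] finv[OF v] in "auto intro: finite_subset")
  have n1: "EX v:W. T1 v ~= {} \<or> S1 v ~= {}"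
  proof (rule ccontr)
   assume *: "\<not> ?thesis"
   have "D v = 0 & A v = 0" if "v : W" for v using 1[OF that] 3[OF that] * that by force
   with nt show False by blast
  qed
  have n2: "EX v:W. T2 v ~= {} \<or> S2 v ~= {}"
  proof (rule ccontr)
   assume *: "\<not> ?thesis"
   have "D v = idm (T v) & A v = idm (S v)" if "v : W" for v
   proof -
    have "idm (S v) - A v = 0" "idm (T v) - D v = 0" using 2[OF that] 4[OF that] * that by force+
    then show ?thesis by (simp only: right_minus_eq)
   qed
   with nt show False by blast
  qed
  let ?x = "(restrict T1 W, restrict S1 W, restrict T2 W, restrict S2 W)"
  have "?x : X" unfolding X_def using 1 2 3 4 cS cT n1 n2 by (auto simp: PiE_iff)
  \<comment> \<open>The parameters realising \<open>y\<close>: the factors \<open>a\<close> and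
    \<open>d\<close> of the idempotents, of which the charts read the entries outside the unit
    blocks, and the compressed matrices \<open>b y c\<close> as the two summands.\<close>
  define w where "w = (%(c::bool, p, i, k). case p of Inl v => (if c then a1 v i k else a2 v i k)
   | Inr (Inl v) => (if c then d1 v i k else d2 v i k)
   | Inr (Inr ar) => (if c then (b1 (tgt ar) *[S (tgt ar)] (y ar *[T (src ar)] c1 (src ar))) i k
     else (b2 (tgt ar) *[S (tgt ar)] (y ar *[T (src ar)] c2 (src ar))) i k))"
  \<comment> \<open>The two charts give \<open>A y D = A y\<close> and
    \<open>(1 - A) y (1 - D) = y - A y\<close>.\<close>
  have "?\<phi> ?x p w = z p" if "p : ?I" for p
  proof -
   obtain ar i j where p: "p = (ar, i, j)" "ar : E" "i : S (tgt ar)" "j : T (src ar)"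
    using \<open>p : ?I\<close> by (auto simp: entries_def)
   have W: "tgt ar : W" "src ar : W" using Q p(2) by (auto simp: bquiver_def)
   let ?s = "tgt ar" and ?t = "src ar"
   have "chart_map src tgt True (restrict T1 W) (restrict S1 W) p w
     = (a1 ?s *[S1 ?s] ((b1 ?s *[S ?s] (y ar *[T ?t] c1 ?t)) *[T1 ?t] d1 ?t)) i j"
    using 1[OF W(1)] 3[OF W(2)] W unfolding p(1) chart_map_def mmul_def[of "a1 ?s"] mmul_def[of _ _ "d1 ?t"] prod.case
    by (intro sum.cong arg_cong2[where f = "(*)"]) (auto simp: w_def)
   also have "... = (A ?s *[S ?s] (y ar *[T ?t] D ?t)) i j"
    using 1[OF W(1)] 3[OF W(2)] by (metis mmul_assoc)
   also have "A ?s *[S ?s] (y ar *[T ?t] D ?t) = A ?s *[S ?s] y ar"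
    using hom[OF p(2)] A(2)[OF W(1)] by (metis mmul_assoc)
   finally have e1: "chart_map src tgt True (restrict T1 W) (restrict S1 W) p w = (A ?s *[S ?s] y ar) i j" .
   have "chart_map src tgt False (restrict T2 W) (restrict S2 W) p w
     = (a2 ?s *[S2 ?s] ((b2 ?s *[S ?s] (y ar *[T ?t] c2 ?t)) *[T2 ?t] d2 ?t)) i j"
    using 2[OF W(1)] 4[OF W(2)] W unfolding p(1) chart_map_def mmul_def[of "a2 ?s"] mmul_def[of _ _ "d2 ?t"] prod.case
    by (intro sum.cong arg_cong2[where f = "(*)"]) (auto simp: w_def)
   also have "... = ((idm (S ?s) - A ?s) *[S ?s] (y ar *[T ?t] (idm (T ?t) - D ?t))) i j"
    using 2[OF W(1)] 4[OF W(2)] by (metis mmul_assoc)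
   also have "(idm (S ?s) - A ?s) *[S ?s] (y ar *[T ?t] (idm (T ?t) - D ?t)) = y ar - A ?s *[S ?s] y ar"
   proof -
    have y: "y ar : mats (S ?s) (T ?t)" using rep p(2) by (simp add: brep_def)
    have id: "idm (S ?s) *[S ?s] y ar = y ar" "y ar *[T ?t] idm (T ?t) = y ar"
     using idm_mmul[OF finv(2)[OF W(1)] y] mmul_idm[OF finv(1)[OF W(2)] y] .
    have "A ?s *[S ?s] (A ?s *[S ?s] y ar) = A ?s *[S ?s] y ar" using A(2)[OF W(1)] by (metis mmul_assoc)
    moreover have "idm (S ?s) *[S ?s] (A ?s *[S ?s] y ar) = A ?s *[S ?s] y ar"
     using idm_mmul[OF finv(2)[OF W(1)] mats_mmul[OF A(1)[OF W(1)] y]] .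
    ultimately show ?thesis by (simp add: mmul_diff_left mmul_diff_right id hom[OF p(2), symmetric])
   qed
   finally have e2: "chart_map src tgt False (restrict T2 W) (restrict S2 W) p w = (y ar - A ?s *[S ?s] y ar) i j" .
   show ?thesis unfolding prod.case e1 e2 using that by (simp add: p(1) y_def)
  qed
  then have "f (%p. ?\<phi> ?x p w) = f z" by (intro polyfun_cong[OF f(1)])
  with f0[OF \<open>?x : X\<close>] f(2) show False by simp
 qed
 with rep show ?thesis by blast
qed

section \<open>Representation spaces and orbits\<close>

text \<open>\<open>fm\<close> and \<open>tm\<close> pass between the matrices of the statement,
  which carry their dimensions, and index functions extended by zero.\<close>

definition fm :: "'k::zero mat => nat => nat => 'k" where
 "fm A i j = (if i < dim_row A & j < dim_col A then A $$ (i, j) else 0)"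

definition tm :: "nat => nat => (nat => nat => 'k) => 'k mat" where
 "tm n m F = mat n m (%(i, j). F i j)"

lemma tm_carrier [simp]: "tm n m F : carrier_mat n m"
 by (simp add: tm_def)

lemma fm_mats: "A : carrier_mat n m ==> fm A : mats {..<n} {..<m}"
 by (auto simp: fm_def mats_def split: if_splits)

lemma fm_tm: "F : mats {..<n} {..<m} ==> fm (tm n m F) = F"
 by (auto simp: fm_def tm_def fun_eq_iff matsD)

lemma tm_fm: "A : carrier_mat n m ==> tm n m (fm A) = A"
 by (auto simp: fm_def tm_def intro!: eq_matI)

lemma fm_inject: "A : carrier_mat n m ==> B : carrier_mat n m ==> fm A = fm B ==> A = B"
 by (metis tm_fm)

lemma fm_index: "A : carrier_mat n m ==> i < n ==> j < m ==> fm A i j = A $$ (i, j)"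
 by (auto simp: fm_def)

lemma fm_mult:
 assumes "A : carrier_mat n k" "B : carrier_mat k m"
 shows "fm (A * B) = fm A *{k} fm B"
proof (intro ext)
 fix i j
 show "fm (A * B) i j = (fm A *{k} fm B) i j"
 proof (cases "i < n & j < m")
  case True
  have "(\<Sum>l = 0..<k. A $$ (i, l) * B $$ (l, j)) = (\<Sum>l<k. fm A i l * fm B l j)"
   by (intro sum.cong) (use True assms in "auto simp: fm_index[of _ n k] fm_index[of _ k m]")
  then show ?thesis using True assms by (simp add: fm_def mmul_def scalar_prod_def)
 next
  case False
  then show ?thesis
   using matsD[OF fm_mats[of "A * B" n m]] matsD[OF mats_mmul[OF fm_mats[OF assms(1)] fm_mats[OF assms(2)]]] assms
   by (metis lessThan_iff mult_carrier_mat)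
 qed
qed

lemma fm_one: "fm (1\<^sub>m n) = idm {..<n}"
 by (auto simp: fm_def idm_def fun_eq_iff)

lemma fm_zero: "fm (0\<^sub>m n m) = 0"
 by (auto simp: fm_def fun_eq_iff)

lemma tm_mult:
 "F : mats {..<n} {..<k} ==> G : mats {..<k} {..<m} ==> tm n k F * tm k m G = tm n m (F *{k} G)"
 by (rule fm_inject[of _ n m])
  (auto simp: fm_mult[OF tm_carrier tm_carrier] fm_tm mats_mmul intro: mult_carrier_mat[OF tm_carrier tm_carrier])

lemma tm_idm: "tm n n (idm {..<n}) = 1\<^sub>m n"
 by (rule fm_inject[of _ n n]) (auto simp: fm_tm fm_one)

text \<open>A group element is kept together with its inverse, so that composition and inversion act
  on pairs and no inverse has to be formed in \<open>act\<close>.\<close>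

definition inverse_pair :: "('v, 'a) pre_digraph => ('v => nat) => ('v => nat => nat => 'k::field)
  => ('v => nat => nat => 'k) => bool" where
 "inverse_pair Q d g h \<longleftrightarrow> (ALL v:verts Q. g v : mats {..<d v} {..<d v} & h v : mats {..<d v} {..<d v} &
   g v *{d v} h v = idm {..<d v} & h v *{d v} g v = idm {..<d v})"

definition act :: "('v, 'a) pre_digraph => ('v => nat) => ('v => nat => nat => 'k::field)
  => ('v => nat => nat => 'k) => ('a => 'k mat) => 'a => 'k mat" where
 "act Q d g h x = (\<lambda>ar\<in>arcs Q. tm (d (head Q ar)) (d (tail Q ar))
   (g (head Q ar) *{d (head Q ar)} (fm (x ar) *{d (tail Q ar)} h (tail Q ar))))"

lemma rep_spaceD: "x : rep_space Q d ==> ar : arcs Q ==> x ar : carrier_mat (d (head Q ar)) (d (tail Q ar))"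
 by (auto simp: rep_space_def)

lemma rep_space_fm:
 "x : rep_space Q d ==> ar : arcs Q ==> fm (x ar) : mats {..<d (head Q ar)} {..<d (tail Q ar)}"
 by (auto intro: fm_mats rep_spaceD)

lemma rep_space_eqI:
 assumes "x : rep_space Q d" "y : rep_space Q d" "!!ar. ar : arcs Q ==> fm (x ar) = fm (y ar)"
 shows "x = y"
 using assms unfolding rep_space_def
 by (intro PiE_ext[of x _ _ y]) (auto intro: fm_inject[OF rep_spaceD rep_spaceD] simp: rep_space_def)

lemma act_rep_space: "act Q d g h x : rep_space Q d"
 by (auto simp: act_def rep_space_def)

lemma fm_act:
 assumes "wf_digraph Q" "inverse_pair Q d g h" "x : rep_space Q d" "ar : arcs Q"
 shows "fm (act Q d g h x ar) =
  g (head Q ar) *{d (head Q ar)} (fm (x ar) *{d (tail Q ar)} h (tail Q ar))"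
proof -
 have "g (head Q ar) : mats {..<d (head Q ar)} {..<d (head Q ar)}"
  "h (tail Q ar) : mats {..<d (tail Q ar)} {..<d (tail Q ar)}"
  using assms(1,2,4) by (auto simp: inverse_pair_def wf_digraph_def)
 then show ?thesis unfolding act_def
  using fm_tm[OF mats_mmul[OF _ mats_mmul[OF rep_space_fm[OF assms(3,4)]]]] assms(4) by simp
qed

text \<open>From here on orbits are described by \<open>act\<close> and inverse pairs instead of
  units of matrix rings.\<close>

lemma GL_orbit_eq:
 fixes x :: "'a => 'k::field mat"
 assumes wf: "wf_digraph Q" and x: "x : rep_space Q d"
 shows "GL_orbit Q d x = {act Q d g h x | g h. inverse_pair Q d g h}"
proof (intro subset_antisym subsetI)
 fix y assume "y : GL_orbit Q d x"
 then obtain g where g: "g : GL Q d" and y: "y = GL_action Q d g x" by (auto simp: GL_orbit_def)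
 let ?R = "%v. ring_mat TYPE('k) (d v) ()"
 define h where "h v = inv\<^bsub>?R v\<^esub> g v" for v
 have gh: "g v : carrier_mat (d v) (d v)" "h v : carrier_mat (d v) (d v)"
  "g v * h v = 1\<^sub>m (d v)" "h v * g v = 1\<^sub>m (d v)" if "v : verts Q" for v
 proof -
  interpret R: ring "?R v" by (rule ring_mat)
  have U: "g v : Units (?R v)" using g that by (auto simp: GL_def)
  show "g v : carrier_mat (d v) (d v)" "h v : carrier_mat (d v) (d v)"
   using R.Units_closed[OF U] R.Units_inv_closed[OF U] by (simp_all add: ring_mat_simps h_def)
  show "g v * h v = 1\<^sub>m (d v)" "h v * g v = 1\<^sub>m (d v)"
   using R.Units_r_inv[OF U] R.Units_l_inv[OF U] by (simp_all add: ring_mat_simps h_def)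
 qed
 have inv: "inverse_pair Q d (%v. fm (g v)) (%v. fm (h v))"
  unfolding inverse_pair_def
 proof (intro ballI conjI)
  fix v assume v: "v : verts Q"
  show "fm (g v) *{d v} fm (h v) = idm {..<d v}" "fm (h v) *{d v} fm (g v) = idm {..<d v}"
   using gh[OF v] fm_mult[OF gh(1)[OF v] gh(2)[OF v]] fm_mult[OF gh(2)[OF v] gh(1)[OF v]] by (simp_all add: fm_one)
 qed (use gh in "auto intro: fm_mats")
 have "y = act Q d (%v. fm (g v)) (%v. fm (h v)) x"
 proof (rule rep_space_eqI[OF _ act_rep_space])
  have W: "head Q ar : verts Q" "tail Q ar : verts Q" if "ar : arcs Q" for ar
   using wf that by (auto simp: wf_digraph_def)
  have car: "g (head Q ar) * x ar * h (tail Q ar) : carrier_mat (d (head Q ar)) (d (tail Q ar))" if "ar : arcs Q" for ar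
   using gh(1)[OF W(1)[OF that]] gh(2)[OF W(2)[OF that]] rep_spaceD[OF x that] by auto
  then show "y : rep_space Q d" by (auto simp: y GL_action_def rep_space_def h_def)
  fix ar assume ar: "ar : arcs Q"
  have "fm (y ar) = fm (g (head Q ar) * x ar * h (tail Q ar))" using ar by (simp add: y GL_action_def h_def)
  also have "... = fm (g (head Q ar)) *{d (head Q ar)} (fm (x ar) *{d (tail Q ar)} fm (h (tail Q ar)))"
   using gh(1)[OF W(1)[OF ar]] gh(2)[OF W(2)[OF ar]] rep_spaceD[OF x ar]
   by (simp add: fm_mult[of _ "d (head Q ar)" "d (tail Q ar)" _ "d (tail Q ar)"]
    fm_mult[of _ "d (head Q ar)" "d (head Q ar)" _ "d (tail Q ar)"] mmul_assoc)
  finally show "fm (y ar) = fm (act Q d (%v. fm (g v)) (%v. fm (h v)) x ar)"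
   using fm_act[OF wf inv x ar] by simp
 qed
 with inv show "y : {act Q d g h x | g h. inverse_pair Q d g h}" by blast
next
 fix y assume "y : {act Q d g h x | g h. inverse_pair Q d g h}"
 then obtain g h where inv: "inverse_pair Q d g h" and y: "y = act Q d g h x" by blast
 let ?R = "%v. ring_mat TYPE('k) (d v) ()"
 let ?g = "\<lambda>v\<in>verts Q. tm (d v) (d v) (g v)"
 have gh: "tm (d v) (d v) (g v) : Units (?R v)" "inv\<^bsub>?R v\<^esub> tm (d v) (d v) (g v) = tm (d v) (d v) (h v)"
  if "v : verts Q" for v
 proof -
  interpret R: ring "?R v" by (rule ring_mat)
  have 1: "tm (d v) (d v) (g v) * tm (d v) (d v) (h v) = 1\<^sub>m (d v)"
   "tm (d v) (d v) (h v) * tm (d v) (d v) (g v) = 1\<^sub>m (d v)"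
   using inv that by (simp_all add: inverse_pair_def tm_mult tm_idm)
  then show "tm (d v) (d v) (g v) : Units (?R v)"
   unfolding Units_def ring_mat_simps by (auto intro!: bexI[of _ "tm (d v) (d v) (h v)"])
  show "inv\<^bsub>?R v\<^esub> tm (d v) (d v) (g v) = tm (d v) (d v) (h v)"
   by (rule R.inv_char) (use 1 in "auto simp: ring_mat_simps")
 qed
 have "?g : GL Q d" using gh(1) by (auto simp: GL_def)
 moreover have "y = GL_action Q d ?g x"
  unfolding y act_def GL_action_def
 proof (rule restrict_ext)
  fix ar assume ar: "ar : arcs Q"
  then have W: "head Q ar : verts Q" "tail Q ar : verts Q" using wf by (auto simp: wf_digraph_def)
  have m: "g (head Q ar) : mats {..<d (head Q ar)} {..<d (head Q ar)}"
   "h (tail Q ar) : mats {..<d (tail Q ar)} {..<d (tail Q ar)}"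
   using inv W by (auto simp: inverse_pair_def)
  have "tm (d (head Q ar)) (d (head Q ar)) (g (head Q ar)) * x ar * tm (d (tail Q ar)) (d (tail Q ar)) (h (tail Q ar))
   = tm (d (head Q ar)) (d (tail Q ar)) (g (head Q ar) *{d (head Q ar)} (fm (x ar) *{d (tail Q ar)} h (tail Q ar)))"
   by (subst tm_fm[OF rep_spaceD[OF x ar], symmetric])
    (simp add: tm_mult m rep_space_fm[OF x ar] mats_mmul[OF m(1) rep_space_fm[OF x ar]] mmul_assoc)
  then show "tm (d (head Q ar)) (d (tail Q ar)) (g (head Q ar) *{d (head Q ar)} (fm (x ar) *{d (tail Q ar)} h (tail Q ar)))
   = ?g (head Q ar) * x ar * inv\<^bsub>?R (tail Q ar)\<^esub> ?g (tail Q ar)"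
   using W gh(2)[OF W(2)] by simp
 qed
 ultimately show "y : GL_orbit Q d x" by (auto simp: GL_orbit_def)
qed

lemma inverse_pair_idm: "inverse_pair Q d (%v. idm {..<d v}) (%v. idm {..<d v})"
 by (simp add: inverse_pair_def idm_mmul_idm)

lemma inverse_pair_comp:
 assumes "inverse_pair Q d g h" "inverse_pair Q d g' h'"
 shows "inverse_pair Q d (%v. g' v *{d v} g v) (%v. h v *{d v} h' v)"
 unfolding inverse_pair_def
proof (intro ballI conjI)
 fix v assume v: "v : verts Q"
 let ?D = "{..<d v}"
 have *: "g v : mats ?D ?D" "h v : mats ?D ?D" "g v *[?D] h v = idm ?D" "h v *[?D] g v = idm ?D"
  "g' v : mats ?D ?D" "h' v : mats ?D ?D" "g' v *[?D] h' v = idm ?D" "h' v *[?D] g' v = idm ?D"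
  using assms v by (auto simp: inverse_pair_def)
 show "g' v *[?D] g v : mats ?D ?D" "h v *[?D] h' v : mats ?D ?D" using * by auto
 have "(g' v *[?D] g v) *[?D] (h v *[?D] h' v) = g' v *[?D] ((g v *[?D] h v) *[?D] h' v)" by (simp only: mmul_assoc)
 then show "(g' v *[?D] g v) *[?D] (h v *[?D] h' v) = idm ?D" using * by (simp add: idm_mmul)
 have "(h v *[?D] h' v) *[?D] (g' v *[?D] g v) = h v *[?D] ((h' v *[?D] g' v) *[?D] g v)" by (simp only: mmul_assoc)
 then show "(h v *[?D] h' v) *[?D] (g' v *[?D] g v) = idm ?D" using * by (simp add: idm_mmul)
qed

lemma inverse_pair_swap: "inverse_pair Q d g h ==> inverse_pair Q d h g"
 by (auto simp: inverse_pair_def)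

lemma act_comp:
 assumes "wf_digraph Q" "inverse_pair Q d g h" "inverse_pair Q d g' h'" "x : rep_space Q d"
 shows "act Q d g' h' (act Q d g h x) = act Q d (%v. g' v *{d v} g v) (%v. h v *{d v} h' v) x"
proof (rule rep_space_eqI[OF act_rep_space act_rep_space])
 fix ar assume ar: "ar : arcs Q"
 show "fm (act Q d g' h' (act Q d g h x) ar) = fm (act Q d (%v. g' v *{d v} g v) (%v. h v *{d v} h' v) x ar)"
  by (simp add: fm_act[OF assms(1,3) act_rep_space ar] fm_act[OF assms(1,2,4) ar]
   fm_act[OF assms(1) inverse_pair_comp[OF assms(2,3)] assms(4) ar] mmul_assoc)
qed

lemma act_idm:
 assumes "wf_digraph Q" "x : rep_space Q d"
 shows "act Q d (%v. idm {..<d v}) (%v. idm {..<d v}) x = x"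
proof (rule rep_space_eqI[OF act_rep_space assms(2)])
 fix ar assume ar: "ar : arcs Q"
 note x = rep_space_fm[OF assms(2) ar]
 show "fm (act Q d (%v. idm {..<d v}) (%v. idm {..<d v}) x ar) = fm (x ar)"
  by (simp add: fm_act[OF assms(1) inverse_pair_idm assms(2) ar] mmul_idm[OF _ x] idm_mmul[OF _ x])
qed

lemma GL_orbit_subset_rep_space: "wf_digraph Q ==> x : rep_space Q d ==> GL_orbit Q d x \<subseteq> rep_space Q d"
 by (auto simp: GL_orbit_eq act_rep_space)

lemma GL_orbit_refl: "wf_digraph Q ==> x : rep_space Q d ==> x : GL_orbit Q d x"
 unfolding GL_orbit_eq using act_idm[of Q x d] inverse_pair_idm[of Q d] by (metis (mono_tags, lifting) mem_Collect_eq)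

lemma GL_orbit_sym:
 assumes "wf_digraph Q" "x : rep_space Q d" "y : GL_orbit Q d x"
 shows "x : GL_orbit Q d y"
proof -
 obtain g h where gh: "inverse_pair Q d g h" and y: "y = act Q d g h x"
  using assms(3) unfolding GL_orbit_eq[OF assms(1,2)] by blast
 have yr: "y : rep_space Q d" unfolding y by (rule act_rep_space)
 have "act Q d h g y = x"
 proof (rule rep_space_eqI[OF act_rep_space assms(2)])
  fix ar assume ar: "ar : arcs Q"
  then have W: "head Q ar : verts Q" "tail Q ar : verts Q" using assms(1) by (auto simp: wf_digraph_def)
  let ?H = "{..<d (head Q ar)}" and ?T = "{..<d (tail Q ar)}"
  have "fm (act Q d h g y ar) = (h (head Q ar) *[?H] g (head Q ar)) *[?H] (fm (x ar) *[?T] (h (tail Q ar) *[?T] g (tail Q ar)))"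
   unfolding fm_act[OF assms(1) inverse_pair_swap[OF gh] yr ar] unfolding y fm_act[OF assms(1) gh assms(2) ar]
   by (simp only: mmul_assoc)
  also have "... = fm (x ar)"
   using gh W rep_space_fm[OF assms(2) ar] by (simp add: inverse_pair_def mmul_idm idm_mmul)
  finally show "fm (act Q d h g y ar) = fm (x ar)" .
 qed
 then show ?thesis unfolding GL_orbit_eq[OF assms(1) yr] using inverse_pair_swap[OF gh] by blast
qed

lemma GL_orbit_trans:
 assumes "wf_digraph Q" "x : rep_space Q d" "y : GL_orbit Q d x" "z : GL_orbit Q d y"
 shows "z : GL_orbit Q d x"
proof -
 obtain g h where gh: "inverse_pair Q d g h" and y: "y = act Q d g h x"
  using assms(3) unfolding GL_orbit_eq[OF assms(1,2)] by blast
 have yr: "y : rep_space Q d" unfolding y by (rule act_rep_space)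
 obtain g' h' where gh': "inverse_pair Q d g' h'" and z: "z = act Q d g' h' y"
  using assms(4) unfolding GL_orbit_eq[OF assms(1) yr] by blast
 show ?thesis unfolding GL_orbit_eq[OF assms(1,2)] z y act_comp[OF assms(1) gh gh' assms(2)]
  using inverse_pair_comp[OF gh gh'] by blast
qed

lemma GL_orbit_eq_if_mem:
 assumes "wf_digraph Q" "x : rep_space Q d" "y : GL_orbit Q d x"
 shows "GL_orbit Q d y = GL_orbit Q d x"
proof -
 have y: "y : rep_space Q d" using assms GL_orbit_subset_rep_space by blast
 show ?thesis
  using GL_orbit_trans[OF assms(1,2,3)] GL_orbit_trans[OF assms(1) y GL_orbit_sym[OF assms]] by blast
qed

section \<open>The Zariski topology\<close>

lemma rep_polys_sum: "(!!x. x : X ==> f x : rep_polys Q d) ==> (%z. SUM x:X. f x z) : rep_polys Q d"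
 by (induction X rule: infinite_finite_induct) (auto intro: rep_polys.intros)

lemma rep_polys_prod: "(!!x. x : X ==> f x : rep_polys Q d) ==> (%z. \<Prod>x\<in>X. f x z) : rep_polys Q d"
 by (induction X rule: infinite_finite_induct) (auto intro: rep_polys.intros)

lemma rep_polys_det:
 assumes "!!i j. i < n ==> j < n ==> (%x. F x i j) : rep_polys Q d"
 shows "(%x. det (tm n n (F x))) : rep_polys Q d"
proof -
 have "(%x. det (tm n n (F x))) = (%x. \<Sum>p | p permutes {0..<n}. signof p * (\<Prod>i = 0..<n. F x i (p i)))"
  unfolding det_def'[OF tm_carrier]
 proof (intro ext sum.cong refl arg_cong2[where f = "(*)"] prod.cong)
  fix x p i assume "p : {p. p permutes {0..<n}}" "i : {0..<n}"
  then have "p i < n" using permutes_in_image[of p "{0..<n}" i] by auto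
  then show "tm n n (F x) $$ (i, p i) = F x i (p i)" using \<open>i : {0..<n}\<close> by (simp add: tm_def)
 qed
 also have "... : rep_polys Q d"
 proof (intro rep_polys_sum rep_polys.times rep_polys.const rep_polys_prod)
  fix p i assume "p : {p. p permutes {0..<n}}" "i : {0..<n}"
  then show "(%x. F x i (p i)) : rep_polys Q d"
   using permutes_in_image[of p "{0..<n}" i] by (intro assms) auto
 qed
 finally show ?thesis .
qed

lemma closedin_zariski:
 "closedin (zariski Q I d) C \<longleftrightarrow> (\<exists>F \<subseteq> rep_polys Q d. C = Rep Q I d \<inter> {x. ALL f:F. f x = 0})"
proof -
 have "closedin (zariski Q I d) C \<longleftrightarrow> C \<subseteq> Rep Q I d & (\<exists>F \<subseteq> rep_polys Q d. Rep Q I d - C = Rep Q I d - {x. ALL f:F. f x = 0})"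
  unfolding closedin_def topspace_zariski openin_zariski ..
 also have "... \<longleftrightarrow> (\<exists>F \<subseteq> rep_polys Q d. C = Rep Q I d \<inter> {x. ALL f:F. f x = 0})"
 proof (intro iffI; elim exE conjE)
  fix F assume "C \<subseteq> Rep Q I d" "F \<subseteq> rep_polys Q d" "Rep Q I d - C = Rep Q I d - {x. ALL f:F. f x = 0}"
  then show "\<exists>F \<subseteq> rep_polys Q d. C = Rep Q I d \<inter> {x. ALL f:F. f x = 0}"
   by (intro exI[of _ F] conjI) auto
 next
  fix F assume "F \<subseteq> rep_polys Q d" "C = Rep Q I d \<inter> {x. ALL f:F. f x = 0}"
  then show "C \<subseteq> Rep Q I d & (\<exists>F \<subseteq> rep_polys Q d. Rep Q I d - C = Rep Q I d - {x. ALL f:F. f x = 0})"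
   by (intro conjI exI[of _ F]) auto
 qed
 finally show ?thesis .
qed

text \<open>The closure is itself a common zero set, cut out by polynomials that vanish on
  \<open>S\<close>; conversely each such polynomial defines a closed set containing
  \<open>S\<close>.\<close>

lemma in_zariski_closure:
 assumes "S \<subseteq> Rep Q I d"
 shows "x : zariski Q I d closure_of S \<longleftrightarrow>
  x : Rep Q I d & (ALL f:rep_polys Q d. (ALL y:S. f y = 0) --> f x = 0)"
proof (intro iffI conjI ballI impI)
 assume x: "x : zariski Q I d closure_of S"
 then show "x : Rep Q I d" by (simp add: in_closure_of topspace_zariski)
 fix f assume f: "f : rep_polys Q d" "ALL y:S. f y = 0"
 have "closedin (zariski Q I d) (Rep Q I d \<inter> {x. ALL f:{f}. f x = 0})"
  unfolding closedin_zariski by (intro exI[of _ "{f}"] conjI refl) (use f in auto)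
 then have "zariski Q I d closure_of S \<subseteq> Rep Q I d \<inter> {x. ALL f:{f}. f x = 0}"
  by (rule closure_of_minimal[rotated]) (use f assms in auto)
 with x show "f x = 0" by auto
next
 assume x: "x : Rep Q I d & (ALL f:rep_polys Q d. (ALL y:S. f y = 0) --> f x = 0)"
 obtain F where F: "F \<subseteq> rep_polys Q d" "zariski Q I d closure_of S = Rep Q I d \<inter> {x. ALL f:F. f x = 0}"
  using closedin_closure_of[of "zariski Q I d" S] unfolding closedin_zariski by blast
 have "S \<subseteq> zariski Q I d closure_of S" using assms by (intro closure_of_subset) (simp add: topspace_zariski)
 with F x show "x : zariski Q I d closure_of S" by blast
qed

lemma irreducible_in_closure:
 assumes "irreducible_in X S"
 shows "irreducible_in X (X closure_of S)"
 unfolding irreducible_in_def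
proof (intro conjI allI impI)
 have S: "S \<subseteq> topspace X" "S ~= {}" using assms by (auto simp: irreducible_in_def)
 then have sub: "S \<subseteq> X closure_of S" by (intro closure_of_subset)
 show "X closure_of S \<subseteq> topspace X" by (rule closure_of_subset_topspace)
 show "X closure_of S ~= {}" using sub S(2) by blast
 fix A B assume AB: "closedin X A & closedin X B & X closure_of S \<subseteq> A \<union> B"
 then have "S \<subseteq> A \<or> S \<subseteq> B" using assms sub unfolding irreducible_in_def by blast
 then show "X closure_of S \<subseteq> A \<or> X closure_of S \<subseteq> B" using AB by (metis closure_of_minimal)
qed

lemma irreducible_in_finite_Union:
 assumes "irreducible_in X S" "finite \<A>" "!!A. A : \<A> ==> closedin X A" "S \<subseteq> \<Union>\<A>"
 shows "EX A:\<A>. S \<subseteq> A"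
 using assms(2-4)
proof (induction \<A> rule: finite_induct)
 case empty
 then show ?case using assms(1) by (auto simp: irreducible_in_def)
next
 case (insert A \<A>)
 have "closedin X (\<Union>\<A>)" using insert by (intro closedin_Union) auto
 then have "S \<subseteq> A \<or> S \<subseteq> \<Union>\<A>" using insert.prems assms(1) unfolding irreducible_in_def by auto
 then show ?case using insert by auto
qed

section \<open>Polynomial and rational functions of one parameter\<close>

definition polyn :: "('k::field => 'k) set" where
 "polyn = {f. EX p. ALL x. f x = poly p x}"

lemma polyn_const: "(%x. c) : polyn"
 unfolding polyn_def by (auto intro: exI[of _ "[:c:]"])

lemma polyn_line: "(%x. a + x * b) : polyn"
 unfolding polyn_def by (auto intro!: exI[of _ "[:a, b:]"])

lemma polyn_add: "f : polyn ==> g : polyn ==> (%x. f x + g x) : polyn"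
 unfolding polyn_def mem_Collect_eq by (metis poly_add)

lemma polyn_mult: "f : polyn ==> g : polyn ==> (%x. f x * g x) : polyn"
 unfolding polyn_def mem_Collect_eq by (metis poly_mult)

lemma polyn_sum: "(!!x. x : X ==> f x : polyn) ==> (%z. SUM x:X. f x z) : polyn"
 by (induction X rule: infinite_finite_induct) (auto intro: polyn_const polyn_add)

lemma polyn_prod: "(!!x. x : X ==> f x : polyn) ==> (%z. \<Prod>x\<in>X. f x z) : polyn"
 by (induction X rule: infinite_finite_induct) (auto intro: polyn_const polyn_mult)

lemma polyn_det:
 assumes "!!x. A x : carrier_mat n n" "!!i j. i < n ==> j < n ==> (%x. A x $$ (i, j)) : polyn"
 shows "(%x. det (A x)) : polyn"
 unfolding det_def'[OF assms(1)]
proof (intro polyn_sum polyn_mult polyn_const polyn_prod)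
 fix p i assume "p : {p. p permutes {0..<n}}" "i : {0..<n}"
 then show "(%x. A x $$ (i, p i)) : polyn"
  using permutes_in_image[of p "{0..<n}" i] by (intro assms(2)) auto
qed

lemma polyn_adj_mat:
 assumes "!!x. A x : carrier_mat n n" "!!i j. i < n ==> j < n ==> (%x. A x $$ (i, j)) : polyn" "i < n" "j < n"
 shows "(%x. adj_mat (A x) $$ (i, j)) : polyn"
proof -
 have dims: "dim_row (A x) = n" "dim_col (A x) = n" for x using assms(1)[of x] by auto
 have "(%x. det (mat_delete (A x) j i)) : polyn"
 proof (rule polyn_det[of _ "n - 1"])
  show "mat_delete (A x) j i : carrier_mat (n - 1) (n - 1)" for x by (simp add: mat_delete_def dims)
  show "(%x. mat_delete (A x) j i $$ (k, l)) : polyn" if "k < n - 1" "l < n - 1" for k l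
   using that by (simp add: mat_delete_def dims assms(2))
 qed
 then show ?thesis
  unfolding adj_mat_def dims cofactor_def using assms(3,4)
  by (auto intro!: polyn_mult polyn_const)
qed

text \<open>Regular functions on the part of the line where \<open>D\<close> is nonzero: a power of
  \<open>D\<close> clears the denominators. Nothing is required at the zeros of \<open>D\<close>,
  where the curve to be studied may leave the union of orbits.\<close>

definition rational where
 "rational D f \<longleftrightarrow> (EX N. EX g:polyn. ALL x. D x ~= (0::'k::field) --> f x * D x ^ N = g x)"

lemma rational_add:
 assumes "D : polyn" "rational D f" "rational D g"
 shows "rational D (%x. f x + g x)"
proof -
 obtain N p where f: "p : polyn" "!!x. D x ~= 0 ==> f x * D x ^ N = p x"
  using assms(2) unfolding rational_def by blast
 obtain M q where g: "q : polyn" "!!x. D x ~= 0 ==> g x * D x ^ M = q x"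
  using assms(3) unfolding rational_def by blast
 note * = f(1) g(1) f(2) g(2)
 have pow: "(%x. D x ^ k) : polyn" for k
  using polyn_prod[of "{..<k}" "%_. D"] assms(1) by simp
 have "(f x + g x) * D x ^ (N + M) = p x * D x ^ M + q x * D x ^ N" if "D x ~= 0" for x
  unfolding *(3,4)[OF that, symmetric] by (simp add: power_add algebra_simps)
 moreover have "(%x. p x * D x ^ M + q x * D x ^ N) : polyn"
  by (intro polyn_add polyn_mult * pow)
 ultimately show ?thesis unfolding rational_def
  by (intro exI[of _ "N + M"] bexI[of _ "%x. p x * D x ^ M + q x * D x ^ N"]) simp_all
qed

lemma rational_mult:
 assumes "rational D f" "rational D g"
 shows "rational D (%x. f x * g x)"
proof -
 obtain N p where f: "p : polyn" "!!x. D x ~= 0 ==> f x * D x ^ N = p x"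
  using assms(1) unfolding rational_def by blast
 obtain M q where g: "q : polyn" "!!x. D x ~= 0 ==> g x * D x ^ M = q x"
  using assms(2) unfolding rational_def by blast
 note * = f(1) g(1) f(2) g(2)
 have "(f x * g x) * D x ^ (N + M) = p x * q x" if "D x ~= 0" for x
  unfolding *(3,4)[OF that, symmetric] by (simp add: power_add algebra_simps)
 with polyn_mult[OF *(1,2)] show ?thesis unfolding rational_def
  by (intro exI[of _ "N + M"] bexI[of _ "%x. p x * q x"]) simp_all
qed

lemma rational_polyn: "f : polyn ==> rational D f"
 unfolding rational_def by (intro exI[of _ 0]) auto

lemma rational_sum:
 "D : polyn ==> (!!x. x : X ==> rational D (f x)) ==> rational D (%z. SUM x:X. f x z)"
 by (induction X rule: infinite_finite_induct) (auto intro: rational_polyn polyn_const rational_add)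

definition line_rep where
 "line_rep Q d x y c = (\<lambda>ar\<in>arcs Q. tm (d (head Q ar)) (d (tail Q ar)) (%i j. fm (x ar) i j + c * (fm (y ar) i j - fm (x ar) i j)))"

text \<open>Two points \<open>g x g\<inverse>\<close> and \<open>g' x' g'\<inverse>\<close> are joined by a rational curve, obtained by moving \<open>g\<close> to
  \<open>g'\<close> and \<open>x\<close> to \<open>x'\<close> along lines.\<close>

lemma irreducible_orbits:
 fixes L :: "('a => 'k::field mat) set"
 assumes inf: "infinite (UNIV :: 'k set)" and fin: "fin_digraph Q" and L: "L \<subseteq> rep_space Q d" "L ~= {}"
  and line: "!!x y c. x : L ==> y : L ==> line_rep Q d x y c : L"
  and sub: "(\<Union>x\<in>L. GL_orbit Q d x) \<subseteq> Rep Q I d"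
 shows "irreducible_in (zariski Q I d) (\<Union>x\<in>L. GL_orbit Q d x)"
 unfolding irreducible_in_def topspace_zariski
proof (intro conjI allI impI sub, goal_cases)
 interpret fin_digraph Q by fact
 have wf: "wf_digraph Q" by (rule wf_digraph_axioms)
 {
  case 1
  then show ?case using L GL_orbit_refl[OF wf] by fast
 next
  case (2 A B)
  show ?case
  proof (rule ccontr)
   assume "\<not> ?case"
   then obtain p1 p2 x1 x2 where p: "p1 \<notin> A" "p2 \<notin> B" "x1 : L" "x2 : L" "p1 : GL_orbit Q d x1" "p2 : GL_orbit Q d x2"
    by blast
   have xr: "x1 : rep_space Q d" "x2 : rep_space Q d" using p L by auto
   obtain F where F: "F \<subseteq> rep_polys Q d" "A = Rep Q I d \<inter> {x. ALL f:F. f x = 0}"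
    using 2 unfolding closedin_zariski by blast
   then obtain f1 where f1: "f1 : rep_polys Q d" "f1 p1 ~= 0" "!!x. x : A ==> f1 x = 0"
    using p(1,3,5) sub by blast
   obtain F where F: "F \<subseteq> rep_polys Q d" "B = Rep Q I d \<inter> {x. ALL f:F. f x = 0}"
    using 2 unfolding closedin_zariski by blast
   then obtain f2 where f2: "f2 : rep_polys Q d" "f2 p2 ~= 0" "!!x. x : B ==> f2 x = 0"
    using p(2,4,6) sub by blast
   obtain g1 h1 where g1: "inverse_pair Q d g1 h1" "p1 = act Q d g1 h1 x1"
    using p(5) unfolding GL_orbit_eq[OF wf xr(1)] by blast
   obtain g2 h2 where g2: "inverse_pair Q d g2 h2" "p2 = act Q d g2 h2 x2"
    using p(6) unfolding GL_orbit_eq[OF wf xr(2)] by blast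
   \<comment> \<open>The curve: \<open>g\<close> and \<open>x\<close> move along lines from the
     first point to the second, \<open>h\<close> is the inverse of \<open>g\<close> by the adjugate
     formula, and \<open>D\<close> is the product of the determinants, nonzero exactly where
     \<open>g c\<close> is invertible at every vertex.\<close>
   define g where "g c v i j = g1 v i j + c * (g2 v i j - g1 v i j)" for c v i j
   define G where "G c v = tm (d v) (d v) (g c v)" for c v
   define h where "h c v i j = inverse (det (G c v)) * fm (adj_mat (G c v)) i j" for c v i j
   define x where "x c = line_rep Q d x1 x2 c" for c
   define y where "y c = act Q d (g c) (h c) (x c)" for c
   define D where "D c = (\<Prod>v\<in>verts Q. det (G c v))" for c
   have gm: "g c v : mats {..<d v} {..<d v}" if "v : verts Q" for c v
   proof (rule matsI)
    fix i j assume ij: "i \<notin> {..<d v} \<or> j \<notin> {..<d v}"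
    have "g1 v : mats {..<d v} {..<d v}" "g2 v : mats {..<d v} {..<d v}"
     using g1(1) g2(1) that by (auto simp: inverse_pair_def)
    then show "g c v i j = 0" using ij by (simp only: g_def matsD) simp
   qed
   have xL: "x c : L" for c unfolding x_def by (rule line[OF p(3,4)])
   then have xcr: "x c : rep_space Q d" for c using L by blast
   have G_entry: "(%c. G c v $$ (i, j)) : polyn" if "i < d v" "j < d v" for v i j
    using that polyn_line by (simp add: G_def tm_def g_def)
   have Gc: "G c v : carrier_mat (d v) (d v)" for c v by (simp add: G_def)
   have Dp: "D : polyn" unfolding D_def by (intro polyn_prod polyn_det[OF Gc G_entry])
   have inv: "inverse_pair Q d (g c) (h c)" if "D c ~= 0" for c
    unfolding inverse_pair_def
   proof (intro ballI)
    fix v assume v: "v : verts Q"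
    have det: "det (G c v) ~= 0" using that v by (auto simp: D_def)
    have ac: "adj_mat (G c v) : carrier_mat (d v) (d v)" using adj_mat(1)[OF Gc] .
    have Gg: "fm (G c v) = g c v" unfolding G_def by (rule fm_tm[OF gm[OF v]])
    have h: "h c v = fm (inverse (det (G c v)) \<cdot>\<^sub>m adj_mat (G c v))"
     using ac by (auto simp: h_def fm_def fun_eq_iff)
    have hc: "inverse (det (G c v)) \<cdot>\<^sub>m adj_mat (G c v) : carrier_mat (d v) (d v)" using ac by simp
    have "G c v * (inverse (det (G c v)) \<cdot>\<^sub>m adj_mat (G c v)) = inverse (det (G c v)) \<cdot>\<^sub>m (G c v * adj_mat (G c v))"
     by (rule mult_smult_distrib[OF Gc ac])
    also have "... = 1\<^sub>m (d v)" using det by (intro eq_matI) (auto simp: adj_mat(2)[OF Gc])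
    finally have 1: "fm (G c v) *{d v} h c v = idm {..<d v}"
     unfolding h fm_mult[OF Gc hc, symmetric] by (simp add: fm_one)
    have "(inverse (det (G c v)) \<cdot>\<^sub>m adj_mat (G c v)) * G c v = inverse (det (G c v)) \<cdot>\<^sub>m (adj_mat (G c v) * G c v)"
     by (rule mult_smult_assoc_mat[OF ac Gc])
    also have "... = 1\<^sub>m (d v)" using det by (intro eq_matI) (auto simp: adj_mat(3)[OF Gc])
    finally have 2: "h c v *{d v} fm (G c v) = idm {..<d v}"
     unfolding h fm_mult[OF hc Gc, symmetric] by (simp add: fm_one)
    show "g c v : mats {..<d v} {..<d v} & h c v : mats {..<d v} {..<d v} &
      g c v *{d v} h c v = idm {..<d v} & h c v *{d v} g c v = idm {..<d v}"
     using gm[OF v] 1 2 fm_mats[OF hc] unfolding Gg h[symmetric] by blast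
   qed
   have y_in: "y c : (\<Union>x\<in>L. GL_orbit Q d x)" if "D c ~= 0" for c
    using xL inv[OF that] GL_orbit_eq[OF wf xcr] unfolding y_def by blast
   have h_rat: "rational D (%c. h c v i j)" if v: "v : verts Q" and ij: "i < d v" "j < d v" for v i j
   proof -
    have D': "D c = det (G c v) * (\<Prod>u\<in>verts Q - {v}. det (G c u))" for c
     unfolding D_def by (rule prod.remove[OF finite_verts v])
    have "h c v i j * D c ^ 1 = adj_mat (G c v) $$ (i, j) * (\<Prod>u\<in>verts Q - {v}. det (G c u))" if "D c ~= 0" for c
     using that fm_index[OF adj_mat(1)[OF Gc] ij] by (simp add: h_def D')
    moreover have "(%c. adj_mat (G c v) $$ (i, j) * (\<Prod>u\<in>verts Q - {v}. det (G c u))) : polyn"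
     by (intro polyn_mult polyn_prod polyn_det[OF Gc G_entry] polyn_adj_mat[OF Gc G_entry] ij)
    ultimately show ?thesis unfolding rational_def
     by (intro exI[of _ 1] bexI[of _ "%c. adj_mat (G c v) $$ (i, j) * (\<Prod>u\<in>verts Q - {v}. det (G c u))"]) simp_all
   qed
   have rat: "rational D (%c. f (y c))" if "f : rep_polys Q d" for f
    using that
   proof (induction rule: rep_polys.induct)
    case (const a)
    show ?case by (rule rational_polyn[OF polyn_const])
   next
    case (coord ar i j)
    have W: "head Q ar : verts Q" "tail Q ar : verts Q" using coord by auto
    have "y c ar $$ (i, j) = (\<Sum>k<d (head Q ar). g c (head Q ar) i k * (\<Sum>l<d (tail Q ar).
      (fm (x1 ar) k l + c * (fm (x2 ar) k l - fm (x1 ar) k l)) * h c (tail Q ar) l j))" for c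
     using coord by (simp add: y_def act_def tm_def mmul_def x_def line_rep_def fm_def)
    then show ?case unfolding g_def
     by (simp only:) (intro rational_sum[OF Dp] rational_mult rational_polyn[OF polyn_line] h_rat[OF W(2) _ coord(3)], simp_all)
   next
    case (plus f g)
    then show ?case by (intro rational_add[OF Dp])
   next
    case (times f g)
    then show ?case by (intro rational_mult)
   qed
   \<comment> \<open>At the parameters 0 and 1 the inverse comes from the adjugate, while the given
     points come with \<open>h1\<close> and \<open>h2\<close>; these agree because inverses are
     unique.\<close>
   have unique: "act Q d g h z = act Q d g h' z" if "inverse_pair Q d g h" "inverse_pair Q d g h'" for g h h' z
   proof -
    have "h v = h' v" if v: "v : verts Q" for v
    proof -
     let ?D = "{..<d v}"
     have *: "h v : mats ?D ?D" "h' v : mats ?D ?D" "g v *[?D] h' v = idm ?D" "h v *[?D] g v = idm ?D"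
      using that \<open>inverse_pair Q d g h\<close> \<open>inverse_pair Q d g h'\<close> v by (auto simp: inverse_pair_def)
     have "h v = h v *[?D] (g v *[?D] h' v)" unfolding * by (rule mmul_idm[symmetric]) (use * in auto)
     also have "... = h' v" unfolding mmul_assoc[symmetric] *(4) by (rule idm_mmul) (use * in auto)
     finally show ?thesis .
    qed
    then show ?thesis unfolding act_def by (auto intro!: restrict_ext)
   qed
   have det_nz: "det (tm (d v) (d v) (g' v)) ~= 0" if v: "v : verts Q" and gh': "inverse_pair Q d g' h'" for v g' h'
   proof -
    have "tm (d v) (d v) (g' v) * tm (d v) (d v) (h' v) = 1\<^sub>m (d v)"
     using gh' v by (simp add: inverse_pair_def tm_mult tm_idm)
    then have "det (tm (d v) (d v) (g' v)) * det (tm (d v) (d v) (h' v)) = 1"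
     by (metis det_mult det_one tm_carrier)
    then show ?thesis by auto
   qed
   have g0: "g 0 = g1" and ge1: "g 1 = g2" by (auto simp: g_def fun_eq_iff)
   have D0: "D 0 ~= 0" using det_nz[OF _ g1(1)] by (simp add: D_def G_def g0)
   have D1: "D 1 ~= 0" using det_nz[OF _ g2(1)] by (simp add: D_def G_def ge1)
   have x0: "x 0 = x1"
    unfolding x_def
    by (rule rep_space_eqI[OF xcr[unfolded x_def] xr(1)]) (simp add: line_rep_def tm_fm[OF rep_spaceD[OF xr(1)]])
   have x1: "x 1 = x2"
    unfolding x_def
    by (rule rep_space_eqI[OF xcr[unfolded x_def] xr(2)]) (simp add: line_rep_def tm_fm[OF rep_spaceD[OF xr(2)]])
   have y0: "y 0 = p1" unfolding y_def g1(2) x0 using unique[OF inv[OF D0, unfolded g0] g1(1)] by (simp add: g0)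
   have y1: "y 1 = p2" unfolding y_def g2(2) x1 using unique[OF inv[OF D1, unfolded ge1] g2(1)] by (simp add: ge1)
   obtain N P where P: "P : polyn" "!!c. D c ~= 0 ==> f1 (y c) * D c ^ N = P c"
    using rat[OF f1(1)] unfolding rational_def by blast
   obtain M R where R: "R : polyn" "!!c. D c ~= 0 ==> f2 (y c) * D c ^ M = R c"
    using rat[OF f2(1)] unfolding rational_def by blast
   note NP = P(1) R(1) P(2) R(2)
   obtain Pp Rp Dq where pp: "!!c. P c = poly Pp c" "!!c. R c = poly Rp c" "!!c. D c = poly Dq c"
    using NP(1,2) Dp unfolding polyn_def by blast
   have "poly Pp 0 ~= 0" using NP(3)[OF D0] f1(2) D0 y0 pp(1) by auto
   moreover have "poly Rp 1 ~= 0" using NP(4)[OF D1] f2(2) D1 y1 pp(2) by auto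
   moreover have "poly Dq 0 ~= 0" using D0 pp(3) by simp
   \<comment> \<open>A common non-root is a parameter where the curve point lies in the union of
     orbits but neither in \<open>A\<close> nor in \<open>B\<close>.\<close>
   ultimately have "Pp * Rp * Dq ~= 0" by auto
   from nonroot[OF inf this] obtain c where c: "poly Pp c ~= 0" "poly Rp c ~= 0" "poly Dq c ~= 0" by auto
   then have Dc: "D c ~= 0" using pp by simp
   have "f1 (y c) ~= 0" "f2 (y c) ~= 0" using NP(3,4)[OF Dc] c pp by auto
   then have "y c \<notin> A" "y c \<notin> B" using f1(3) f2(3) by auto
   with y_in[OF Dc] 2 show False by blast
  qed
 }
qed

section \<open>Representations with vanishing products of arrows\<close>

definition square_zero_reps :: "('v, 'a) pre_digraph => ('v => nat) => ('a => 'k::field mat) set" where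
 "square_zero_reps Q d = {x : rep_space Q d. ALL ar:arcs Q. ALL br:arcs Q. head Q ar = tail Q br -->
   fm (x br) *{d (tail Q br)} fm (x ar) = 0}"

definition rhom :: "('v, 'a) pre_digraph => ('v => nat) => ('a => 'k::field mat) => ('v => nat) => ('a => 'k mat)
  => ('v => nat => nat => 'k) => bool" where
 "rhom Q d x d' x' g \<longleftrightarrow> (ALL v:verts Q. g v : mats {..<d' v} {..<d v}) &
   (ALL ar:arcs Q. g (head Q ar) *{d (head Q ar)} fm (x ar) = fm (x' ar) *{d' (tail Q ar)} g (tail Q ar))"

definition rindec :: "('v, 'a) pre_digraph => ('v => nat) => ('a => 'k::field mat) => bool" where
 "rindec Q d x \<longleftrightarrow> (EX v:verts Q. d v ~= 0) &
   (ALL p. rhom Q d x d x p & (ALL v:verts Q. p v *{d v} p v = p v) -->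
    (ALL v:verts Q. p v = 0) \<or> (ALL v:verts Q. p v = idm {..<d v}))"

text \<open>Points of \<open>block_reps Q d s\<close> have image and cokernel concentrated in fixed coordinate
  subspaces; they are representations of the separated quiver.\<close>

definition block_reps :: "('v, 'a) pre_digraph => ('v => nat) => ('v => nat) => ('a => 'k::field mat) set" where
 "block_reps Q d s = {x : rep_space Q d. ALL ar:arcs Q. fm (x ar) : mats {..<s (head Q ar)} {s (tail Q ar)..<d (tail Q ar)}}"

abbreviation top_index :: "('v => nat) => ('v => nat) => 'v => nat set" where
 "top_index d s \<equiv> (%v. {s v..<d v})"

abbreviation soc_index :: "('v => nat) => 'v => nat set" where
 "soc_index s \<equiv> (%v. {..<s v})"

lemma bquiver_digraph: "fin_digraph Q ==> bquiver (verts Q) (arcs Q) (tail Q) (head Q)"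
 by (auto simp: bquiver_def fin_digraph_def fin_digraph_axioms_def wf_digraph_def)

text \<open>An intermediate coordinate would have to lie below \<open>s\<close> to be reached by the
  first arrow, and at or above \<open>s\<close> to be seen by the second.\<close>

lemma block_reps_subset:
 fixes Q :: "('v, 'a) pre_digraph"
 assumes "!!v. v : verts Q ==> s v \<le> d v"
 shows "block_reps Q d s \<subseteq> square_zero_reps Q d"
proof
 fix x :: "'a => 'k::field mat" assume x: "x : block_reps Q d s"
 have "fm (x br) *{d (tail Q br)} fm (x ar) = 0"
  if "ar : arcs Q" "br : arcs Q" "head Q ar = tail Q br" for ar br
 proof (intro ext)
  fix i j
  have "fm (x br) : mats {..<s (head Q br)} {s (tail Q br)..<d (tail Q br)}"
   "fm (x ar) : mats {..<s (tail Q br)} {s (tail Q ar)..<d (tail Q ar)}"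
   using x that by (auto simp: block_reps_def)
  then have "fm (x br) i k = 0 \<or> fm (x ar) k j = 0" for k
   using matsD[of "fm (x br)" _ _ i k] matsD[of "fm (x ar)" _ _ k j] by (cases "k < s (tail Q br)") auto
  then show "(fm (x br) *{d (tail Q br)} fm (x ar)) i j = 0 i j"
   unfolding mmul_def by (auto intro!: sum.neutral)
 qed
 with x show "x : square_zero_reps Q d" by (auto simp: block_reps_def square_zero_reps_def)
qed

lemma block_reps_brep:
 assumes "x : block_reps Q d s"
 shows "brep (verts Q) (arcs Q) (tail Q) (head Q) (top_index d s) (soc_index s) (%ar. fm (x ar))"
 using assms by (auto simp: block_reps_def brep_def)

lemma block_reps_line: "x : block_reps Q d s ==> y : block_reps Q d s ==> wf_digraph Q ==>
 (!!v. v : verts Q ==> s v \<le> d v) ==> line_rep Q d x y c : block_reps Q d s"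
 unfolding block_reps_def mem_Collect_eq
proof (intro conjI ballI)
 show "line_rep Q d x y c : rep_space Q d" by (auto simp: line_rep_def rep_space_def)
 fix ar assume *: "x : rep_space Q d & (ALL ar:arcs Q. fm (x ar) : mats {..<s (head Q ar)} {s (tail Q ar)..<d (tail Q ar)})"
  "y : rep_space Q d & (ALL ar:arcs Q. fm (y ar) : mats {..<s (head Q ar)} {s (tail Q ar)..<d (tail Q ar)})"
  "wf_digraph Q" "!!v. v : verts Q ==> s v \<le> d v" and ar: "ar : arcs Q"
 let ?F = "%i j. fm (x ar) i j + c * (fm (y ar) i j - fm (x ar) i j)"
 have "fm (x ar) : mats {..<s (head Q ar)} {s (tail Q ar)..<d (tail Q ar)}"
  "fm (y ar) : mats {..<s (head Q ar)} {s (tail Q ar)..<d (tail Q ar)}"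
  using * ar by auto
 then have F: "?F : mats {..<s (head Q ar)} {s (tail Q ar)..<d (tail Q ar)}"
  by (intro matsI) (simp only: matsD, simp)
 moreover have "s (head Q ar) \<le> d (head Q ar)" using * ar by (auto simp: wf_digraph_def)
 ultimately have "?F : mats {..<d (head Q ar)} {..<d (tail Q ar)}" by (elim mats_mono) auto
 then show "fm (line_rep Q d x y c ar) : mats {..<s (head Q ar)} {s (tail Q ar)..<d (tail Q ar)}"
  using F ar by (simp add: line_rep_def fm_tm)
qed

lemma GL_orbit_square_zero:
 assumes wf: "wf_digraph Q" and x: "x : square_zero_reps Q d"
 shows "GL_orbit Q d x \<subseteq> square_zero_reps Q d"
proof
 fix y assume "y : GL_orbit Q d x"
 have xr: "x : rep_space Q d" using x by (simp add: square_zero_reps_def)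
 obtain g h where gh: "inverse_pair Q d g h" and y: "y = act Q d g h x"
  using \<open>y : GL_orbit Q d x\<close> unfolding GL_orbit_eq[OF wf xr] by blast
 have "fm (y br) *{d (tail Q br)} fm (y ar) = 0"
  if ar: "ar : arcs Q" and br: "br : arcs Q" and eq: "head Q ar = tail Q br" for ar br
 proof -
  let ?v = "tail Q br" and ?H = "{..<d (head Q br)}" and ?T = "{..<d (tail Q ar)}"
  have v: "?v : verts Q" using wf br by (auto simp: wf_digraph_def)
  have "fm (y br) *{d ?v} fm (y ar) = g (head Q br) *[?H] (fm (x br) *{d ?v}
    ((h ?v *{d ?v} g ?v) *{d ?v} (fm (x ar) *[?T] h (tail Q ar))))"
   unfolding y fm_act[OF wf gh xr ar] fm_act[OF wf gh xr br] unfolding eq by (simp only: mmul_assoc)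
  also have "h ?v *{d ?v} g ?v = idm {..<d ?v}" using gh v by (simp add: inverse_pair_def)
  also have "idm {..<d ?v} *{d ?v} (fm (x ar) *[?T] h (tail Q ar)) = fm (x ar) *[?T] h (tail Q ar)"
  proof (rule idm_mmul)
   have "h (tail Q ar) : mats ?T ?T" using gh wf ar by (auto simp: inverse_pair_def wf_digraph_def)
   then show "fm (x ar) *[?T] h (tail Q ar) : mats {..<d ?v} ?T"
    using rep_space_fm[OF xr ar] unfolding eq by (rule mats_mmul[rotated])
  qed simp
  also have "fm (x br) *{d ?v} (fm (x ar) *[?T] h (tail Q ar)) = (fm (x br) *{d ?v} fm (x ar)) *[?T] h (tail Q ar)"
   by (simp only: mmul_assoc)
  also have "fm (x br) *{d ?v} fm (x ar) = 0" using x ar br eq by (auto simp: square_zero_reps_def)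
  finally show ?thesis by (simp only: mmul_zero)
 qed
 moreover have "y : rep_space Q d" unfolding y by (rule act_rep_space)
 ultimately show "y : square_zero_reps Q d" by (simp add: square_zero_reps_def)
qed

text \<open>Take \<open>s v\<close> as the dimension of the sum of the images of the arrows into
  \<open>v\<close>, and adapt the basis to this subspace and a complement. Arrows out of
  \<open>v\<close> kill the subspace because products of consecutive arrows vanish, which gives the
  block shape; surjectivity holds because the subspace is exactly the image.\<close>

lemma block_normal_form:
 fixes Q :: "('v, 'a) pre_digraph" and x :: "'a => 'k::field mat"
 assumes fin: "fin_digraph Q" and x: "x : square_zero_reps Q d"
 obtains s y where "!!v. v : verts Q ==> s v \<le> d v" "!!v. v \<notin> verts Q ==> s v = 0"
  "y : block_reps Q d s" "x : GL_orbit Q d y"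
  "bsurj (verts Q) (arcs Q) (head Q) (soc_index s) (%ar. fm (y ar))"
proof -
 interpret fin_digraph Q by fact
 note wf = wf_digraph_axioms and Q = bquiver_digraph[OF fin]
 have xr: "x : rep_space Q d" using x by (simp add: square_zero_reps_def)
 let ?y = "%ar. fm (x ar)"
 let ?N = "in_index (arcs Q) (tail Q) (head Q) (soc_index d)" and ?M = "gather (arcs Q) (head Q) ?y"
 have rep: "brep (verts Q) (arcs Q) (tail Q) (head Q) (soc_index d) (soc_index d) ?y"
  using rep_space_fm[OF xr] by (auto simp: brep_def)
 have finN: "finite (?N v)" for v by (rule finite_in_index[OF Q]) simp
 have "\<exists>n a b a' b' \<rho>. n \<le> d v & a : mats {..<d v} {..<n} & b : mats {..<n} {..<d v} &
   a' : mats {..<d v} {n..<d v} & b' : mats {n..<d v} {..<d v} &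
   b *{d v} a = idm {..<n} & b' *{d v} a' = idm {n..<d v} &
   a *{n} b = ?M v *[?N v] \<rho> & a *{n} b + a' *[{n..<d v}] b' = idm {..<d v} &
   \<rho> : mats (?N v) {..<d v} & (a *{n} b) *{d v} ?M v = ?M v" for v
 proof -
  let ?D = "{..<d v}"
  have M: "?M v : mats ?D (?N v)" by (rule gather_mats[OF rep])
  obtain \<rho> where \<rho>: "\<rho> : mats (?N v) ?D" "?M v *[?N v] (\<rho> *[?D] ?M v) = ?M v"
   using generalized_inverse[OF finN finite_lessThan M] by blast
  \<comment> \<open>A projection onto the image of \<open>?M v\<close>. Splitting \<open>P\<close>
    and \<open>idm ?D - P\<close> gives bases of the image and of a complement.\<close>
  define P where "P = ?M v *[?N v] \<rho>"
  have PM: "P *[?D] ?M v = ?M v" unfolding P_def by (simp add: mmul_assoc \<rho>(2))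
  have P: "P : mats ?D ?D" "P *[?D] P = P"
   using M \<rho>(1) PM unfolding P_def by (auto simp flip: mmul_assoc)
  have P': "idm ?D - P : mats ?D ?D" "(idm ?D - P) *[?D] (idm ?D - P) = idm ?D - P"
   using P by (auto simp: mmul_simps idm_mmul mmul_idm idm_mmul_idm)
  obtain S a b where 1: "S \<subseteq> ?D" "a : mats ?D S" "b : mats S ?D" "a *[S] b = P" "b *[?D] a = idm S"
   by (rule idempotent_factors[OF finite_lessThan P])
  obtain S' a' b' where 2: "S' \<subseteq> ?D" "a' : mats ?D S'" "b' : mats S' ?D" "a' *[S'] b' = idm ?D - P" "b' *[?D] a' = idm S'"
   by (rule idempotent_factors[OF finite_lessThan P'])
  have finS: "finite S" "finite S'" using 1(1) 2(1) by (auto intro: finite_subset)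
  have "card S + card S' = d v"
   using complementary_splittings(3)[OF finite_lessThan finS 1(2,3,5) 2(2,3,5)] 1(4) 2(4) by simp
  then have c: "card S \<le> d v" "card {..<card S} = card S" "card {card S..<d v} = card S'" by auto
  obtain a1 b1 where 3: "a1 : mats ?D {..<card S}" "b1 : mats {..<card S} ?D"
   "a1 *{card S} b1 = a *[S] b" "b1 *[?D] a1 = idm {..<card S}"
   by (rule reindex_splitting[OF finS(1) finite_lessThan c(2) 1(2,3,5)])
  obtain a2 b2 where 4: "a2 : mats ?D {card S..<d v}" "b2 : mats {card S..<d v} ?D"
   "a2 *[{card S..<d v}] b2 = a' *[S'] b'" "b2 *[?D] a2 = idm {card S..<d v}"
   by (rule reindex_splitting[OF finS(2) finite_atLeastLessThan c(3) 2(2,3,5)])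
  show ?thesis
   by (intro exI[of _ "card S"] exI[of _ a1] exI[of _ b1] exI[of _ a2] exI[of _ b2] exI[of _ \<rho>] conjI
    c(1) 3(1,2,4) 4(1,2,4) \<rho>(1)) (simp_all add: 3(3) 4(3) 1(4) 2(4) P_def[symmetric] PM)
 qed
 then obtain s a b a' b' \<rho> where sd: "!!v. s v \<le> d v" and
  a: "!!v. a v : mats {..<d v} {..<s v}" and b: "!!v. b v : mats {..<s v} {..<d v}" and
  a': "!!v. a' v : mats {..<d v} {s v..<d v}" and b': "!!v. b' v : mats {s v..<d v} {..<d v}" and
  ba: "!!v. b v *{d v} a v = idm {..<s v}" and ba': "!!v. b' v *{d v} a' v = idm {s v..<d v}" and
  ab: "!!v. a v *{s v} b v = ?M v *[?N v] \<rho> v" and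
  sum: "!!v. a v *{s v} b v + a' v *[{s v..<d v}] b' v = idm {..<d v}" and
  \<rho>: "!!v. \<rho> v : mats (?N v) {..<d v}" and
  abM: "!!v. (a v *{s v} b v) *{d v} ?M v = ?M v" by metis
 have cross: "b v *{d v} a' v = 0" "b' v *{d v} a v = 0" for v
  using complementary_splittings(1,2)[OF finite_lessThan finite_lessThan finite_atLeastLessThan a b ba a' b' ba' sum] .
 have px: "(a (head Q ar) *{s (head Q ar)} b (head Q ar)) *{d (head Q ar)} ?y ar = ?y ar" if "ar : arcs Q" for ar
  using abM[of "head Q ar"] unfolding mmul_gather by (rule gather_eqD[OF _ that refl])
 have xM: "?y br *{d (tail Q br)} ?M (tail Q br) = 0" if br: "br : arcs Q" for br
 proof -
  have "gather (arcs Q) (head Q) (%ar. ?y br *{d (tail Q br)} ?y ar) (tail Q br)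
    = gather (arcs Q) (head Q) (%ar. 0) (tail Q br)"
   by (rule gather_cong) (use x br in "auto simp: square_zero_reps_def")
  then show ?thesis unfolding mmul_gather by (simp add: gather_def fun_eq_iff)
 qed
 have xp: "?y br *{d (tail Q br)} (a (tail Q br) *{s (tail Q br)} b (tail Q br)) = 0" if "br : arcs Q" for br
  unfolding ab by (simp add: xM[OF that] flip: mmul_assoc)
 \<comment> \<open>The matrix of \<open>x\<close> from the complement coordinates at the tail to the
   image coordinates at the head.\<close>
 define Y where "Y ar = b (head Q ar) *{d (head Q ar)} (?y ar *{d (tail Q ar)} a' (tail Q ar))" for ar
 have Y: "Y ar : mats {..<s (head Q ar)} {s (tail Q ar)..<d (tail Q ar)}" for ar
  unfolding Y_def by (rule mats_mmul[OF b mats_mmul[OF _ a']]) (rule fm_mats[of _ "dim_row (x ar)" "dim_col (x ar)"], simp)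
 have Y': "Y ar : mats {..<d (head Q ar)} {..<d (tail Q ar)}" for ar
  using Y sd[of "head Q ar"] by (rule_tac mats_mono) auto
 define y where "y = (\<lambda>ar\<in>arcs Q. tm (d (head Q ar)) (d (tail Q ar)) (Y ar))"
 have yr: "y : rep_space Q d" by (auto simp: y_def rep_space_def)
 have fy: "fm (y ar) = Y ar" if "ar : arcs Q" for ar using that fm_tm[OF Y'] by (simp add: y_def)
 have Yx: "Y ar *[{s (tail Q ar)..<d (tail Q ar)}] b' (tail Q ar) = b (head Q ar) *{d (head Q ar)} ?y ar" if ar: "ar : arcs Q" for ar
 proof -
  have "?y ar = ?y ar *{d (tail Q ar)} (a (tail Q ar) *{s (tail Q ar)} b (tail Q ar) + a' (tail Q ar) *[{s (tail Q ar)..<d (tail Q ar)}] b' (tail Q ar))"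
   unfolding sum by (rule mmul_idm[OF _ rep_space_fm[OF xr ar], symmetric]) simp
  also have "... = ?y ar *{d (tail Q ar)} (a' (tail Q ar) *[{s (tail Q ar)..<d (tail Q ar)}] b' (tail Q ar))"
   unfolding mmul_add_right xp[OF ar] by simp
  finally show ?thesis unfolding Y_def mmul_assoc by simp
 qed
 define g where "g v = a v + a' v" for v
 define h where "h v = b v + b' v" for v
 have split: "A *{d v} B = A *{s v} B + A *[{s v..<d v}] B" for A B :: "nat => nat => 'k" and v
 proof -
  have eq: "{..<d v} = {..<s v} \<union> {s v..<d v}" using sd[of v] by auto
  show ?thesis unfolding mmul_def fun_eq_iff plus_fun_apply by (subst eq) (auto intro!: sum.union_disjoint)
 qed
 have dj: "{s v..<d v} \<inter> {..<s v} = {}" "{..<s v} \<inter> {s v..<d v} = {}" for v by auto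
 have gm: "g v : mats {..<d v} {..<d v}" for v
  unfolding g_def using sd[of v] by (intro mats_add mats_mono[OF a[of v]] mats_mono[OF a'[of v]]) auto
 have hm: "h v : mats {..<d v} {..<d v}" for v
  unfolding h_def using sd[of v] by (intro mats_add mats_mono[OF b[of v]] mats_mono[OF b'[of v]]) auto
 have gS: "g v *{s v} A = a v *{s v} A" "g v *[{s v..<d v}] A = a' v *[{s v..<d v}] A" for v and A :: "nat => nat => 'k"
  unfolding g_def mmul_add_left by (simp_all add: mmul_disjoint(1)[OF a' dj(1)] mmul_disjoint(1)[OF a dj(2)])
 have hS: "A *{s v} h v = A *{s v} b v" "A *[{s v..<d v}] h v = A *[{s v..<d v}] b' v" for v and A :: "nat => nat => 'k"
  unfolding h_def mmul_add_right by (simp_all add: mmul_disjoint(2)[OF b' dj(1)] mmul_disjoint(2)[OF b dj(2)])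
 have "g v *{d v} h v = idm {..<d v}" for v
  unfolding split gS hS by (rule sum)
 moreover have "h v *{d v} g v = idm {..<d v}" for v
 proof -
  have "h v *{d v} g v = idm {..<s v} + idm {s v..<d v}"
   unfolding g_def h_def by (simp add: mmul_add_left mmul_add_right ba ba' cross)
  also have "... = idm {..<d v}" using sd[of v] by (auto simp: idm_def fun_eq_iff)
  finally show ?thesis .
 qed
 ultimately have gh: "inverse_pair Q d g h" using gm hm by (simp add: inverse_pair_def)
 have "x = act Q d g h y"
 proof (rule rep_space_eqI[OF xr act_rep_space])
  fix ar assume ar: "ar : arcs Q"
  let ?h = "head Q ar" and ?t = "tail Q ar"
  have "fm (act Q d g h y ar) = g ?h *{d ?h} (Y ar *{d ?t} h ?t)"
   unfolding fm_act[OF wf gh yr ar] fy[OF ar] ..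
  also have "Y ar *{d ?t} h ?t = Y ar *[{s ?t..<d ?t}] b' ?t"
   unfolding split[of _ ?t] hS by (simp add: mmul_disjoint(1)[OF Y dj(1)])
  also have "... = b ?h *{d ?h} ?y ar" by (rule Yx[OF ar])
  also have "g ?h *{d ?h} (b ?h *{d ?h} ?y ar) = a ?h *{s ?h} (b ?h *{d ?h} ?y ar)"
   unfolding split[of _ ?h] gS
   using mmul_disjoint(2)[OF mats_mmul[OF b rep_space_fm[OF xr ar]] dj(2)] by (simp flip: split)
  also have "... = ?y ar" using px[OF ar] by (simp only: mmul_assoc)
  finally show "fm (x ar) = fm (act Q d g h y ar)" ..
 qed
 then have orb: "x : GL_orbit Q d y" unfolding GL_orbit_eq[OF wf yr] using gh by blast
 \<comment> \<open>The value 0 outside the vertices leaves only finitely many possible socle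
   dimensions.\<close>
 define s' where "s' v = (if v : verts Q then s v else 0)" for v
 have s': "s' v = s v" if "v : verts Q" for v using that by (simp add: s'_def)
 have "y : block_reps Q d s'" using Y yr fy s' by (auto simp: block_reps_def)
 moreover have "bsurj (verts Q) (arcs Q) (head Q) (soc_index s') (%ar. fm (y ar))"
  unfolding bsurj_def
 proof (intro ballI allI impI, elim conjE)
  fix v and r :: "nat => 'k" and i0
  assume v: "v : verts Q" and r: "ALL i. i \<notin> {..<s' v} --> r i = 0"
   and ry: "ALL ar:arcs Q. head Q ar = v --> (ALL j. (SUM i:{..<s' v}. r i * fm (y ar) i j) = 0)"
  \<comment> \<open>The row vector as a matrix with one row. From \<open>R Y = 0\<close> follows
    \<open>R b M = 0\<close>, hence \<open>R b (a b) = 0\<close>, and \<open>b a = 1\<close> gives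
    \<open>R = 0\<close>.\<close>
  define R where "R = (%(_::unit). r)"
  have R: "R : mats UNIV {..<s v}" using r s'[OF v] by (auto simp: R_def mats_def)
  have RY: "R *{s v} Y ar = 0" if "ar : arcs Q" "head Q ar = v" for ar
   using ry that fy s'[OF v] by (auto simp: R_def mmul_def fun_eq_iff)
  have "(R *{s v} b v) *{d v} ?y ar = 0" if "ar : arcs Q" "head Q ar = v" for ar
  proof -
   have "(R *{s v} b v) *{d v} ?y ar = (R *{s v} Y ar) *[{s (tail Q ar)..<d (tail Q ar)}] b' (tail Q ar)"
    using Yx[OF that(1)] unfolding that(2) mmul_assoc by simp
   then show ?thesis by (simp add: RY[OF that])
  qed
  then have "gather (arcs Q) (head Q) (%ar. (R *{s v} b v) *{d v} ?y ar) v = gather (arcs Q) (head Q) (%_. 0) v"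
   by (intro gather_cong) auto
  also have "... = 0" by (simp add: gather_def fun_eq_iff)
  finally have "(R *{s v} b v) *{d v} ?M v = 0" unfolding mmul_gather .
  then have "((R *{s v} b v) *{d v} ?M v) *[?N v] \<rho> v = 0" by simp
  then have "R *{s v} (b v *{d v} (a v *{s v} b v)) = 0" unfolding ab by (simp add: mmul_assoc)
  moreover have "b v *{d v} (a v *{s v} b v) = b v"
   unfolding mmul_assoc[symmetric] ba by (rule idm_mmul[OF _ b]) simp
  ultimately have "(R *{s v} b v) *{d v} a v = 0" by simp
  then have "R *{s v} idm {..<s v} = 0" unfolding mmul_assoc ba .
  then have "R = 0" using mmul_idm[OF finite_lessThan R] by simp
  then show "r i0 = 0" by (simp add: R_def fun_eq_iff)
 qed
 ultimately show thesis using orb sd by (intro that[of s' y]) (auto simp: s'_def)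
qed

lemma mmul_range:
 assumes "s \<le> (d::nat)"
 shows "A : mats R {..<s} ==> A *{d} B = A *{s} B"
  "B : mats {..<s} C ==> A *{d} B = A *{s} B"
  "A : mats R {s..<d} ==> A *{d} B = A *[{s..<d}] B"
  "B : mats {s..<d} C ==> A *{d} B = A *[{s..<d}] B"
 using assms by (auto intro!: mmul_eq_superset)

lemma idm_split: "s \<le> (d::nat) ==> idm {..<s} + idm {s..<d} = idm {..<d}"
 by (auto simp: idm_def fun_eq_iff)

text \<open>An endomorphism is block triangular because the representation is surjective at the sinks;
  its diagonal blocks form an endomorphism of the representation of the separated quiver.\<close>

lemma bindec_rindec:
 fixes Q :: "('v, 'a) pre_digraph" and y :: "'a => 'k::field mat"
 assumes fin: "fin_digraph Q" and sd: "!!v. v : verts Q ==> s v \<le> d v" and y: "y : block_reps Q d s"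
  and surj: "bsurj (verts Q) (arcs Q) (head Q) (soc_index s) (%ar. fm (y ar))"
  and ind: "bindec (verts Q) (arcs Q) (tail Q) (head Q) (top_index d s) (soc_index s) (%ar. fm (y ar))"
 shows "rindec Q d y"
 unfolding rindec_def
proof (intro conjI allI impI)
 interpret fin_digraph Q by fact
 show "EX v:verts Q. d v ~= 0" using ind sd by (force simp: bindec_def)
 fix p assume "rhom Q d y d y p & (ALL v:verts Q. p v *{d v} p v = p v)"
 then have p: "!!v. v : verts Q ==> p v : mats {..<d v} {..<d v}"
  and py: "!!ar. ar : arcs Q ==> p (head Q ar) *{d (head Q ar)} fm (y ar) = fm (y ar) *{d (tail Q ar)} p (tail Q ar)"
  and pp: "!!v. v : verts Q ==> p v *{d v} p v = p v" by (auto simp: rhom_def)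
 define e :: "'v => nat => nat => 'k" where "e v = idm {..<s v}" for v
 define f :: "'v => nat => nat => 'k" where "f v = idm {s v..<d v}" for v
 have e: "e v : mats {..<s v} {..<s v}" and f: "f v : mats {s v..<d v} {s v..<d v}" for v by (auto simp: e_def f_def)
 have ee: "e v *{d v} e v = e v" "f v *{d v} f v = f v" "e v *{d v} f v = 0" "f v *{d v} e v = 0"
  and ef: "e v + f v = idm {..<d v}" if "v : verts Q" for v
 proof -
  note r = mmul_range[OF sd[OF that]]
  have "e v *{d v} e v = e v *{s v} e v" by (rule r(1)[OF e])
  also have "... = e v" unfolding e_def by (rule idm_mmul_idm) simp
  finally show "e v *{d v} e v = e v" .
  have "f v *{d v} f v = f v *[{s v..<d v}] f v" by (rule r(3)[OF f])
  also have "... = f v" unfolding f_def by (rule idm_mmul_idm) simp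
  finally show "f v *{d v} f v = f v" .
  show "e v *{d v} f v = 0" unfolding r(1)[OF e] by (rule mmul_disjoint(2)[OF f]) auto
  show "f v *{d v} e v = 0" unfolding r(3)[OF f] by (rule mmul_disjoint(2)[OF e]) auto
  show "e v + f v = idm {..<d v}" unfolding e_def f_def by (rule idm_split[OF sd[OF that]])
 qed
 have idp: "idm {..<d v} *{d v} p v = p v" "p v *{d v} idm {..<d v} = p v" if "v : verts Q" for v
  using p[OF that] by (auto intro: idm_mmul mmul_idm)
 have y_mats: "fm (y ar) : mats {..<s (head Q ar)} {s (tail Q ar)..<d (tail Q ar)}" if "ar : arcs Q" for ar
  using y that by (simp add: block_reps_def)
 have ey: "e (head Q ar) *{d (head Q ar)} fm (y ar) = fm (y ar)" "f (head Q ar) *{d (head Q ar)} fm (y ar) = 0"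
  "fm (y ar) *{d (tail Q ar)} f (tail Q ar) = fm (y ar)" if ar: "ar : arcs Q" for ar
 proof -
  note rh = mmul_range[OF sd[OF head_in_verts[OF ar]]] and rt = mmul_range[OF sd[OF tail_in_verts[OF ar]]]
  have "e (head Q ar) *{d (head Q ar)} fm (y ar) = e (head Q ar) *{s (head Q ar)} fm (y ar)"
   by (rule rh(1)[OF e])
  also have "... = fm (y ar)" unfolding e_def by (rule idm_mmul[OF _ y_mats[OF ar]]) simp
  finally show "e (head Q ar) *{d (head Q ar)} fm (y ar) = fm (y ar)" .
  show "f (head Q ar) *{d (head Q ar)} fm (y ar) = 0"
   unfolding rh(3)[OF f] by (rule mmul_disjoint(2)[OF y_mats[OF ar]]) auto
  have "fm (y ar) *{d (tail Q ar)} f (tail Q ar) = fm (y ar) *[{s (tail Q ar)..<d (tail Q ar)}] f (tail Q ar)"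
   by (rule rt(3)[OF y_mats[OF ar]])
  also have "... = fm (y ar)" unfolding f_def by (rule mmul_idm[OF _ y_mats[OF ar]]) simp
  finally show "fm (y ar) *{d (tail Q ar)} f (tail Q ar) = fm (y ar)" .
 qed
 \<comment> \<open>The four blocks of \<open>p\<close> with respect to the socle idempotent
   \<open>e\<close> and the top idempotent \<open>f\<close>; \<open>C\<close> is the one that leads
   from the socle to the top.\<close>
 define A where "A v = e v *{d v} (p v *{d v} e v)" for v
 define B where "B v = e v *{d v} (p v *{d v} f v)" for v
 define C where "C v = f v *{d v} (p v *{d v} e v)" for v
 define D where "D v = f v *{d v} (p v *{d v} f v)" for v
 have Am: "A v : mats {..<s v} {..<s v}" and Bm: "B v : mats {..<s v} {s v..<d v}"
  and Cm: "C v : mats {s v..<d v} {..<s v}" and Dm: "D v : mats {s v..<d v} {s v..<d v}" if "v : verts Q" for v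
  unfolding A_def B_def C_def D_def using mats_mmul[OF e mats_mmul[OF p[OF that] e]] mats_mmul[OF e mats_mmul[OF p[OF that] f]]
   mats_mmul[OF f mats_mmul[OF p[OF that] e]] mats_mmul[OF f mats_mmul[OF p[OF that] f]] by auto
 have pABCD: "p v = A v + B v + C v + D v" if v: "v : verts Q" for v
 proof -
  have "p v = (e v + f v) *{d v} (p v *{d v} (e v + f v))" unfolding ef[OF v] idp[OF v] by simp
  then show ?thesis unfolding A_def B_def C_def D_def by (simp add: mmul_add_left mmul_add_right add_ac)
 qed
 \<comment> \<open>The rows of \<open>C v\<close> annihilate all arrows into \<open>v\<close>:
   \<open>p\<close> maps images of arrows into images of arrows, and \<open>f\<close> kills
   these.\<close>
 have C0: "C v = 0" if v: "v : verts Q" for v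
 proof -
  have Cy: "C v *{s v} fm (y ar) = 0" if ar: "ar : arcs Q" "head Q ar = v" for ar
  proof -
   have "C v *{s v} fm (y ar) = C v *{d v} fm (y ar)" by (rule mmul_range(1)[OF sd[OF v] Cm[OF v], symmetric])
   also have "... = f v *{d v} (p v *{d v} fm (y ar))" unfolding C_def mmul_assoc using ey(1)[OF ar(1)] ar(2) by simp
   also have "... = (f v *{d v} fm (y ar)) *{d (tail Q ar)} p (tail Q ar)" using py[OF ar(1)] ar(2) by (simp add: mmul_assoc)
   also have "f v *{d v} fm (y ar) = 0" using ey(2)[OF ar(1)] ar(2) by simp
   finally show ?thesis by (simp only: mmul_zero)
  qed
  have "C v k i = 0" for k i
  proof -
   have "ALL i. i \<notin> {..<s v} --> C v k i = 0" using matsD[OF Cm[OF v]] by simp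
   moreover have "ALL ar:arcs Q. head Q ar = v --> (ALL j. (SUM i:{..<s v}. C v k i * fm (y ar) i j) = 0)"
    using Cy by (simp add: mmul_def fun_eq_iff)
   ultimately show ?thesis using surj v unfolding bsurj_def by blast
  qed
  then show ?thesis by (simp add: fun_eq_iff)
 qed
 have AA: "A v *{d v} A v = A v" "D v *{d v} D v = D v" if v: "v : verts Q" for v
 proof -
  have "A v *{d v} A v = e v *{d v} (p v *{d v} ((e v *{d v} e v) *{d v} (p v *{d v} e v)))"
   unfolding A_def by (simp only: mmul_assoc)
  also have "e v *{d v} e v = idm {..<d v} - f v *{d v} f v" unfolding ee(1,2)[OF v] ef[OF v, symmetric] by simp
  also have "e v *{d v} (p v *{d v} ((idm {..<d v} - f v *{d v} f v) *{d v} (p v *{d v} e v)))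
   = e v *{d v} ((p v *{d v} (idm {..<d v} *{d v} p v)) *{d v} e v) - B v *{d v} C v"
   unfolding B_def C_def by (simp only: mmul_diff_left mmul_diff_right mmul_assoc)
  also have "... = A v" unfolding idp[OF v] pp[OF v] C0[OF v] A_def by simp
  finally show "A v *{d v} A v = A v" .
  have "D v *{d v} D v = f v *{d v} (p v *{d v} ((f v *{d v} f v) *{d v} (p v *{d v} f v)))"
   unfolding D_def by (simp only: mmul_assoc)
  also have "f v *{d v} f v = idm {..<d v} - e v *{d v} e v" unfolding ee(1,2)[OF v] ef[OF v, symmetric] by simp
  also have "f v *{d v} (p v *{d v} ((idm {..<d v} - e v *{d v} e v) *{d v} (p v *{d v} f v)))
   = f v *{d v} ((p v *{d v} (idm {..<d v} *{d v} p v)) *{d v} f v) - C v *{d v} B v"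
   unfolding B_def C_def by (simp only: mmul_diff_left mmul_diff_right mmul_assoc)
  also have "... = D v" unfolding idp[OF v] pp[OF v] C0[OF v] D_def by simp
  finally show "D v *{d v} D v = D v" .
 qed
 have "bhom (verts Q) (arcs Q) (tail Q) (head Q) (top_index d s) (soc_index s) (%ar. fm (y ar)) (top_index d s) (soc_index s) (%ar. fm (y ar)) D A"
  unfolding bhom_def
 proof (intro conjI ballI)
  fix ar assume ar: "ar : arcs Q"
  let ?h = "head Q ar" and ?t = "tail Q ar" and ?y = "fm (y ar)"
  note vh = head_in_verts[OF ar] and vt = tail_in_verts[OF ar]
  have "A ?h *{s ?h} ?y = A ?h *{d ?h} ?y" by (rule mmul_range(1)[OF sd[OF vh] Am[OF vh], symmetric])
  also have "... = e ?h *{d ?h} (?y *{d ?t} p ?t)" unfolding A_def mmul_assoc ey(1)[OF ar] py[OF ar] ..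
  also have "... = p ?h *{d ?h} ?y" unfolding mmul_assoc[symmetric] ey(1)[OF ar] py[OF ar] ..
  also have "... = p ?h *{d ?h} (?y *{d ?t} f ?t)" unfolding ey(3)[OF ar] ..
  also have "... = ?y *{d ?t} (p ?t *{d ?t} f ?t)" unfolding mmul_assoc[symmetric] py[OF ar] ..
  also have "... = ?y *{d ?t} D ?t" unfolding D_def mmul_assoc[symmetric] ey(3)[OF ar] ..
  also have "... = ?y *[{s ?t..<d ?t}] D ?t" by (rule mmul_range(3)[OF sd[OF vt] y_mats[OF ar]])
  finally show "A ?h *{s ?h} ?y = ?y *[{s ?t..<d ?t}] D ?t" .
 qed (use Am Dm in auto)
 moreover have "ALL v:verts Q. D v *[{s v..<d v}] D v = D v & A v *{s v} A v = A v"
  using AA by (simp add: mmul_range(1)[OF sd Am] mmul_range(3)[OF sd Dm])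
 ultimately have "(ALL v:verts Q. D v = 0 & A v = 0) \<or> (ALL v:verts Q. D v = f v & A v = e v)"
  using ind unfolding bindec_def e_def f_def by blast
 then show "(ALL v:verts Q. p v = 0) \<or> (ALL v:verts Q. p v = idm {..<d v})"
 proof
  \<comment> \<open>Here \<open>p\<close> is the off-diagonal block \<open>B\<close> with
    \<open>B B = 0\<close>, so the idempotent \<open>p\<close> is 0. In the other case
    \<open>p = 1 + B\<close>, and idempotence gives \<open>B = 0\<close>.\<close>
  assume 0: "ALL v:verts Q. D v = 0 & A v = 0"
  have "p v = 0" if v: "v : verts Q" for v
  proof -
   have pB: "p v = B v" using pABCD[OF v] C0[OF v] 0 v by simp
   have "p v = B v *{d v} B v" using pp[OF v] unfolding pB by simp
   also have "... = e v *{d v} (p v *{d v} ((f v *{d v} e v) *{d v} (p v *{d v} f v)))"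
    unfolding B_def by (simp only: mmul_assoc)
   finally show ?thesis unfolding ee(4)[OF v] by simp
  qed
  then show ?thesis by blast
 next
  assume 1: "ALL v:verts Q. D v = f v & A v = e v"
  have "p v = idm {..<d v}" if v: "v : verts Q" for v
  proof -
   have "p v = A v + B v + D v" using pABCD[OF v] C0[OF v] by simp
   also have "... = e v + f v + B v" using 1 v by simp
   finally have pB: "p v = idm {..<d v} + B v" unfolding ef[OF v] .
   have Bm': "B v : mats {..<d v} {..<d v}" using Bm[OF v] sd[OF v] by (elim mats_mono) auto
   have BB: "B v *{d v} B v = 0"
    unfolding mmul_range(3)[OF sd[OF v] Bm[OF v]] by (rule mmul_disjoint(2)[OF Bm[OF v]]) auto
   have "idm {..<d v} + B v = (idm {..<d v} + B v) *{d v} (idm {..<d v} + B v)" using pp[OF v] unfolding pB by simp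
   also have "... = idm {..<d v} + B v + B v"
    by (simp add: mmul_add_left mmul_add_right BB idm_mmul[OF _ Bm'] mmul_idm[OF _ Bm'] idm_mmul_idm add_ac)
   finally have "B v = 0" by simp
   with pB show ?thesis by simp
  qed
  then show ?thesis by blast
 qed
qed

text \<open>The block sum \<open>A + D\<close> of an endomorphism of the separated representation is
  an endomorphism of \<open>y\<close>, since the columns of \<open>y\<close> are supported in the
  top and its rows in the socle.\<close>

lemma rindec_bindec:
 fixes Q :: "('v, 'a) pre_digraph" and y :: "'a => 'k::field mat"
 assumes fin: "fin_digraph Q" and sd: "!!v. v : verts Q ==> s v \<le> d v" and y: "y : block_reps Q d s"
  and ind: "rindec Q d y"
 shows "bindec (verts Q) (arcs Q) (tail Q) (head Q) (top_index d s) (soc_index s) (%ar. fm (y ar))"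
 unfolding bindec_def
proof (intro conjI allI impI)
 interpret fin_digraph Q by fact
 show "EX v:verts Q. {s v..<d v} ~= {} \<or> {..<s v} ~= {}"
 proof -
  obtain v where "v : verts Q" "d v ~= 0" using ind unfolding rindec_def by blast
  then show ?thesis by (intro bexI[of _ v]) (auto simp: lessThan_empty_iff)
 qed
 fix D A
 assume *: "bhom (verts Q) (arcs Q) (tail Q) (head Q) (top_index d s) (soc_index s) (%ar. fm (y ar))
   (top_index d s) (soc_index s) (%ar. fm (y ar)) D A &
  (ALL v:verts Q. D v *[{s v..<d v}] D v = D v & A v *{s v} A v = A v)"
 then have Dm: "!!v. v : verts Q ==> D v : mats {s v..<d v} {s v..<d v}"
  and Am: "!!v. v : verts Q ==> A v : mats {..<s v} {..<s v}"
  and hom: "!!ar. ar : arcs Q ==> A (head Q ar) *{s (head Q ar)} fm (y ar) = fm (y ar) *[{s (tail Q ar)..<d (tail Q ar)}] D (tail Q ar)"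
  by (auto simp: bhom_def)
 define p where "p v = A v + D v" for v
 have y_mats: "fm (y ar) : mats {..<s (head Q ar)} {s (tail Q ar)..<d (tail Q ar)}" if "ar : arcs Q" for ar
  using y that by (simp add: block_reps_def)
 have "rhom Q d y d y p"
  unfolding rhom_def
 proof (intro conjI ballI)
  fix v assume v: "v : verts Q"
  show "p v : mats {..<d v} {..<d v}"
   unfolding p_def using sd[OF v] by (intro mats_add mats_mono[OF Am[OF v]] mats_mono[OF Dm[OF v]]) auto
 next
  fix ar assume ar: "ar : arcs Q"
  let ?h = "head Q ar" and ?t = "tail Q ar" and ?y = "fm (y ar)"
  note vh = head_in_verts[OF ar] and vt = tail_in_verts[OF ar]
  have "D ?h *{s ?h} ?y = 0" "?y *[{s ?t..<d ?t}] A ?t = 0"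
   by (rule mmul_disjoint(1)[OF Dm[OF vh]], force) (rule mmul_disjoint(2)[OF Am[OF vt]], force)
  then show "p ?h *{d ?h} ?y = ?y *{d ?t} p ?t"
   unfolding p_def mmul_range(2)[OF sd[OF vh] y_mats[OF ar]] mmul_range(3)[OF sd[OF vt] y_mats[OF ar]]
    mmul_add_left mmul_add_right using hom[OF ar] by simp
 qed
 moreover have "p v *{d v} p v = p v" if v: "v : verts Q" for v
 proof -
  have "A v *{s v} D v = 0" "D v *[{s v..<d v}] A v = 0"
   by (rule mmul_disjoint(2)[OF Dm[OF v]], force) (rule mmul_disjoint(2)[OF Am[OF v]], force)
  then show ?thesis
   unfolding p_def mmul_add_left mmul_add_right mmul_range(1)[OF sd[OF v] Am[OF v]] mmul_range(3)[OF sd[OF v] Dm[OF v]]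
   using * v by simp
 qed
 ultimately have cases: "(ALL v:verts Q. p v = 0) \<or> (ALL v:verts Q. p v = idm {..<d v})"
  using ind unfolding rindec_def by blast
 have blocks: "A v i j = (if i < s v & j < s v then p v i j else 0)"
  "D v i j = (if i : {s v..<d v} & j : {s v..<d v} then p v i j else 0)" if v: "v : verts Q" for v i j
  using matsD[OF Am[OF v], of i j] matsD[OF Dm[OF v], of i j] by (auto simp: p_def)
 from cases show "(ALL v:verts Q. D v = 0 & A v = 0) \<or> (ALL v:verts Q. D v = idm {s v..<d v} & A v = idm {..<s v})"
 proof
  assume 0: "ALL v:verts Q. p v = 0"
  have "D v = 0 & A v = 0" if v: "v : verts Q" for v using blocks[OF v] 0 v by (simp add: fun_eq_iff)
  then show ?thesis by blast
 next
  assume 1: "ALL v:verts Q. p v = idm {..<d v}"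
  have "D v = idm {s v..<d v} & A v = idm {..<s v}" if v: "v : verts Q" for v
   using blocks[OF v] 1 v sd[OF v] by (auto simp: fun_eq_iff idm_def)
  then show ?thesis by blast
 qed
qed

text \<open>As for endomorphisms, \<open>A + D\<close> puts the two halves of the isomorphism
  together, now to a group element.\<close>

lemma biso_GL_orbit:
 fixes Q :: "('v, 'a) pre_digraph" and y y' :: "'a => 'k::field mat"
 assumes fin: "fin_digraph Q" and sd: "!!v. v : verts Q ==> s v \<le> d v"
  and y: "y : block_reps Q d s" "y' : block_reps Q d s"
  and iso: "biso (verts Q) (arcs Q) (tail Q) (head Q) (top_index d s) (soc_index s) (%ar. fm (y ar))
   (top_index d s) (soc_index s) (%ar. fm (y' ar))"
 shows "y' : GL_orbit Q d y"
proof -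
 interpret fin_digraph Q by fact
 obtain D A D' A' where hom: "bhom (verts Q) (arcs Q) (tail Q) (head Q) (top_index d s) (soc_index s) (%ar. fm (y ar))
   (top_index d s) (soc_index s) (%ar. fm (y' ar)) D A" "bhom (verts Q) (arcs Q) (tail Q) (head Q) (top_index d s) (soc_index s) (%ar. fm (y' ar))
   (top_index d s) (soc_index s) (%ar. fm (y ar)) D' A'"
  and inv: "ALL v:verts Q. D' v *[{s v..<d v}] D v = idm {s v..<d v} & D v *[{s v..<d v}] D' v = idm {s v..<d v} &
       A' v *{s v} A v = idm {..<s v} & A v *{s v} A' v = idm {..<s v}"
  using iso unfolding biso_def by blast
 have m: "D v : mats {s v..<d v} {s v..<d v}" "D' v : mats {s v..<d v} {s v..<d v}"
  "A v : mats {..<s v} {..<s v}" "A' v : mats {..<s v} {..<s v}" if "v : verts Q" for v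
  using hom that by (auto simp: bhom_def)
 define g where "g v = A v + D v" for v
 define h where "h v = A' v + D' v" for v
 have "inverse_pair Q d g h"
  unfolding inverse_pair_def
 proof (intro ballI)
  fix v assume v: "v : verts Q"
  note r = mmul_range[OF sd[OF v]]
  have cross: "A v *{s v} D' v = 0" "A' v *{s v} D v = 0" "D v *[{s v..<d v}] A' v = 0" "D' v *[{s v..<d v}] A v = 0"
   by (rule mmul_disjoint(2)[OF m(2)[OF v]], force, rule mmul_disjoint(2)[OF m(1)[OF v]], force,
    rule mmul_disjoint(2)[OF m(4)[OF v]], force, rule mmul_disjoint(2)[OF m(3)[OF v]], force)
  have "g v : mats {..<d v} {..<d v}" "h v : mats {..<d v} {..<d v}"
   unfolding g_def h_def using sd[OF v]
   by (intro mats_add mats_mono[OF m(1)[OF v]] mats_mono[OF m(3)[OF v]] mats_mono[OF m(2)[OF v]] mats_mono[OF m(4)[OF v]]; auto)+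
  moreover have "g v *{d v} h v = idm {..<d v}" "h v *{d v} g v = idm {..<d v}"
   unfolding g_def h_def mmul_add_left mmul_add_right r(1)[OF m(3)[OF v]] r(1)[OF m(4)[OF v]] r(3)[OF m(1)[OF v]] r(3)[OF m(2)[OF v]]
   using inv v cross idm_split[OF sd[OF v]] by simp_all
  ultimately show "g v : mats {..<d v} {..<d v} & h v : mats {..<d v} {..<d v} &
    g v *{d v} h v = idm {..<d v} & h v *{d v} g v = idm {..<d v}" by blast
 qed
 moreover have "y' = act Q d g h y"
 proof (rule rep_space_eqI[OF _ act_rep_space])
  show "y' : rep_space Q d" using y by (simp add: block_reps_def)
  have yr: "y : rep_space Q d" using y by (simp add: block_reps_def)
  fix ar assume ar: "ar : arcs Q"
  let ?h = "head Q ar" and ?t = "tail Q ar"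
  note vh = head_in_verts[OF ar] and vt = tail_in_verts[OF ar]
  have ym: "fm (y ar) : mats {..<s ?h} {s ?t..<d ?t}" "fm (y' ar) : mats {..<s ?h} {s ?t..<d ?t}"
   using y ar by (auto simp: block_reps_def)
  have Dy: "D ?h *{s ?h} X = 0" for X :: "nat => nat => 'k" by (rule mmul_disjoint(1)[OF m(1)[OF vh]]) force
  have yA: "X *[{s ?t..<d ?t}] A' ?t = 0" for X :: "nat => nat => 'k" by (rule mmul_disjoint(2)[OF m(4)[OF vt]]) force
  have "fm (act Q d g h y ar) = (g ?h *{d ?h} fm (y ar)) *{d ?t} h ?t"
   unfolding fm_act[OF wf_digraph_axioms \<open>inverse_pair Q d g h\<close> yr ar] by (simp only: mmul_assoc)
  also have "g ?h *{d ?h} fm (y ar) = A ?h *{s ?h} fm (y ar)"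
   unfolding mmul_range(2)[OF sd[OF vh] ym(1)] g_def mmul_add_left Dy by simp
  also have "... = fm (y' ar) *[{s ?t..<d ?t}] D ?t" using hom(1) ar by (simp add: bhom_def)
  also have "(fm (y' ar) *[{s ?t..<d ?t}] D ?t) *{d ?t} h ?t = fm (y' ar) *[{s ?t..<d ?t}] (D ?t *[{s ?t..<d ?t}] D' ?t)"
   unfolding mmul_assoc mmul_range(3)[OF sd[OF vt] m(1)[OF vt]] h_def mmul_add_right yA by simp
  also have "... = fm (y' ar)" using inv vt mmul_idm[OF _ ym(2)] by simp
  finally show "fm (y' ar) = fm (act Q d g h y ar)" ..
 qed
 moreover have "y : rep_space Q d" using y by (simp add: block_reps_def)
 ultimately show ?thesis using GL_orbit_eq[OF wf_digraph_axioms] by blast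
qed

section \<open>The components of the representation variety\<close>

definition block_orbits :: "('v, 'a) pre_digraph => ('v => nat) => ('v => nat) => ('a => 'k::field mat) set" where
 "block_orbits Q d s = (\<Union>x\<in>block_reps Q d s. GL_orbit Q d x)"

text \<open>The criterion by which bounds on ranks become polynomial equations, and so pass to
  closures.\<close>

lemma det_factorization_zero:
 fixes A :: "nat => 'l => 'k::field"
 assumes "finite M" "card M < n"
 shows "det (tm n n (A *[M] B)) = 0"
proof -
 obtain c where c: "\<exists>j<n. c j ~= 0" "!!i. i : M ==> (\<Sum>j<n. B i j * c j) = 0"
  using nontrivial_kernel[OF assms(1) finite_lessThan, of n B] assms(2) by auto
 have "tm n n (A *[M] B) *\<^sub>v vec n c = 0\<^sub>v n"
 proof (intro eq_vecI)
  fix i assume "i < dim_vec (0\<^sub>v n)"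
  then have i: "i < n" by simp
  have "(tm n n (A *[M] B) *\<^sub>v vec n c) $ i = (\<Sum>j<n. SUM l:M. A i l * B l j * c j)"
   using i by (simp add: tm_def mmul_def scalar_prod_def atLeast0LessThan sum_distrib_right)
  also have "... = (SUM l:M. A i l * (\<Sum>j<n. B l j * c j))"
   by (subst sum.swap) (simp add: sum_distrib_left mult.assoc)
  also have "... = 0" using c(2) by simp
  finally show "(tm n n (A *[M] B) *\<^sub>v vec n c) $ i = 0\<^sub>v n $ i" using i by simp
 qed (simp add: tm_def)
 moreover have "vec n c ~= 0\<^sub>v n" using c(1) by (metis index_vec index_zero_vec(1))
 ultimately show ?thesis using det_0_iff_vec_prod_zero[OF tm_carrier] by (metis vec_carrier)
qed

context
 fixes Q :: "('v, 'a) pre_digraph" and I :: "(('v, 'a) path => 'k::alg_closed_field) set"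
 assumes fin: "fin_digraph Q" and Rep: "!!d. Rep Q I d = square_zero_reps Q d"
begin

interpretation fin_digraph Q by (rule fin)

lemma block_orbits_subset: "(!!v. v : verts Q ==> s v \<le> d v) ==> block_orbits Q d s \<subseteq> Rep Q I d"
 unfolding block_orbits_def Rep
 using block_reps_subset GL_orbit_square_zero[OF wf_digraph_axioms] by blast

lemma block_reps_subset_orbits: "block_reps Q d s \<subseteq> block_orbits Q d s"
 unfolding block_orbits_def using GL_orbit_refl[OF wf_digraph_axioms] by (auto simp: block_reps_def)

text \<open>Semicontinuity of the rank. On \<open>block_orbits Q d s'\<close> the matrix of all
  arrows into \<open>v\<close> factors through \<open>s' v\<close> dimensions, while at
  \<open>y\<close> it has rank \<open>s v\<close>; one determinant adapted to \<open>y\<close> tells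
  the two apart.\<close>

lemma soc_dim_le_if_in_closure:
 assumes sd: "!!v. v : verts Q ==> s v \<le> d v" "!!v. v : verts Q ==> s' v \<le> d v" and y: "y : block_reps Q d s"
  and surj: "bsurj (verts Q) (arcs Q) (head Q) (soc_index s) (%ar. fm (y ar))"
  and cl: "y : zariski Q I d closure_of block_orbits Q d s'" and v: "v : verts Q"
 shows "s v \<le> s' v"
proof (rule ccontr)
 assume lt: "\<not> ?thesis"
 let ?N = "in_index (arcs Q) (tail Q) (head Q) (top_index d s) v"
 obtain \<rho> where \<rho>: "gather (arcs Q) (head Q) (%ar. fm (y ar)) v *[?N] \<rho> = idm {..<s v}"
  using bsurj_right_inverse[OF bquiver_digraph[OF fin] block_reps_brep[OF y] surj v] by metis
 \<comment> \<open>The upper \<open>s v\<close> rows of the gathered matrix of \<open>x\<close>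
   times a fixed right inverse \<rho> of that of \<open>y\<close>: linear in \<open>x\<close>, and
   the identity at \<open>x = y\<close>.\<close>
 define F where "F x i k = (SUM p:?N. x (fst p) $$ (i, snd p) * \<rho> p k)" for x :: "'a => 'k mat" and i k
 have N: "fst p : arcs Q" "head Q (fst p) = v" "snd p < d (tail Q (fst p))" if "p : ?N" for p
  using that by (auto simp: in_index_def)
 have "(%x. det (tm (s v) (s v) (F x))) : rep_polys Q d"
  unfolding F_def
 proof (intro rep_polys_det rep_polys_sum rep_polys.times rep_polys.const)
  fix i p assume "i < s v" "p : ?N"
  then show "(%x. x (fst p) $$ (i, snd p)) : rep_polys Q d"
   using N[of p] sd(1)[OF v] by (intro rep_polys.coord) auto
 qed
 moreover have "det (tm (s v) (s v) (F x)) = 0" if x_in: "x : block_orbits Q d s'" for x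
 proof -
  obtain z where z: "z : block_reps Q d s'" "x : GL_orbit Q d z" using x_in by (auto simp: block_orbits_def)
  have zr: "z : rep_space Q d" using z by (simp add: block_reps_def)
  obtain g h where gh: "inverse_pair Q d g h" and x: "x = act Q d g h z"
   using z(2) unfolding GL_orbit_eq[OF wf_digraph_axioms zr] by blast
  define H where "H l k = (SUM p:?N. (fm (z (fst p)) *{d (tail Q (fst p))} h (tail Q (fst p))) l (snd p) * \<rho> p k)" for l k
  have "F x i k = (g v *{s' v} H) i k" if i: "i < s v" for i k
  proof -
   have "x (fst p) $$ (i, snd p) = (\<Sum>l<s' v. g v i l * (fm (z (fst p)) *{d (tail Q (fst p))} h (tail Q (fst p))) l (snd p))"
    if p: "p : ?N" for p
   proof -
    let ?ar = "fst p"
    have xr: "x : rep_space Q d" unfolding x by (rule act_rep_space)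
    have zm: "fm (z ?ar) : mats {..<s' v} {s' (tail Q ?ar)..<d (tail Q ?ar)}" using z(1) N[OF p] by (auto simp: block_reps_def)
    have ht: "h (tail Q ?ar) : mats {..<d (tail Q ?ar)} {..<d (tail Q ?ar)}"
     using gh N(1)[OF p] by (auto simp: inverse_pair_def)
    have "x ?ar $$ (i, snd p) = fm (x ?ar) i (snd p)"
     using fm_index[OF rep_spaceD[OF xr N(1)[OF p]]] N[OF p] i sd(1)[OF v] by simp
    also have "fm (x ?ar) = g v *{d v} (fm (z ?ar) *{d (tail Q ?ar)} h (tail Q ?ar))"
     unfolding x fm_act[OF wf_digraph_axioms gh zr N(1)[OF p]] N(2)[OF p] ..
    also have "... = g v *{s' v} (fm (z ?ar) *{d (tail Q ?ar)} h (tail Q ?ar))"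
     by (rule mmul_range(2)[OF sd(2)[OF v] mats_mmul[OF zm ht]])
    finally show ?thesis by (simp add: mmul_def)
   qed
   then have "F x i k = (SUM p:?N. \<Sum>l<s' v. g v i l * ((fm (z (fst p)) *{d (tail Q (fst p))} h (tail Q (fst p))) l (snd p) * \<rho> p k))"
    unfolding F_def by (simp add: sum_distrib_right mult.assoc)
   also have "... = (\<Sum>l<s' v. SUM p:?N. g v i l * ((fm (z (fst p)) *{d (tail Q (fst p))} h (tail Q (fst p))) l (snd p) * \<rho> p k))"
    by (rule sum.swap)
   finally show ?thesis unfolding H_def mmul_def[of "g v"] by (simp add: sum_distrib_left)
  qed
  then have "tm (s v) (s v) (F x) = tm (s v) (s v) (g v *{s' v} H)" by (intro eq_matI) (auto simp: tm_def)
  then show ?thesis using det_factorization_zero[of "{..<s' v}" "s v" "g v" H] lt by simp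
 qed
 moreover have "block_orbits Q d s' \<subseteq> Rep Q I d" by (rule block_orbits_subset) (rule sd(2))
 ultimately have "det (tm (s v) (s v) (F y)) = 0"
  using cl by (auto simp: in_zariski_closure)
 moreover have "F y i k = idm {..<s v} i k" if "i < s v" for i k
 proof -
  have yr: "y : rep_space Q d" using y by (simp add: block_reps_def)
  have "F y i k = (SUM p:?N. gather (arcs Q) (head Q) (%ar. fm (y ar)) v i p * \<rho> p k)"
   unfolding F_def
  proof (rule sum.cong[OF refl])
   fix p assume p: "p : ?N"
   have "y (fst p) $$ (i, snd p) = fm (y (fst p)) i (snd p)"
    using fm_index[OF rep_spaceD[OF yr N(1)[OF p]]] N[OF p] that sd(1)[OF v] by simp
   then show "y (fst p) $$ (i, snd p) * \<rho> p k = gather (arcs Q) (head Q) (%ar. fm (y ar)) v i p * \<rho> p k"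
    using N[OF p] by (simp add: gather_def case_prod_beta')
  qed
  then show ?thesis using \<rho> by (simp add: mmul_def fun_eq_iff)
 qed
 then have "tm (s v) (s v) (F y) = 1\<^sub>m (s v)" by (intro eq_matI) (auto simp: tm_def idm_def)
 ultimately show False by simp
qed

text \<open>The dual bound, for the arrows out of \<open>v\<close>: on
  \<open>block_orbits Q d s'\<close> they factor through the \<open>d v - s' v\<close> top
  dimensions, while at \<open>y\<close> they are jointly injective on \<open>d v - s v\<close>
  dimensions.\<close>

lemma top_dim_le_if_in_closure:
 assumes sd: "!!v. v : verts Q ==> s v \<le> d v" "!!v. v : verts Q ==> s' v \<le> d v" and y: "y : block_reps Q d s"
  and inj: "binj (verts Q) (arcs Q) (tail Q) (top_index d s) (%ar. fm (y ar))"
  and cl: "y : zariski Q I d closure_of block_orbits Q d s'" and v: "v : verts Q"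
 shows "s' v \<le> s v"
proof (rule ccontr)
 assume lt: "\<not> ?thesis"
 let ?N = "in_index (arcs Q) (head Q) (tail Q) (soc_index s) v" and ?t = "d v - s v"
 obtain \<rho> where \<rho>: "gather (arcs Q) (tail Q) (%ar. transp (fm (y ar))) v *[?N] \<rho> = idm {s v..<d v}"
  using bsurj_right_inverse[OF bquiver_op[OF bquiver_digraph[OF fin]] brep_transp[OF block_reps_brep[OF y]] inj v] by metis
 \<comment> \<open>The top coordinates at \<open>v\<close> start at \<open>s v\<close>, hence the
   shifts in the indices of a matrix that itself starts at 0.\<close>
 define F where "F x j k = (SUM p:?N. x (fst p) $$ (snd p, s v + j) * \<rho> p (s v + k))" for x :: "'a => 'k mat" and j k
 have N: "fst p : arcs Q" "tail Q (fst p) = v" "snd p < d (head Q (fst p))" if "p : ?N" for p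
  using that sd(1)[of "head Q (fst p)"] by (auto simp: in_index_def)
 have "(%x. det (tm ?t ?t (F x))) : rep_polys Q d"
  unfolding F_def
 proof (intro rep_polys_det rep_polys_sum rep_polys.times rep_polys.const)
  fix j p assume "j < ?t" "p : ?N"
  then show "(%x. x (fst p) $$ (snd p, s v + j)) : rep_polys Q d"
   using N[of p] by (intro rep_polys.coord) auto
 qed
 moreover have "det (tm ?t ?t (F x)) = 0" if x_in: "x : block_orbits Q d s'" for x
 proof -
  obtain z where z: "z : block_reps Q d s'" "x : GL_orbit Q d z" using x_in by (auto simp: block_orbits_def)
  have zr: "z : rep_space Q d" using z by (simp add: block_reps_def)
  obtain g h where gh: "inverse_pair Q d g h" and x: "x = act Q d g h z"
   using z(2) unfolding GL_orbit_eq[OF wf_digraph_axioms zr] by blast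
  define H where "H l k = (SUM p:?N. (g (head Q (fst p)) *{d (head Q (fst p))} fm (z (fst p))) (snd p) l * \<rho> p (s v + k))" for l k
  define B where "B j l = h v l (s v + j)" for j l
  have "F x j k = (B *[{s' v..<d v}] H) j k" if j: "j < ?t" for j k
  proof -
   have "x (fst p) $$ (snd p, s v + j) = (\<Sum>l=s' v..<d v. B j l * (g (head Q (fst p)) *{d (head Q (fst p))} fm (z (fst p))) (snd p) l)"
    if p: "p : ?N" for p
   proof -
    let ?ar = "fst p"
    have xr: "x : rep_space Q d" unfolding x by (rule act_rep_space)
    have zm: "fm (z ?ar) : mats {..<s' (head Q ?ar)} {s' v..<d v}" using z(1) N[OF p] by (auto simp: block_reps_def)
    have gm: "g (head Q ?ar) : mats {..<d (head Q ?ar)} {..<d (head Q ?ar)}"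
     using gh N(1)[OF p] by (auto simp: inverse_pair_def)
    have "x ?ar $$ (snd p, s v + j) = fm (x ?ar) (snd p) (s v + j)"
     using fm_index[OF rep_spaceD[OF xr N(1)[OF p]]] N[OF p] j by simp
    also have "fm (x ?ar) = (g (head Q ?ar) *{d (head Q ?ar)} fm (z ?ar)) *{d v} h v"
     unfolding x fm_act[OF wf_digraph_axioms gh zr N(1)[OF p]] N(2)[OF p] by (simp only: mmul_assoc)
    also have "... = (g (head Q ?ar) *{d (head Q ?ar)} fm (z ?ar)) *[{s' v..<d v}] h v"
     by (rule mmul_range(3)[OF sd(2)[OF v] mats_mmul[OF gm zm]])
    finally show ?thesis by (simp add: mmul_def[of _ _ "h v"] B_def mult.commute)
   qed
   then have "F x j k = (SUM p:?N. \<Sum>l=s' v..<d v. B j l * ((g (head Q (fst p)) *{d (head Q (fst p))} fm (z (fst p))) (snd p) l * \<rho> p (s v + k)))"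
    unfolding F_def by (simp add: sum_distrib_right mult.assoc)
   also have "... = (\<Sum>l=s' v..<d v. SUM p:?N. B j l * ((g (head Q (fst p)) *{d (head Q (fst p))} fm (z (fst p))) (snd p) l * \<rho> p (s v + k)))"
    by (rule sum.swap)
   finally show ?thesis unfolding H_def mmul_def[of B] by (simp add: sum_distrib_left)
  qed
  then have "tm ?t ?t (F x) = tm ?t ?t (B *[{s' v..<d v}] H)" by (intro eq_matI) (auto simp: tm_def)
  then show ?thesis using det_factorization_zero[of "{s' v..<d v}" ?t B H] lt sd(2)[OF v] by simp
 qed
 moreover have "block_orbits Q d s' \<subseteq> Rep Q I d" by (rule block_orbits_subset) (rule sd(2))
 ultimately have "det (tm ?t ?t (F y)) = 0"
  using cl by (auto simp: in_zariski_closure)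
 moreover have "F y j k = idm {s v..<d v} (s v + j) (s v + k)" if "j < ?t" for j k
 proof -
  have yr: "y : rep_space Q d" using y by (simp add: block_reps_def)
  have "F y j k = (SUM p:?N. gather (arcs Q) (tail Q) (%ar. transp (fm (y ar))) v (s v + j) p * \<rho> p (s v + k))"
   unfolding F_def
  proof (rule sum.cong[OF refl])
   fix p assume p: "p : ?N"
   have "y (fst p) $$ (snd p, s v + j) = fm (y (fst p)) (snd p) (s v + j)"
    using fm_index[OF rep_spaceD[OF yr N(1)[OF p]]] N[OF p] that by simp
   then show "y (fst p) $$ (snd p, s v + j) * \<rho> p (s v + k) = gather (arcs Q) (tail Q) (%ar. transp (fm (y ar))) v (s v + j) p * \<rho> p (s v + k)"
    using N[OF p] by (simp add: gather_def case_prod_beta' transp_def)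
  qed
  then show ?thesis using \<rho> by (simp add: mmul_def fun_eq_iff)
 qed
 then have "tm ?t ?t (F y) = 1\<^sub>m ?t" by (intro eq_matI) (auto simp: tm_def idm_def)
 ultimately show False by simp
qed

lemma block_reps_cong:
 assumes "!!v. v : verts Q ==> s v = s' v"
 shows "block_reps Q d s = (block_reps Q d s' :: ('a => 'k mat) set)"
proof -
 have "s (head Q ar) = s' (head Q ar)" "s (tail Q ar) = s' (tail Q ar)" if "ar : arcs Q" for ar
  using assms that by simp_all
 then show ?thesis unfolding block_reps_def by auto
qed

lemma irreducible_block_orbits:
 assumes sd: "!!v. v : verts Q ==> s v \<le> d v"
 shows "irreducible_in (zariski Q I d) (block_orbits Q d s)"
 unfolding block_orbits_def
proof (rule irreducible_orbits[OF infinite_UNIV_alg_closed fin])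
 show "block_reps Q d s \<subseteq> rep_space Q d" by (auto simp: block_reps_def)
 have "(\<lambda>ar\<in>arcs Q. tm (d (head Q ar)) (d (tail Q ar)) 0) : (block_reps Q d s :: ('a => 'k mat) set)"
  by (auto simp: block_reps_def rep_space_def fm_tm)
 then show "(block_reps Q d s :: ('a => 'k mat) set) ~= {}" by blast
 show "line_rep Q d x y c : block_reps Q d s" if "x : block_reps Q d s" "y : block_reps Q d s" for x y and c :: 'k
  by (rule block_reps_line[OF that wf_digraph_axioms sd])
 show "(\<Union>x\<in>block_reps Q d s. GL_orbit Q d x) \<subseteq> Rep Q I d"
  using block_orbits_subset[of s d] sd unfolding block_orbits_def by blast
qed

lemma in_block_orbits:
 assumes "x : Rep Q I d"
 obtains s where "ALL v:verts Q. s v \<le> d v" "ALL v. v \<notin> verts Q --> s v = 0" "x : block_orbits Q d s"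
proof -
 obtain s y where "!!v. v : verts Q ==> s v \<le> d v" "!!v. v \<notin> verts Q ==> s v = 0"
  "y : block_reps Q d s" "x : GL_orbit Q d y"
  using block_normal_form[OF fin assms[unfolded Rep]] by metis
 then show thesis using that[of s] unfolding block_orbits_def by blast
qed

lemma finite_socle_dims:
 "finite {s :: 'v => nat. (ALL v:verts Q. s v \<le> d v) & (ALL v. v \<notin> verts Q --> s v = 0)}" (is "finite ?S")
proof -
 have "d v \<le> sum d (verts Q)" if "v : verts Q" for v using that by (intro member_le_sum) auto
 then have "?S \<subseteq> {s. ALL v. (v : verts Q --> s v : {..sum d (verts Q)}) & (v \<notin> verts Q --> s v = 0)}"
  by (auto intro: le_trans)
 moreover have "finite ..." by (rule finite_set_of_finite_funs) auto
 ultimately show ?thesis by (rule finite_subset)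
qed

text \<open>By the normal form, the closures of finitely many sets \<open>block_orbits Q d s\<close>
  cover the variety.\<close>

lemma irreducible_in_block_closure:
 assumes "irreducible_in (zariski Q I d) C"
 obtains s where "!!v. v : verts Q ==> s v \<le> d v" "C \<subseteq> zariski Q I d closure_of block_orbits Q d s"
proof -
 let ?S = "{s :: 'v => nat. (ALL v:verts Q. s v \<le> d v) & (ALL v. v \<notin> verts Q --> s v = 0)}"
 let ?cl = "%s. zariski Q I d closure_of block_orbits Q d s"
 have "C \<subseteq> \<Union>(?cl ` ?S)"
 proof
  fix x assume "x : C"
  then have "x : Rep Q I d" using assms by (auto simp: irreducible_in_def topspace_zariski)
  then obtain s where "ALL v:verts Q. s v \<le> d v" "ALL v. v \<notin> verts Q --> s v = 0" "x : block_orbits Q d s"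
   by (rule in_block_orbits)
  then have s: "s : ?S" "x : block_orbits Q d s" by auto
  have "block_orbits Q d s \<subseteq> topspace (zariski Q I d)"
   using block_orbits_subset[of s d] s(1) by (simp add: topspace_zariski)
  then have "block_orbits Q d s \<subseteq> ?cl s" by (rule closure_of_subset)
  with s show "x : \<Union>(?cl ` ?S)" by blast
 qed
 have "EX A:?cl ` ?S. C \<subseteq> A"
  by (rule irreducible_in_finite_Union[OF assms finite_imageI[OF finite_socle_dims] _ \<open>C \<subseteq> \<Union>(?cl ` ?S)\<close>]) auto
 then show thesis using that by blast
qed

text \<open>Any larger irreducible set lies in the closure of some
  \<open>block_orbits Q d s'\<close>. As that closure contains \<open>y\<close>, the two rank
  inequalities force \<open>s' = s\<close> on the vertices.\<close>

lemma block_component: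
 assumes sd: "!!v. v : verts Q ==> s v \<le> d v" and y: "y : block_reps Q d s"
  and surj: "bsurj (verts Q) (arcs Q) (head Q) (soc_index s) (%ar. fm (y ar))"
  and inj: "binj (verts Q) (arcs Q) (tail Q) (top_index d s) (%ar. fm (y ar))"
 shows "zariski Q I d closure_of block_orbits Q d s : irreducible_components (zariski Q I d)"
  and "y : zariski Q I d closure_of block_orbits Q d s"
proof -
 let ?cl = "%s. zariski Q I d closure_of block_orbits Q d s"
 have sub: "block_orbits Q d s \<subseteq> ?cl s"
  by (intro closure_of_subset) (simp add: topspace_zariski block_orbits_subset sd)
 then show ycl: "y : ?cl s" using y block_reps_subset_orbits by blast
 show "?cl s : irreducible_components (zariski Q I d)"
  unfolding irreducible_components_def
 proof (intro CollectI conjI allI impI)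
  show "irreducible_in (zariski Q I d) (?cl s)"
   by (intro irreducible_in_closure irreducible_block_orbits sd)
  fix D assume D: "irreducible_in (zariski Q I d) D & ?cl s \<subseteq> D"
  then obtain s' where s': "!!v. v : verts Q ==> s' v \<le> d v" "D \<subseteq> ?cl s'"
   using irreducible_in_block_closure by metis
  have ycl': "y : ?cl s'" using ycl D s'(2) by blast
  have "s v = s' v" if "v : verts Q" for v
   using soc_dim_le_if_in_closure[OF sd s'(1) y surj ycl' that] top_dim_le_if_in_closure[OF sd s'(1) y inj ycl' that] by simp
  then have "block_orbits Q d s = (block_orbits Q d s' :: ('a => 'k mat) set)"
   unfolding block_orbits_def using block_reps_cong by metis
  with s'(2) D show "D = ?cl s" by auto
 qed
qed

text \<open>The projection to the block of \<open>block_reps Q d s\<close> maps the orbit of a point \<open>x\<close> of that block into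
  the set of all \<open>a x b\<close>, which satisfies a polynomial relation if the Tits form is not positive.\<close>

lemma block_component_no_dense_orbit:
 fixes y :: "'a => 'k mat"
 assumes sd: "!!v. v : verts Q ==> s v \<le> d v" and y: "y : block_reps Q d s"
  and surj: "bsurj (verts Q) (arcs Q) (head Q) (soc_index s) (%ar. fm (y ar))"
  and inj: "binj (verts Q) (arcs Q) (tail Q) (top_index d s) (%ar. fm (y ar))"
  and ne: "EX v:verts Q. d v ~= 0"
  and q: "bform (verts Q) (arcs Q) (tail Q) (head Q) (%v. int (card {s v..<d v})) (%v. int (card {..<s v})) \<le> 0"
 shows "\<not> has_dense_orbit Q I d (zariski Q I d closure_of block_orbits Q d s)"
proof
 let ?cl = "%s. zariski Q I d closure_of block_orbits Q d s"
 assume "has_dense_orbit Q I d (?cl s)"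
 then obtain x where x: "x : ?cl s" "(subtopology (zariski Q I d) (?cl s)) closure_of (GL_orbit Q d x) = ?cl s"
  unfolding has_dense_orbit_def by blast
 then have dense: "?cl s \<subseteq> zariski Q I d closure_of GL_orbit Q d x"
  unfolding closure_of_subtopology by (metis Int_lower2 closure_of_mono inf.coboundedI2)
 have "x : Rep Q I d" using x(1) by (simp add: in_closure_of topspace_zariski)
 from in_block_orbits[OF this] obtain s' where s': "!!v. v : verts Q ==> s' v \<le> d v" "x : block_orbits Q d s'" by metis
 then obtain z where z: "z : block_reps Q d s'" "x : GL_orbit Q d z" unfolding block_orbits_def by blast
 have zr: "z : rep_space Q d" using z(1) by (simp add: block_reps_def)
 have orb: "GL_orbit Q d x = GL_orbit Q d z" by (rule GL_orbit_eq_if_mem[OF wf_digraph_axioms zr z(2)])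
 have ycl: "y : ?cl s" by (rule block_component(2)[OF sd y surj inj])
 have "GL_orbit Q d x \<subseteq> block_orbits Q d s'" unfolding orb block_orbits_def using z(1) by blast
 then have ycl': "y : ?cl s'" using ycl dense closure_of_mono by blast
 \<comment> \<open>The dense orbit has a block type \<open>s'\<close> of its own. Its closure
   contains \<open>y\<close>, so again \<open>s' = s\<close>, and the representative
   \<open>z\<close> lies in the block \<open>s\<close> itself.\<close>
 have ss': "s v = s' v" if "v : verts Q" for v
  using soc_dim_le_if_in_closure[OF sd s'(1) y surj ycl' that] top_dim_le_if_in_closure[OF sd s'(1) y inj ycl' that] by simp
 then have "block_reps Q d s' = (block_reps Q d s :: ('a => 'k mat) set)" using block_reps_cong by metis
 with z(1) have zs: "z : block_reps Q d s" by blast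
 have ne': "EX v:verts Q. {s v..<d v} ~= {} \<or> {..<s v} ~= {}"
 proof -
  obtain v where "v : verts Q" "d v ~= 0" using ne by blast
  then show ?thesis by (intro bexI[of _ v]) (auto simp: lessThan_empty_iff)
 qed
 let ?E = "entries (arcs Q) (tail Q) (head Q) (top_index d s) (soc_index s)"
 obtain f w where f: "f : polyfun ?E" "f w ~= 0" and f0: "!!a b. f (%(ar, i, j). (a (head Q ar) *{s (head Q ar)}
   (fm (z ar) *[{s (tail Q ar)..<d (tail Q ar)}] b (tail Q ar))) i j) = 0"
  using orbit_relation[OF infinite_UNIV_alg_closed bquiver_digraph[OF fin] block_reps_brep[OF zs] ne' q] by blast
 let ?\<pi> = "%x (ar, i, j). x ar $$ (i, j)"
 have E: "ar : arcs Q" "i < s (head Q ar)" "s (head Q ar) \<le> d (head Q ar)" "s (tail Q ar) \<le> j" "j < d (tail Q ar)"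
  if "(ar, i, j) : ?E" for ar i j
  using that sd by (auto simp: entries_def)
 have poly: "(%x. f (?\<pi> x)) : rep_polys Q d"
  using f(1)
 proof (induction rule: polyfun.induct)
  case (coord p)
  obtain ar i j where p: "p = (ar, i, j)" by (cases p)
  show ?case using E[of ar i j] coord unfolding p prod.case by (intro rep_polys.coord) auto
 qed (auto intro: rep_polys.intros)
 have "f (?\<pi> u) = 0" if u: "u : GL_orbit Q d x" for u
 proof -
  obtain g h where gh: "inverse_pair Q d g h" and u: "u = act Q d g h z"
   using u unfolding orb GL_orbit_eq[OF wf_digraph_axioms zr] by blast
  have ur: "u : rep_space Q d" unfolding u by (rule act_rep_space)
  have "f (?\<pi> u) = f (%(ar, i, j). (g (head Q ar) *{s (head Q ar)}
   (fm (z ar) *[{s (tail Q ar)..<d (tail Q ar)}] h (tail Q ar))) i j)"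
  proof (rule polyfun_cong[OF f(1)])
   fix p assume p_in: "p : ?E"
   obtain ar i j where p: "p = (ar, i, j)" by (cases p)
   note e = E[OF p_in[unfolded p]]
   have zm: "fm (z ar) : mats {..<s (head Q ar)} {s (tail Q ar)..<d (tail Q ar)}" using zs e(1) by (simp add: block_reps_def)
   have hm: "h (tail Q ar) : mats {..<d (tail Q ar)} {..<d (tail Q ar)}" using gh e(1) by (auto simp: inverse_pair_def)
   have "u ar $$ (i, j) = fm (u ar) i j" using fm_index[OF rep_spaceD[OF ur e(1)]] e by simp
   also have "fm (u ar) = g (head Q ar) *{d (head Q ar)} (fm (z ar) *{d (tail Q ar)} h (tail Q ar))"
    unfolding u by (rule fm_act[OF wf_digraph_axioms gh zr e(1)])
   also have "... = g (head Q ar) *{s (head Q ar)} (fm (z ar) *{d (tail Q ar)} h (tail Q ar))"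
    by (rule mmul_range(2)[OF e(3) mats_mmul[OF zm hm]])
   also have "fm (z ar) *{d (tail Q ar)} h (tail Q ar) = fm (z ar) *[{s (tail Q ar)..<d (tail Q ar)}] h (tail Q ar)"
    by (rule mmul_range(3)[OF _ zm]) (use sd e(1) in simp)
   finally show "?\<pi> u p = (case p of (ar, i, j) => (g (head Q ar) *{s (head Q ar)}
     (fm (z ar) *[{s (tail Q ar)..<d (tail Q ar)}] h (tail Q ar))) i j)" unfolding p by simp
  qed
  then show ?thesis using f0 by simp
 qed
 moreover have "GL_orbit Q d x \<subseteq> Rep Q I d"
  unfolding orb Rep using z(1) GL_orbit_square_zero[OF wf_digraph_axioms] block_reps_subset[of Q s' d] s'(1) by blast
 ultimately have cl0: "f (?\<pi> u) = 0" if "u : zariski Q I d closure_of GL_orbit Q d x" for u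
  using that poly by (auto simp: in_zariski_closure)
 let ?W = "%ar i j. if (ar, i, j) : ?E then w (ar, i, j) else 0"
 \<comment> \<open>The point of the block with entries \<open>w\<close>: it belongs to the
   component, and \<open>f\<close> does not vanish there although it vanishes on the closure of the
   orbit.\<close>
 define u where "u = (\<lambda>ar\<in>arcs Q. tm (d (head Q ar)) (d (tail Q ar)) (?W ar))"
 have W: "?W ar : mats {..<s (head Q ar)} {s (tail Q ar)..<d (tail Q ar)}" for ar by (auto simp: mats_def entries_def)
 have W': "?W ar : mats {..<d (head Q ar)} {..<d (tail Q ar)}" if "ar : arcs Q" for ar
  by (rule mats_mono[OF W]) (use sd[of "head Q ar"] that in auto)
 have "u : block_reps Q d s" using W fm_tm[OF W'] by (auto simp: block_reps_def u_def rep_space_def)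
 then have "u : ?cl s"
  using block_reps_subset_orbits closure_of_subset[of "block_orbits Q d s" "zariski Q I d"] block_orbits_subset[of s d] sd
  by (auto simp: topspace_zariski)
 then have "f (?\<pi> u) = 0" using dense cl0 by blast
 moreover have "f (?\<pi> u) = f w"
 proof (rule polyfun_cong[OF f(1)])
  fix p assume p_in: "p : ?E"
  obtain ar i j where p: "p = (ar, i, j)" by (cases p)
  show "?\<pi> u p = w p" using E[OF p_in[unfolded p]] p_in unfolding p by (simp add: u_def tm_def)
 qed
 ultimately show False using f(2) by simp
qed

text \<open>An irreducible component lies in the closure of one of finitely many orbits. Orbits are
  irreducible, so maximality makes the component equal to that closure.\<close>

lemma dense_orbit_if_finite_orbits:
 assumes F: "finite F" "F \<subseteq> Rep Q I d" "!!x. x : Rep Q I d ==> EX z:F. x : GL_orbit Q d z"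
  and C: "C : irreducible_components (zariski Q I d)"
 shows "has_dense_orbit Q I d C"
proof -
 let ?cl = "%z. zariski Q I d closure_of GL_orbit Q d z"
 have irr: "irreducible_in (zariski Q I d) C" and
  maxi: "!!D. irreducible_in (zariski Q I d) D ==> C \<subseteq> D ==> D = C"
  using C by (auto simp: irreducible_components_def)
 have rs: "z : rep_space Q d" "GL_orbit Q d z \<subseteq> Rep Q I d" "z : GL_orbit Q d z" if "z : F" for z
 proof -
  show 1: "z : rep_space Q d" using that F(2) by (auto simp: Rep square_zero_reps_def)
  show "GL_orbit Q d z \<subseteq> Rep Q I d" using that F(2) GL_orbit_square_zero[OF wf_digraph_axioms] unfolding Rep by blast
  show "z : GL_orbit Q d z" by (rule GL_orbit_refl[OF wf_digraph_axioms 1])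
 qed
 have sub: "GL_orbit Q d z \<subseteq> ?cl z" if "z : F" for z
  using rs(2)[OF that] by (intro closure_of_subset) (simp add: topspace_zariski)
 have "C \<subseteq> \<Union>(?cl ` F)"
 proof
  fix x assume "x : C"
  then have "x : Rep Q I d" using irr by (auto simp: irreducible_in_def topspace_zariski)
  from F(3)[OF this] obtain z where "z : F" "x : GL_orbit Q d z" by (rule bexE)
  with sub show "x : \<Union>(?cl ` F)" by auto
 qed
 have "EX A:?cl ` F. C \<subseteq> A"
  by (rule irreducible_in_finite_Union[OF irr finite_imageI[OF F(1)] _ \<open>C \<subseteq> \<Union>(?cl ` F)\<close>]) auto
 then obtain z where z: "z : F" "C \<subseteq> ?cl z" by blast
 \<comment> \<open>A single orbit is the case \<open>L = {z}\<close>, as the line from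
   \<open>z\<close> to \<open>z\<close> is constant.\<close>
 have "irreducible_in (zariski Q I d) (\<Union>x\<in>{z}. GL_orbit Q d x)"
 proof (rule irreducible_orbits[OF infinite_UNIV_alg_closed fin])
  show "line_rep Q d x y c : {z}" if "x : {z}" "y : {z}" for x y and c :: 'k
  proof -
   have "line_rep Q d z z c = z"
   proof (rule rep_space_eqI[OF _ rs(1)[OF z(1)]])
    fix ar assume ar: "ar : arcs Q"
    then show "fm (line_rep Q d z z c ar) = fm (z ar)"
     using tm_fm[OF rep_spaceD[OF rs(1)[OF z(1)] ar]] by (simp add: line_rep_def)
   qed (auto simp: line_rep_def rep_space_def)
   with that show ?thesis by simp
  qed
 qed (use rs[OF z(1)] in auto)
 then have "?cl z = C" using z(2) by (intro maxi irreducible_in_closure) auto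
 then have "GL_orbit Q d z \<subseteq> C" "(subtopology (zariski Q I d) C) closure_of (GL_orbit Q d z) = C"
  using sub[OF z(1)] by (auto simp: closure_of_subtopology Int_absorb1)
 moreover have "z : C" using rs(3)[OF z(1)] calculation(1) by blast
 ultimately show ?thesis unfolding has_dense_orbit_def by blast
qed

end

section \<open>Algebras with radical square zero\<close>

lemma path_algebra_simps:
 "f : carrier (path_algebra Q) \<longleftrightarrow> finite {\<pi>. f \<pi> ~= 0} & {\<pi>. f \<pi> ~= 0} \<subseteq> paths Q"
 "f \<otimes>\<^bsub>path_algebra Q\<^esub> g = (%(u, p). \<Sum>k\<le>length p. f (walk_end Q u (take k p), drop k p) * g (u, take k p))"
 "\<one>\<^bsub>path_algebra Q\<^esub> = (%(u, p). if u : verts Q & p = [] then 1 else 0)"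
 "\<zero>\<^bsub>path_algebra Q\<^esub> = (%_. 0)"
 "f \<oplus>\<^bsub>path_algebra Q\<^esub> g = (%\<pi>. f \<pi> + g \<pi>)"
 by (simp_all add: path_algebra_def)

definition single :: "'k::field => ('v, 'a) path => ('v, 'a) path => 'k" where
 "single c \<pi> \<pi>' = (if \<pi>' = \<pi> then c else 0)"

lemma single_carrier: "\<pi> : paths Q ==> single c \<pi> : carrier (path_algebra Q)"
 by (auto simp: path_algebra_simps single_def intro: finite_subset[of _ "{\<pi>}"])

text \<open>Induction over the finite support. The case \<open>single\<close> may assume that the
  path lies in the support of \<open>f\<close>, but must treat every coefficient.\<close>

lemma path_algebra_induct [consumes 1, case_names zero single add]:
 fixes f :: "('v, 'a) path => 'k::field"
 assumes f: "f : carrier (path_algebra Q)" and zero: "P \<zero>\<^bsub>path_algebra Q\<^esub>"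
  and single: "!!c \<pi>. f \<pi> ~= 0 ==> P (single c \<pi>)"
  and add: "!!g h. g : carrier (path_algebra Q) ==> h : carrier (path_algebra Q) ==> P g ==> P h ==> P (g \<oplus>\<^bsub>path_algebra Q\<^esub> h)"
 shows "P f"
proof -
 have "P g" if "finite S" "{\<pi>. g \<pi> ~= 0} \<subseteq> S" "S \<subseteq> {\<pi>. f \<pi> ~= 0}" for g S
  using that
 proof (induction S arbitrary: g rule: finite_induct)
  case empty
  then have "g = \<zero>\<^bsub>path_algebra Q\<^esub>" by (auto simp: path_algebra_simps)
  then show ?case using zero by simp
 next
  case (insert \<pi> S)
  have supp: "{\<pi>'. (g(\<pi> := 0)) \<pi>' ~= 0} \<subseteq> S" using insert.prems(1) by auto
  have fS: "insert \<pi> S \<subseteq> paths Q" using insert.prems(2) f unfolding path_algebra_simps by blast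
  have "g(\<pi> := 0) : carrier (path_algebra Q)"
   unfolding path_algebra_simps(1)
   by (intro conjI finite_subset[OF supp insert.hyps(1)] subset_trans[OF supp]) (use fS in simp)
  moreover have "single (g \<pi>) \<pi> : carrier (path_algebra Q)" using fS by (intro single_carrier) simp
  moreover have "P (g(\<pi> := 0))" by (rule insert.IH[OF supp]) (use insert.prems in simp)
  moreover have "P (single (g \<pi>) \<pi>)" using insert.prems(2) by (intro single) auto
  ultimately have "P (g(\<pi> := 0) \<oplus>\<^bsub>path_algebra Q\<^esub> single (g \<pi>) \<pi>)" by (rule add)
  moreover have "g(\<pi> := 0) \<oplus>\<^bsub>path_algebra Q\<^esub> single (g \<pi>) \<pi> = g"
   by (auto simp: path_algebra_simps single_def fun_eq_iff)
  ultimately show ?case by simp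
 qed
 from this[of "{\<pi>. f \<pi> ~= 0}" f] show ?thesis using f by (simp add: path_algebra_simps)
qed

lemma mult_single:
 "(f \<otimes>\<^bsub>path_algebra Q\<^esub> single c (u, p)) (u', p') =
  (if u' = u & take (length p) p' = p then f (walk_end Q u p, drop (length p) p') * c else 0)"
proof -
 have "(f \<otimes>\<^bsub>path_algebra Q\<^esub> single c (u, p)) (u', p')
  = (\<Sum>k\<le>length p'. if k = length p then (if u' = u & take (length p) p' = p then f (walk_end Q u p, drop (length p) p') * c else 0) else 0)"
  unfolding path_algebra_simps(2) prod.case
 proof (rule sum.cong[OF refl])
  fix k assume k: "k : {..length p'}"
  show "f (walk_end Q u' (take k p'), drop k p') * single c (u, p) (u', take k p')
   = (if k = length p then (if u' = u & take (length p) p' = p then f (walk_end Q u p, drop (length p) p') * c else 0) else 0)"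
  proof (cases "k = length p")
   case True
   then show ?thesis by (cases "u' = u"; cases "take (length p) p' = p") (simp_all add: single_def)
  next
   case False
   then have "take k p' ~= p" using k by auto
   then show ?thesis using False by (simp add: single_def)
  qed
 qed
 also have "... = (if u' = u & take (length p) p' = p then f (walk_end Q u p, drop (length p) p') * c else 0)"
 proof (cases "length p \<le> length p'")
  case False
  then have "length (take (length p) p') ~= length p" by simp
  then have "take (length p) p' ~= p" by (rule contrapos_nn) (rule arg_cong)
  then show ?thesis using False by simp
 next
  case True
  then have "length p : {..length p'}" by simp
  then show ?thesis unfolding sum.delta[OF finite_atMost] by (simp only: if_True)
 qed
 finally show ?thesis .
qed

lemma single_mult_single:
 "single c (v, q) \<otimes>\<^bsub>path_algebra Q\<^esub> single 1 (u, p) = (if v = walk_end Q u p then single c (u, p @ q) else (%_. 0))"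
proof
 fix \<pi> :: "('a, 'b) path"
 obtain u' p' where \<pi>: "\<pi> = (u', p')" by force
 have "take (length p) p' = p & drop (length p) p' = q \<longleftrightarrow> p' = p @ q" by (metis append_eq_conv_conj)
 then show "(single c (v, q) \<otimes>\<^bsub>path_algebra Q\<^esub> single 1 (u, p)) \<pi>
   = (if v = walk_end Q u p then single c (u, p @ q) else (%_. 0)) \<pi>"
  unfolding \<pi> mult_single by (auto simp: single_def)
qed

lemma arrow_ideal_power_0: "arrow_ideal_power Q 0 = carrier (path_algebra Q)"
 by (auto simp: arrow_ideal_power_def)

lemma arrow_ideal_power_mult:
 assumes "wf_digraph Q" "f : arrow_ideal_power Q k" "g : arrow_ideal_power Q l"
 shows "f \<otimes>\<^bsub>path_algebra Q\<^esub> g : arrow_ideal_power Q (k + l)"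
 unfolding arrow_ideal_power_def
proof (intro CollectI conjI allI impI)
 show "f \<otimes>\<^bsub>path_algebra Q\<^esub> g : carrier (path_algebra Q)"
  using assms by (intro path_algebra_mult_closed) (auto simp: arrow_ideal_power_def)
 fix u p assume "(f \<otimes>\<^bsub>path_algebra Q\<^esub> g) (u, p) ~= 0"
 then obtain j where j: "j \<le> length p" "f (walk_end Q u (take j p), drop j p) * g (u, take j p) ~= 0"
  unfolding path_algebra_simps(2) prod.case by (metis (no_types, lifting) atMost_iff sum.not_neutral_contains_not_neutral)
 then have "k \<le> length (drop j p)" "l \<le> length (take j p)"
  using assms(2,3) unfolding arrow_ideal_power_def by fastforce+
 then show "k + l \<le> length p" using j(1) by simp
qed

text \<open>The partial sums of the geometric series are the witnesses.\<close>

lemma (in ring) one_minus_nilpotent_left_inverse: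
 assumes z: "z : carrier R" and "z [^] (m::nat) = \<zero>"
 shows "EX u:carrier R. u \<otimes> (\<one> \<ominus> z) = \<one>"
proof -
 have "EX u:carrier R. u \<otimes> (\<one> \<ominus> z) = \<one> \<ominus> z [^] n" for n :: nat
 proof (induction n)
  case 0
  show ?case by (rule bexI[of _ \<zero>]) (use z in "auto simp: minus_eq r_neg")
 next
  case (Suc n)
  then obtain u where u: "u : carrier R" "u \<otimes> (\<one> \<ominus> z) = \<one> \<ominus> z [^] n" by blast
  have zn: "z [^] n : carrier R" using z by simp
  have "(u \<oplus> z [^] n) \<otimes> (\<one> \<ominus> z) = (\<one> \<ominus> z [^] n) \<oplus> z [^] n \<otimes> (\<one> \<ominus> z)"
   using u z zn by (simp add: l_distr)
  also have "... = \<one> \<ominus> z [^] Suc n"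
   using z zn by (simp add: minus_eq r_distr r_minus a_assoc) (simp add: a_assoc[symmetric] l_neg)
  finally show ?case using u(1) zn by blast
 qed
 from this[of m] show ?thesis using assms(2) by (simp add: minus_eq)
qed

text \<open>If a maximal left ideal does not contain \<open>X\<close>, then \<open>1 - r X\<close> lies in it for some \<open>r\<close>.\<close>

lemma (in ring) in_jacobson_radical:
 assumes X: "X : carrier R" and nil: "!!r. r : carrier R ==> \<exists>m::nat. (r \<otimes> X) [^] m = \<zero>"
 shows "X : jacobson_radical R"
 unfolding jacobson_radical_def
proof (intro IntI X InterI, elim CollectE)
 fix L assume L: "maximal_left_ideal L R"
 then have LI: "subgroup L (add_monoid R)" "!!a x. a : carrier R ==> x : L ==> a \<otimes> x : L" "L ~= carrier R"
  by (auto simp: maximal_left_ideal_def left_ideal_def)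
 have Lc: "L \<subseteq> carrier R" using subgroup.subset[OF LI(1)] by simp
 have add: "x \<oplus> y : L" if "x : L" "y : L" for x y using subgroup.m_closed[OF LI(1) that] by simp
 have zero: "\<zero> : L" using subgroup.one_closed[OF LI(1)] by simp
 show "X : L"
 proof (rule ccontr)
  assume nX: "X \<notin> L"
  define L' where "L' = {l \<oplus> r \<otimes> X | l r. l : L & r : carrier R}"
  have "left_ideal L' R"
   unfolding left_ideal_def
  proof (intro conjI ballI)
   show "subgroup L' (add_monoid R)"
   proof (rule add.subgroupI)
    show "L' \<subseteq> carrier R" using Lc X by (auto simp: L'_def)
    show "L' ~= {}" using zero by (auto simp: L'_def)
   next
    fix a assume "a : L'"
    then obtain l r where a: "a = l \<oplus> r \<otimes> X" "l : L" "r : carrier R" by (auto simp: L'_def)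
    have "\<ominus> a = \<ominus> l \<oplus> (\<ominus> r) \<otimes> X" using a Lc X by (auto simp: minus_add l_minus)
    moreover have "\<ominus> l : L" using subgroup.m_inv_closed[OF LI(1) a(2)] by (simp add: a_inv_def)
    ultimately show "\<ominus> a : L'" using a(3) unfolding L'_def by blast
   next
    fix a b assume "a : L'" "b : L'"
    then obtain l r l' r' where a: "a = l \<oplus> r \<otimes> X" "l : L" "r : carrier R" "b = l' \<oplus> r' \<otimes> X" "l' : L" "r' : carrier R"
     unfolding L'_def by blast
    have "a \<oplus> b = (l \<oplus> l') \<oplus> (r \<oplus> r') \<otimes> X" using a Lc X by (simp add: l_distr subset_iff a_ac)
    then show "a \<oplus> b : L'" using a add unfolding L'_def by blast
   qed
   fix c a assume c: "c : carrier R" and "a : L'"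
   then obtain l r where a: "a = l \<oplus> r \<otimes> X" "l : L" "r : carrier R" by (auto simp: L'_def)
   have "c \<otimes> a = c \<otimes> l \<oplus> (c \<otimes> r) \<otimes> X" using a c Lc X by (auto simp: r_distr m_assoc subset_iff)
   then show "c \<otimes> a : L'" using a c LI(2) unfolding L'_def by blast
  qed
  moreover have "L \<subseteq> L'"
  proof
   fix l assume "l : L"
   then have "l = l \<oplus> \<zero> \<otimes> X" using X Lc by auto
   then show "l : L'" using \<open>l : L\<close> unfolding L'_def by blast
  qed
  moreover have "X = \<zero> \<oplus> \<one> \<otimes> X" using X by simp
  then have "X : L'" using zero unfolding L'_def by blast
  ultimately have "L' = carrier R" using L nX unfolding maximal_left_ideal_def by blast
  then obtain l r where lr: "\<one> = l \<oplus> r \<otimes> X" "l : L" "r : carrier R" unfolding L'_def by blast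
  then have l: "l = \<one> \<ominus> r \<otimes> X" using Lc X by (auto simp: minus_eq a_assoc r_neg subset_iff)
  obtain m :: nat where "(r \<otimes> X) [^] m = \<zero>" using nil[OF lr(3)] by blast
  then obtain u where "u : carrier R" "u \<otimes> l = \<one>"
   using one_minus_nilpotent_left_inverse[of "r \<otimes> X" m] lr(3) X unfolding l by auto
  then have "\<one> : L" using LI(2)[OF _ lr(2)] by metis
  then have "a : L" if "a : carrier R" for a using LI(2)[OF that] that by fastforce
  then show False using LI(3) Lc by blast
 qed
qed

text \<open>Admissibility makes every left multiple of an arrow nilpotent modulo \<open>I\<close>,
  so arrows lie in the radical. Then \<open>J^2 = 0\<close> puts all paths of length two into
  \<open>I\<close>, and left multiplication those of greater length; the other inclusion is part of
  admissibility.\<close>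

lemma square_zero_ideal:
 fixes Q :: "('v, 'a) pre_digraph" and I :: "(('v, 'a) path => 'k::field) set"
 assumes fin: "fin_digraph Q" and adm: "admissible_ideal Q I"
  and J2: "ideal_prod (quiver_algebra Q I)
      (jacobson_radical (quiver_algebra Q I)) (jacobson_radical (quiver_algebra Q I))
     = {\<zero>\<^bsub>quiver_algebra Q I\<^esub>}"
 shows "I = arrow_ideal_power Q 2"
proof
 interpret fin_digraph Q by fact
 let ?A = "path_algebra Q :: (('v, 'a) path => 'k) ring" and ?R = "quiver_algebra Q I"
 obtain m where adm': "ideal I ?A" "I \<subseteq> arrow_ideal_power Q 2" "arrow_ideal_power Q m \<subseteq> I"
  using adm unfolding admissible_ideal_def by blast
 show "I \<subseteq> arrow_ideal_power Q 2" by fact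
 have zero: "\<zero>\<^bsub>?R\<^esub> = I" unfolding quiver_algebra_def FactRing_def by (simp only: ring_record_simps)
 interpret A: ring ?A by (rule ring_path_algebra[OF fin])
 interpret I: ideal I ?A by fact
 interpret R: ring ?R unfolding quiver_algebra_def by (rule I.quotient_is_ring)
 interpret h: ring_hom_ring ?A ?R "(+>\<^bsub>?A\<^esub>) I" unfolding quiver_algebra_def by (rule I.rcos_ring_hom_ring)
 let ?cl = "%f. I +>\<^bsub>?A\<^esub> f"
 have path1: "(tail Q ar, [ar]) : paths Q" if "ar : arcs Q" for ar
  using that by (simp add: paths_Cons[OF wf_digraph_axioms] paths_Nil[OF wf_digraph_axioms])
 let ?a = "%ar. single 1 (tail Q ar, [ar]) :: ('v, 'a) path => 'k"
 have arrow: "?cl (?a ar) : jacobson_radical ?R" if ar: "ar : arcs Q" for ar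
 proof (rule R.in_jacobson_radical)
  have ac: "?a ar : carrier ?A" by (rule single_carrier[OF path1[OF ar]])
  then show "?cl (?a ar) : carrier ?R" by (rule h.hom_closed)
  fix r assume "r : carrier ?R"
  then obtain f where f: "f : carrier ?A" "r = ?cl f" 
   unfolding quiver_algebra_def FactRing_def A_RCOSETS_def' partial_object.simps by blast
  have "?a ar : arrow_ideal_power Q 1" using ac by (auto simp: arrow_ideal_power_def single_def)
  then have fa: "f \<otimes>\<^bsub>?A\<^esub> ?a ar : arrow_ideal_power Q 1"
   using arrow_ideal_power_mult[OF wf_digraph_axioms, of f 0 "?a ar" 1] f(1) by (simp add: arrow_ideal_power_0)
  have "(f \<otimes>\<^bsub>?A\<^esub> ?a ar) [^]\<^bsub>?A\<^esub> n : arrow_ideal_power Q n" for n :: nat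
  proof (induction n)
   case 0
   show ?case unfolding arrow_ideal_power_0 by (rule A.nat_pow_closed[OF A.m_closed[OF f(1) ac]])
  next
   case (Suc n)
   show ?case using arrow_ideal_power_mult[OF wf_digraph_axioms Suc fa] unfolding A.nat_pow_Suc by (simp only: Suc_eq_plus1)
  qed
  then have "(f \<otimes>\<^bsub>?A\<^esub> ?a ar) [^]\<^bsub>?A\<^esub> m : I" using adm'(3) by blast
  then have "?cl ((f \<otimes>\<^bsub>?A\<^esub> ?a ar) [^]\<^bsub>?A\<^esub> m) = \<zero>\<^bsub>?R\<^esub>" unfolding zero by (rule I.a_rcos_const)
  moreover have "?cl ((f \<otimes>\<^bsub>?A\<^esub> ?a ar) [^]\<^bsub>?A\<^esub> m) = (r \<otimes>\<^bsub>?R\<^esub> ?cl (?a ar)) [^]\<^bsub>?R\<^esub> m"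
   unfolding h.hom_nat_pow[OF A.m_closed[OF f(1) ac]] h.hom_mult[OF f(1) ac] f(2) ..
  ultimately show "\<exists>m::nat. (r \<otimes>\<^bsub>?R\<^esub> ?cl (?a ar)) [^]\<^bsub>?R\<^esub> m = \<zero>\<^bsub>?R\<^esub>" by metis
 qed
 have two: "single 1 (tail Q ar, [ar, br]) : I" if "ar : arcs Q" "br : arcs Q" "head Q ar = tail Q br" for ar br
 proof -
  have ac: "?a ar : carrier ?A" "?a br : carrier ?A" using that by (auto intro: single_carrier[OF path1])
  have "?cl (?a br) \<otimes>\<^bsub>?R\<^esub> ?cl (?a ar) : ideal_prod ?R (jacobson_radical ?R) (jacobson_radical ?R)"
   using arrow that by (intro ideal_prod.prod)
  then have "?cl (?a br \<otimes>\<^bsub>?A\<^esub> ?a ar) = I" unfolding J2 zero h.hom_mult[OF ac(2,1)] by (rule singletonD)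
  moreover have "?a br \<otimes>\<^bsub>?A\<^esub> ?a ar = single 1 (tail Q ar, [ar, br])"
   using that(3) by (simp add: single_mult_single walk_end_Cons walk_end_Nil)
  moreover have "?a br \<otimes>\<^bsub>?A\<^esub> ?a ar : ?cl (?a br \<otimes>\<^bsub>?A\<^esub> ?a ar)"
   by (rule I.a_rcos_self[OF A.m_closed[OF ac(2,1)]])
  ultimately show ?thesis by (simp only:)
 qed
 \<comment> \<open>The first two arrows are split off, and the rest \<open>q\<close> multiplies from
   the left, since the path traversed later is the left factor.\<close>
 have long: "single c (u, p) : I" if up: "(u, p) : paths Q" "2 \<le> length p" for c u p
 proof -
  obtain ar br q where p: "p = ar # br # q" using up(2) by (metis Suc_le_length_iff numeral_2_eq_2)
  have *: "ar : arcs Q" "u = tail Q ar" "br : arcs Q" "head Q ar = tail Q br" "(head Q br, q) : paths Q"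
   using up(1) unfolding p by (auto simp: paths_Cons[OF wf_digraph_axioms])
  have "single c (head Q br, q) \<otimes>\<^bsub>?A\<^esub> single 1 (tail Q ar, [ar, br]) : I"
   by (rule I.I_l_closed[OF two[OF *(1,3,4)] single_carrier[OF *(5)]])
  then show ?thesis by (simp add: single_mult_single walk_end_Cons walk_end_Nil p *(2))
 qed
 show "arrow_ideal_power Q 2 \<subseteq> I"
 proof
  fix f :: "('v, 'a) path => 'k" assume f: "f : arrow_ideal_power Q 2"
  then have fc: "f : carrier ?A" by (simp add: arrow_ideal_power_def)
  from fc show "f : I"
  proof (rule path_algebra_induct)
   show "\<zero>\<^bsub>?A\<^esub> : I" by (rule I.zero_closed)
   show "g \<oplus>\<^bsub>?A\<^esub> h : I" if "g : I" "h : I" for g h using that by (rule I.a_closed)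
   fix c \<pi> assume nz: "f \<pi> ~= 0"
   obtain u p where \<pi>: "\<pi> = (u, p)" by (cases \<pi>)
   show "single c \<pi> : I" unfolding \<pi>
    by (rule long) (use f nz in \<open>auto simp: \<pi> arrow_ideal_power_def path_algebra_simps\<close>)
  qed
 qed
qed

section \<open>Modules of representations\<close>

context
 fixes Q :: "('v, 'a) pre_digraph"
 assumes fin: "fin_digraph Q"
begin

interpretation fin_digraph Q by (rule fin)

lemma awalk_single_iff: "awalk u [ar] v \<longleftrightarrow> ar : arcs Q & tail Q ar = u & head Q ar = v"
 by (auto simp: awalk_Cons_iff awalk_Nil_iff)

lemma path_matrix_carrier:
 assumes "x : rep_space Q d" "awalk u p v"
 shows "path_matrix Q d x u p : carrier_mat (d v) (d u)"
 using assms(2)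
proof (induction p arbitrary: u)
 case Nil
 then show ?case by (simp add: awalk_Nil_iff)
next
 case (Cons ar p)
 then have "path_matrix Q d x (head Q ar) p : carrier_mat (d v) (d (head Q ar))" "x ar : carrier_mat (d (head Q ar)) (d u)"
  using rep_spaceD[OF assms(1), of ar] by (auto simp: awalk_Cons_iff)
 then show ?case unfolding path_matrix.simps by (rule mult_carrier_mat)
qed

lemma square_zero_matD:
 assumes "x : square_zero_reps Q d" "ar : arcs Q" "br : arcs Q" "head Q ar = tail Q br"
 shows "x br * x ar = 0\<^sub>m (d (head Q br)) (d (tail Q ar))"
proof -
 have c: "x br : carrier_mat (d (head Q br)) (d (tail Q br))" "x ar : carrier_mat (d (tail Q br)) (d (tail Q ar))"
  using assms rep_spaceD[of x Q d br] rep_spaceD[of x Q d ar] by (simp_all add: square_zero_reps_def)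
 have "fm (x br * x ar) = fm (0\<^sub>m (d (head Q br)) (d (tail Q ar)))"
  using assms unfolding fm_mult[OF c] fm_zero by (auto simp: square_zero_reps_def)
 then show ?thesis using c by (intro fm_inject) auto
qed

lemma path_matrix_long:
 assumes x: "x : square_zero_reps Q d" and "awalk u p v" "2 \<le> length p"
 shows "path_matrix Q d x u p = 0\<^sub>m (d v) (d u)"
proof -
 obtain ar br q where p: "p = ar # br # q" using assms(3) by (metis Suc_le_length_iff numeral_2_eq_2)
 have xr: "x : rep_space Q d" using x by (simp add: square_zero_reps_def)
 have *: "ar : arcs Q" "tail Q ar = u" "br : arcs Q" "head Q ar = tail Q br" "awalk (head Q br) q v"
  using assms(2) unfolding p by (auto simp: awalk_Cons_iff)
 have c: "path_matrix Q d x (head Q br) q : carrier_mat (d v) (d (head Q br))" by (rule path_matrix_carrier[OF xr *(5)])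
 have "path_matrix Q d x u p = path_matrix Q d x (head Q br) q * (x br * x ar)"
  using c rep_spaceD[OF xr *(1)] rep_spaceD[OF xr *(3)] *(4)
  unfolding p by (simp add: assoc_mult_mat[of _ "d v" "d (head Q br)" _ "d (tail Q br)" _ "d (tail Q ar)"])
 also have "... = 0\<^sub>m (d v) (d u)" unfolding square_zero_matD[OF x *(1,3,4)] using c *(2) by simp
 finally show ?thesis .
qed

text \<open>Matrices of paths of length at least two vanish, so only the trivial path and the single
  arrows contribute.\<close>

lemma block_matrix_entry:
 fixes f :: "('v, 'a) path => 'k::field"
 assumes x: "x : square_zero_reps Q d" and f: "f : carrier (path_algebra Q)" and uv: "u : verts Q" "v : verts Q"
  and ij: "i < d v" "j < d u"
 shows "block_matrix Q d x f u v $$ (i, j) = (if u = v & i = j then f (v, []) else 0)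
  + (\<Sum>ar | ar : arcs Q & head Q ar = v. if tail Q ar = u then f (u, [ar]) * fm (x ar) i j else 0)"
proof -
 let ?S = "{p. awalk u p v & f (u, p) ~= 0}" and ?A = "{ar. ar : arcs Q & head Q ar = v & tail Q ar = u}"
 let ?g = "%p. f (u, p) * path_matrix Q d x u p $$ (i, j)"
 \<comment> \<open>Agrees with \<open>?g\<close> on the short paths in the support of
   \<open>f\<close> and vanishes at the other short paths, so the sum can be extended to the trivial
   path and all arrows from \<open>u\<close> to \<open>v\<close>.\<close>
 let ?g' = "%p. if p = [] then (if u = v & i = j then f (v, []) else 0) else f (u, p) * fm (x (hd p)) i j"
 have xr: "x : rep_space Q d" using x by (simp add: square_zero_reps_def)
 have "finite (Pair u ` ?S)" using f unfolding path_algebra_simps by (auto elim!: finite_subset[rotated])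
 then have finS: "finite ?S" by (rule finite_imageD) (simp add: inj_on_def)
 have finA: "finite ?A" by simp
 have long: "?g p = 0" if "p : ?S" "p \<notin> insert [] ((%ar. [ar]) ` ?A)" for p
 proof -
  have "2 \<le> length p"
  proof (rule ccontr)
   assume "\<not> ?thesis"
   then consider "p = []" | ar where "p = [ar]" by (cases p; cases "List.tl p") auto
   then show False using that by cases (auto simp: awalk_single_iff)
  qed
  then show ?thesis using path_matrix_long[OF x, of u p v] that ij by simp
 qed
 have "block_matrix Q d x f u v $$ (i, j) = sum ?g ?S" using ij by (simp add: block_matrix_def)
 also have "... = sum ?g' (insert [] ((%ar. [ar]) ` ?A))"
 proof (rule sum.mono_neutral_cong)
  show "?g p = 0" if "p : ?S - insert [] ((%ar. [ar]) ` ?A)" for p using long that by blast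
  show "?g' p = 0" if "p : insert [] ((%ar. [ar]) ` ?A) - ?S" for p
   using that uv by (auto simp: awalk_Nil_iff awalk_single_iff)
  show "?g p = ?g' p" if "p : ?S \<inter> insert [] ((%ar. [ar]) ` ?A)" for p
  proof (cases "p = []")
   case True
   then have "u = v" using that by (simp add: awalk_Nil_iff)
   then show ?thesis using True ij by simp
  next
   case False
   have "p : insert [] ((%ar. [ar]) ` ?A)" using that by (rule IntD2)
   with False obtain ar where ar: "p = [ar]" "ar : ?A" by blast
   have "x ar : carrier_mat (d v) (d u)" using rep_spaceD[OF xr, of ar] ar(2) by auto
   then show ?thesis using ar ij by (simp add: fm_index)
  qed
 qed (use finS finA in auto)
 also have "... = ?g' [] + sum ?g' ((%ar. [ar]) ` ?A)" using finA by (subst sum.insert) auto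
 also have "sum ?g' ((%ar. [ar]) ` ?A) = (SUM ar:?A. f (u, [ar]) * fm (x ar) i j)"
  by (subst sum.reindex) (auto simp: inj_on_def)
 also have "?A = {ar : {ar. ar : arcs Q & head Q ar = v}. tail Q ar = u}" by auto
 also have "(SUM ar:.... f (u, [ar]) * fm (x ar) i j) =
   (\<Sum>ar | ar : arcs Q & head Q ar = v. if tail Q ar = u then f (u, [ar]) * fm (x ar) i j else 0)"
  by (rule sum.inter_filter) simp
 finally show ?thesis by simp
qed

text \<open>Elements of \<open>I\<close> have no coefficients at paths of length 0 or 1, so they act
  as zero; conversely, testing with a single path of length two gives the product of two
  arrows.\<close>

lemma Rep_eq_square_zero_reps:
 fixes I :: "(('v, 'a) path => 'k::field) set"
 assumes I: "I = arrow_ideal_power Q 2"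
 shows "Rep Q I d = square_zero_reps Q d"
proof
 show "square_zero_reps Q d \<subseteq> Rep Q I d"
 proof
  fix x :: "'a => 'k mat" assume x: "x : square_zero_reps Q d"
  have "block_matrix Q d x f u v = 0\<^sub>m (d v) (d u)" if f: "f : I" and uv: "u : verts Q" "v : verts Q" for f u v
  proof (rule eq_matI)
   fix i j assume "i < dim_row (0\<^sub>m (d v) (d u))" "j < dim_col (0\<^sub>m (d v) (d u))"
   moreover have "f (w, []) = 0" "f (w, [ar]) = 0" for w ar
    using f unfolding I arrow_ideal_power_def by fastforce+
   moreover have "f : carrier (path_algebra Q)" using f by (simp add: I arrow_ideal_power_def)
   ultimately show "block_matrix Q d x f u v $$ (i, j) = 0\<^sub>m (d v) (d u) $$ (i, j)"
    using block_matrix_entry[OF x _ uv, of f i j] by (simp cong: if_cong)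
  qed (simp_all add: block_matrix_def)
  with x show "x : Rep Q I d" by (auto simp: Rep_def square_zero_reps_def)
 qed
 show "Rep Q I d \<subseteq> square_zero_reps Q d"
 proof
  fix x :: "'a => 'k mat" assume x: "x : Rep Q I d"
  then have xr: "x : rep_space Q d" by (simp add: Rep_def)
  have "fm (x br) *{d (tail Q br)} fm (x ar) = 0" if ab: "ar : arcs Q" "br : arcs Q" "head Q ar = tail Q br" for ar br
  proof -
   let ?u = "tail Q ar" and ?v = "head Q br"
   let ?f = "single 1 (?u, [ar, br]) :: ('v, 'a) path => 'k"
   have aw: "awalk ?u [ar, br] ?v" using ab by (auto simp: awalk_Cons_iff awalk_Nil_iff)
   have "(?u, [ar, br]) : paths Q" using aw by (auto simp: paths_def)
   then have "?f : I" unfolding I arrow_ideal_power_def by (auto intro: single_carrier simp: single_def)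
   then have 0: "block_matrix Q d x ?f ?u ?v = 0\<^sub>m (d ?v) (d ?u)" using x ab by (simp add: Rep_def)
   have c: "x br : carrier_mat (d ?v) (d (tail Q br))" "x ar : carrier_mat (d (tail Q br)) (d ?u)"
    using rep_spaceD[OF xr] ab by metis+
   have S: "{p. awalk ?u p ?v & ?f (?u, p) ~= 0} = {[ar, br]}" using aw by (auto simp: single_def)
   have "x br * x ar = 0\<^sub>m (d ?v) (d ?u)"
   proof (rule eq_matI)
    fix i j assume "i < dim_row (0\<^sub>m (d ?v) (d ?u))" "j < dim_col (0\<^sub>m (d ?v) (d ?u))"
    then have "(1\<^sub>m (d ?v) * x br * x ar) $$ (i, j) = 0"
     using arg_cong[OF 0, of "%A. A $$ (i, j)"] unfolding block_matrix_def S by (simp add: single_def)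
    moreover have "1\<^sub>m (d ?v) * x br = x br" using c(1) by simp
    ultimately show "(x br * x ar) $$ (i, j) = 0\<^sub>m (d ?v) (d ?u) $$ (i, j)"
     using \<open>i < _\<close> \<open>j < _\<close> by simp
   qed (use c in auto)
   then show ?thesis unfolding fm_mult[OF c, symmetric] by (simp add: fm_zero)
  qed
  with xr show "x : square_zero_reps Q d" by (simp add: square_zero_reps_def)
 qed
qed

text \<open>The action in coordinates, to which computations with \<open>rep_module\<close> are
  reduced: a scalar from the trivial path and one term for each arrow into \<open>v\<close>.\<close>

lemma path_algebra_action_index:
 fixes f :: "('v, 'a) path => 'k::field"
 assumes x: "x : square_zero_reps Q d" and f: "f : carrier (path_algebra Q)"
  and w: "w : (\<Pi>\<^sub>E v\<in>verts Q. carrier_vec (d v))" and v: "v : verts Q" "i < d v"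
 shows "path_algebra_action Q d x f w v $ i = f (v, []) * w v $ i
  + (\<Sum>ar | ar : arcs Q & head Q ar = v. f (tail Q ar, [ar]) * (\<Sum>j<d (tail Q ar). fm (x ar) i j * w (tail Q ar) $ j))"
proof -
 have wd: "dim_vec (w u) = d u" if "u : verts Q" for u using w that by (auto simp: PiE_iff)
 let ?A = "{ar. ar : arcs Q & head Q ar = v}"
 have "path_algebra_action Q d x f w v $ i = (SUM u:verts Q. (block_matrix Q d x f u v *\<^sub>v w u) $ i)"
  using v by (simp add: path_algebra_action_def)
 also have "... = (SUM u:verts Q. (if u = v then f (v, []) * w v $ i else 0)
   + (SUM ar:?A. if u = tail Q ar then f (tail Q ar, [ar]) * (\<Sum>j<d (tail Q ar). fm (x ar) i j * w (tail Q ar) $ j) else 0))"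
 proof (rule sum.cong[OF refl])
  fix u assume u: "u : verts Q"
  have "(block_matrix Q d x f u v *\<^sub>v w u) $ i = (\<Sum>j<d u. block_matrix Q d x f u v $$ (i, j) * w u $ j)"
   using v wd[OF u] by (simp add: block_matrix_def scalar_prod_def atLeast0LessThan)
  also have "... = (\<Sum>j<d u. (if j = i then (if u = v then f (v, []) * w v $ i else 0) else 0)
    + (SUM ar:?A. if u = tail Q ar then f (tail Q ar, [ar]) * (fm (x ar) i j * w (tail Q ar) $ j) else 0))"
  proof (rule sum.cong[OF refl])
   fix j assume "j : {..<d u}"
   then show "block_matrix Q d x f u v $$ (i, j) * w u $ j = (if j = i then (if u = v then f (v, []) * w v $ i else 0) else 0)
    + (SUM ar:?A. if u = tail Q ar then f (tail Q ar, [ar]) * (fm (x ar) i j * w (tail Q ar) $ j) else 0)"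
    using block_matrix_entry[OF x f u v(1) v(2), of j]
    by (auto simp: distrib_right sum_distrib_right intro!: sum.cong arg_cong2[where f = "(+)"])
  qed
  also have "... = (if u = v then f (v, []) * w v $ i else 0)
    + (SUM ar:?A. \<Sum>j<d u. if u = tail Q ar then f (tail Q ar, [ar]) * (fm (x ar) i j * w (tail Q ar) $ j) else 0)"
   using v(2) by (subst sum.swap) (auto simp: sum.distrib)
  also have "(SUM ar:?A. \<Sum>j<d u. if u = tail Q ar then f (tail Q ar, [ar]) * (fm (x ar) i j * w (tail Q ar) $ j) else 0)
   = (SUM ar:?A. if u = tail Q ar then f (tail Q ar, [ar]) * (\<Sum>j<d (tail Q ar). fm (x ar) i j * w (tail Q ar) $ j) else 0)"
   by (intro sum.cong) (auto simp: sum_distrib_left)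
  finally show "(block_matrix Q d x f u v *\<^sub>v w u) $ i = (if u = v then f (v, []) * w v $ i else 0)
   + (SUM ar:?A. if u = tail Q ar then f (tail Q ar, [ar]) * (\<Sum>j<d (tail Q ar). fm (x ar) i j * w (tail Q ar) $ j) else 0)" .
 qed
 also have "... = f (v, []) * w v $ i + (SUM ar:?A. SUM u:verts Q. if u = tail Q ar then f (tail Q ar, [ar]) * (\<Sum>j<d (tail Q ar). fm (x ar) i j * w (tail Q ar) $ j) else 0)"
  using v(1) unfolding sum.distrib by (subst (2) sum.swap) simp
 also have "(SUM ar:?A. SUM u:verts Q. if u = tail Q ar then f (tail Q ar, [ar]) * (\<Sum>j<d (tail Q ar). fm (x ar) i j * w (tail Q ar) $ j) else 0)
  = (SUM ar:?A. f (tail Q ar, [ar]) * (\<Sum>j<d (tail Q ar). fm (x ar) i j * w (tail Q ar) $ j))"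
  by (intro sum.cong) auto
 finally show ?thesis .
qed

end

section \<open>Left modules\<close>

definition left_module_hom ::
 "('r, 'm) ring_scheme => ('r, 'w, 'n) module_scheme => ('r, 'u, 'l) module_scheme => ('w => 'u) => bool" where
 "left_module_hom R M N h \<longleftrightarrow> (ALL w:carrier M. h w : carrier N) &
   (ALL w:carrier M. ALL w':carrier M. h (w \<oplus>\<^bsub>M\<^esub> w') = h w \<oplus>\<^bsub>N\<^esub> h w') &
   (ALL a:carrier R. ALL w:carrier M. h (a \<odot>\<^bsub>M\<^esub> w) = a \<odot>\<^bsub>N\<^esub> h w)"

lemma left_module_homD:
 assumes "left_module_hom R M N h"
 shows "w : carrier M ==> h w : carrier N"
  and "w : carrier M ==> w' : carrier M ==> h (w \<oplus>\<^bsub>M\<^esub> w') = h w \<oplus>\<^bsub>N\<^esub> h w'"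
  and "a : carrier R ==> w : carrier M ==> h (a \<odot>\<^bsub>M\<^esub> w) = a \<odot>\<^bsub>N\<^esub> h w"
 using assms by (auto simp: left_module_hom_def)

text \<open>Stated for bare additive maps between abelian groups, so that it serves for module maps
  and for the scalar action in either argument.\<close>

lemma additive_zero:
 assumes "abelian_group M" "abelian_group N" "!!w. w : carrier M ==> h w : carrier N"
  and "!!w w'. w : carrier M ==> w' : carrier M ==> h (w \<oplus>\<^bsub>M\<^esub> w') = h w \<oplus>\<^bsub>N\<^esub> h w'"
 shows "h \<zero>\<^bsub>M\<^esub> = \<zero>\<^bsub>N\<^esub>"
proof -
 interpret M: abelian_group M by fact
 interpret N: abelian_group N by fact
 have c: "h \<zero>\<^bsub>M\<^esub> : carrier N" by (rule assms(3)[OF M.zero_closed])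
 have "h \<zero>\<^bsub>M\<^esub> \<oplus>\<^bsub>N\<^esub> h \<zero>\<^bsub>M\<^esub> = h \<zero>\<^bsub>M\<^esub> \<oplus>\<^bsub>N\<^esub> \<zero>\<^bsub>N\<^esub>"
  unfolding assms(4)[OF M.zero_closed M.zero_closed, symmetric] M.l_zero[OF M.zero_closed] N.r_zero[OF c] ..
 then have "\<ominus>\<^bsub>N\<^esub> h \<zero>\<^bsub>M\<^esub> \<oplus>\<^bsub>N\<^esub> (h \<zero>\<^bsub>M\<^esub> \<oplus>\<^bsub>N\<^esub> h \<zero>\<^bsub>M\<^esub>) = \<ominus>\<^bsub>N\<^esub> h \<zero>\<^bsub>M\<^esub> \<oplus>\<^bsub>N\<^esub> (h \<zero>\<^bsub>M\<^esub> \<oplus>\<^bsub>N\<^esub> \<zero>\<^bsub>N\<^esub>)" by (simp only:)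
 then show ?thesis using c by (simp add: N.a_assoc[symmetric] N.l_neg)
qed

lemma additive_finsum:
 assumes M: "abelian_group M" and N: "abelian_group N" and cl: "!!w. w : carrier M ==> h w : carrier N"
  and add: "!!w w'. w : carrier M ==> w' : carrier M ==> h (w \<oplus>\<^bsub>M\<^esub> w') = h w \<oplus>\<^bsub>N\<^esub> h w'"
  and f: "finite B" "!!b. b : B ==> f b : carrier M"
 shows "h (\<Oplus>\<^bsub>M\<^esub>b\<in>B. f b) = (\<Oplus>\<^bsub>N\<^esub>b\<in>B. h (f b))"
proof -
 interpret M: abelian_group M by fact
 interpret N: abelian_group N by fact
 show ?thesis using f
 proof (induction B rule: finite_induct)
  case empty
  show ?case unfolding M.finsum_empty N.finsum_empty by (rule additive_zero[OF M N cl add])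
 next
  case (insert b B)
  have f: "f : B \<rightarrow> carrier M" "f b : carrier M" using insert.prems by auto
  have hf: "(%b. h (f b)) : B \<rightarrow> carrier N" "h (f b) : carrier N" using f cl by auto
  show ?case
   unfolding M.finsum_insert[OF insert.hyps f] N.finsum_insert[OF insert.hyps hf]
    add[OF f(2) M.finsum_closed[OF f(1)]]
   using insert.IH insert.prems by simp
 qed
qed

lemma (in left_module) smult_r_zero: "a : carrier R ==> a \<odot>\<^bsub>M\<^esub> \<zero>\<^bsub>M\<^esub> = \<zero>\<^bsub>M\<^esub>"
 by (rule additive_zero[OF M.abelian_group_axioms M.abelian_group_axioms]) (auto intro: smult_closed smult_r_distr)

lemma (in left_module) smult_l_zero: "w : carrier M ==> \<zero>\<^bsub>R\<^esub> \<odot>\<^bsub>M\<^esub> w = \<zero>\<^bsub>M\<^esub>"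
 by (rule additive_zero[OF R.abelian_group_axioms M.abelian_group_axioms]) (auto intro: smult_closed smult_l_distr)

lemma (in left_module) submodule_leftI:
 assumes "U \<subseteq> carrier M" "\<zero>\<^bsub>M\<^esub> : U" "!!a. a : U ==> \<ominus>\<^bsub>M\<^esub> a : U"
  "!!a b. a : U ==> b : U ==> a \<oplus>\<^bsub>M\<^esub> b : U" "!!a b. a : carrier R ==> b : U ==> a \<odot>\<^bsub>M\<^esub> b : U"
 shows "submodule U R M"
 using assms by (intro submodule.intro subgroup.intro) (auto simp: submodule_axioms_def a_inv_def)

lemma (in left_module) submodule_leftE:
 assumes "submodule U R M"
 shows "U \<subseteq> carrier M" "\<zero>\<^bsub>M\<^esub> : U" "!!a. a : U ==> \<ominus>\<^bsub>M\<^esub> a : U"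
  "!!a b. a : U ==> b : U ==> a \<oplus>\<^bsub>M\<^esub> b : U" "!!a b. a : carrier R ==> b : U ==> a \<odot>\<^bsub>M\<^esub> b : U"
proof -
 have g: "subgroup U (add_monoid M)" using assms by (rule submodule.axioms)
 show "U \<subseteq> carrier M" using subgroup.subset[OF g] by simp
 show "\<zero>\<^bsub>M\<^esub> : U" using subgroup.one_closed[OF g] by simp
 show "\<ominus>\<^bsub>M\<^esub> a : U" if "a : U" for a using subgroup.m_inv_closed[OF g that] by (simp add: a_inv_def)
 show "a \<oplus>\<^bsub>M\<^esub> b : U" if "a : U" "b : U" for a b using subgroup.m_closed[OF g that] by simp
 show "a \<odot>\<^bsub>M\<^esub> b : U" if "a : carrier R" "b : U" for a b by (rule submodule.smult_closed[OF assms that])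
qed

text \<open>A direct sum decomposition is the same as an idempotent endomorphism: its fixed points
  and its kernel are complementary submodules, and conversely the projection to one summand along
  the other is idempotent.\<close>

lemma indecomposable_module_iff:
 fixes M (structure)
 assumes "left_module R M"
 shows "indecomposable_module R M \<longleftrightarrow> carrier M ~= {\<zero>} &
  (ALL h. left_module_hom R M M h & (ALL w:carrier M. h (h w) = h w) -->
   (ALL w:carrier M. h w = \<zero>) \<or> (ALL w:carrier M. h w = w))"
proof -
 interpret left_module R M by fact
 note ag = M.abelian_group_axioms
 show ?thesis
 proof (intro iffI conjI allI impI)
  assume ind: "indecomposable_module R M"
  then show "carrier M ~= {\<zero>}" by (simp add: indecomposable_module_def)
  fix h assume h: "left_module_hom R M M h & (ALL w:carrier M. h (h w) = h w)"
  note hD = left_module_homD[OF conjunct1[OF h]]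
  have hh: "h (h w) = h w" if "w : carrier M" for w using h that by blast
  have h0: "h \<zero> = \<zero>" by (rule additive_zero[OF ag ag hD(1,2)])
  have hm: "h (\<ominus> w) = \<ominus> h w" if w: "w : carrier M" for w
  proof -
   have "h (\<ominus> w) \<oplus> h w = \<zero>"
    unfolding hD(2)[OF M.a_inv_closed[OF w] w, symmetric] M.l_neg[OF w] by (rule h0)
   then show ?thesis by (intro M.minus_equality[symmetric] hD(1) w M.a_inv_closed)
  qed
  let ?U = "{w\<in>carrier M. h w = w}" and ?V = "{w\<in>carrier M. h w = \<zero>}"
  have ind': "U = {\<zero>} \<or> V = {\<zero>}"
   if "submodule U R M" "submodule V R M" "U \<inter> V = {\<zero>}" "U <+>\<^bsub>M\<^esub> V = carrier M" for U V
   using ind that unfolding indecomposable_module_def by simp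
  have U: "submodule ?U R M" by (rule submodule_leftI) (use hD h0 hm smult_closed in auto)
  have V': "submodule ?V R M" by (rule submodule_leftI) (use hD h0 hm smult_closed smult_r_zero in auto)
  have UV: "?U \<inter> ?V = {\<zero>}" using h0 by auto
  have V: "w \<oplus> \<ominus> h w : ?V" if w: "w : carrier M" for w
   using w hD(1)[OF w] by (simp add: hD(2) hm hh M.r_neg)
  have "?U <+>\<^bsub>M\<^esub> ?V = carrier M"
  proof (intro subset_antisym subsetI)
   fix w assume "w : ?U <+>\<^bsub>M\<^esub> ?V"
   then show "w : carrier M" by (auto simp: set_add_def')
  next
   fix w assume w: "w : carrier M"
   have "w = h w \<oplus> (w \<oplus> \<ominus> h w)" using w hD(1)[OF w] by (simp add: M.a_lcomm M.r_neg)
   moreover have "h w : ?U" using w hD(1) hh by simp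
   ultimately show "w : ?U <+>\<^bsub>M\<^esub> ?V" using V[OF w] unfolding set_add_def' by blast
  qed
  then have "?U = {\<zero>} \<or> ?V = {\<zero>}" by (rule ind'[OF U V' UV])
  then show "(ALL w:carrier M. h w = \<zero>) \<or> (ALL w:carrier M. h w = w)"
  proof
   assume "?U = {\<zero>}"
   then show ?thesis using hD(1) hh by blast
  next
   assume V0: "?V = {\<zero>}"
   have "h w = w" if w: "w : carrier M" for w
   proof -
    have "w \<oplus> \<ominus> h w = \<zero>" using V[OF w] unfolding V0 by (rule singletonD)
    then have "\<ominus> (\<ominus> h w) = w" by (rule M.minus_equality) (use w hD(1)[OF w] in auto)
    then show ?thesis using hD(1)[OF w] by simp
   qed
   then show ?thesis by blast
  qed
 next
  assume R: "carrier M ~= {\<zero>} &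
  (ALL h. left_module_hom R M M h & (ALL w:carrier M. h (h w) = h w) -->
   (ALL w:carrier M. h w = \<zero>) \<or> (ALL w:carrier M. h w = w))"
  show "indecomposable_module R M"
   unfolding indecomposable_module_def
  proof (intro conjI allI impI, fact, use R in blast, elim conjE)
   fix U V assume U: "submodule U R M" and V: "submodule V R M" and UV: "U \<inter> V = {\<zero>}" "U <+>\<^bsub>M\<^esub> V = carrier M"
   note UE = submodule_leftE[OF U] and VE = submodule_leftE[OF V]
   have Uc: "u : U ==> u : carrier M" and Vc: "u : V ==> u : carrier M" for u using UE(1) VE(1) by auto
   have unique: "u = u'" if "u : U" "u' : U" "v : V" "v' : V" "u \<oplus> v = u' \<oplus> v'" for u u' v v'
   proof -
    have c: "u : carrier M" "u' : carrier M" "v : carrier M" "v' : carrier M" using that Uc Vc by auto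
    have "\<ominus> u' \<oplus> u = (\<ominus> u' \<oplus> (u \<oplus> v)) \<oplus> \<ominus> v" using c by (simp add: M.a_assoc M.r_neg)
    also have "... = v' \<oplus> \<ominus> v" unfolding that(5) using c by (simp add: M.a_assoc[symmetric] M.l_neg)
    finally have "\<ominus> u' \<oplus> u : V" using that VE(3,4) by simp
    then have "\<ominus> u' \<oplus> u : U \<inter> V" using that UE(3,4) by simp
    then have "\<ominus> u' \<oplus> u = \<zero>" unfolding UV by simp
    then have "\<ominus> u = \<ominus> u'" by (rule M.minus_equality) (use c in auto)
    then show ?thesis using c by (metis M.minus_minus)
   qed
   \<comment> \<open>The projection to \<open>U\<close> along \<open>V\<close>; the description is
     well defined by \<open>unique\<close>.\<close>
   define h where "h w = (THE u. u : U & (EX v:V. w = u \<oplus> v))" for w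
   have h: "h (u \<oplus> v) = u" if "u : U" "v : V" for u v
    unfolding h_def
   proof (rule the_equality)
    show "u : U & (EX v':V. u \<oplus> v = u \<oplus> v')" using that by blast
    show "u' = u" if "u' : U & (EX v':V. u \<oplus> v = u' \<oplus> v')" for u'
     using that unique[OF _ \<open>u : U\<close> _ \<open>v : V\<close>, of u'] by metis
   qed
   have dec: "EX u:U. EX v:V. w = u \<oplus> v" if "w : carrier M" for w
    using that unfolding UV(2)[symmetric] set_add_def' by blast
   have hU: "h u = u" if "u : U" for u using h[OF that VE(2)] Uc[OF that] by simp
   have hV: "h v = \<zero>" if "v : V" for v using h[OF UE(2) that] Vc[OF that] by simp
   have hc: "h w : U" if w: "w : carrier M" for w
   proof -
    obtain u v where "u : U" "v : V" "w = u \<oplus> v" using dec[OF w] by blast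
    then show ?thesis using h by simp
   qed
   have "left_module_hom R M M h"
    unfolding left_module_hom_def
   proof (intro conjI ballI)
    show "h w : carrier M" if "w : carrier M" for w using hc[OF that] Uc by blast
   next
    fix w w' assume "w : carrier M" "w' : carrier M"
    then obtain u v u' v' where e: "u : U" "v : V" "w = u \<oplus> v" "u' : U" "v' : V" "w' = u' \<oplus> v'" using dec by metis
    have "w \<oplus> w' = (u \<oplus> u') \<oplus> (v \<oplus> v')" using e Uc Vc by (simp add: M.a_ac)
    then show "h (w \<oplus> w') = h w \<oplus> h w'" using e h UE(4) VE(4) by simp
   next
    fix a w assume a: "a : carrier R" and "w : carrier M"
    then obtain u v where e: "u : U" "v : V" "w = u \<oplus> v" using dec by metis
    have "a \<odot> w = (a \<odot> u) \<oplus> (a \<odot> v)" unfolding e(3) using a e Uc Vc by (intro smult_r_distr) auto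
    then show "h (a \<odot> w) = a \<odot> h w" using e h UE(5)[OF a] VE(5)[OF a] by simp
   qed
   moreover have "h (h w) = h w" if "w : carrier M" for w using hU hc that by blast
   ultimately have "(ALL w:carrier M. h w = \<zero>) \<or> (ALL w:carrier M. h w = w)" using R by blast
   then show "U = {\<zero>} \<or> V = {\<zero>}"
   proof
    assume 0: "ALL w:carrier M. h w = \<zero>"
    have "u = \<zero>" if "u : U" for u using hU[OF that] 0 Uc[OF that] by simp
    then show ?thesis using UE(2) by blast
   next
    assume 1: "ALL w:carrier M. h w = w"
    have "v = \<zero>" if "v : V" for v using hV[OF that] 1 Vc[OF that] by simp
    then show ?thesis using VE(2) by blast
   qed
  qed
 qed
qed

lemma module_iso_iff_hom:
 "module_iso R M N \<longleftrightarrow> (EX h. bij_betw h (carrier M) (carrier N) & left_module_hom R M N h)"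
 unfolding module_iso_def left_module_hom_def by (auto simp: bij_betw_def)

lemma left_module_hom_comp:
 "left_module_hom R L M g ==> left_module_hom R M N h ==> left_module_hom R L N (h \<circ> g)"
 unfolding left_module_hom_def by simp

lemma left_module_hom_inverse:
 assumes "left_module R M" "bij_betw h (carrier M) (carrier N)" "left_module_hom R M N h"
 shows "left_module_hom R N M (the_inv_into (carrier M) h)"
 unfolding left_module_hom_def
proof -
 interpret left_module R M by fact
 let ?g = "the_inv_into (carrier M) h"
 have inj: "inj_on h (carrier M)" and im: "h ` carrier M = carrier N" using assms(2) by (auto simp: bij_betw_def)
 note hD = left_module_homD[OF assms(3)]
 have g: "?g w : carrier M" "h (?g w) = w" if "w : carrier N" for w
  using the_inv_into_into[OF inj _ subset_refl, of w] f_the_inv_into_f[OF inj, of w] im that by auto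
 have gh: "?g (h w) = w" if "w : carrier M" for w by (rule the_inv_into_f_f[OF inj that])
 show "(ALL w:carrier N. ?g w : carrier M) &
  (ALL w:carrier N. ALL w':carrier N. ?g (w \<oplus>\<^bsub>N\<^esub> w') = ?g w \<oplus>\<^bsub>M\<^esub> ?g w') &
  (ALL a:carrier R. ALL w:carrier N. ?g (a \<odot>\<^bsub>N\<^esub> w) = a \<odot>\<^bsub>M\<^esub> ?g w)"
 proof (intro conjI ballI)
  fix w w' assume w: "w : carrier N" "w' : carrier N"
  have "?g (h (?g w \<oplus>\<^bsub>M\<^esub> ?g w')) = ?g w \<oplus>\<^bsub>M\<^esub> ?g w'" using g(1) w by (intro gh M.a_closed)
  then show "?g (w \<oplus>\<^bsub>N\<^esub> w') = ?g w \<oplus>\<^bsub>M\<^esub> ?g w'" using w by (simp add: hD(2) g)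
 next
  fix a w assume w: "a : carrier R" "w : carrier N"
  have "?g (h (a \<odot>\<^bsub>M\<^esub> ?g w)) = a \<odot>\<^bsub>M\<^esub> ?g w" using g(1) w by (intro gh smult_closed)
  then show "?g (a \<odot>\<^bsub>N\<^esub> w) = a \<odot>\<^bsub>M\<^esub> ?g w" using w by (simp add: hD(3) g)
 qed (use g in blast)
qed

lemma module_isoE:
 assumes "left_module R M" "module_iso R M N"
 obtains h g where "left_module_hom R M N h" "left_module_hom R N M g"
  "!!w. w : carrier M ==> g (h w) = w" "!!w. w : carrier N ==> h (g w) = w"
proof -
 obtain h where h: "bij_betw h (carrier M) (carrier N)" "left_module_hom R M N h"
  using assms(2) unfolding module_iso_iff_hom by blast
 show thesis
  by (rule that[OF h(2) left_module_hom_inverse[OF assms(1) h]])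
   (use h(1) in "auto simp: bij_betw_def the_inv_into_f_f f_the_inv_into_f")
qed

lemma module_isoI:
 assumes "left_module_hom R M N h" "left_module_hom R N M g"
  "!!w. w : carrier M ==> g (h w) = w" "!!w. w : carrier N ==> h (g w) = w"
 shows "module_iso R M N"
 unfolding module_iso_iff_hom
 by (intro exI[of _ h] conjI assms(1) bij_betw_byWitness[of _ g])
  (use assms left_module_homD(1)[OF assms(1)] left_module_homD(1)[OF assms(2)] in auto)

lemma module_iso_refl: "left_module R M ==> module_iso R M M"
 by (rule module_isoI[of _ _ _ id id]) (auto simp: left_module_hom_def)

lemma module_iso_sym:
 assumes "left_module R M" "module_iso R M N"
 shows "module_iso R N M"
proof -
 obtain h g where "left_module_hom R M N h" "left_module_hom R N M g"
  "!!w. w : carrier M ==> g (h w) = w" "!!w. w : carrier N ==> h (g w) = w"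
  using assms by (rule module_isoE) (rule that)
 then show ?thesis by (intro module_isoI)
qed

lemma module_iso_trans:
 assumes "module_iso R L M" "module_iso R M N"
 shows "module_iso R L N"
 using assms unfolding module_iso_iff_hom by (metis bij_betw_trans left_module_hom_comp)

lemma indecomposable_module_iso:
 assumes M: "left_module R M" and N: "left_module R N" and iso: "module_iso R M N" and ind: "indecomposable_module R M"
 shows "indecomposable_module R N"
proof -
 interpret M: left_module R M by fact
 interpret N: left_module R N by fact
 obtain h g where h: "left_module_hom R M N h" and g: "left_module_hom R N M g"
  and gh: "!!w. w : carrier M ==> g (h w) = w" and hg: "!!w. w : carrier N ==> h (g w) = w"
  using M iso by (rule module_isoE) (rule that)
 note hD = left_module_homD[OF h] and gD = left_module_homD[OF g]
 have h0: "h \<zero>\<^bsub>M\<^esub> = \<zero>\<^bsub>N\<^esub>" by (rule additive_zero[OF M.M.abelian_group_axioms N.M.abelian_group_axioms hD(1,2)])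
 have g0: "g \<zero>\<^bsub>N\<^esub> = \<zero>\<^bsub>M\<^esub>" using gh[of "\<zero>\<^bsub>M\<^esub>"] h0 by simp
 show ?thesis unfolding indecomposable_module_iff[OF N]
 proof (intro conjI allI impI)
  show "carrier N ~= {\<zero>\<^bsub>N\<^esub>}"
  proof
   assume N0: "carrier N = {\<zero>\<^bsub>N\<^esub>}"
   have "w = \<zero>\<^bsub>M\<^esub>" if "w : carrier M" for w using gh[OF that] hD(1)[OF that] g0 unfolding N0 by simp
   then have "carrier M = {\<zero>\<^bsub>M\<^esub>}" using M.M.zero_closed by blast
   then show False using ind by (simp add: indecomposable_module_def)
  qed
  fix k assume k: "left_module_hom R N N k & (ALL w:carrier N. k (k w) = k w)"
  note kD = left_module_homD[OF conjunct1[OF k]]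
  have "left_module_hom R M M (g \<circ> (k \<circ> h))" using k h g by (intro left_module_hom_comp) auto
  moreover have "(g \<circ> (k \<circ> h)) ((g \<circ> (k \<circ> h)) w) = (g \<circ> (k \<circ> h)) w" if "w : carrier M" for w
   using k that by (simp add: hg kD hD)
  ultimately have "(ALL w:carrier M. (g \<circ> (k \<circ> h)) w = \<zero>\<^bsub>M\<^esub>) \<or> (ALL w:carrier M. (g \<circ> (k \<circ> h)) w = w)"
   using ind unfolding indecomposable_module_iff[OF M] by blast
  then show "(ALL w:carrier N. k w = \<zero>\<^bsub>N\<^esub>) \<or> (ALL w:carrier N. k w = w)"
  proof
   assume 0: "ALL w:carrier M. (g \<circ> (k \<circ> h)) w = \<zero>\<^bsub>M\<^esub>"
   have "k w = \<zero>\<^bsub>N\<^esub>" if w: "w : carrier N" for w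
    using 0[rule_format, OF gD(1)[OF w]] hg[OF kD(1)[OF w]] by (simp add: hg[OF w] h0)
   then show ?thesis by blast
  next
   assume 1: "ALL w:carrier M. (g \<circ> (k \<circ> h)) w = w"
   have "k w = w" if w: "w : carrier N" for w
    using 1[rule_format, OF gD(1)[OF w]] hg[OF kD(1)[OF w]] by (simp add: hg[OF w])
   then show ?thesis by blast
  qed
 qed
qed

text \<open>All axioms carry over along the bijection. The condition on zero is explicit because
  nothing else is known about the record \<open>N\<close>, whose zero might not be the neutral
  element.\<close>

lemma left_module_transfer:
 assumes M: "left_module R M" and bij: "bij_betw h (carrier M) (carrier N)" and h: "left_module_hom R M N h"
  and zero: "h \<zero>\<^bsub>M\<^esub> = \<zero>\<^bsub>N\<^esub>"
 shows "left_module R N"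
proof -
 interpret M: left_module R M by fact
 note hD = left_module_homD[OF h]
 have im: "carrier N = h ` carrier M" using bij by (simp add: bij_betw_def)
 show ?thesis
 proof (rule left_module.intro)
  show "ring R" by (rule M.R.ring_axioms)
  show "abelian_group N"
  proof (rule abelian_groupI)
   show "\<zero>\<^bsub>N\<^esub> : carrier N" unfolding zero[symmetric] by (rule hD(1)[OF M.M.zero_closed])
   show "EX y:carrier N. y \<oplus>\<^bsub>N\<^esub> x = \<zero>\<^bsub>N\<^esub>" if x: "x : carrier N" for x
   proof -
    obtain w where w: "w : carrier M" "x = h w" using x unfolding im by blast
    have "h (\<ominus>\<^bsub>M\<^esub> w) \<oplus>\<^bsub>N\<^esub> x = \<zero>\<^bsub>N\<^esub>" 
     unfolding w(2) hD(2)[OF M.M.a_inv_closed[OF w(1)] w(1), symmetric] M.M.l_neg[OF w(1)] by (rule zero)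
    then show ?thesis by (rule bexI[OF _ hD(1)[OF M.M.a_inv_closed[OF w(1)]]])
   qed
  next
   fix x y z assume "x : carrier N" "y : carrier N" "z : carrier N"
   then obtain a b c where abc: "a : carrier M" "b : carrier M" "c : carrier M" "x = h a" "y = h b" "z = h c"
    unfolding im by blast
   show "x \<oplus>\<^bsub>N\<^esub> y \<oplus>\<^bsub>N\<^esub> z = x \<oplus>\<^bsub>N\<^esub> (y \<oplus>\<^bsub>N\<^esub> z)"
    unfolding abc(4-6) using hD(2) abc(1-3) M.M.a_assoc M.M.a_closed by metis
  next
   fix x y assume "x : carrier N" "y : carrier N"
   then obtain a b where ab: "a : carrier M" "b : carrier M" "x = h a" "y = h b" unfolding im by blast
   show "x \<oplus>\<^bsub>N\<^esub> y : carrier N" unfolding ab(3,4) hD(2)[OF ab(1,2), symmetric] by (intro hD(1) M.M.a_closed ab)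
   show "x \<oplus>\<^bsub>N\<^esub> y = y \<oplus>\<^bsub>N\<^esub> x"
    unfolding ab(3,4) hD(2)[OF ab(1,2), symmetric] hD(2)[OF ab(2,1), symmetric] M.M.a_comm[OF ab(1,2)] ..
  next
   fix x assume "x : carrier N"
   then obtain a where a: "a : carrier M" "x = h a" unfolding im by blast
   show "\<zero>\<^bsub>N\<^esub> \<oplus>\<^bsub>N\<^esub> x = x"
    unfolding a(2) zero[symmetric] hD(2)[OF M.M.zero_closed a(1), symmetric] M.M.l_zero[OF a(1)] ..
  qed
  show "left_module_axioms R N"
  proof (rule left_module_axioms.intro)
   fix a x y assume "a : carrier R" "x : carrier N" "y : carrier N"
   then obtain v w where c: "a : carrier R" "v : carrier M" "w : carrier M" and e: "x = h v" "y = h w"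
    unfolding im by blast
   show "a \<odot>\<^bsub>N\<^esub> (x \<oplus>\<^bsub>N\<^esub> y) = a \<odot>\<^bsub>N\<^esub> x \<oplus>\<^bsub>N\<^esub> a \<odot>\<^bsub>N\<^esub> y"
    unfolding e using M.smult_r_distr[OF c] hD(2,3) c M.smult_closed M.M.a_closed by metis
  next
   fix a b x assume "a : carrier R" "b : carrier R" "x : carrier N"
   then obtain v where c: "a : carrier R" "b : carrier R" "v : carrier M" and e: "x = h v"
    unfolding im by blast
   show "(a \<oplus>\<^bsub>R\<^esub> b) \<odot>\<^bsub>N\<^esub> x = a \<odot>\<^bsub>N\<^esub> x \<oplus>\<^bsub>N\<^esub> b \<odot>\<^bsub>N\<^esub> x"
    unfolding e using M.smult_l_distr[OF c] hD(2,3) c M.smult_closed M.R.a_closed by metis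
   show "(a \<otimes>\<^bsub>R\<^esub> b) \<odot>\<^bsub>N\<^esub> x = a \<odot>\<^bsub>N\<^esub> (b \<odot>\<^bsub>N\<^esub> x)"
    unfolding e using M.smult_assoc[OF c] hD(3) c M.smult_closed M.R.m_closed by metis
  next
   fix a x assume a: "a : carrier R" and "x : carrier N"
   then obtain v where v: "v : carrier M" "x = h v" unfolding im by blast
   show "a \<odot>\<^bsub>N\<^esub> x : carrier N" unfolding v(2) hD(3)[OF a v(1), symmetric] by (intro hD(1) M.smult_closed a v)
  next
   fix x assume "x : carrier N"
   then obtain v where v: "v : carrier M" "x = h v" unfolding im by blast
   show "\<one>\<^bsub>R\<^esub> \<odot>\<^bsub>N\<^esub> x = x" unfolding v(2) hD(3)[OF M.R.one_closed v(1), symmetric] M.smult_one[OF v(1)] ..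
  qed
 qed
qed

text \<open>Isomorphism classes are formed among modules with carrier in the vectors over the field,
  so the module of a representation has to be copied to that type along an injection.\<close>

lemma module_transport:
 fixes f :: "'w => 'u" and M :: "('r, 'w) module"
 assumes M: "left_module R M" and inj: "inj_on f (carrier M)"
 obtains N :: "('r, 'u) module" where "left_module R N" "module_iso R M N"
proof -
 interpret M: left_module R M by fact
 define g where "g = the_inv_into (carrier M) f"
 have g: "g (f w) = w" if "w : carrier M" for w unfolding g_def by (rule the_inv_into_f_f[OF inj that])
 let ?N = "\<lparr> carrier = f ` carrier M, monoid.mult = (%_ _. undefined), one = undefined, zero = f \<zero>\<^bsub>M\<^esub>,
   add = (%a b. f (g a \<oplus>\<^bsub>M\<^esub> g b)), smult = (%r a. f (r \<odot>\<^bsub>M\<^esub> g a)) \<rparr> :: ('r, 'u) module"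
 have bij: "bij_betw f (carrier M) (carrier ?N)" using inj by (simp add: bij_betw_def)
 have h: "left_module_hom R M ?N f" by (auto simp: left_module_hom_def g)
 show thesis
  by (rule that[OF left_module_transfer[OF M bij h]]) (use bij h in "auto simp: module_iso_iff_hom")
qed

lemma finite_dim_module_iso:
 assumes M: "finite_dim_module Q I M" and N: "left_module (quiver_algebra Q I) N"
  and iso: "module_iso (quiver_algebra Q I) M N"
  and scalar: "!!c. quiver_algebra_scalar Q I c : carrier (quiver_algebra Q I)"
 shows "finite_dim_module Q I N"
proof -
 let ?R = "quiver_algebra Q I" and ?s = "quiver_algebra_scalar Q I"
 interpret M: left_module ?R M using M by (simp add: finite_dim_module_def)
 interpret N: left_module ?R N by fact
 obtain B where B: "finite B" "B \<subseteq> carrier M" "!!w. w : carrier M ==> EX c. w = (\<Oplus>\<^bsub>M\<^esub>b\<in>B. ?s (c b) \<odot>\<^bsub>M\<^esub> b)"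
  using M unfolding finite_dim_module_def by blast
 obtain h g where h: "left_module_hom ?R M N h" and g: "left_module_hom ?R N M g"
  and gh: "!!w. w : carrier M ==> g (h w) = w" and hg: "!!w. w : carrier N ==> h (g w) = w"
  using M.left_module_axioms iso by (rule module_isoE) (rule that)
 note hD = left_module_homD[OF h] and gD = left_module_homD[OF g]
 have inj: "inj_on h B" using gh B(2) by (intro inj_on_inverseI[of _ g]) auto
 have "EX c. w = (\<Oplus>\<^bsub>N\<^esub>b\<in>h ` B. ?s (c b) \<odot>\<^bsub>N\<^esub> b)" if w: "w : carrier N" for w
 proof -
  obtain c where c: "g w = (\<Oplus>\<^bsub>M\<^esub>b\<in>B. ?s (c b) \<odot>\<^bsub>M\<^esub> b)" using B(3)[OF gD(1)[OF w]] by blast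
  have "w = h (\<Oplus>\<^bsub>M\<^esub>b\<in>B. ?s (c b) \<odot>\<^bsub>M\<^esub> b)" unfolding c[symmetric] hg[OF w] ..
  also have "... = (\<Oplus>\<^bsub>N\<^esub>b\<in>B. h (?s (c b) \<odot>\<^bsub>M\<^esub> b))"
   by (rule additive_finsum[OF M.M.abelian_group_axioms N.M.abelian_group_axioms hD(1,2) B(1)])
    (use B(2) scalar in "auto intro: M.smult_closed")
  also have "... = (\<Oplus>\<^bsub>N\<^esub>b\<in>B. ?s (c (g (h b))) \<odot>\<^bsub>N\<^esub> h b)"
   by (rule N.M.finsum_cong') (use B(2) scalar in "auto simp: hD(3) gh subset_iff intro!: N.smult_closed hD(1)")
  also have "... = (\<Oplus>\<^bsub>N\<^esub>b\<in>h ` B. ?s (c (g b)) \<odot>\<^bsub>N\<^esub> b)"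
   by (rule N.M.finsum_reindex[symmetric, OF _ inj]) (use B(2) scalar in "auto intro!: N.smult_closed hD(1)")
  finally show ?thesis by (intro exI[of _ "%b. c (g b)"])
 qed
 then show ?thesis unfolding finite_dim_module_def
  using N B(1,2) hD(1) by (intro conjI exI[of _ "h ` B"]) auto
qed

lemma mats_eqI:
 assumes "A : mats R C" "B : mats R C" "!!i j. i : R ==> j : C ==> A i j = B i j"
 shows "A = B"
proof (intro ext)
 fix i j
 show "A i j = B i j"
  using assms(3)[of i j] matsD[OF assms(1), of i j] matsD[OF assms(2), of i j] by (cases "i : R & j : C") auto
qed

section \<open>Coordinates on the modules of representations\<close>

abbreviation coset_smult where
 "coset_smult Q I M f w \<equiv> (I +>\<^bsub>path_algebra Q\<^esub> f) \<odot>\<^bsub>M\<^esub> w"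

abbreviation vecs :: "('v, 'a) pre_digraph => ('v => nat) => ('v => 'k::field vec) set" where
 "vecs Q d \<equiv> \<Pi>\<^sub>E v\<in>verts Q. carrier_vec (d v)"

definition rep_map :: "('v, 'a) pre_digraph => ('v => nat) => ('v => nat) => ('v => nat => nat => 'k::field)
  => ('v => 'k vec) => 'v => 'k vec" where
 "rep_map Q d d' p w = (\<lambda>v\<in>verts Q. vec (d' v) (%i. \<Sum>j<d v. p v i j * w v $ j))"

definition basis_vec :: "('v, 'a) pre_digraph => ('v => nat) => 'v => nat => 'v => 'k::field vec" where
 "basis_vec Q d v j = (\<lambda>u\<in>verts Q. vec (d u) (%i. if u = v & i = j then 1 else 0))"

lemma rep_module_carrier: "carrier (rep_module Q d x) = vecs Q d"
 by (simp add: rep_module_def)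

lemma rep_vec_eqI:
 assumes "w : vecs Q d" "w' : vecs Q d"
  and "!!v i. v : verts Q ==> i < d v ==> w v $ i = w' v $ i"
 shows "w = w'"
proof (rule PiE_ext[OF assms(1,2)])
 fix v assume v: "v : verts Q"
 have "w v : carrier_vec (d v)" "w' v : carrier_vec (d v)" using v assms(1,2) by (auto simp: PiE_iff)
 then show "w v = w' v" using assms(3)[OF v] by (intro eq_vecI) auto
qed

lemma rep_module_add:
 assumes "w : vecs Q d" "w' : vecs Q d"
 shows "w \<oplus>\<^bsub>rep_module Q d x\<^esub> w' : vecs Q d"
  and "v : verts Q ==> i < d v ==> (w \<oplus>\<^bsub>rep_module Q d x\<^esub> w') v $ i = w v $ i + w' v $ i"
proof -
 have c: "w v : carrier_vec (d v)" "w' v : carrier_vec (d v)" if "v : verts Q" for v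
  using assms that by (auto simp: PiE_iff)
 show "w \<oplus>\<^bsub>rep_module Q d x\<^esub> w' : vecs Q d"
  using c by (auto simp: rep_module_def)
 show "(w \<oplus>\<^bsub>rep_module Q d x\<^esub> w') v $ i = w v $ i + w' v $ i" if "v : verts Q" "i < d v"
  using c[OF that(1)] that by (simp add: rep_module_def)
qed

lemma rep_module_zero:
 "\<zero>\<^bsub>rep_module Q d x\<^esub> : vecs Q d"
 "v : verts Q ==> i < d v ==> \<zero>\<^bsub>rep_module Q d x\<^esub> v $ i = 0"
 by (auto simp: rep_module_def)

lemma abelian_group_rep_module:
 fixes Q :: "('v, 'a) pre_digraph" and x :: "'a => 'k::field mat"
 shows "abelian_group (rep_module Q d x)"
proof (rule abelian_groupI, unfold rep_module_carrier)
 let ?V = "vecs Q d :: ('v => 'k vec) set"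
 show "\<zero>\<^bsub>rep_module Q d x\<^esub> : ?V" by (rule rep_module_zero)
 fix w assume w: "w : ?V"
 show "\<zero>\<^bsub>rep_module Q d x\<^esub> \<oplus>\<^bsub>rep_module Q d x\<^esub> w = w"
  using w by (intro rep_vec_eqI[of _ Q d]) (simp_all add: rep_module_add rep_module_zero)
 let ?w' = "\<lambda>v\<in>verts Q. - w v"
 have w': "?w' : ?V" using w by (auto simp: PiE_iff)
 have "?w' \<oplus>\<^bsub>rep_module Q d x\<^esub> w = \<zero>\<^bsub>rep_module Q d x\<^esub>"
 proof (rule rep_vec_eqI[of _ Q d])
  fix v i assume vi: "v : verts Q" "i < d v"
  moreover have "w v : carrier_vec (d v)" using w vi by (auto simp: PiE_iff)
  ultimately show "(?w' \<oplus>\<^bsub>rep_module Q d x\<^esub> w) v $ i = \<zero>\<^bsub>rep_module Q d x\<^esub> v $ i"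
   by (simp add: rep_module_add(2)[OF w' w] rep_module_zero(2))
 qed (simp_all add: rep_module_add(1)[OF w' w] rep_module_zero(1))
 with w' show "EX y:?V. y \<oplus>\<^bsub>rep_module Q d x\<^esub> w = \<zero>\<^bsub>rep_module Q d x\<^esub>" by blast
 fix w2 assume w2: "w2 : ?V"
 show "w \<oplus>\<^bsub>rep_module Q d x\<^esub> w2 : ?V" by (rule rep_module_add(1)[OF w w2])
 show "w \<oplus>\<^bsub>rep_module Q d x\<^esub> w2 = w2 \<oplus>\<^bsub>rep_module Q d x\<^esub> w"
  using w w2 by (intro rep_vec_eqI[of _ Q d]) (simp_all add: rep_module_add)
 fix w3 assume w3: "w3 : ?V"
 show "w \<oplus>\<^bsub>rep_module Q d x\<^esub> w2 \<oplus>\<^bsub>rep_module Q d x\<^esub> w3 = w \<oplus>\<^bsub>rep_module Q d x\<^esub> (w2 \<oplus>\<^bsub>rep_module Q d x\<^esub> w3)"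
  using w w2 w3 by (intro rep_vec_eqI[of _ Q d]) (simp_all add: rep_module_add)
qed

lemma rep_module_finsum:
 fixes x :: "'a => 'k::field mat"
 assumes "finite B" "!!b. b : B ==> F b : vecs Q d"
 shows "(\<Oplus>\<^bsub>rep_module Q d x\<^esub>b\<in>B. F b) : vecs Q d"
  and "v : verts Q ==> i < d v ==> (\<Oplus>\<^bsub>rep_module Q d x\<^esub>b\<in>B. F b) v $ i = (SUM b:B. F b v $ i)"
proof -
 interpret abelian_group "rep_module Q d x" by (rule abelian_group_rep_module)
 have cl: "(\<Oplus>\<^bsub>rep_module Q d x\<^esub>b\<in>C. F b) : vecs Q d" if "C \<subseteq> B" for C
  unfolding rep_module_carrier[of Q d x, symmetric]
  by (rule finsum_closed) (use that assms(2) in "auto simp: rep_module_carrier")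
 then show "(\<Oplus>\<^bsub>rep_module Q d x\<^esub>b\<in>B. F b) : vecs Q d" by simp
 assume v: "v : verts Q" "i < d v"
 have "(\<Oplus>\<^bsub>rep_module Q d x\<^esub>b\<in>C. F b) v $ i = (SUM b:C. F b v $ i)" if "finite C" "C \<subseteq> B" for C
  using that
 proof (induction C rule: finite_induct)
  case empty
  then show ?case using v by (simp add: rep_module_zero)
 next
  case (insert b C)
  have F: "F : C \<rightarrow> carrier (rep_module Q d x)" "F b : carrier (rep_module Q d x)"
   using insert.prems assms(2) unfolding rep_module_carrier by blast+
  have Fb: "F b : vecs Q d" using insert.prems assms(2) by blast
  have C: "C \<subseteq> B" using insert.prems by blast
  show ?case
   unfolding finsum_insert[OF insert.hyps F] rep_module_add(2)[OF Fb cl[OF C] v] insert.IH[OF C] sum.insert[OF insert.hyps] ..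
 qed
 from this[OF assms(1) subset_refl] show "(\<Oplus>\<^bsub>rep_module Q d x\<^esub>b\<in>B. F b) v $ i = (SUM b:B. F b v $ i)" .
qed

lemma rep_map_closed: "rep_map Q d d' p w : vecs Q d'"
 by (simp add: rep_map_def)

lemma rep_map_index: "v : verts Q ==> i < d' v ==> rep_map Q d d' p w v $ i = (\<Sum>j<d v. p v i j * w v $ j)"
 by (simp add: rep_map_def)

lemma rep_map_comp: "rep_map Q d' d'' q (rep_map Q d d' p w) = rep_map Q d d'' (%v. q v *{d' v} p v) w"
proof (rule rep_vec_eqI[OF rep_map_closed rep_map_closed])
 fix v i assume v: "v : verts Q" "i < d'' v"
 have "rep_map Q d' d'' q (rep_map Q d d' p w) v $ i = (\<Sum>j<d' v. q v i j * (\<Sum>k<d v. p v j k * w v $ k))"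
  using v by (simp add: rep_map_index)
 also have "... = (\<Sum>k<d v. \<Sum>j<d' v. q v i j * p v j k * w v $ k)"
  unfolding sum_distrib_left by (subst sum.swap) (simp add: mult.assoc)
 finally show "rep_map Q d' d'' q (rep_map Q d d' p w) v $ i = rep_map Q d d'' (%v. q v *{d' v} p v) w v $ i"
  using v by (simp add: rep_map_index mmul_def sum_distrib_right)
qed

lemma rep_map_cong: "(!!v. v : verts Q ==> p v = q v) ==> rep_map Q d d' p w = rep_map Q d d' q w"
 by (rule rep_vec_eqI[OF rep_map_closed rep_map_closed]) (simp add: rep_map_index)

lemma rep_map_idm: "w : vecs Q d ==> rep_map Q d d (%v. idm {..<d v}) w = w"
proof (rule rep_vec_eqI[OF rep_map_closed])
 fix v i assume v: "v : verts Q" "i < d v"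
 have "(\<Sum>j<d v. idm {..<d v} i j * w v $ j) = (\<Sum>j<d v. if j = i then w v $ i else 0)"
  by (rule sum.cong) (auto simp: idm_def)
 then show "rep_map Q d d (%v. idm {..<d v}) w v $ i = w v $ i" using v by (simp add: rep_map_index)
qed

lemma rep_map_zero: "rep_map Q d d' (%v. 0) w = \<zero>\<^bsub>rep_module Q d' x\<^esub>"
 by (rule rep_vec_eqI[OF rep_map_closed rep_module_zero(1)]) (simp add: rep_map_index rep_module_zero)

lemma basis_vec_closed: "basis_vec Q d v j : vecs Q d"
 by (simp add: basis_vec_def)

lemma basis_vec_index: "u : verts Q ==> i < d u ==> basis_vec Q d v j u $ i = (if u = v & i = j then 1 else 0)"
 by (simp add: basis_vec_def)

lemma rep_map_basis_vec:
 assumes "u : verts Q" "i < d' u" "j < d v"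
 shows "rep_map Q d d' p (basis_vec Q d v j) u $ i = (if u = v then p v i j else 0)"
proof -
 have "(\<Sum>l<d u. p u i l * basis_vec Q d v j u $ l) = (\<Sum>l<d u. if l = j then (if u = v then p v i j else 0) else 0)"
  by (rule sum.cong) (use assms in "auto simp: basis_vec_index")
 then show ?thesis using assms by (auto simp: rep_map_index)
qed

text \<open>Basis vectors recover the matrix entries; equations between maps thus become equations
  between matrices.\<close>

lemma rep_map_inject:
 assumes "!!v. v : verts Q ==> p v : mats {..<d' v} {..<d v}" "!!v. v : verts Q ==> q v : mats {..<d' v} {..<d v}"
  and "!!w. w : vecs Q d ==> rep_map Q d d' p w = rep_map Q d d' q w" and v: "v : verts Q"
 shows "p v = q v"
proof (rule mats_eqI[OF assms(1,2)[OF v]])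
 fix i j assume "i : {..<d' v}" "j : {..<d v}"
 then show "p v i j = q v i j"
  using rep_map_basis_vec[OF v, of i d' j d v p] rep_map_basis_vec[OF v, of i d' j d v q] assms(3)[OF basis_vec_closed, of v j] by simp
qed

text \<open>Collects what \<open>square_zero_ideal\<close> provides; the comparison of points of the
  variety with modules takes place here.\<close>

locale square_zero_algebra =
 fixes Q :: "('v, 'a) pre_digraph" and I :: "(('v, 'a) path => 'k::field) set"
 assumes fin: "fin_digraph Q" and I_eq: "I = arrow_ideal_power Q 2" and ideal: "ideal I (path_algebra Q)"
begin

interpretation fin_digraph Q by (rule fin)

interpretation PA: ring "path_algebra Q :: (('v, 'a) path => 'k) ring" by (rule ring_path_algebra[OF fin])

interpretation I: ideal I "path_algebra Q" by (rule ideal)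

interpretation cl: ring_hom_ring "path_algebra Q" "quiver_algebra Q I" "(+>\<^bsub>path_algebra Q\<^esub>) I"
 unfolding quiver_algebra_def by (rule I.rcos_ring_hom_ring)

lemma quiver_algebra_carrierE:
 assumes "a : carrier (quiver_algebra Q I)"
 obtains f where "f : carrier (path_algebra Q)" "a = I +>\<^bsub>path_algebra Q\<^esub> f"
 using assms unfolding quiver_algebra_def FactRing_def A_RCOSETS_def' partial_object.simps by blast

lemma quiver_algebra_zero: "\<zero>\<^bsub>quiver_algebra Q I\<^esub> = I"
 unfolding quiver_algebra_def FactRing_def by (simp only: ring_record_simps)

lemma vertex_path: "v : verts Q ==> (v, []) : paths Q"
 using paths_Nil[OF wf_digraph_axioms] by blast

lemma arrow_path: "ar : arcs Q ==> (tail Q ar, [ar]) : paths Q"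
 by (simp add: paths_Cons[OF wf_digraph_axioms] paths_Nil[OF wf_digraph_axioms])

lemma coset_smult_closed:
 "left_module (quiver_algebra Q I) M ==> f : carrier (path_algebra Q) ==> w : carrier M ==> coset_smult Q I M f w : carrier M"
 by (rule left_module.smult_closed[OF _ cl.hom_closed])

lemma coset_smult_add:
 assumes "left_module (quiver_algebra Q I) M" "f : carrier (path_algebra Q)" "g : carrier (path_algebra Q)" "w : carrier M"
 shows "coset_smult Q I M (f \<oplus>\<^bsub>path_algebra Q\<^esub> g) w = coset_smult Q I M f w \<oplus>\<^bsub>M\<^esub> coset_smult Q I M g w"
 unfolding cl.hom_add[OF assms(2,3)]
 by (rule left_module.smult_l_distr[OF assms(1) cl.hom_closed[OF assms(2)] cl.hom_closed[OF assms(3)] assms(4)])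

lemma coset_smult_mult:
 assumes "left_module (quiver_algebra Q I) M" "f : carrier (path_algebra Q)" "g : carrier (path_algebra Q)" "w : carrier M"
 shows "coset_smult Q I M (f \<otimes>\<^bsub>path_algebra Q\<^esub> g) w = coset_smult Q I M f (coset_smult Q I M g w)"
 unfolding cl.hom_mult[OF assms(2,3)]
 by (rule left_module.smult_assoc[OF assms(1) cl.hom_closed[OF assms(2)] cl.hom_closed[OF assms(3)] assms(4)])

lemma coset_smult_ideal:
 assumes "left_module (quiver_algebra Q I) M" "f : I" "w : carrier M"
 shows "coset_smult Q I M f w = \<zero>\<^bsub>M\<^esub>"
 using left_module.smult_l_zero[OF assms(1,3)] by (simp only: I.a_rcos_const[OF assms(2)] quiver_algebra_zero)

lemma coset_smult_one:
 assumes "left_module (quiver_algebra Q I) M" "w : carrier M"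
 shows "coset_smult Q I M \<one>\<^bsub>path_algebra Q\<^esub> w = w"
 unfolding cl.hom_one by (rule left_module.smult_one[OF assms])

text \<open>Modulo the ideal the algebra is generated by scalar multiples of the trivial paths and by the arrows.\<close>

lemma left_module_hom_if_generators:
 assumes M: "left_module (quiver_algebra Q I) M" and N: "left_module (quiver_algebra Q I) N"
  and h: "!!w. w : carrier M ==> h w : carrier N"
   "!!w w'. w : carrier M ==> w' : carrier M ==> h (w \<oplus>\<^bsub>M\<^esub> w') = h w \<oplus>\<^bsub>N\<^esub> h w'"
  and vertex: "!!c v w. v : verts Q ==> w : carrier M ==>
   h (coset_smult Q I M (single c (v, [])) w) = coset_smult Q I N (single c (v, [])) (h w)"
  and arrow: "!!ar w. ar : arcs Q ==> w : carrier M ==>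
   h (coset_smult Q I M (single 1 (tail Q ar, [ar])) w) = coset_smult Q I N (single 1 (tail Q ar, [ar])) (h w)"
 shows "left_module_hom (quiver_algebra Q I) M N h"
 unfolding left_module_hom_def
proof (intro conjI ballI)
 interpret M: left_module "quiver_algebra Q I" M by fact
 interpret N: left_module "quiver_algebra Q I" N by fact
 have h0: "h \<zero>\<^bsub>M\<^esub> = \<zero>\<^bsub>N\<^esub>" by (rule additive_zero[OF M.M.abelian_group_axioms N.M.abelian_group_axioms h])
 fix a w assume a: "a : carrier (quiver_algebra Q I)" and w: "w : carrier M"
 obtain f where f: "f : carrier (path_algebra Q)" "a = I +>\<^bsub>path_algebra Q\<^esub> f" using a by (rule quiver_algebra_carrierE)
 have "h (coset_smult Q I M f w) = coset_smult Q I N f (h w)"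
  using f(1)
 proof (rule path_algebra_induct)
  have "\<zero>\<^bsub>path_algebra Q\<^esub> : I" by (rule I.zero_closed)
  then show "h (coset_smult Q I M \<zero>\<^bsub>path_algebra Q\<^esub> w) = coset_smult Q I N \<zero>\<^bsub>path_algebra Q\<^esub> (h w)"
   by (simp only: coset_smult_ideal[OF M _ w] coset_smult_ideal[OF N _ h(1)[OF w]] h0)
 next
  fix g g' :: "('v, 'a) path => 'k" assume g: "g : carrier (path_algebra Q)" "g' : carrier (path_algebra Q)"
   and IH: "h (coset_smult Q I M g w) = coset_smult Q I N g (h w)" "h (coset_smult Q I M g' w) = coset_smult Q I N g' (h w)"
  show "h (coset_smult Q I M (g \<oplus>\<^bsub>path_algebra Q\<^esub> g') w) = coset_smult Q I N (g \<oplus>\<^bsub>path_algebra Q\<^esub> g') (h w)"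
   unfolding coset_smult_add[OF M g w] coset_smult_add[OF N g h(1)[OF w]]
    h(2)[OF coset_smult_closed[OF M g(1) w] coset_smult_closed[OF M g(2) w]] IH ..
 next
  fix c :: 'k and \<pi> assume "f \<pi> ~= 0"
  then have \<pi>: "\<pi> : paths Q" using f(1) by (auto simp: path_algebra_simps)
  obtain u p where up: "\<pi> = (u, p)" by (cases \<pi>)
  consider "p = []" | ar where "p = [ar]" | "2 \<le> length p" by (cases p; cases "List.tl p") auto
  then show "h (coset_smult Q I M (single c \<pi>) w) = coset_smult Q I N (single c \<pi>) (h w)"
  proof cases
   case 1
   then show ?thesis using vertex[OF paths_start[OF \<pi>[unfolded up]] w] unfolding up by simp
  next
   case (2 ar)
   then have ar: "ar : arcs Q" "u = tail Q ar" using \<pi> unfolding up by (simp_all add: paths_Cons[OF wf_digraph_axioms])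
   have hv: "head Q ar : verts Q" using ar(1) by simp
   \<comment> \<open>Moves the scalar of an arrow into a trivial path, so that the two kinds of
     generators suffice.\<close>
   have e: "single c \<pi> = single c (head Q ar, []) \<otimes>\<^bsub>path_algebra Q\<^esub> single 1 (tail Q ar, [ar])"
    unfolding up 2 ar(2) by (simp add: single_mult_single walk_end_Cons walk_end_Nil)
   have s: "single c (head Q ar, []) : carrier (path_algebra Q)" "single 1 (tail Q ar, [ar]) : carrier (path_algebra Q)"
    by (intro single_carrier vertex_path hv) (intro single_carrier arrow_path ar(1))
   show ?thesis
    unfolding e coset_smult_mult[OF M s w] coset_smult_mult[OF N s h(1)[OF w]] arrow[OF ar(1) w, symmetric]
    by (rule vertex[OF hv coset_smult_closed[OF M s(2) w]])
  next
   case 3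
   have "single c \<pi> : I" unfolding I_eq arrow_ideal_power_def
    using 3 single_carrier[OF \<pi>, of c] by (auto simp: up single_def)
   then show ?thesis by (simp only: coset_smult_ideal[OF M _ w] coset_smult_ideal[OF N _ h(1)[OF w]] h0)
  qed
 qed
 then show "h (a \<odot>\<^bsub>M\<^esub> w) = a \<odot>\<^bsub>N\<^esub> h w" unfolding f(2) .
qed (use h in auto)

lemma action_closed: "path_algebra_action Q d x f w : vecs Q d"
 by (simp add: path_algebra_action_def)

text \<open>Justifies \<open>the_elem\<close> in \<open>rep_module\<close>: representatives of a
  coset differ by an element of \<open>I\<close>, which has no coefficients at paths of length 0 and
  1, and only those enter the action.\<close>

lemma rep_module_smult:
 assumes x: "x : square_zero_reps Q d" and f: "f : carrier (path_algebra Q)"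
  and w: "w : vecs Q d"
 shows "coset_smult Q I (rep_module Q d x) f w = path_algebra_action Q d x f w"
proof -
 have "path_algebra_action Q d x g w = path_algebra_action Q d x f w" if g: "g : I +>\<^bsub>path_algebra Q\<^esub> f" for g
 proof -
  obtain k where k: "k : I" "g = k \<oplus>\<^bsub>path_algebra Q\<^esub> f" using g unfolding a_r_coset_def' by blast
  have kc: "k : carrier (path_algebra Q)" by (rule I.a_Hcarr[OF k(1)])
  have gc: "g : carrier (path_algebra Q)" unfolding k(2) by (rule PA.a_closed[OF kc f])
  have "k (u, []) = 0" "k (u, [ar]) = 0" for u ar
   using k(1) unfolding I_eq arrow_ideal_power_def by fastforce+
  then have "g (u, []) = f (u, [])" "g (u, [ar]) = f (u, [ar])" for u ar
   unfolding k(2) by (simp_all add: path_algebra_simps)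
  then show ?thesis
   by (intro rep_vec_eqI[OF action_closed action_closed])
    (simp add: path_algebra_action_index[OF fin x gc w] path_algebra_action_index[OF fin x f w])
 qed
 moreover have "f : I +>\<^bsub>path_algebra Q\<^esub> f" by (rule I.a_rcos_self[OF f])
 ultimately have "(%f. path_algebra_action Q d x f w) ` (I +>\<^bsub>path_algebra Q\<^esub> f) = {path_algebra_action Q d x f w}"
  by blast
 then show ?thesis unfolding rep_module_def module.simps by (simp only: the_elem_eq)
qed

text \<open>Associativity is where the vanishing of consecutive products enters: the action of
  \<open>f g\<close> ignores terms with two arrows, and in the iterated action they are zero by
  \<open>XX\<close>.\<close>

lemma left_module_rep_module:
 assumes x: "x : square_zero_reps Q d"
 shows "left_module (quiver_algebra Q I) (rep_module Q d x)"
proof (rule left_module.intro)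
 show "ring (quiver_algebra Q I)" unfolding quiver_algebra_def by (rule I.quotient_is_ring)
 show "abelian_group (rep_module Q d x)" by (rule abelian_group_rep_module)
 let ?V = "vecs Q d :: ('v => 'k vec) set"
 let ?A = "%v. {ar. ar : arcs Q & head Q ar = v}"
 define X where "X ar i w = (\<Sum>j<d (tail Q ar). fm (x ar) i j * w (tail Q ar) $ j)" for ar i w
 note sm = rep_module_smult[OF x]
 have idx: "path_algebra_action Q d x f w v $ i = f (v, []) * w v $ i + (SUM ar:?A v. f (tail Q ar, [ar]) * X ar i w)"
  if "f : carrier (path_algebra Q)" "w : ?V" "v : verts Q" "i < d v" for f w v i
  using path_algebra_action_index[OF fin x that] by (simp add: X_def)
 have XX: "(\<Sum>j<d (tail Q ar). fm (x ar) i j * X br j w) = 0" if ab: "ar : arcs Q" "br : arcs Q" "head Q br = tail Q ar" for ar br i w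
 proof -
  have "fm (x ar) *{d (tail Q ar)} fm (x br) = 0" using x ab by (simp add: square_zero_reps_def)
  then have 0: "(\<Sum>j<d (tail Q ar). fm (x ar) i j * fm (x br) j l) = 0" for l by (simp add: mmul_def fun_eq_iff)
  have "(\<Sum>j<d (tail Q ar). fm (x ar) i j * X br j w)
   = (\<Sum>l<d (tail Q br). (\<Sum>j<d (tail Q ar). fm (x ar) i j * fm (x br) j l) * w (tail Q br) $ l)"
   unfolding X_def sum_distrib_left sum_distrib_right by (subst sum.swap) (simp add: mult.assoc)
  then show ?thesis unfolding 0 by simp
 qed
 have X_action: "X ar i (path_algebra_action Q d x g w) = g (tail Q ar, []) * X ar i w"
  if g: "g : carrier (path_algebra Q)" and w: "w : ?V" and ar: "ar : arcs Q" for ar i g w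
 proof -
  have t: "tail Q ar : verts Q" using ar by simp
  have "X ar i (path_algebra_action Q d x g w) = (\<Sum>j<d (tail Q ar). fm (x ar) i j * (g (tail Q ar, []) * w (tail Q ar) $ j))
   + (\<Sum>j<d (tail Q ar). fm (x ar) i j * (SUM br:?A (tail Q ar). g (tail Q br, [br]) * X br j w))"
   unfolding X_def[of ar] sum.distrib[symmetric]
   by (rule sum.cong[OF refl]) (simp add: idx[OF g w t] distrib_left)
  also have "(\<Sum>j<d (tail Q ar). fm (x ar) i j * (SUM br:?A (tail Q ar). g (tail Q br, [br]) * X br j w))
   = (SUM br:?A (tail Q ar). g (tail Q br, [br]) * (\<Sum>j<d (tail Q ar). fm (x ar) i j * X br j w))"
   unfolding sum_distrib_left by (subst sum.swap) (simp add: mult.left_commute)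
  also have "... = 0" using XX[OF ar] by (intro sum.neutral ballI) simp
  finally show ?thesis by (simp add: X_def sum_distrib_left mult.left_commute)
 qed
 have X_add: "X ar i (w \<oplus>\<^bsub>rep_module Q d x\<^esub> w') = X ar i w + X ar i w'" if "w : ?V" "w' : ?V" "ar : arcs Q" for ar i w w'
  unfolding X_def sum.distrib[symmetric]
  by (rule sum.cong[OF refl]) (use that in "simp add: rep_module_add(2)[OF that(1,2)] distrib_left")
 show "left_module_axioms (quiver_algebra Q I) (rep_module Q d x)"
 proof (rule left_module_axioms.intro, unfold rep_module_carrier)
  fix a w w' assume "a : carrier (quiver_algebra Q I)" and w: "w : ?V" "w' : ?V"
  then obtain f where f: "f : carrier (path_algebra Q)" "a = I +>\<^bsub>path_algebra Q\<^esub> f" using quiver_algebra_carrierE by blast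
  show "a \<odot>\<^bsub>rep_module Q d x\<^esub> (w \<oplus>\<^bsub>rep_module Q d x\<^esub> w') = a \<odot>\<^bsub>rep_module Q d x\<^esub> w \<oplus>\<^bsub>rep_module Q d x\<^esub> a \<odot>\<^bsub>rep_module Q d x\<^esub> w'"
   unfolding f(2) sm[OF f(1) w(1)] sm[OF f(1) w(2)] sm[OF f(1) rep_module_add(1)[OF w]]
   by (intro rep_vec_eqI[OF action_closed rep_module_add(1)[OF action_closed action_closed]])
    (simp add: idx[OF f(1)] w rep_module_add[OF w] rep_module_add(2)[OF action_closed action_closed] X_add distrib_left sum.distrib)
 next
  fix a w assume "a : carrier (quiver_algebra Q I)" and w: "w : ?V"
  then obtain f where f: "f : carrier (path_algebra Q)" "a = I +>\<^bsub>path_algebra Q\<^esub> f" using quiver_algebra_carrierE by blast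
  show "a \<odot>\<^bsub>rep_module Q d x\<^esub> w : ?V" unfolding f(2) sm[OF f(1) w] by (rule action_closed)
 next
  fix a b w assume "a : carrier (quiver_algebra Q I)" "b : carrier (quiver_algebra Q I)" and w: "w : ?V"
  then obtain f g where f: "f : carrier (path_algebra Q)" "a = I +>\<^bsub>path_algebra Q\<^esub> f"
   and g: "g : carrier (path_algebra Q)" "b = I +>\<^bsub>path_algebra Q\<^esub> g" using quiver_algebra_carrierE by metis
  show "(a \<oplus>\<^bsub>quiver_algebra Q I\<^esub> b) \<odot>\<^bsub>rep_module Q d x\<^esub> w = a \<odot>\<^bsub>rep_module Q d x\<^esub> w \<oplus>\<^bsub>rep_module Q d x\<^esub> b \<odot>\<^bsub>rep_module Q d x\<^esub> w"
   unfolding f(2) g(2) cl.hom_add[OF f(1) g(1), symmetric] sm[OF f(1) w] sm[OF g(1) w] sm[OF PA.a_closed[OF f(1) g(1)] w]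
  proof (intro rep_vec_eqI[OF action_closed rep_module_add(1)[OF action_closed action_closed]])
   fix v i assume v: "v : verts Q" "i < d v"
   show "path_algebra_action Q d x (f \<oplus>\<^bsub>path_algebra Q\<^esub> g) w v $ i
    = (path_algebra_action Q d x f w \<oplus>\<^bsub>rep_module Q d x\<^esub> path_algebra_action Q d x g w) v $ i"
    unfolding idx[OF PA.a_closed[OF f(1) g(1)] w v] rep_module_add(2)[where d = d and v = v and i = i, OF action_closed action_closed v]
     idx[OF f(1) w v] idx[OF g(1) w v] unfolding path_algebra_simps(5)
    by (simp add: distrib_right sum.distrib)
  qed
  have fg: "(f \<otimes>\<^bsub>path_algebra Q\<^esub> g) (v, []) = f (v, []) * g (v, [])" for v
   unfolding path_algebra_simps(2) by (simp add: walk_end_Nil)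
  \<comment> \<open>An arrow factors in two ways: the arrow from \<open>f\<close> after the trivial
    path at its tail from \<open>g\<close>, or the trivial path at its head from \<open>f\<close>
    after the arrow from \<open>g\<close>.\<close>
  have fg1: "(f \<otimes>\<^bsub>path_algebra Q\<^esub> g) (tail Q ar, [ar]) = f (tail Q ar, [ar]) * g (tail Q ar, []) + f (head Q ar, []) * g (tail Q ar, [ar])" for ar
   unfolding path_algebra_simps(2) by (simp add: walk_end_Nil walk_end_Cons)
  show "(a \<otimes>\<^bsub>quiver_algebra Q I\<^esub> b) \<odot>\<^bsub>rep_module Q d x\<^esub> w = a \<odot>\<^bsub>rep_module Q d x\<^esub> (b \<odot>\<^bsub>rep_module Q d x\<^esub> w)"
   unfolding f(2) g(2) cl.hom_mult[OF f(1) g(1), symmetric] sm[OF g(1) w] sm[OF PA.m_closed[OF f(1) g(1)] w] sm[OF f(1) action_closed]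
  proof (intro rep_vec_eqI[OF action_closed action_closed])
   fix v i assume v: "v : verts Q" "i < d v"
   have "(SUM ar:?A v. (f \<otimes>\<^bsub>path_algebra Q\<^esub> g) (tail Q ar, [ar]) * X ar i w)
    = (SUM ar:?A v. f (tail Q ar, [ar]) * (g (tail Q ar, []) * X ar i w)) + f (v, []) * (SUM ar:?A v. g (tail Q ar, [ar]) * X ar i w)"
    unfolding sum_distrib_left sum.distrib[symmetric] by (rule sum.cong[OF refl]) (auto simp: fg1 algebra_simps)
   moreover have "(SUM ar:?A v. f (tail Q ar, [ar]) * X ar i (path_algebra_action Q d x g w))
    = (SUM ar:?A v. f (tail Q ar, [ar]) * (g (tail Q ar, []) * X ar i w))"
    by (rule sum.cong[OF refl]) (simp add: X_action[OF g(1) w])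
   ultimately show "path_algebra_action Q d x (f \<otimes>\<^bsub>path_algebra Q\<^esub> g) w v $ i
    = path_algebra_action Q d x f (path_algebra_action Q d x g w) v $ i"
    unfolding idx[OF f(1) action_closed v] idx[OF g(1) w v] idx[OF PA.m_closed[OF f(1) g(1)] w v] fg
    by (simp add: algebra_simps)
  qed
 next
  fix w assume w: "w : ?V"
  show "\<one>\<^bsub>quiver_algebra Q I\<^esub> \<odot>\<^bsub>rep_module Q d x\<^esub> w = w"
   unfolding cl.hom_one[symmetric] sm[OF PA.one_closed w]
  proof (intro rep_vec_eqI[OF action_closed w])
   fix v i assume v: "v : verts Q" "i < d v"
   show "path_algebra_action Q d x \<one>\<^bsub>path_algebra Q\<^esub> w v $ i = w v $ i"
    unfolding idx[OF PA.one_closed w v] unfolding path_algebra_simps(3) using v by simp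
  qed
 qed
qed


lemma vertex_action:
 assumes x: "x : square_zero_reps Q d" and w: "w : vecs Q d"
  and v: "v : verts Q" and u: "u : verts Q" "i < d u"
 shows "coset_smult Q I (rep_module Q d x) (single c (v, [])) w u $ i = (if u = v then c * w u $ i else 0)"
proof -
 have s: "single c (v, []) : carrier (path_algebra Q)" by (intro single_carrier vertex_path v)
 show ?thesis
  unfolding rep_module_smult[OF x s w] path_algebra_action_index[OF fin x s w u] by (simp add: single_def)
qed

lemma arrow_action:
 assumes x: "x : square_zero_reps Q d" and w: "w : vecs Q d"
  and ar: "ar : arcs Q" and u: "u : verts Q" "i < d u"
 shows "coset_smult Q I (rep_module Q d x) (single 1 (tail Q ar, [ar])) w u $ i
  = (if u = head Q ar then (\<Sum>j<d (tail Q ar). fm (x ar) i j * w (tail Q ar) $ j) else 0)"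
proof -
 have s: "single 1 (tail Q ar, [ar]) : carrier (path_algebra Q)" by (intro single_carrier arrow_path ar)
 have "(\<Sum>br | br : arcs Q & head Q br = u. single 1 (tail Q ar, [ar]) (tail Q br, [br]) * (\<Sum>j<d (tail Q br). fm (x br) i j * w (tail Q br) $ j))
  = (\<Sum>br | br : arcs Q & head Q br = u. if br = ar then (\<Sum>j<d (tail Q ar). fm (x ar) i j * w (tail Q ar) $ j) else 0)"
  by (rule sum.cong[OF refl]) (simp add: single_def)
 also have "... = (if u = head Q ar then (\<Sum>j<d (tail Q ar). fm (x ar) i j * w (tail Q ar) $ j) else 0)"
  using ar by (subst sum.delta) auto
 finally show ?thesis
  unfolding rep_module_smult[OF x s w] path_algebra_action_index[OF fin x s w u] by (simp add: single_def)
qed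

text \<open>Coordinates are expressed by the algebra itself, as scalar multiples of trivial paths
  acting on basis vectors. Module homomorphisms are therefore determined by the basis
  vectors.\<close>

lemma vec_decomposition:
 assumes x: "x : square_zero_reps Q d" and w: "w : vecs Q d"
 shows "w = (\<Oplus>\<^bsub>rep_module Q d x\<^esub>b\<in>(SIGMA v:verts Q. {..<d v}). case b of (v, j) =>
  coset_smult Q I (rep_module Q d x) (single (w v $ j) (v, [])) (basis_vec Q d v j))"
proof (rule rep_vec_eqI[OF w])
 let ?B = "SIGMA v:verts Q. {..<d v}"
 let ?F = "%b. case b of (v, j) => coset_smult Q I (rep_module Q d x) (single (w v $ j) (v, [])) (basis_vec Q d v j)"
 have B: "finite ?B" by simp
 have F: "?F b : vecs Q d" if "b : ?B" for b
  using that coset_smult_closed[OF left_module_rep_module[OF x], unfolded rep_module_carrier, OF single_carrier[OF vertex_path] basis_vec_closed]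
  by (cases b) auto
 show "(\<Oplus>\<^bsub>rep_module Q d x\<^esub>b\<in>?B. ?F b) : vecs Q d" by (rule rep_module_finsum(1)[OF B F])
 fix u i assume u: "u : verts Q" "i < d u"
 have "(\<Oplus>\<^bsub>rep_module Q d x\<^esub>b\<in>?B. ?F b) u $ i = (SUM b:?B. ?F b u $ i)" by (rule rep_module_finsum(2)[OF B F u])
 also have "... = (SUM b:?B. if b = (u, i) then w u $ i else 0)"
 proof (rule sum.cong[OF refl])
  fix b assume "b : ?B"
  then obtain v j where b: "b = (v, j)" "v : verts Q" "j < d v" by blast
  show "?F b u $ i = (if b = (u, i) then w u $ i else 0)"
   unfolding b(1) prod.case vertex_action[OF x basis_vec_closed b(2) u] basis_vec_index[where d = d and u = u and i = i, OF u] by simp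
 qed
 also have "... = w u $ i" using u by (subst sum.delta[OF B]) simp
 finally show "w u $ i = (\<Oplus>\<^bsub>rep_module Q d x\<^esub>b\<in>?B. ?F b) u $ i" ..
qed

lemma rep_map_hom:
 assumes x: "x : square_zero_reps Q d" and x': "x' : square_zero_reps Q d'" and p: "rhom Q d x d' x' p"
 shows "left_module_hom (quiver_algebra Q I) (rep_module Q d x) (rep_module Q d' x') (rep_map Q d d' p)"
proof (rule left_module_hom_if_generators[OF left_module_rep_module[OF x] left_module_rep_module[OF x']], unfold rep_module_carrier)
 let ?V = "vecs Q d :: ('v => 'k vec) set"
 fix w assume w: "w : ?V"
 show "rep_map Q d d' p w : vecs Q d'" by (rule rep_map_closed)
 fix w' assume w': "w' : ?V"
 show "rep_map Q d d' p (w \<oplus>\<^bsub>rep_module Q d x\<^esub> w') = rep_map Q d d' p w \<oplus>\<^bsub>rep_module Q d' x'\<^esub> rep_map Q d d' p w'"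
  by (intro rep_vec_eqI[OF rep_map_closed rep_module_add(1)[OF rep_map_closed rep_map_closed]])
   (simp add: rep_map_index rep_module_add(2)[OF w w'] rep_module_add(2)[OF rep_map_closed rep_map_closed] distrib_left sum.distrib)
next
 let ?V = "vecs Q d :: ('v => 'k vec) set"
 fix c :: 'k and v w assume v: "v : verts Q" and w: "w : ?V"
 have s: "single c (v, []) : carrier (path_algebra Q)" by (intro single_carrier vertex_path v)
 have smc': "coset_smult Q I (rep_module Q d' x') (single c (v, [])) (rep_map Q d d' p w) : vecs Q d'"
  by (rule coset_smult_closed[OF left_module_rep_module[OF x'] s, unfolded rep_module_carrier, OF rep_map_closed])
 show "rep_map Q d d' p (coset_smult Q I (rep_module Q d x) (single c (v, [])) w)
  = coset_smult Q I (rep_module Q d' x') (single c (v, [])) (rep_map Q d d' p w)"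
 proof (rule rep_vec_eqI[OF rep_map_closed smc'])
  fix u i assume u: "u : verts Q" "i < d' u"
  show "rep_map Q d d' p (coset_smult Q I (rep_module Q d x) (single c (v, [])) w) u $ i
   = coset_smult Q I (rep_module Q d' x') (single c (v, [])) (rep_map Q d d' p w) u $ i"
   unfolding vertex_action[OF x' rep_map_closed v u] rep_map_index[where v = u and i = i and d' = d', OF u]
   by (simp add: vertex_action[OF x w v u(1)] sum_distrib_left mult.left_commute cong: if_cong)
 qed
next
 let ?V = "vecs Q d :: ('v => 'k vec) set"
 fix ar w assume ar: "ar : arcs Q" and w: "w : ?V"
 have s: "single 1 (tail Q ar, [ar]) : carrier (path_algebra Q)" by (intro single_carrier arrow_path ar)
 have smc': "coset_smult Q I (rep_module Q d' x') (single 1 (tail Q ar, [ar])) (rep_map Q d d' p w) : vecs Q d'"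
  by (rule coset_smult_closed[OF left_module_rep_module[OF x'] s, unfolded rep_module_carrier, OF rep_map_closed])
 show "rep_map Q d d' p (coset_smult Q I (rep_module Q d x) (single 1 (tail Q ar, [ar])) w)
  = coset_smult Q I (rep_module Q d' x') (single 1 (tail Q ar, [ar])) (rep_map Q d d' p w)"
 proof (rule rep_vec_eqI[OF rep_map_closed smc'])
  fix u i assume u: "u : verts Q" "i < d' u"
  let ?t = "tail Q ar" and ?h = "head Q ar"
  have t: "?t : verts Q" using ar by simp
  have "(\<Sum>j<d ?h. p ?h i j * (\<Sum>l<d ?t. fm (x ar) j l * w ?t $ l)) = (\<Sum>j<d' ?t. fm (x' ar) i j * (\<Sum>l<d ?t. p ?t j l * w ?t $ l))"
  proof -
   have e: "(p ?h *{d ?h} fm (x ar)) i l = (fm (x' ar) *{d' ?t} p ?t) i l" for l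
    using p ar by (simp add: rhom_def)
   have "(\<Sum>j<d ?h. p ?h i j * (\<Sum>l<d ?t. fm (x ar) j l * w ?t $ l)) = (\<Sum>l<d ?t. (p ?h *{d ?h} fm (x ar)) i l * w ?t $ l)"
    unfolding mmul_def sum_distrib_left sum_distrib_right by (subst sum.swap) (simp add: mult.assoc)
   also have "... = (\<Sum>j<d' ?t. fm (x' ar) i j * (\<Sum>l<d ?t. p ?t j l * w ?t $ l))"
    unfolding e unfolding mmul_def sum_distrib_left sum_distrib_right by (subst sum.swap) (simp add: mult.assoc)
   finally show ?thesis .
  qed
  then show "rep_map Q d d' p (coset_smult Q I (rep_module Q d x) (single 1 (tail Q ar, [ar])) w) u $ i
   = coset_smult Q I (rep_module Q d' x') (single 1 (tail Q ar, [ar])) (rep_map Q d d' p w) u $ i"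
   unfolding arrow_action[OF x' rep_map_closed ar u] rep_map_index[where v = u and i = i and d' = d', OF u]
   by (simp add: arrow_action[OF x w ar u(1)] rep_map_index[OF t] cong: if_cong)
 qed
qed

text \<open>Commuting with the trivial paths keeps a homomorphism inside the vertices, so it is
  given by one matrix \<open>p v\<close> for each vertex; commuting with the arrows makes these
  matrices intertwine \<open>x\<close> and \<open>x'\<close>.\<close>

lemma hom_rep_map:
 assumes x: "x : square_zero_reps Q d" and x': "x' : square_zero_reps Q d'"
  and h: "left_module_hom (quiver_algebra Q I) (rep_module Q d x) (rep_module Q d' x') h"
 obtains p where "rhom Q d x d' x' p" "!!w. w : vecs Q d ==> h w = rep_map Q d d' p w"
proof -
 let ?M = "rep_module Q d x" and ?M' = "rep_module Q d' x'"
 let ?V = "vecs Q d :: ('v => 'k vec) set" and ?V' = "vecs Q d' :: ('v => 'k vec) set"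
 note hD = left_module_homD[OF h, unfolded rep_module_carrier]
 define p where "p v i j = (if v : verts Q & i < d' v & j < d v then h (basis_vec Q d v j) v $ i else 0)" for v i j
 have pm: "p v : mats {..<d' v} {..<d v}" for v by (rule matsI) (auto simp: p_def)
 have hs: "h (coset_smult Q I ?M f w) = coset_smult Q I ?M' f (h w)" if "f : carrier (path_algebra Q)" "w : ?V" for f w
  by (rule hD(3)[OF cl.hom_closed[OF that(1)] that(2)])
 have sc: "coset_smult Q I ?M (single c (v, [])) w : ?V" if "v : verts Q" "w : ?V" for c v w
  using coset_smult_closed[OF left_module_rep_module[OF x] single_carrier[OF vertex_path[OF that(1)]]] that(2) by (simp add: rep_module_carrier)
 have hw: "h w = rep_map Q d d' p w" if w: "w : ?V" for w
 proof (rule rep_vec_eqI[OF hD(1)[OF w] rep_map_closed])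
  let ?B = "SIGMA v:verts Q. {..<d v}"
  let ?F = "%(v, j). coset_smult Q I ?M (single (w v $ j) (v, [])) (basis_vec Q d v j)"
  have B: "finite ?B" by simp
  have F: "?F b : ?V" if "b : ?B" for b using that sc[OF _ basis_vec_closed] by (cases b) auto
  fix u i assume u: "u : verts Q" "i < d' u"
  have "h w = h (\<Oplus>\<^bsub>?M\<^esub>b\<in>?B. ?F b)" using vec_decomposition[OF x w] by (rule arg_cong)
  also have "... = (\<Oplus>\<^bsub>?M'\<^esub>b\<in>?B. h (?F b))"
   by (rule additive_finsum[OF abelian_group_rep_module abelian_group_rep_module, unfolded rep_module_carrier, OF hD(1,2) B F])
  finally have "h w u $ i = (SUM b:?B. h (?F b) u $ i)"
   using rep_module_finsum(2)[where d = d' and v = u and i = i and x = x' and F = "%b. h (?F b)", OF B hD(1)[OF F] u] by simp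
  also have "... = (SUM v:verts Q. \<Sum>j<d v. if v = u then p u i j * w u $ j else 0)"
   unfolding sum.Sigma[OF finite_verts ballI[OF finite_lessThan]]
  proof (rule sum.cong[OF refl])
   fix b assume "b : ?B"
   then obtain v j where b: "b = (v, j)" "v : verts Q" "j < d v" by blast
   have s: "single (w v $ j) (v, []) : carrier (path_algebra Q)" by (intro single_carrier vertex_path b(2))
   show "h (?F b) u $ i = (case b of (v, j) => if v = u then p u i j * w u $ j else 0)"
    unfolding b(1) prod.case hs[OF s basis_vec_closed] vertex_action[OF x' hD(1)[OF basis_vec_closed] b(2) u]
    using b(3) u by (auto simp: p_def)
  qed
  also have "... = (SUM v:verts Q. if v = u then (\<Sum>j<d u. p u i j * w u $ j) else 0)" by (rule sum.cong) auto
  also have "... = (\<Sum>j<d u. p u i j * w u $ j)" using u(1) by simp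
  finally show "h w u $ i = rep_map Q d d' p w u $ i" unfolding rep_map_index[where v = u and i = i and d' = d', OF u] .
 qed
 have "rhom Q d x d' x' p"
  unfolding rhom_def
 proof (intro conjI ballI pm)
  fix ar assume ar: "ar : arcs Q"
  let ?t = "tail Q ar" and ?h = "head Q ar"
  have th: "?t : verts Q" "?h : verts Q" using ar by auto
  have xr: "x : rep_space Q d" "x' : rep_space Q d'" using x x' by (simp_all add: square_zero_reps_def)
  have s: "single 1 (?t, [ar]) : carrier (path_algebra Q)" by (intro single_carrier arrow_path ar)
  show "p ?h *{d ?h} fm (x ar) = fm (x' ar) *{d' ?t} p ?t"
  proof (rule mats_eqI[OF mats_mmul[OF pm rep_space_fm[OF xr(1) ar]] mats_mmul[OF rep_space_fm[OF xr(2) ar] pm]])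
   fix i j assume "i : {..<d' ?h}" "j : {..<d ?t}"
   then have ij: "i < d' ?h" "j < d ?t" by auto
   have smc: "coset_smult Q I ?M (single 1 (?t, [ar])) (basis_vec Q d ?t j) : ?V"
    by (rule coset_smult_closed[OF left_module_rep_module[OF x] s, unfolded rep_module_carrier, OF basis_vec_closed])
   have "(\<Sum>l<d ?t. fm (x ar) k l * basis_vec Q d ?t j ?t $ l) = fm (x ar) k j" for k
   proof -
    have "(\<Sum>l<d ?t. fm (x ar) k l * basis_vec Q d ?t j ?t $ l) = (\<Sum>l<d ?t. if l = j then fm (x ar) k j else 0)"
     by (rule sum.cong) (auto simp: basis_vec_index[OF th(1)])
    then show ?thesis using ij by simp
   qed
   then have L: "coset_smult Q I ?M (single 1 (?t, [ar])) (basis_vec Q d ?t j) ?h $ k = fm (x ar) k j" if "k < d ?h" for k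
    using arrow_action[OF x basis_vec_closed ar th(2) that, of ?t j] by simp
   have "(\<Sum>k<d ?h. p ?h i k * fm (x ar) k j) = h (coset_smult Q I ?M (single 1 (?t, [ar])) (basis_vec Q d ?t j)) ?h $ i"
    unfolding hw[OF smc] rep_map_index[where i = i and d' = d', OF th(2) ij(1)] by (rule sum.cong) (simp_all add: L)
   also have "... = (\<Sum>k<d' ?t. fm (x' ar) i k * h (basis_vec Q d ?t j) ?t $ k)"
    unfolding hs[OF s basis_vec_closed] arrow_action[OF x' hD(1)[OF basis_vec_closed] ar th(2) ij(1)] by simp
   also have "... = (\<Sum>k<d' ?t. fm (x' ar) i k * p ?t k j)"
    by (rule sum.cong) (use th ij in "auto simp: p_def")
   finally show "(p ?h *{d ?h} fm (x ar)) i j = (fm (x' ar) *{d' ?t} p ?t) i j" unfolding mmul_def .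
  qed
 qed
 with hw show thesis by (intro that)
qed

text \<open>Both sides speak of idempotent endomorphisms, and \<open>rep_map\<close> matches these
  with families of matrices.\<close>

lemma indecomposable_rep_module_iff:
 assumes x: "x : square_zero_reps Q d"
 shows "indecomposable_module (quiver_algebra Q I) (rep_module Q d x) \<longleftrightarrow> rindec Q d x"
proof -
 let ?V = "vecs Q d :: ('v => 'k vec) set" and ?z = "\<zero>\<^bsub>rep_module Q d x\<^esub>"
 have ne: "?V ~= {?z} \<longleftrightarrow> (EX v:verts Q. d v ~= 0)"
 proof
  assume V: "?V ~= {?z}"
  show "EX v:verts Q. d v ~= 0"
  proof (rule ccontr)
   assume 0: "\<not> (EX v:verts Q. d v ~= 0)"
   have "w = ?z" if "w : ?V" for w by (rule rep_vec_eqI[OF that rep_module_zero(1)]) (use 0 in auto)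
   then show False using V rep_module_zero(1)[of Q d x] by blast
  qed
 next
  assume "EX v:verts Q. d v ~= 0"
  then obtain v where v: "v : verts Q" "0 < d v" by blast
  have "basis_vec Q d v 0 v $ 0 ~= ?z v $ 0" using v by (simp add: basis_vec_index rep_module_zero)
  then have "basis_vec Q d v 0 ~= ?z" by metis
  then show "?V ~= {?z}" using basis_vec_closed[of Q d v 0] by (metis singletonD)
 qed
 show ?thesis
  unfolding indecomposable_module_iff[OF left_module_rep_module[OF x]] rep_module_carrier rindec_def ne
 proof (intro conj_cong refl iffI allI impI)
  fix p assume H: "ALL h. left_module_hom (quiver_algebra Q I) (rep_module Q d x) (rep_module Q d x) h & (ALL w:?V. h (h w) = h w) -->
    (ALL w:?V. h w = ?z) \<or> (ALL w:?V. h w = w)"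
   and p: "rhom Q d x d x p & (ALL v:verts Q. p v *{d v} p v = p v)"
  have pm: "p v : mats {..<d v} {..<d v}" if "v : verts Q" for v using p that by (simp add: rhom_def)
  have "rep_map Q d d p (rep_map Q d d p w) = rep_map Q d d p w" for w
   unfolding rep_map_comp by (rule rep_map_cong) (use p in blast)
  then have "(ALL w:?V. rep_map Q d d p w = ?z) \<or> (ALL w:?V. rep_map Q d d p w = w)"
   using H[rule_format, of "rep_map Q d d p"] rep_map_hom[OF x x conjunct1[OF p]] by blast
  then show "(ALL v:verts Q. p v = 0) \<or> (ALL v:verts Q. p v = idm {..<d v})"
  proof
   assume 0: "ALL w:?V. rep_map Q d d p w = ?z"
   have "p v = 0" if v: "v : verts Q" for v
    by (rule rep_map_inject[of Q p d d "%v. 0", OF pm _ _ v]) (use 0 in "simp_all add: rep_map_zero[of _ _ _ _ x]")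
   then show ?thesis by blast
  next
   assume 1: "ALL w:?V. rep_map Q d d p w = w"
   have "p v = idm {..<d v}" if v: "v : verts Q" for v
    by (rule rep_map_inject[of Q p d d "%v. idm {..<d v}", OF pm _ _ v]) (use 1 in "simp_all add: rep_map_idm")
   then show ?thesis by blast
  qed
 next
  fix h assume H: "ALL p. rhom Q d x d x p & (ALL v:verts Q. p v *{d v} p v = p v) -->
    (ALL v:verts Q. p v = 0) \<or> (ALL v:verts Q. p v = idm {..<d v})"
   and h: "left_module_hom (quiver_algebra Q I) (rep_module Q d x) (rep_module Q d x) h & (ALL w:?V. h (h w) = h w)"
  obtain p where p: "rhom Q d x d x p" and hp: "!!w. w : ?V ==> h w = rep_map Q d d p w"
   using hom_rep_map[OF x x conjunct1[OF h]] by blast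
  have pm: "p v : mats {..<d v} {..<d v}" if "v : verts Q" for v using p that by (simp add: rhom_def)
  have pp: "p v *{d v} p v : mats {..<d v} {..<d v}" if "v : verts Q" for v
   by (rule mats_mmul[OF pm[OF that] pm[OF that]])
  have hh: "rep_map Q d d (%v. p v *{d v} p v) w = rep_map Q d d p w" if w: "w : ?V" for w
   unfolding rep_map_comp[symmetric] using h w hp[OF rep_map_closed] by (simp add: hp)
  have "p v *{d v} p v = p v" if v: "v : verts Q" for v
   by (rule rep_map_inject[of Q "%v. p v *{d v} p v" d d p, OF _ _ _ v]) (erule pp pm hh)+
  then have "(ALL v:verts Q. p v = 0) \<or> (ALL v:verts Q. p v = idm {..<d v})" using H p by blast
  then show "(ALL w:?V. h w = ?z) \<or> (ALL w:?V. h w = w)"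
  proof
   assume 0: "ALL v:verts Q. p v = 0"
   have "h w = ?z" if w: "w : ?V" for w
    unfolding hp[OF w] rep_map_zero[of Q d d w x, symmetric] by (rule rep_map_cong) (use 0 in blast)
   then show ?thesis by blast
  next
   assume 1: "ALL v:verts Q. p v = idm {..<d v}"
   have "h w = w" if w: "w : ?V" for w
    unfolding hp[OF w] by (subst (2) rep_map_idm[OF w, symmetric], rule rep_map_cong) (use 1 in blast)
   then show ?thesis by blast
  qed
 qed
qed

text \<open>The matrices of an isomorphism and of its inverse form an inverse pair, and intertwining
  is the equation \<open>x' = p x q\<close>.\<close>

lemma module_iso_rep_module_iff:
 assumes x: "x : square_zero_reps Q d" and x': "x' : square_zero_reps Q d"
 shows "module_iso (quiver_algebra Q I) (rep_module Q d x) (rep_module Q d x') \<longleftrightarrow> x' : GL_orbit Q d x"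
proof -
 let ?V = "vecs Q d :: ('v => 'k vec) set"
 have xr: "x : rep_space Q d" "x' : rep_space Q d" using x x' by (simp_all add: square_zero_reps_def)
 show ?thesis
 proof
  assume "module_iso (quiver_algebra Q I) (rep_module Q d x) (rep_module Q d x')"
  with left_module_rep_module[OF x] obtain h g where h: "left_module_hom (quiver_algebra Q I) (rep_module Q d x) (rep_module Q d x') h"
   and g: "left_module_hom (quiver_algebra Q I) (rep_module Q d x') (rep_module Q d x) g"
   and gh': "!!w. w : carrier (rep_module Q d x) ==> g (h w) = w" and hg': "!!w. w : carrier (rep_module Q d x') ==> h (g w) = w"
   by (rule module_isoE) (rule that)
  note gh = gh'[unfolded rep_module_carrier] and hg = hg'[unfolded rep_module_carrier]
  obtain p where p: "rhom Q d x d x' p" and hp: "!!w. w : ?V ==> h w = rep_map Q d d p w" using hom_rep_map[OF x x' h] by blast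
  obtain q where q: "rhom Q d x' d x q" and gq: "!!w. w : ?V ==> g w = rep_map Q d d q w" using hom_rep_map[OF x' x g] by blast
  have pm: "p v : mats {..<d v} {..<d v}" "q v : mats {..<d v} {..<d v}" if "v : verts Q" for v using p q that by (simp_all add: rhom_def)
  have qp: "rep_map Q d d (%v. q v *{d v} p v) w = rep_map Q d d (%v. idm {..<d v}) w" if w: "w : ?V" for w
   unfolding rep_map_comp[symmetric] rep_map_idm[OF w] using gh[OF w] gq[OF rep_map_closed] by (simp add: hp[OF w])
  have pq: "rep_map Q d d (%v. p v *{d v} q v) w = rep_map Q d d (%v. idm {..<d v}) w" if w: "w : ?V" for w
   unfolding rep_map_comp[symmetric] rep_map_idm[OF w] using hg[OF w] hp[OF rep_map_closed] by (simp add: gq[OF w])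
  have pqm: "p v *{d v} q v : mats {..<d v} {..<d v}" "q v *{d v} p v : mats {..<d v} {..<d v}" if "v : verts Q" for v
   using pm[OF that] by (auto intro: mats_mmul)
  have inv: "inverse_pair Q d p q"
   unfolding inverse_pair_def
  proof (intro ballI conjI pm)
   fix v assume v: "v : verts Q"
   show "p v *{d v} q v = idm {..<d v}"
    by (rule rep_map_inject[of Q "%v. p v *{d v} q v" d d "%v. idm {..<d v}", OF _ mats_idm _ v]) (erule pqm pq)+
   show "q v *{d v} p v = idm {..<d v}"
    by (rule rep_map_inject[of Q "%v. q v *{d v} p v" d d "%v. idm {..<d v}", OF _ mats_idm _ v]) (erule pqm qp)+
  qed
  have "act Q d p q x = x'"
  proof (rule rep_space_eqI[OF act_rep_space xr(2)])
   fix ar assume ar: "ar : arcs Q"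
   let ?t = "tail Q ar" and ?h = "head Q ar"
   have t: "?t : verts Q" using ar by simp
   have e: "p ?h *{d ?h} fm (x ar) = fm (x' ar) *{d ?t} p ?t" using p ar by (simp add: rhom_def)
   have i: "p ?t *{d ?t} q ?t = idm {..<d ?t}" using inv t by (simp add: inverse_pair_def)
   show "fm (act Q d p q x ar) = fm (x' ar)"
    unfolding fm_act[OF wf_digraph_axioms inv xr(1) ar] mmul_assoc[symmetric] e
    unfolding mmul_assoc i by (rule mmul_idm[OF finite_lessThan rep_space_fm[OF xr(2) ar]])
  qed
  then show "x' : GL_orbit Q d x" unfolding GL_orbit_eq[OF wf_digraph_axioms xr(1)] using inv by blast
 next
  assume "x' : GL_orbit Q d x"
  then obtain p q where inv: "inverse_pair Q d p q" and x'e: "x' = act Q d p q x" unfolding GL_orbit_eq[OF wf_digraph_axioms xr(1)] by blast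
  note i = inv[unfolded inverse_pair_def, rule_format]
  have p: "rhom Q d x d x' p" "rhom Q d x' d x q"
   unfolding rhom_def
  proof (safe)
   fix ar assume ar: "ar : arcs Q"
   let ?t = "tail Q ar" and ?h = "head Q ar"
   have th: "?t : verts Q" "?h : verts Q" using ar by auto
   have e: "fm (x' ar) = p ?h *{d ?h} (fm (x ar) *{d ?t} q ?t)"
    unfolding x'e by (rule fm_act[OF wf_digraph_axioms inv xr(1) ar])
   note xm = rep_space_fm[OF xr(1) ar]
   have qt: "q ?t *{d ?t} p ?t = idm {..<d ?t}" and qh: "q ?h *{d ?h} p ?h = idm {..<d ?h}"
    using i th by blast+
   show "p ?h *{d ?h} fm (x ar) = fm (x' ar) *{d ?t} p ?t"
    unfolding e mmul_assoc qt mmul_idm[OF finite_lessThan xm] ..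
   show "q ?h *{d ?h} fm (x' ar) = fm (x ar) *{d ?t} q ?t"
    unfolding e unfolding mmul_assoc[symmetric] qh idm_mmul[OF finite_lessThan xm] ..
  qed (use i in auto)
  show "module_iso (quiver_algebra Q I) (rep_module Q d x) (rep_module Q d x')"
  proof (rule module_isoI[OF rep_map_hom[OF x x' p(1)] rep_map_hom[OF x' x p(2)]], unfold rep_module_carrier rep_map_comp)
   fix w assume w: "w : ?V"
   have "rep_map Q d d (%v. q v *{d v} p v) w = rep_map Q d d (%v. idm {..<d v}) w"
    by (rule rep_map_cong) (use i in blast)
   then show "rep_map Q d d (%v. q v *{d v} p v) w = w" unfolding rep_map_idm[OF w] .
   have "rep_map Q d d (%v. p v *{d v} q v) w = rep_map Q d d (%v. idm {..<d v}) w"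
    by (rule rep_map_cong) (use i in blast)
   then show "rep_map Q d d (%v. p v *{d v} q v) w = w" unfolding rep_map_idm[OF w] .
  qed
 qed
qed

end

section \<open>Finite dimensional modules\<close>

text \<open>A spanning subfamily of least size is independent. Scalar multiplication is an abstract
  \<open>S\<close>, because a module over the algebra has its vector space structure only through
  the image of the field; the set \<open>U\<close> is later one of the spaces
  \<open>e v M\<close>.\<close>

lemma basis_exists:
 fixes S :: "'k::field => 'w => 'w" and M (structure)
 assumes ag: "abelian_group M" and cl: "!!c w. w : carrier M ==> S c w : carrier M"
  and add: "!!c c' w. w : carrier M ==> S (c + c') w = S c w \<oplus> S c' w"
  and dist: "!!c w w'. w : carrier M ==> w' : carrier M ==> S c (w \<oplus> w') = S c w \<oplus> S c w'"
  and mult: "!!c c' w. w : carrier M ==> S (c * c') w = S c (S c' w)"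
  and B: "finite B" "!!b. b : B ==> f b : carrier M"
  and span: "!!w. w : U ==> EX c. w = (\<Oplus>b\<in>B. S (c b) (f b))"
 obtains n :: nat and g where "!!i. i < n ==> g i : f ` B" "!!w. w : U ==> EX c. w = (\<Oplus>i\<in>{..<n}. S (c i) (g i))"
  "!!c i. (\<Oplus>i\<in>{..<n}. S (c i) (g i)) = \<zero> ==> i < n ==> c i = 0"
proof -
 interpret abelian_group M by fact
 define P where "P C \<longleftrightarrow> C \<subseteq> B & (ALL w:U. EX c. w = (\<Oplus>b\<in>C. S (c b) (f b)))" for C
 have "P B" using span by (auto simp: P_def)
 then obtain C where C: "P C" and min: "!!D. P D ==> card C \<le> card D"
  using ex_has_least_nat[of P B card] by blast
 have CB: "C \<subseteq> B" and finC: "finite C" using C B(1) by (auto simp: P_def dest: finite_subset)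
 have fC: "f b : carrier M" if "b : C" for b using B(2) CB that by blast
 have sf: "(%b. S (c b) (f b)) : D \<rightarrow> carrier M" if "D \<subseteq> C" for c D using that fC cl by blast
 have S0: "S 0 w = \<zero>" if "w : carrier M" for w
  using add[OF that, of 0 0] cl[OF that, of 0] by (simp add: add.l_cancel_one')
 have indep: "c k = 0" if rel: "(\<Oplus>b\<in>C. S (c b) (f b)) = \<zero>" and k: "k : C" for c k
 proof (rule ccontr)
  assume ck: "c k ~= 0"
  have "P (C - {k})" unfolding P_def
  proof (intro conjI ballI)
   show "C - {k} \<subseteq> B" using CB by blast
   fix w assume "w : U"
   then obtain a where a: "w = (\<Oplus>b\<in>C. S (a b) (f b))" using C unfolding P_def by blast
   \<comment> \<open>Subtracting \<open>t\<close> times the relation removes \<open>f k\<close> from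
     the expression of \<open>w\<close>.\<close>
   define t where "t = a k / c k"
   let ?a = "%b. a b - t * c b"
   have "(\<Oplus>b\<in>C. S (t * c b) (f b)) = (\<Oplus>b\<in>C. S t (S (c b) (f b)))"
    by (rule finsum_cong') (use fC cl mult in auto)
   also have "... = S t (\<Oplus>b\<in>C. S (c b) (f b))"
    by (rule additive_finsum[symmetric, OF ag ag cl dist finC cl[OF fC]])
   also have "... = \<zero>" unfolding rel by (rule additive_zero[OF ag ag cl dist])
   finally have z: "(\<Oplus>b\<in>C. S (t * c b) (f b)) = \<zero>" .
   have "w = (\<Oplus>b\<in>C. S (?a b) (f b) \<oplus> S (t * c b) (f b))"
    unfolding a by (rule finsum_cong') (use fC cl in "auto simp: add[symmetric]")
   also have "... = (\<Oplus>b\<in>C. S (?a b) (f b)) \<oplus> (\<Oplus>b\<in>C. S (t * c b) (f b))"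
    by (rule finsum_addf[OF sf[OF subset_refl] sf[OF subset_refl]])
   also have "... = (\<Oplus>b\<in>C. S (?a b) (f b))" unfolding z using finsum_closed[OF sf[OF subset_refl]] by (rule r_zero)
   also have "... = (\<Oplus>b\<in>insert k (C - {k}). S (?a b) (f b))" using k by (simp add: insert_absorb)
   also have "... = S (?a k) (f k) \<oplus> (\<Oplus>b\<in>C - {k}. S (?a b) (f b))"
    by (rule finsum_insert) (use finC fC cl k in auto)
   also have "S (?a k) (f k) = \<zero>" using S0[OF fC[OF k]] ck by (simp add: t_def)
   also have "\<zero> \<oplus> (\<Oplus>b\<in>C - {k}. S (?a b) (f b)) = (\<Oplus>b\<in>C - {k}. S (?a b) (f b))"
    by (rule l_zero[OF finsum_closed[OF sf]]) blast
   finally show "EX c. w = (\<Oplus>b\<in>C - {k}. S (c b) (f b))" by (intro exI[of _ ?a])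
  qed
  from min[OF this] show False using k finC by (metis card_Diff1_less not_le)
 qed
 obtain e where e: "bij_betw e {..<card C} C" using ex_bij_betw_nat_finite[OF finC] by (auto simp: atLeast0LessThan)
 have inj: "inj_on e {..<card C}" and im: "e ` {..<card C} = C" using e by (auto simp: bij_betw_def)
 have re: "(\<Oplus>b\<in>C. S (c b) (f b)) = (\<Oplus>i\<in>{..<card C}. S (c (e i)) (f (e i)))" for c
  using finsum_reindex[of "%b. S (c b) (f b)" e "{..<card C}"] inj sf[OF subset_refl, of c] unfolding im by simp
 show thesis
 proof (rule that[of "card C" "f \<circ> e"])
  show "(f \<circ> e) i : f ` B" if "i < card C" for i using im CB that by auto
  show "EX c. w = (\<Oplus>i\<in>{..<card C}. S (c i) ((f \<circ> e) i))" if w: "w : U" for w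
  proof -
   obtain c where "w = (\<Oplus>b\<in>C. S (c b) (f b))" using C w unfolding P_def by blast
   then have "w = (\<Oplus>i\<in>{..<card C}. S ((%i. c (e i)) i) ((f \<circ> e) i))" unfolding re by simp
   then show ?thesis by (intro exI[of _ "%i. c (e i)"])
  qed
  fix c i assume z: "(\<Oplus>i\<in>{..<card C}. S (c i) ((f \<circ> e) i)) = \<zero>" and i: "i < card C"
  define g where "g = the_inv_into {..<card C} e"
  have eC: "e i : C" if "i < card C" for i using im that by blast
  have g: "g (e i) = i" if "i < card C" for i unfolding g_def by (rule the_inv_into_f_f[OF inj]) (use that in simp)
  have "(\<Oplus>b\<in>C. S (c (g b)) (f b)) = (\<Oplus>i\<in>{..<card C}. S (c i) ((f \<circ> e) i))"
   unfolding re by (rule finsum_cong') (use g cl[OF fC[OF eC]] in auto)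
  then have "c (g (e i)) = 0" unfolding z by (rule indep) (use im i in auto)
  then show "c i = 0" unfolding g[OF i] .
 qed
qed

context square_zero_algebra
begin

interpretation fin_digraph Q by (rule fin)

interpretation PA: ring "path_algebra Q :: (('v, 'a) path => 'k) ring" by (rule ring_path_algebra[OF fin])

interpretation I: ideal I "path_algebra Q" by (rule ideal)

interpretation cl: ring_hom_ring "path_algebra Q" "quiver_algebra Q I" "(+>\<^bsub>path_algebra Q\<^esub>) I"
 unfolding quiver_algebra_def by (rule I.rcos_ring_hom_ring)

definition scal :: "'k => ('v, 'a) path => 'k" where
 "scal c = (%\<pi>. c * \<one>\<^bsub>path_algebra Q\<^esub> \<pi>)"

lemma quiver_algebra_scalar_eq: "quiver_algebra_scalar Q I c = I +>\<^bsub>path_algebra Q\<^esub> scal c"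
 unfolding quiver_algebra_scalar_def scal_def ..

lemma scal_carrier: "scal c : carrier (path_algebra Q)"
proof -
 have "(\<one>\<^bsub>path_algebra Q\<^esub> :: ('v, 'a) path => 'k) : carrier (path_algebra Q)" by (rule PA.one_closed)
 moreover have "{\<pi>. scal c \<pi> ~= 0} \<subseteq> {\<pi>. (\<one>\<^bsub>path_algebra Q\<^esub> :: ('v, 'a) path => 'k) \<pi> ~= 0}" by (auto simp: scal_def)
 ultimately show ?thesis unfolding path_algebra_simps(1) by (meson finite_subset subset_trans)
qed

lemma quiver_algebra_scalar_carrier: "quiver_algebra_scalar Q I c : carrier (quiver_algebra Q I)"
 unfolding quiver_algebra_scalar_eq by (rule cl.hom_closed[OF scal_carrier])

lemma scal_mult:
 assumes "f : carrier (path_algebra Q)"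
 shows "scal c \<otimes>\<^bsub>path_algebra Q\<^esub> f = (%\<pi>. c * f \<pi>)" "f \<otimes>\<^bsub>path_algebra Q\<^esub> scal c = (%\<pi>. c * f \<pi>)"
proof -
 have "(scal c \<otimes>\<^bsub>path_algebra Q\<^esub> f) \<pi> = c * (\<one>\<^bsub>path_algebra Q\<^esub> \<otimes>\<^bsub>path_algebra Q\<^esub> f) \<pi>"
  "(f \<otimes>\<^bsub>path_algebra Q\<^esub> scal c) \<pi> = c * (f \<otimes>\<^bsub>path_algebra Q\<^esub> \<one>\<^bsub>path_algebra Q\<^esub>) \<pi>" for \<pi>
  unfolding path_algebra_simps(2) scal_def
  by (cases \<pi>; simp add: sum_distrib_left mult.assoc mult.left_commute)+
 then show "scal c \<otimes>\<^bsub>path_algebra Q\<^esub> f = (%\<pi>. c * f \<pi>)" "f \<otimes>\<^bsub>path_algebra Q\<^esub> scal c = (%\<pi>. c * f \<pi>)"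
  unfolding PA.l_one[OF assms] PA.r_one[OF assms] by (auto simp: fun_eq_iff)
qed

lemma scal_add: "scal (c + c') = scal c \<oplus>\<^bsub>path_algebra Q\<^esub> scal c'"
 unfolding path_algebra_simps(5) scal_def by (simp add: distrib_right)

lemma scal_scal: "scal (c * c') = scal c \<otimes>\<^bsub>path_algebra Q\<^esub> scal c'"
 unfolding scal_mult(1)[OF scal_carrier] by (simp add: scal_def mult.assoc)

lemma single_eq_scal: "v : verts Q ==> single c (v, []) = scal c \<otimes>\<^bsub>path_algebra Q\<^esub> single 1 (v, [])"
 unfolding scal_mult(1)[OF single_carrier[OF vertex_path]] by (auto simp: single_def fun_eq_iff)

lemma scalar_action:
 assumes x: "x : square_zero_reps Q d" and w: "w : vecs Q d" and v: "v : verts Q" "i < d v"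
 shows "(quiver_algebra_scalar Q I c \<odot>\<^bsub>rep_module Q d x\<^esub> w) v $ i = c * w v $ i"
proof -
 have 1: "scal c (v, []) = c" "scal c (u, [ar]) = 0" for u ar
  using v by (simp_all add: scal_def path_algebra_simps(3))
 show ?thesis unfolding quiver_algebra_scalar_eq rep_module_smult[OF x scal_carrier w]
  path_algebra_action_index[OF fin x scal_carrier w v] 1 by simp
qed

lemma finite_dim_rep_module:
 assumes x: "x : square_zero_reps Q d"
 shows "finite_dim_module Q I (rep_module Q d x)"
proof -
 let ?M = "rep_module Q d x" and ?B = "SIGMA v:verts Q. {..<d v}" and ?s = "quiver_algebra_scalar Q I"
 let ?E = "%(v, j). basis_vec Q d v j :: 'v => 'k vec"
 let ?V = "vecs Q d :: ('v => 'k vec) set"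
 interpret left_module "quiver_algebra Q I" ?M by (rule left_module_rep_module[OF x])
 have E: "?E b : ?V" for b by (cases b) (simp add: basis_vec_closed)
 have sE: "?s c \<odot>\<^bsub>?M\<^esub> ?E b : ?V" for c b
  using smult_closed[OF quiver_algebra_scalar_carrier, of "?E b" c] E[of b] unfolding rep_module_carrier by blast
 have inj: "inj_on ?E ?B"
 proof (rule inj_onI)
  fix a b assume "a : ?B" "b : ?B" and e: "?E a = ?E b"
  then obtain v j u k where ab: "a = (v, j)" "b = (u, k)" "v : verts Q" "j < d v" by blast
  have "?E a v $ j = ?E b v $ j" unfolding e ..
  then show "a = b" using ab by (simp add: basis_vec_index split: if_splits)
 qed
 have "EX c. w = (\<Oplus>\<^bsub>?M\<^esub>b\<in>?E ` ?B. ?s (c b) \<odot>\<^bsub>?M\<^esub> b)" if w: "w : ?V" for w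
 proof -
  define g where "g = the_inv_into ?B ?E"
  define c where "c b = w (fst (g b)) $ snd (g b)" for b
  have c: "c (?E b) = w (fst b) $ snd b" if "b : ?B" for b
   unfolding c_def g_def by (simp only: the_inv_into_f_f[OF inj that])
  let ?F = "%b. case b of (v, j) => coset_smult Q I ?M (single (w v $ j) (v, [])) (basis_vec Q d v j)"
  have F: "?F b = ?s (c (?E b)) \<odot>\<^bsub>?M\<^esub> ?E b" if b: "b : ?B" for b
  proof -
   obtain v j where vj: "b = (v, j)" "v : verts Q" "j < d v" using b by blast
   have s: "single (w v $ j) (v, []) : carrier (path_algebra Q)" by (intro single_carrier vertex_path vj)
   have cb: "c (?E b) = w v $ j" using c[OF b] vj by simp
   show ?thesis unfolding cb
   proof (rule rep_vec_eqI)
    show "?s (w v $ j) \<odot>\<^bsub>?M\<^esub> ?E b : ?V" by (rule sE)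
    show "?F b : ?V" unfolding vj(1) prod.case
     by (rule coset_smult_closed[OF left_module_rep_module[OF x] s, unfolded rep_module_carrier, OF basis_vec_closed])
    fix u i assume u: "u : verts Q" "i < d u"
    show "?F b u $ i = (?s (w v $ j) \<odot>\<^bsub>?M\<^esub> ?E b) u $ i"
     unfolding scalar_action[OF x E u] unfolding vj(1) prod.case vertex_action[OF x basis_vec_closed vj(2) u]
      basis_vec_index[where d = d and u = u and i = i, OF u]
     by simp
   qed
  qed
  have "w = (\<Oplus>\<^bsub>?M\<^esub>b\<in>?B. ?F b)" by (rule vec_decomposition[OF x w])
  also have "... = (\<Oplus>\<^bsub>?M\<^esub>b\<in>?B. ?s (c (?E b)) \<odot>\<^bsub>?M\<^esub> ?E b)"
   by (rule M.finsum_cong'[OF refl _ F]) (use sE in "auto simp: rep_module_carrier")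
  also have "... = (\<Oplus>\<^bsub>?M\<^esub>b\<in>?E ` ?B. ?s (c b) \<odot>\<^bsub>?M\<^esub> b)"
   by (rule M.finsum_reindex[symmetric, OF _ inj]) (use sE in "auto simp: rep_module_carrier")
  finally show ?thesis by (intro exI[of _ c])
 qed
 moreover have "finite (?E ` ?B)" by simp
 moreover have "?E ` ?B \<subseteq> ?V" using E by blast
 ultimately show ?thesis
  unfolding finite_dim_module_def rep_module_carrier using left_module_rep_module[OF x] by blast
qed

lemma rep_module_injection:
 fixes x :: "'a => 'k mat"
 obtains f :: "('v => 'k vec) => 'k vec" where "inj_on f (carrier (rep_module Q d x))"
proof -
 let ?B = "SIGMA v:verts Q. {..<d v}"
 have "finite ?B" by simp
 then obtain e where e: "bij_betw e {0..<card ?B} ?B" using ex_bij_betw_nat_finite by blast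
 let ?f = "%w :: 'v => 'k vec. vec (card ?B) (%k. w (fst (e k)) $ snd (e k))"
 have "inj_on ?f (carrier (rep_module Q d x))"
  unfolding rep_module_carrier
 proof (rule inj_onI)
  fix w w' :: "'v => 'k vec"
  assume w: "w : vecs Q d" "w' : vecs Q d" and eq: "?f w = ?f w'"
  show "w = w'"
  proof (rule rep_vec_eqI[OF w])
   fix v i assume "v : verts Q" "i < d v"
   then have "(v, i) : e ` {0..<card ?B}" using e by (simp add: bij_betw_def)
   then obtain k where k: "k < card ?B" "e k = (v, i)" by force
   have "?f w $ k = ?f w' $ k" unfolding eq ..
   then show "w v $ i = w' v $ i" using k by simp
  qed
 qed
 then show thesis by (rule that)
qed

text \<open>The trivial paths are orthogonal idempotents with sum 1, so the module is the direct sum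
  of the spaces \<open>e v M\<close>. Bases of these spaces turn the arrows into matrices, and
  products of two arrows vanish because such paths lie in \<open>I\<close>.\<close>

lemma finite_dim_module_rep:
 fixes M (structure)
 assumes M: "finite_dim_module Q I M"
 obtains d x where "x : square_zero_reps Q d" "!!v. v \<notin> verts Q ==> d v = 0"
  "module_iso (quiver_algebra Q I) (rep_module Q d x) M"
proof -
 let ?R = "quiver_algebra Q I"
 have lm: "left_module ?R M" using M by (simp add: finite_dim_module_def)
 interpret left_module ?R M by (rule lm)
 note ag = M.abelian_group_axioms
 define sm where "sm f w = coset_smult Q I M f w" for f w
 define S where "S c w = sm (scal c) w" for c w
 define e where "e v = (single 1 (v, []) :: ('v, 'a) path => 'k)" for v
 define gen where "gen ar = (single 1 (tail Q ar, [ar]) :: ('v, 'a) path => 'k)" for ar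
 have ec: "e v : carrier (path_algebra Q)" if "v : verts Q" for v unfolding e_def by (intro single_carrier vertex_path that)
 have arc: "gen ar : carrier (path_algebra Q)" if "ar : arcs Q" for ar unfolding gen_def by (intro single_carrier arrow_path that)
 have smc: "sm f w : carrier M" if "f : carrier (path_algebra Q)" "w : carrier M" for f w
  unfolding sm_def by (rule coset_smult_closed[OF lm that])
 have sm_mult: "sm (f \<otimes>\<^bsub>path_algebra Q\<^esub> g) w = sm f (sm g w)"
  if "f : carrier (path_algebra Q)" "g : carrier (path_algebra Q)" "w : carrier M" for f g w
  unfolding sm_def by (rule coset_smult_mult[OF lm that])
 have sm_dist: "sm f (w \<oplus> w') = sm f w \<oplus> sm f w'" if "f : carrier (path_algebra Q)" "w : carrier M" "w' : carrier M" for f w w'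
  unfolding sm_def by (rule smult_r_distr[OF cl.hom_closed[OF that(1)] that(2,3)])
 have sm_0: "sm f w = \<zero>" if "f : I" "w : carrier M" for f w unfolding sm_def by (rule coset_smult_ideal[OF lm that])
 have sm_zero: "sm f \<zero> = \<zero>" if "f : carrier (path_algebra Q)" for f
  by (rule additive_zero[OF ag ag smc[OF that] sm_dist[OF that]])
 have sm_sum: "sm f (\<Oplus>b\<in>B. h b) = (\<Oplus>b\<in>B. sm f (h b))"
  if "f : carrier (path_algebra Q)" "finite B" "!!b. b : B ==> h b : carrier M" for f B h
  by (rule additive_finsum[OF ag ag smc[OF that(1)] sm_dist[OF that(1)] that(2,3)])
 have Sc: "S c w : carrier M" if "w : carrier M" for c w unfolding S_def by (rule smc[OF scal_carrier that])
 have S_add: "S (c + c') w = S c w \<oplus> S c' w" if "w : carrier M" for c c' w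
  unfolding S_def sm_def scal_add by (rule coset_smult_add[OF lm scal_carrier scal_carrier that])
 have S_dist: "S c (w \<oplus> w') = S c w \<oplus> S c w'" if "w : carrier M" "w' : carrier M" for c w w'
  unfolding S_def by (rule sm_dist[OF scal_carrier that])
 have S_mult: "S (c * c') w = S c (S c' w)" if "w : carrier M" for c c' w
  unfolding S_def scal_scal by (rule sm_mult[OF scal_carrier scal_carrier that])
 have S_sm: "sm f (S c w) = S c (sm f w)" if "f : carrier (path_algebra Q)" "w : carrier M" for f c w
  unfolding S_def sm_mult[OF scal_carrier that, symmetric] sm_mult[OF that(1) scal_carrier that(2), symmetric] scal_mult[OF that(1)] ..
 have S_scalar: "quiver_algebra_scalar Q I c \<odot> w = S c w" for c w
  unfolding S_def sm_def quiver_algebra_scalar_eq ..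
 have S_zero: "S c \<zero> = \<zero>" for c unfolding S_def by (rule sm_zero[OF scal_carrier])
 have ee: "sm (e u) (sm (e v) w) = (if u = v then sm (e v) w else \<zero>)" if "u : verts Q" "v : verts Q" "w : carrier M" for u v w
 proof -
  have p: "e u \<otimes>\<^bsub>path_algebra Q\<^esub> e v = (if u = v then e v else \<zero>\<^bsub>path_algebra Q\<^esub>)"
   unfolding e_def by (simp add: single_mult_single walk_end_Nil path_algebra_simps(4))
  show ?thesis unfolding sm_mult[OF ec[OF that(1)] ec[OF that(2)] that(3), symmetric] p
   using sm_0[OF I.zero_closed that(3)] by simp
 qed
 \<comment> \<open>Says that \<open>b\<close> lists a basis of \<open>e v M\<close> over the field,
   with \<open>n\<close> elements.\<close>
 define basis_at where "basis_at v n b \<longleftrightarrow> (\<forall>i<n. b i : sm (e v) ` carrier M) &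
   (ALL w:carrier M. EX c. sm (e v) w = (\<Oplus>i\<in>{..<n :: nat}. S (c i) (b i))) &
   (ALL c. (\<Oplus>i\<in>{..<n}. S (c i) (b i)) = \<zero> --> (\<forall>i<n. c i = 0))" for v n b
 have "EX n b. ALL v:verts Q. basis_at v (n v) (b v)"
 proof -
  obtain B where B: "finite B" "B \<subseteq> carrier M" "!!w. w : carrier M ==> EX c. w = (\<Oplus>b\<in>B. S (c b) b)"
   using M unfolding finite_dim_module_def S_scalar by blast
  have "EX n b. basis_at v n b" if v: "v : verts Q" for v
  proof -
   have span: "EX c. w = (\<Oplus>b\<in>B. S (c b) (sm (e v) b))" if w: "w : sm (e v) ` carrier M" for w
   proof -
    obtain m where m: "m : carrier M" "w = sm (e v) m" using w by blast
    obtain c where c: "m = (\<Oplus>b\<in>B. S (c b) b)" using B(3)[OF m(1)] by blast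
    have "w = (\<Oplus>b\<in>B. sm (e v) (S (c b) b))"
     unfolding m(2) c by (rule sm_sum[OF ec[OF v] B(1)]) (use B(2) Sc in blast)
    also have "... = (\<Oplus>b\<in>B. S (c b) (sm (e v) b))"
     by (rule M.finsum_cong') (use B(2) Sc smc[OF ec[OF v]] S_sm[OF ec[OF v]] in auto)
    finally show ?thesis by (intro exI[of _ c])
   qed
   have fB: "sm (e v) b : carrier M" if "b : B" for b using smc[OF ec[OF v]] B(2) that by blast
   obtain n :: nat and g where g: "!!i. i < n ==> g i : sm (e v) ` B"
    "!!w. w : sm (e v) ` carrier M ==> EX c. w = (\<Oplus>i\<in>{..<n}. S (c i) (g i))"
    "!!c i. (\<Oplus>i\<in>{..<n}. S (c i) (g i)) = \<zero> ==> i < n ==> c i = 0"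
    by (rule basis_exists[where M = M and S = S and f = "sm (e v)" and B = B and U = "sm (e v) ` carrier M",
       OF ag Sc S_add S_dist S_mult B(1) fB span]) (assumption | rule that)+
   have "g i : sm (e v) ` carrier M" if "i < n" for i using g(1)[OF that] B(2) by blast
   then show ?thesis unfolding basis_at_def by (intro exI[of _ n] exI[of _ g]) (use g(2,3) in auto)
  qed
  then have "ALL v. EX nb. v : verts Q --> basis_at v (fst nb) (snd nb)" by auto
  from choice[OF this] obtain nb where nb: "ALL v. v : verts Q --> basis_at v (fst (nb v)) (snd (nb v))" ..
  show ?thesis by (intro exI[of _ "%v. fst (nb v)"] exI[of _ "%v. snd (nb v)"] ballI nb[rule_format])
 qed
 then obtain n b where nb': "ALL v:verts Q. basis_at v (n v) (b v)" by (elim exE)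
 note nb = bspec[OF nb']
 define d where "d v = (if v : verts Q then n v else 0)" for v
 have b: "b v i : sm (e v) ` carrier M" if "v : verts Q" "i < d v" for v i using nb[OF that(1)] that by (simp add: d_def basis_at_def)
 have bc: "b v i : carrier M" if "v : verts Q" "i < d v" for v i using b[OF that] by (elim imageE) (simp only: smc[OF ec[OF that(1)]])
 \<comment> \<open>The linear map from coordinates to \<open>e v M\<close> given by the chosen
   basis.\<close>
 define \<phi> where "\<phi> v c = (\<Oplus>i\<in>{..<d v}. S (c i) (b v i))" for v c
 have span: "EX c. sm (e v) w = \<phi> v c" if "v : verts Q" "w : carrier M" for v w
  using nb[OF that(1)] that unfolding d_def \<phi>_def basis_at_def by (simp only: if_True)
 have indep: "c i = 0" if "v : verts Q" "\<phi> v c = \<zero>" "i < d v" for v c i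
  using nb[OF that(1)] that by (simp add: d_def \<phi>_def basis_at_def)
 have Sb: "(%i. S (c i) (b v i)) : {..<d v} \<rightarrow> carrier M" if "v : verts Q" for v c using bc[OF that] Sc by auto
 have \<phi>c: "\<phi> v c : carrier M" if "v : verts Q" for v c unfolding \<phi>_def by (rule M.finsum_closed[OF Sb[OF that]])
 have \<phi>_cong: "\<phi> v c = \<phi> v c'" if "v : verts Q" "!!i. i < d v ==> c i = c' i" for v c c'
  unfolding \<phi>_def by (rule M.finsum_cong') (use Sb[OF that(1)] that(2) in auto)
 have \<phi>_add: "\<phi> v (%i. c i + c' i) = \<phi> v c \<oplus> \<phi> v c'" if "v : verts Q" for v c c'
  unfolding \<phi>_def M.finsum_addf[OF Sb[OF that] Sb[OF that], symmetric]
  by (rule M.finsum_cong') (use bc[OF that] Sc S_add in auto)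
 have \<phi>_scale: "\<phi> v (%i. t * c i) = S t (\<phi> v c)" if "v : verts Q" for v t c
 proof -
  have "S t (\<phi> v c) = (\<Oplus>i\<in>{..<d v}. S t (S (c i) (b v i)))"
   unfolding \<phi>_def by (rule additive_finsum[OF ag ag Sc S_dist finite_lessThan]) (use bc[OF that] Sc in auto)
  also have "... = \<phi> v (%i. t * c i)"
   unfolding \<phi>_def by (rule M.finsum_cong') (use bc[OF that] Sc S_mult in auto)
  finally show ?thesis ..
 qed
 have \<phi>_0: "\<phi> v (%i. 0) = \<zero>" if "v : verts Q" for v
 proof -
  have "\<phi> v (%i. 0) \<oplus> \<phi> v (%i. 0) = \<phi> v (%i. 0)" using \<phi>_add[OF that, of "%i. 0" "%i. 0"] by simp
  then show ?thesis using \<phi>c[OF that] by (simp add: M.add.l_cancel_one)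
 qed
 have \<phi>_sum: "\<phi> v (%i. \<Sum>j<m. c j i) = (\<Oplus>j\<in>{..<m :: nat}. \<phi> v (c j))" if v: "v : verts Q" for v m c
 proof (induction m)
  case 0
  then show ?case using \<phi>_0[OF v] by simp
 next
  case (Suc m)
  have "\<phi> v (%i. \<Sum>j<Suc m. c j i) = \<phi> v (c m) \<oplus> (\<Oplus>j\<in>{..<m}. \<phi> v (c j))"
   unfolding Suc[symmetric] \<phi>_add[OF v, symmetric] by (simp add: add.commute)
  also have "... = (\<Oplus>j\<in>{..<Suc m}. \<phi> v (c j))"
   unfolding lessThan_Suc by (rule M.finsum_insert[symmetric]) (use \<phi>c[OF v] in auto)
  finally show ?case .
 qed
 have e\<phi>: "sm (e u) (\<phi> v c) = (if u = v then \<phi> v c else \<zero>)" if uv: "u : verts Q" "v : verts Q" for u v c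
 proof -
  have eb: "sm (e u) (S (c i) (b v i)) = (if u = v then S (c i) (b v i) else \<zero>)" if i: "i < d v" for i
  proof -
   obtain m where m: "m : carrier M" "b v i = sm (e v) m" using b[OF uv(2) i] by blast
   show ?thesis unfolding S_sm[OF ec[OF uv(1)] bc[OF uv(2) i]] unfolding m(2) ee[OF uv m(1)] using S_zero by simp
  qed
  have "sm (e u) (\<phi> v c) = (\<Oplus>i\<in>{..<d v}. sm (e u) (S (c i) (b v i)))"
   unfolding \<phi>_def by (rule sm_sum[OF ec[OF uv(1)] finite_lessThan]) (use Sb[OF uv(2)] in auto)
  also have "... = (\<Oplus>i\<in>{..<d v}. if u = v then S (c i) (b v i) else \<zero>)"
   by (rule M.finsum_cong') (use Sc[OF bc[OF uv(2)]] eb in auto)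
  also have "... = (if u = v then \<phi> v c else \<zero>)" by (simp add: \<phi>_def M.finsum_zero)
  finally show ?thesis .
 qed
 have "EX c. \<forall>j<d (tail Q ar). sm (gen ar) (b (tail Q ar) j) = \<phi> (head Q ar) (c j)" if ar: "ar : arcs Q" for ar
 proof -
  have th: "tail Q ar : verts Q" "head Q ar : verts Q" using ar by auto
  have e: "e (head Q ar) \<otimes>\<^bsub>path_algebra Q\<^esub> gen ar = gen ar"
   unfolding e_def gen_def by (simp add: single_mult_single walk_end_Cons walk_end_Nil)
  have "EX c. sm (gen ar) (b (tail Q ar) j) = \<phi> (head Q ar) c" if "j < d (tail Q ar)" for j
   using span[OF th(2) smc[OF arc[OF ar] bc[OF th(1) that]]]
   unfolding sm_mult[OF ec[OF th(2)] arc[OF ar] bc[OF th(1) that], symmetric] e .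
  then show ?thesis by metis
 qed
 then obtain X where X: "sm (gen ar) (b (tail Q ar) j) = \<phi> (head Q ar) (X ar j)" if "ar : arcs Q" "j < d (tail Q ar)" for ar j by metis
 define x where "x = (\<lambda>ar\<in>arcs Q. mat (d (head Q ar)) (d (tail Q ar)) (%(i, j). X ar j i))"
 have xr: "x : rep_space Q d" by (auto simp: x_def rep_space_def)
 have fmx: "fm (x ar) i j = X ar j i" if "ar : arcs Q" "i < d (head Q ar)" "j < d (tail Q ar)" for ar i j
  using that by (simp add: fm_def x_def)
 have arrow: "sm (gen ar) (\<phi> (tail Q ar) c) = \<phi> (head Q ar) (%i. \<Sum>j<d (tail Q ar). fm (x ar) i j * c j)"
  if ar: "ar : arcs Q" for ar c
 proof -
  let ?t = "tail Q ar" and ?h = "head Q ar"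
  have th: "?t : verts Q" "?h : verts Q" using ar by auto
  have "sm (gen ar) (\<phi> ?t c) = (\<Oplus>j\<in>{..<d ?t}. sm (gen ar) (S (c j) (b ?t j)))"
   unfolding \<phi>_def by (rule sm_sum[OF arc[OF ar] finite_lessThan]) (use Sb[OF th(1)] in auto)
  also have "... = (\<Oplus>j\<in>{..<d ?t}. \<phi> ?h (%i. c j * X ar j i))"
   by (rule M.finsum_cong') (use Sc[OF \<phi>c[OF th(2)]] \<phi>_scale[OF th(2)] S_sm[OF arc[OF ar] bc[OF th(1)]] X[OF ar] in auto)
  also have "... = \<phi> ?h (%i. \<Sum>j<d ?t. c j * X ar j i)" by (rule \<phi>_sum[OF th(2), symmetric])
  also have "... = \<phi> ?h (%i. \<Sum>j<d ?t. fm (x ar) i j * c j)"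
   by (rule \<phi>_cong[OF th(2)], rule sum.cong) (simp_all add: fmx[OF ar])
  finally show ?thesis .
 qed
 have xs: "x : square_zero_reps Q d"
  unfolding square_zero_reps_def
 proof (intro CollectI conjI xr ballI impI)
  fix ar br assume ab: "ar : arcs Q" "br : arcs Q" "head Q ar = tail Q br"
  have th: "tail Q ar : verts Q" "head Q ar : verts Q" "head Q br : verts Q" using ab by auto
  show "fm (x br) *{d (tail Q br)} fm (x ar) = 0"
  proof (rule mats_eqI[OF mats_mmul[OF rep_space_fm[OF xr ab(2)] rep_space_fm[OF xr ab(1)]] mats_zero])
   fix k j assume kj: "k : {..<d (head Q br)}" "j : {..<d (tail Q ar)}"
   let ?m = "b (tail Q ar) j"
   have mc: "?m : carrier M" by (rule bc[OF th(1)]) (use kj in simp)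
   have "gen br \<otimes>\<^bsub>path_algebra Q\<^esub> gen ar : I"
   proof -
    have "gen br : arrow_ideal_power Q 1" "gen ar : arrow_ideal_power Q 1"
     using arc[OF ab(1)] arc[OF ab(2)] by (auto simp: arrow_ideal_power_def gen_def single_def)
    then show ?thesis unfolding I_eq using arrow_ideal_power_mult[OF wf_digraph_axioms, of "gen br" 1 "gen ar" 1]
     by (simp only: one_add_one)
   qed
   then have "\<zero> = sm (gen br) (sm (gen ar) ?m)"
    unfolding sm_mult[OF arc[OF ab(2)] arc[OF ab(1)] mc, symmetric] using sm_0[OF _ mc] by metis
   also have "... = sm (gen br) (\<phi> (tail Q br) (X ar j))" using X[OF ab(1), of j] kj ab(3) by simp
   also have "... = \<phi> (head Q br) (%k. \<Sum>i<d (tail Q br). fm (x br) k i * X ar j i)" by (rule arrow[OF ab(2)])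
   finally have "(\<Sum>i<d (tail Q br). fm (x br) k i * X ar j i) = 0" using kj by (intro indep[OF th(3)]) auto
   then show "(fm (x br) *{d (tail Q br)} fm (x ar)) k j = 0 k j"
    using kj ab(3) by (simp add: mmul_def fmx[OF ab(1)])
  qed
 qed
 let ?N = "rep_module Q d x" and ?V = "vecs Q d :: ('v => 'k vec) set"
 \<comment> \<open>Assembles an element of the module from its coordinates at all vertices;
   \<open>eH\<close> recovers the part at one vertex, which gives injectivity.\<close>
 define H where "H w = (\<Oplus>v\<in>verts Q. \<phi> v (%i. w v $ i))" for w
 have Hc: "H w : carrier M" for w unfolding H_def by (rule M.finsum_closed) (use \<phi>c in auto)
 have eH: "sm (e u) (H w) = \<phi> u (%i. w u $ i)" if u: "u : verts Q" for u w
 proof -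
  have "sm (e u) (H w) = (\<Oplus>v\<in>verts Q. sm (e u) (\<phi> v (%i. w v $ i)))"
   unfolding H_def by (rule sm_sum[OF ec[OF u] finite_verts \<phi>c])
  also have "... = (\<Oplus>v\<in>verts Q. if u = v then \<phi> v (%i. w v $ i) else \<zero>)"
   by (rule M.finsum_cong') (use \<phi>c e\<phi>[OF u] in auto)
  also have "... = \<phi> u (%i. w u $ i)" by (rule M.finsum_singleton[OF u finite_verts]) (use \<phi>c in auto)
  finally show ?thesis .
 qed
 have Hsingle: "H w = \<phi> u c" if u: "u : verts Q" and w: "!!v i. v : verts Q ==> i < d v ==> w v $ i = (if v = u then c i else 0)" for u c w
 proof -
  have "\<phi> v (%i. w v $ i) = (if u = v then \<phi> v c else \<zero>)" if v: "v : verts Q" for v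
  proof (cases "u = v")
   case True
   then show ?thesis using \<phi>_cong[OF v, of "%i. w v $ i" c] w[OF v] by simp
  next
   case False
   then show ?thesis using \<phi>_cong[OF v, of "%i. w v $ i" "%i. 0"] w[OF v] \<phi>_0[OF v] by simp
  qed
  then have "H w = (\<Oplus>v\<in>verts Q. if u = v then \<phi> v c else \<zero>)"
   unfolding H_def by (intro M.finsum_cong') (use \<phi>c in auto)
  also have "... = \<phi> u c" by (rule M.finsum_singleton[OF u finite_verts]) (use \<phi>c in auto)
  finally show ?thesis .
 qed
 have hom: "left_module_hom ?R ?N M H"
 proof (rule left_module_hom_if_generators[OF left_module_rep_module[OF xs] lm Hc], unfold rep_module_carrier)
  fix w w' assume w: "w : ?V" "w' : ?V"
  have "H (w \<oplus>\<^bsub>?N\<^esub> w') = (\<Oplus>v\<in>verts Q. \<phi> v (%i. w v $ i) \<oplus> \<phi> v (%i. w' v $ i))"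
   unfolding H_def
  proof (rule M.finsum_cong')
   fix v assume v: "v : verts Q"
   show "\<phi> v (%i. (w \<oplus>\<^bsub>?N\<^esub> w') v $ i) = \<phi> v (%i. w v $ i) \<oplus> \<phi> v (%i. w' v $ i)"
    unfolding \<phi>_add[OF v, symmetric] by (rule \<phi>_cong[OF v]) (rule rep_module_add(2)[OF w v])
  qed (use \<phi>c in auto)
  also have "... = H w \<oplus> H w'" unfolding H_def by (rule M.finsum_addf) (use \<phi>c in auto)
  finally show "H (w \<oplus>\<^bsub>?N\<^esub> w') = H w \<oplus> H w'" .
 next
  fix c v w assume v: "v : verts Q" and w: "w : ?V"
  have "H (coset_smult Q I ?N (single c (v, [])) w) = \<phi> v (%i. c * w v $ i)"
   by (rule Hsingle[OF v]) (auto simp: vertex_action[OF xs w v])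
  also have "... = S c (sm (e v) (H w))" unfolding \<phi>_scale[OF v] eH[OF v] ..
  also have "... = sm (single c (v, [])) (H w)"
   unfolding S_def sm_mult[OF scal_carrier ec[OF v] Hc, symmetric] unfolding e_def single_eq_scal[OF v, of c] ..
  finally show "H (coset_smult Q I ?N (single c (v, [])) w) = coset_smult Q I M (single c (v, [])) (H w)" unfolding sm_def .
 next
  fix ar w assume ar: "ar : arcs Q" and w: "w : ?V"
  have th: "tail Q ar : verts Q" "head Q ar : verts Q" using ar by auto
  have ae: "gen ar \<otimes>\<^bsub>path_algebra Q\<^esub> e (tail Q ar) = gen ar"
   unfolding e_def gen_def by (simp add: single_mult_single walk_end_Nil)
  have "H (coset_smult Q I ?N (single 1 (tail Q ar, [ar])) w) = \<phi> (head Q ar) (%i. \<Sum>j<d (tail Q ar). fm (x ar) i j * w (tail Q ar) $ j)"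
   by (rule Hsingle[OF th(2)]) (auto simp: arrow_action[OF xs w ar])
  also have "... = sm (gen ar) (sm (e (tail Q ar)) (H w))" unfolding eH[OF th(1)] arrow[OF ar] ..
  also have "... = sm (gen ar) (H w)" unfolding sm_mult[OF arc[OF ar] ec[OF th(1)] Hc, symmetric] ae ..
  finally show "H (coset_smult Q I ?N (single 1 (tail Q ar, [ar])) w) = coset_smult Q I M (single 1 (tail Q ar, [ar])) (H w)"
   unfolding sm_def gen_def .
 qed
 have "bij_betw H (carrier ?N) (carrier M)"
  unfolding bij_betw_def rep_module_carrier
 proof (intro conjI inj_onI subset_antisym subsetI)
  fix w w' assume w: "w : ?V" "w' : ?V" and eq: "H w = H w'"
  show "w = w'"
  proof (rule rep_vec_eqI[OF w])
   fix v i assume v: "v : verts Q" "i < d v"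
   have e: "\<phi> v (%i. w v $ i) = \<phi> v (%i. w' v $ i)" unfolding eH[OF v(1), symmetric] eq ..
   have "\<phi> v (%i. (w v $ i - w' v $ i) + w' v $ i) = \<phi> v (%i. w v $ i - w' v $ i) \<oplus> \<phi> v (%i. w' v $ i)"
    by (rule \<phi>_add[OF v(1)])
   then have "\<phi> v (%i. w' v $ i) = \<phi> v (%i. w v $ i - w' v $ i) \<oplus> \<phi> v (%i. w' v $ i)" using e by simp
   then have "\<phi> v (%i. w v $ i - w' v $ i) = \<zero>"
    using \<phi>c[OF v(1)] by (simp add: M.add.r_cancel_one')
   then show "w v $ i = w' v $ i" using indep[OF v(1) _ v(2), of "%i. w v $ i - w' v $ i"] by simp
  qed
 next
  fix m assume "m : H ` ?V"
  then show "m : carrier M" using Hc by blast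
 next
  fix m assume m: "m : carrier M"
  \<comment> \<open>Taken over all vertices, the trivial paths add up to the unit of the path
    algebra, which gives surjectivity.\<close>
  have one: "(\<Oplus>\<^bsub>path_algebra Q\<^esub>v\<in>C. e v) = (%(u, p). if u : C & p = [] then 1 else 0)"
   if "finite C" "C \<subseteq> verts Q" for C
   using that
  proof (induction C rule: finite_induct)
   case empty
   show ?case unfolding PA.finsum_empty path_algebra_simps(4) by auto
  next
   case (insert v C)
   have C: "C \<subseteq> verts Q" using insert.prems by blast
   have "(\<Oplus>\<^bsub>path_algebra Q\<^esub>v\<in>insert v C. e v) = e v \<oplus>\<^bsub>path_algebra Q\<^esub> (\<Oplus>\<^bsub>path_algebra Q\<^esub>v\<in>C. e v)"
    by (rule PA.finsum_insert[OF insert.hyps]) (use insert.prems ec in auto)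
   also have "... = (%(u, p). if u : insert v C & p = [] then 1 else 0)"
    unfolding insert.IH[OF C] unfolding path_algebra_simps(5) e_def
    using insert.hyps(2) by (auto simp: single_def fun_eq_iff)
   finally show ?case .
  qed
  have "m = sm (\<Oplus>\<^bsub>path_algebra Q\<^esub>v\<in>verts Q. e v) m"
  proof -
   have "(\<Oplus>\<^bsub>path_algebra Q\<^esub>v\<in>verts Q. e v) = \<one>\<^bsub>path_algebra Q\<^esub>"
    unfolding one[OF finite_verts subset_refl] path_algebra_simps(3) ..
   then show ?thesis using coset_smult_one[OF lm m] by (simp only: sm_def)
  qed
  also have "... = (\<Oplus>v\<in>verts Q. sm (e v) m)"
   by (rule additive_finsum[OF PA.abelian_group_axioms ag, where h = "%f. sm f m"])
    (use m smc ec coset_smult_add[OF lm _ _ m] in "auto simp: sm_def")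
  finally have m1: "m = (\<Oplus>v\<in>verts Q. sm (e v) m)" .
  obtain c where c: "sm (e v) m = \<phi> v (c v)" if "v : verts Q" for v using span[OF _ m] by metis
  define w where "w = (\<lambda>v\<in>verts Q. vec (d v) (c v))"
  have "w : ?V" by (auto simp: w_def)
  moreover have "m = H w"
  proof -
   have "sm (e v) m = \<phi> v (%i. w v $ i)" if v: "v : verts Q" for v
    unfolding c[OF v] by (rule \<phi>_cong[OF v]) (simp add: w_def v)
   then have "(\<Oplus>v\<in>verts Q. sm (e v) m) = H w"
    unfolding H_def by (intro M.finsum_cong') (use \<phi>c in auto)
   then show ?thesis using m1 by simp
  qed
  ultimately show "m : H ` ?V" by blast
 qed
 with hom have "module_iso ?R ?N M" unfolding module_iso_iff_hom by blast
 moreover have "d v = 0" if "v \<notin> verts Q" for v using that by (simp add: d_def)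
 ultimately show thesis using that xs by blast
qed

end

section \<open>Finitely many orbits\<close>

text \<open>\<open>G\<close> factors through \<open>F\<close> on \<open>X\<close>; it is used to
  bound classes and orbits by their invariants.\<close>

lemma finite_image_factor:
 assumes "finite (F ` X)" "!!x y. x : X ==> y : X ==> F x = F y ==> G x = G y"
 shows "finite (G ` X)"
proof -
 have "G x = G (SOME y. y : X & F y = F x)" if x: "x : X" for x
 proof -
  have "EX y. y : X & F y = F x" using x by blast
  from someI_ex[OF this] show ?thesis by (intro assms(2)[OF x]) (erule conjunct1, erule conjunct2[THEN sym])
 qed
 then have "G ` X \<subseteq> (%c. G (SOME y. y : X & F y = c)) ` F ` X" by auto
 then show ?thesis using assms(1) by (rule finite_subset[OF _ finite_imageI])
qed

text \<open>A direct sum decomposition of the space of dimension \<open>n\<close> into parts of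
  dimensions \<open>r\<close> and \<open>n - r\<close>, with inclusions \<open>a\<close>,
  \<open>a'\<close> and projections \<open>b\<close>, \<open>b'\<close>.\<close>

definition splitting :: "nat => nat => (nat => nat => 'k::field) => (nat => nat => 'k)
  => (nat => nat => 'k) => (nat => nat => 'k) => bool" where
 "splitting n r a b a' b' \<longleftrightarrow> r \<le> n &
   a : mats {..<n} {..<r} & b : mats {..<r} {..<n} & a' : mats {..<n} {..<n - r} & b' : mats {..<n - r} {..<n} &
   b *{n} a = idm {..<r} & b' *{n} a' = idm {..<n - r} & b *{n} a' = 0 & b' *{n} a = 0 &
   a *{r} b + a' *{n - r} b' = idm {..<n}"

lemma splittingD:
 assumes "splitting n r a b a' b'"
 shows "r \<le> n" "a : mats {..<n} {..<r}" "b : mats {..<r} {..<n}" "a' : mats {..<n} {..<n - r}" "b' : mats {..<n - r} {..<n}"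
  "b *{n} a = idm {..<r}" "b' *{n} a' = idm {..<n - r}" "b *{n} a' = 0" "b' *{n} a = 0"
  "a *{r} b + a' *{n - r} b' = idm {..<n}"
 using assms by (simp_all add: splitting_def)

lemma idempotent_splitting:
 fixes p :: "nat => nat => 'k::field"
 assumes p: "p : mats {..<n} {..<n}" "p *{n} p = p"
 obtains r a b a' b' where "splitting n r a b a' b'" "a *{r} b = p"
proof -
 have split: "EX r a b. a : mats {..<n} {..<r} & b : mats {..<r} {..<n} & a *{r} b = q & b *{n} a = idm {..<r :: nat}"
  if q: "q : mats {..<n} {..<n}" "q *{n} q = q" for q :: "nat => nat => 'k"
 proof -
  obtain S a b where S: "S \<subseteq> {..<n}" "a : mats {..<n} S" "b : mats S {..<n}" "a *[S] b = q" "b *{n} a = idm S"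
   by (rule split_idempotent[OF finite_lessThan q])
  have fS: "finite S" using S(1) finite_subset by blast
  have "card {..<card S} = card S" by simp
  then obtain a' b' where "a' : mats {..<n} {..<card S}" "b' : mats {..<card S} {..<n}" "a' *{card S} b' = a *[S] b"
   "b' *{n} a' = idm {..<card S}"
   by (rule reindex_splitting[OF fS finite_lessThan _ S(2,3,5)])
  then show ?thesis unfolding S(4) by blast
 qed
 obtain r :: nat and a b where ab: "a : mats {..<n} {..<r}" "b : mats {..<r} {..<n}" "a *{r} b = p" "b *{n} a = idm {..<r}"
  using split[OF p] by blast
 have i: "idm {..<n} *{n} idm {..<n} = (idm {..<n} :: nat => nat => 'k)" by (rule idm_mmul_idm) simp
 have "idm {..<n} - p : mats {..<n} {..<n}" using p(1) by (intro mats_diff mats_idm)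
 moreover have "(idm {..<n} - p) *{n} (idm {..<n} - p) = idm {..<n} - p"
  unfolding mmul_diff_left mmul_diff_right i p(2) idm_mmul[OF finite_lessThan p(1)] mmul_idm[OF finite_lessThan p(1)] by simp
 ultimately obtain r' :: nat and a' b' where ab': "a' : mats {..<n} {..<r'}" "b' : mats {..<r'} {..<n}" "a' *{r'} b' = idm {..<n} - p" "b' *{n} a' = idm {..<r'}"
  using split by blast
 have sum: "a *{r} b + a' *{r'} b' = idm {..<n}" unfolding ab(3) ab'(3) by simp
 note cs = complementary_splittings[OF finite_lessThan finite_lessThan finite_lessThan ab(1,2,4) ab'(1,2,4) sum]
 have r: "r' = n - r" "r \<le> n" using cs(3) by simp_all
 show thesis by (rule that[of r a b a' b']) (use ab ab' cs(1,2) sum r in "simp_all add: splitting_def")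
qed

text \<open>A nontrivial idempotent endomorphism \<open>p\<close> is split at every vertex. As it
  commutes with the arrows, compressing \<open>x\<close> to the two parts gives representations
  whose sum is \<open>x\<close>; they inherit the vanishing products, since \<open>p\<close> can be
  moved past an arrow.\<close>

lemma square_zero_reps_splitting:
 fixes x :: "'a => 'k::field mat"
 assumes fin: "fin_digraph Q" and x: "x : square_zero_reps Q d"
  and ne: "EX v:verts Q. d v ~= 0" and dec: "\<not> rindec Q d x"
 obtains r a b a' b' x1 x2 where "!!v. v : verts Q ==> splitting (d v) (r v) (a v) (b v) (a' v) (b' v)"
  "!!v. v \<notin> verts Q ==> r v = 0" "EX v:verts Q. r v ~= 0" "EX v:verts Q. r v ~= d v"
  "x1 : square_zero_reps Q r" "x2 : square_zero_reps Q (%v. d v - r v)"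
  "!!ar. ar : arcs Q ==> fm (x ar) = a (head Q ar) *{r (head Q ar)} (fm (x1 ar) *{r (tail Q ar)} b (tail Q ar))
   + a' (head Q ar) *{d (head Q ar) - r (head Q ar)} (fm (x2 ar) *{d (tail Q ar) - r (tail Q ar)} b' (tail Q ar))"
proof -
 interpret fin_digraph Q by fact
 obtain p where hom: "rhom Q d x d x p" and idem: "!!v. v : verts Q ==> p v *{d v} p v = p v"
  and nontriv: "EX v:verts Q. p v ~= 0" "EX v:verts Q. p v ~= idm {..<d v}"
  using dec ne unfolding rindec_def by blast
 have pm: "p v : mats {..<d v} {..<d v}" if "v : verts Q" for v using hom that by (simp add: rhom_def)
 have comm: "p (head Q ar) *{d (head Q ar)} fm (x ar) = fm (x ar) *{d (tail Q ar)} p (tail Q ar)"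
  if "ar : arcs Q" for ar using hom that by (simp add: rhom_def)
 have xr: "x : rep_space Q d" using x by (simp add: square_zero_reps_def)
 have "EX q. v : verts Q --> splitting (d v) (fst q) (fst (snd q)) (fst (snd (snd q))) (fst (snd (snd (snd q)))) (snd (snd (snd (snd q)))) &
   fst (snd q) *{fst q} fst (snd (snd q)) = p v" for v
 proof (cases "v : verts Q")
  case True
  obtain r a b a' b' where "splitting (d v) r a b a' b'" "a *{r} b = p v"
   by (rule idempotent_splitting[OF pm[OF True] idem[OF True]])
  then show ?thesis by (intro exI[of _ "(r, a, b, a', b')"]) simp
 qed simp
 then have "ALL v. EX q. v : verts Q --> splitting (d v) (fst q) (fst (snd q)) (fst (snd (snd q))) (fst (snd (snd (snd q)))) (snd (snd (snd (snd q)))) &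
   fst (snd q) *{fst q} fst (snd (snd q)) = p v" by (rule allI)
 from choice[OF this] obtain q where q: "ALL v. v : verts Q --> splitting (d v) (fst (q v)) (fst (snd (q v))) (fst (snd (snd (q v)))) (fst (snd (snd (snd (q v))))) (snd (snd (snd (snd (q v))))) &
   fst (snd (q v)) *{fst (q v)} fst (snd (snd (q v))) = p v" ..
 define r where "r v = (if v : verts Q then fst (q v) else 0)" for v
 define a where "a v = fst (snd (q v))" for v
 define b where "b v = fst (snd (snd (q v)))" for v
 define a' where "a' v = fst (snd (snd (snd (q v))))" for v
 define b' where "b' v = snd (snd (snd (snd (q v))))" for v
 have sp: "splitting (d v) (r v) (a v) (b v) (a' v) (b' v)" and ab: "a v *{r v} b v = p v" if "v : verts Q" for v
  using spec[OF q, of v] that by (simp_all add: r_def a_def b_def a'_def b'_def)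
 have ab': "a' v *{d v - r v} b' v = idm {..<d v} - p v" if "v : verts Q" for v
  using splittingD(10)[OF sp[OF that]] unfolding ab[OF that] by (metis add_diff_cancel_left')
 have r0: "EX v:verts Q. r v ~= 0"
 proof -
  obtain v where v: "v : verts Q" "p v ~= 0" using nontriv(1) by blast
  then have "r v ~= 0" using ab[OF v(1)] by auto
  then show ?thesis using v by blast
 qed
 have rd: "EX v:verts Q. r v ~= d v"
 proof -
  obtain v where v: "v : verts Q" "p v ~= idm {..<d v}" using nontriv(2) by blast
  then have "r v ~= d v" using ab'[OF v(1)] by auto
  then show ?thesis using v by blast
 qed
 define x1 where "x1 = (\<lambda>ar\<in>arcs Q. tm (r (head Q ar)) (r (tail Q ar))
  (b (head Q ar) *{d (head Q ar)} (fm (x ar) *{d (tail Q ar)} a (tail Q ar))))"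
 define x2 where "x2 = (\<lambda>ar\<in>arcs Q. tm (d (head Q ar) - r (head Q ar)) (d (tail Q ar) - r (tail Q ar))
  (b' (head Q ar) *{d (head Q ar)} (fm (x ar) *{d (tail Q ar)} a' (tail Q ar))))"
 have fm1: "fm (x1 ar) = b (head Q ar) *{d (head Q ar)} (fm (x ar) *{d (tail Q ar)} a (tail Q ar))"
  and fm2: "fm (x2 ar) = b' (head Q ar) *{d (head Q ar)} (fm (x ar) *{d (tail Q ar)} a' (tail Q ar))"
  if ar: "ar : arcs Q" for ar
 proof -
  have th: "tail Q ar : verts Q" "head Q ar : verts Q" using ar by auto
  note D = splittingD[OF sp[OF th(1)]] splittingD[OF sp[OF th(2)]]
  note X = rep_space_fm[OF xr ar]
  show "fm (x1 ar) = b (head Q ar) *{d (head Q ar)} (fm (x ar) *{d (tail Q ar)} a (tail Q ar))"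
   unfolding x1_def restrict_apply'[OF ar] by (rule fm_tm[OF mats_mmul[OF D(13) mats_mmul[OF X D(2)]]])
  show "fm (x2 ar) = b' (head Q ar) *{d (head Q ar)} (fm (x ar) *{d (tail Q ar)} a' (tail Q ar))"
   unfolding x2_def restrict_apply'[OF ar] by (rule fm_tm[OF mats_mmul[OF D(15) mats_mmul[OF X D(4)]]])
 qed
 have zero: "fm (x br) *{d (tail Q br)} (p (tail Q br) *{d (tail Q br)} (fm (x ar) *{d (tail Q ar)} Z)) = 0"
  "fm (x br) *{d (tail Q br)} (fm (x ar) *{d (tail Q ar)} Z) = 0"
  if ab: "ar : arcs Q" "br : arcs Q" "head Q ar = tail Q br" for ar br and Z :: "nat => nat => 'k"
 proof -
  have 0: "fm (x br) *{d (tail Q br)} fm (x ar) = 0" using x ab by (simp add: square_zero_reps_def)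
  show "fm (x br) *{d (tail Q br)} (fm (x ar) *{d (tail Q ar)} Z) = 0"
   unfolding mmul_assoc[symmetric] 0 by simp
  have "fm (x br) *{d (tail Q br)} (p (tail Q br) *{d (tail Q br)} (fm (x ar) *{d (tail Q ar)} Z))
   = p (head Q br) *{d (head Q br)} ((fm (x br) *{d (tail Q br)} fm (x ar)) *{d (tail Q ar)} Z)"
   unfolding mmul_assoc[symmetric] comm[OF ab(2)] ..
  then show "fm (x br) *{d (tail Q br)} (p (tail Q br) *{d (tail Q br)} (fm (x ar) *{d (tail Q ar)} Z)) = 0"
   unfolding 0 by simp
 qed
 have idm_x: "idm {..<d (head Q ar)} *{d (head Q ar)} fm (x ar) = fm (x ar)" "fm (x ar) *{d (tail Q ar)} idm {..<d (tail Q ar)} = fm (x ar)"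
  if "ar : arcs Q" for ar using idm_mmul[OF _ rep_space_fm[OF xr that]] mmul_idm[OF _ rep_space_fm[OF xr that]] by simp_all
 have x1: "x1 : square_zero_reps Q r"
  unfolding square_zero_reps_def
 proof (intro CollectI conjI ballI impI)
  show "x1 : rep_space Q r" by (auto simp: x1_def rep_space_def)
  fix ar br assume ab0: "ar : arcs Q" "br : arcs Q" "head Q ar = tail Q br"
  have t: "tail Q br : verts Q" using ab0 by auto
  have "a (tail Q br) *{r (tail Q br)} (b (tail Q br) *{d (tail Q br)} Z) = p (tail Q br) *{d (tail Q br)} Z" for Z :: "nat => nat => 'k"
   unfolding mmul_assoc[symmetric] ab[OF t] ..
  then show "fm (x1 br) *{r (tail Q br)} fm (x1 ar) = 0"
   unfolding fm1[OF ab0(1)] fm1[OF ab0(2)] by (simp add: mmul_assoc ab0(3) zero[OF ab0])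
 qed
 have x2: "x2 : square_zero_reps Q (%v. d v - r v)"
  unfolding square_zero_reps_def
 proof (intro CollectI conjI ballI impI)
  show "x2 : rep_space Q (%v. d v - r v)" by (auto simp: x2_def rep_space_def)
  fix ar br assume ab0: "ar : arcs Q" "br : arcs Q" "head Q ar = tail Q br"
  have t: "tail Q br : verts Q" using ab0 by auto
  have e: "a' (tail Q br) *{d (tail Q br) - r (tail Q br)} (b' (tail Q br) *{d (tail Q br)} Z)
   = idm {..<d (tail Q br)} *{d (tail Q br)} Z - p (tail Q br) *{d (tail Q br)} Z" for Z :: "nat => nat => 'k"
   unfolding mmul_assoc[symmetric] ab'[OF t] mmul_diff_left ..
  have i: "fm (x br) *{d (tail Q br)} (idm {..<d (tail Q br)} *{d (tail Q br)} Z) = fm (x br) *{d (tail Q br)} Z" for Z :: "nat => nat => 'k"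
   unfolding mmul_assoc[symmetric] idm_x(2)[OF ab0(2)] ..
  show "fm (x2 br) *{d (tail Q br) - r (tail Q br)} fm (x2 ar) = 0"
   unfolding fm2[OF ab0(1)] fm2[OF ab0(2)] by (simp add: mmul_assoc mmul_diff_right ab0(3) e i zero[OF ab0])
 qed
 show thesis
 proof (rule that[of r a b a' b' x1 x2, OF sp _ r0 rd x1 x2])
  show "r v = 0" if "v \<notin> verts Q" for v using that by (simp add: r_def)
  fix ar assume ar: "ar : arcs Q"
  let ?t = "tail Q ar" and ?h = "head Q ar"
  have th: "?t : verts Q" "?h : verts Q" using ar by auto
  let ?X = "fm (x ar)"
  have 1: "a ?h *{r ?h} (fm (x1 ar) *{r ?t} b ?t) = p ?h *{d ?h} ?X"
  proof -
   have "a ?h *{r ?h} (fm (x1 ar) *{r ?t} b ?t) = (a ?h *{r ?h} b ?h) *{d ?h} (?X *{d ?t} (a ?t *{r ?t} b ?t))"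
    unfolding fm1[OF ar] mmul_assoc ..
   also have "... = (p ?h *{d ?h} p ?h) *{d ?h} ?X" unfolding ab[OF th(1)] ab[OF th(2)] comm[OF ar, symmetric] mmul_assoc ..
   finally show ?thesis unfolding idem[OF th(2)] .
  qed
  have 2: "a' ?h *{d ?h - r ?h} (fm (x2 ar) *{d ?t - r ?t} b' ?t) = ?X - p ?h *{d ?h} ?X"
  proof -
   have "a' ?h *{d ?h - r ?h} (fm (x2 ar) *{d ?t - r ?t} b' ?t)
    = (a' ?h *{d ?h - r ?h} b' ?h) *{d ?h} (?X *{d ?t} (a' ?t *{d ?t - r ?t} b' ?t))"
    unfolding fm2[OF ar] mmul_assoc ..
   also have "... = (idm {..<d ?h} - p ?h) *{d ?h} (?X - p ?h *{d ?h} ?X)"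
    unfolding ab'[OF th(1)] ab'[OF th(2)] mmul_diff_right idm_x(2)[OF ar] comm[OF ar] ..
   also have "... = ?X - p ?h *{d ?h} ?X"
    unfolding mmul_diff_right mmul_diff_left idm_x(1)[OF ar] mmul_assoc[symmetric] idem[OF th(2)]
     idm_mmul[OF finite_lessThan pm[OF th(2)]] by simp
   finally show ?thesis .
  qed
  show "?X = a ?h *{r ?h} (fm (x1 ar) *{r ?t} b ?t) + a' ?h *{d ?h - r ?h} (fm (x2 ar) *{d ?t - r ?t} b' ?t)"
   unfolding 1 2 by simp
 qed
qed

lemma splitting_inverse:
 assumes s: "splitting n r a b a' b'" and t: "splitting n r A B A' B'"
  and g: "g : mats {..<r} {..<r}" "h : mats {..<r} {..<r}" "g *{r} h = idm {..<r}"
  and g': "g' : mats {..<n - r} {..<n - r}" "h' : mats {..<n - r} {..<n - r}" "g' *{n - r} h' = idm {..<n - r}"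
 shows "(A *{r} (g *{r} b) + A' *{n - r} (g' *{n - r} b'))
  *{n} (a *{r} (h *{r} B) + a' *{n - r} (h' *{n - r} B')) = idm {..<n}"
proof -
 note S = splittingD[OF s] and T = splittingD[OF t]
 have c: "b *{n} (a *{r} Z) = idm {..<r} *{r} Z" "b' *{n} (a' *{n - r} Z) = idm {..<n - r} *{n - r} Z"
  "b *{n} (a' *{n - r} Z) = 0" "b' *{n} (a *{r} Z) = 0"
  "g *{r} (h *{r} Z) = idm {..<r} *{r} Z" "g' *{n - r} (h' *{n - r} Z) = idm {..<n - r} *{n - r} Z"
  for Z :: "nat => nat => 'a"
  unfolding mmul_assoc[symmetric] S(6,7,8,9) g(3) g'(3) by simp_all
 have i: "idm {..<r} *{r} (h *{r} Z) = h *{r} Z" "idm {..<n - r} *{n - r} (h' *{n - r} Z) = h' *{n - r} Z"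
  for Z :: "nat => nat => 'a"
  unfolding mmul_assoc[symmetric] idm_mmul[OF finite_lessThan g(2)] idm_mmul[OF finite_lessThan g'(2)] by simp_all
 have B: "idm {..<r} *{r} B = B" "idm {..<n - r} *{n - r} B' = B'"
  using idm_mmul[OF _ T(3)] idm_mmul[OF _ T(5)] by simp_all
 show ?thesis by (simp add: mmul_simps c i B T(10))
qed

text \<open>The orbit of a direct sum depends only on the dimensions and the orbits of the summands:
  \<open>G\<close> reads a vector in the first splitting, applies the group elements of the summands
  and writes the result in the second.\<close>

lemma GL_orbit_splitting:
 fixes x y :: "'a => 'k::field mat"
 assumes wf: "wf_digraph Q" and xy: "x : rep_space Q d" "y : rep_space Q d"
  and s: "!!v. v : verts Q ==> splitting (d v) (r v) (a v) (b v) (a' v) (b' v)"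
  and t: "!!v. v : verts Q ==> splitting (d v) (r v) (A v) (B v) (A' v) (B' v)"
  and x: "!!ar. ar : arcs Q ==> fm (x ar) = a (head Q ar) *{r (head Q ar)} (fm (x1 ar) *{r (tail Q ar)} b (tail Q ar))
   + a' (head Q ar) *{d (head Q ar) - r (head Q ar)} (fm (x2 ar) *{d (tail Q ar) - r (tail Q ar)} b' (tail Q ar))"
  and y: "!!ar. ar : arcs Q ==> fm (y ar) = A (head Q ar) *{r (head Q ar)} (fm (y1 ar) *{r (tail Q ar)} B (tail Q ar))
   + A' (head Q ar) *{d (head Q ar) - r (head Q ar)} (fm (y2 ar) *{d (tail Q ar) - r (tail Q ar)} B' (tail Q ar))"
  and 1: "x1 : rep_space Q r" "y1 : GL_orbit Q r x1"
  and 2: "x2 : rep_space Q (%v. d v - r v)" "y2 : GL_orbit Q (%v. d v - r v) x2"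
 shows "y : GL_orbit Q d x"
proof -
 interpret wf_digraph Q by fact
 obtain g h where gh: "inverse_pair Q r g h" and y1: "y1 = act Q r g h x1" using 1(2) unfolding GL_orbit_eq[OF wf 1(1)] by blast
 obtain g' h' where gh': "inverse_pair Q (%v. d v - r v) g' h'" and y2: "y2 = act Q (%v. d v - r v) g' h' x2"
  using 2(2) unfolding GL_orbit_eq[OF wf 2(1)] by blast
 define G where "G v = A v *{r v} (g v *{r v} b v) + A' v *{d v - r v} (g' v *{d v - r v} b' v)" for v
 define H where "H v = a v *{r v} (h v *{r v} B v) + a' v *{d v - r v} (h' v *{d v - r v} B' v)" for v
 have GH: "inverse_pair Q d G H"
  unfolding inverse_pair_def
 proof (intro ballI conjI)
  fix v assume v: "v : verts Q"
  note S = splittingD[OF s[OF v]] and T = splittingD[OF t[OF v]]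
  note p = bspec[OF gh[unfolded inverse_pair_def] v] and p' = bspec[OF gh'[unfolded inverse_pair_def] v]
  show "G v : mats {..<d v} {..<d v}" unfolding G_def by (rule mats_add[OF mats_mmul[OF T(2) mats_mmul[OF conjunct1[OF p] S(3)]] mats_mmul[OF T(4) mats_mmul[OF conjunct1[OF p'] S(5)]]])
  show "H v : mats {..<d v} {..<d v}" unfolding H_def
   by (rule mats_add[OF mats_mmul[OF S(2) mats_mmul[OF conjunct1[OF conjunct2[OF p]] T(3)]] mats_mmul[OF S(4) mats_mmul[OF conjunct1[OF conjunct2[OF p']] T(5)]]])
  show "G v *{d v} H v = idm {..<d v}" unfolding G_def H_def
   by (rule splitting_inverse[OF s[OF v] t[OF v]]) (use p p' in simp_all)
  show "H v *{d v} G v = idm {..<d v}" unfolding G_def H_def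
   by (rule splitting_inverse[OF t[OF v] s[OF v]]) (use p p' in simp_all)
 qed
 have "act Q d G H x = y"
 proof (rule rep_space_eqI[OF act_rep_space xy(2)])
  fix ar assume ar: "ar : arcs Q"
  let ?t = "tail Q ar" and ?h = "head Q ar"
  have th: "?t : verts Q" "?h : verts Q" using ar by auto
  note S = splittingD[OF s[OF th(2)]] and T = splittingD[OF s[OF th(1)]]
  have c: "b ?h *{d ?h} (a ?h *{r ?h} Z) = idm {..<r ?h} *{r ?h} Z"
   "b' ?h *{d ?h} (a' ?h *{d ?h - r ?h} Z) = idm {..<d ?h - r ?h} *{d ?h - r ?h} Z"
   "b ?h *{d ?h} (a' ?h *{d ?h - r ?h} Z) = 0" "b' ?h *{d ?h} (a ?h *{r ?h} Z) = 0"
   "b ?t *{d ?t} (a ?t *{r ?t} Z) = idm {..<r ?t} *{r ?t} Z"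
   "b' ?t *{d ?t} (a' ?t *{d ?t - r ?t} Z) = idm {..<d ?t - r ?t} *{d ?t - r ?t} Z"
   "b ?t *{d ?t} (a' ?t *{d ?t - r ?t} Z) = 0" "b' ?t *{d ?t} (a ?t *{r ?t} Z) = 0"
   for Z :: "nat => nat => 'k"
   unfolding mmul_assoc[symmetric] S(6,7,8,9) T(6,7,8,9) by simp_all
  have i: "idm {..<r ?h} *{r ?h} (fm (x1 ar) *{r ?t} Z) = fm (x1 ar) *{r ?t} Z"
   "idm {..<d ?h - r ?h} *{d ?h - r ?h} (fm (x2 ar) *{d ?t - r ?t} Z) = fm (x2 ar) *{d ?t - r ?t} Z"
   "fm (x1 ar) *{r ?t} (idm {..<r ?t} *{r ?t} Z) = fm (x1 ar) *{r ?t} Z"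
   "fm (x2 ar) *{d ?t - r ?t} (idm {..<d ?t - r ?t} *{d ?t - r ?t} Z) = fm (x2 ar) *{d ?t - r ?t} Z"
   for Z :: "nat => nat => 'k"
   unfolding mmul_assoc[symmetric] idm_mmul[OF finite_lessThan rep_space_fm[OF 1(1) ar]] idm_mmul[OF finite_lessThan rep_space_fm[OF 2(1) ar]]
    mmul_idm[OF finite_lessThan rep_space_fm[OF 1(1) ar]] mmul_idm[OF finite_lessThan rep_space_fm[OF 2(1) ar]] by simp_all
  show "fm (act Q d G H x ar) = fm (y ar)"
   unfolding fm_act[OF wf GH xy(1) ar] y[OF ar] x[OF ar] y1 y2 fm_act[OF wf gh 1(1) ar] fm_act[OF wf gh' 2(1) ar] G_def H_def
   by (simp add: mmul_simps c i)
 qed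
 then show ?thesis unfolding GL_orbit_eq[OF wf xy(1)] using GH by blast
qed

text \<open>Induction on the total dimension. A decomposable point is assigned the dimensions of a
  first summand and the orbits of both summands; there are finitely many such data, and they
  determine its orbit.\<close>

lemma finite_orbits:
 fixes Q :: "('v, 'a) pre_digraph"
 assumes fin: "fin_digraph Q"
  and indec: "!!d. finite (GL_orbit Q d ` {x : square_zero_reps Q d. rindec Q d (x :: 'a => 'k::field mat)})"
 shows "finite (GL_orbit Q d ` (square_zero_reps Q d :: ('a => 'k mat) set))"
proof (induction "SUM v:verts Q. d v" arbitrary: d rule: less_induct)
 case less
 interpret fin_digraph Q by fact
 note wf = wf_digraph_axioms
 let ?Z = "%d. square_zero_reps Q d :: ('a => 'k mat) set"
 have rs: "x : rep_space Q d" if "x : ?Z d" for x d using that by (simp add: square_zero_reps_def)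
 show ?case
 proof (cases "EX v:verts Q. d v ~= 0")
  case False
  have "x = y" if "x : ?Z d" "y : ?Z d" for x y
  proof (rule rep_space_eqI[OF rs[OF that(1)] rs[OF that(2)]])
   fix ar assume ar: "ar : arcs Q"
   then have "d (head Q ar) = 0" using False by auto
   then show "fm (x ar) = fm (y ar)" using rep_space_fm[OF rs[OF that(1)] ar] rep_space_fm[OF rs[OF that(2)] ar] by simp
  qed
  then have "EX x0. ?Z d \<subseteq> {x0}" by blast
  then have "finite (?Z d)" using finite_subset by blast
  then show ?thesis by (rule finite_imageI)
 next
  case True
  let ?D = "{x : ?Z d. \<not> rindec Q d x}"
  define dec where "dec x r x1 x2 \<longleftrightarrow> (EX a b a' b'. (ALL v:verts Q. splitting (d v) (r v) (a v) (b v) (a' v) (b' v)) &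
   (ALL ar:arcs Q. fm (x ar) = a (head Q ar) *{r (head Q ar)} (fm (x1 ar) *{r (tail Q ar)} b (tail Q ar))
   + a' (head Q ar) *{d (head Q ar) - r (head Q ar)} (fm (x2 ar) *{d (tail Q ar) - r (tail Q ar)} b' (tail Q ar))))"
   for x x1 x2 :: "'a => 'k mat" and r
  \<comment> \<open>The dimension vectors of proper nonzero summands, with value 0 outside the
    vertices so that there are finitely many.\<close>
  let ?R = "{r. (ALL v:verts Q. r v \<le> d v) & (ALL v. v \<notin> verts Q --> r v = 0) & (EX v:verts Q. r v ~= 0) & (EX v:verts Q. r v ~= d v)}"
  have "EX k. x : ?D --> fst k : ?R & fst (snd k) : ?Z (fst k) & snd (snd k) : ?Z (%v. d v - fst k v) & dec x (fst k) (fst (snd k)) (snd (snd k))" for x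
  proof (cases "x : ?D")
   case D: True
   then have x: "x : ?Z d" "\<not> rindec Q d x" by auto
   obtain r a b a' b' x1 x2 where sp: "!!v. v : verts Q ==> splitting (d v) (r v) (a v) (b v) (a' v) (b' v)"
    and r: "!!v. v \<notin> verts Q ==> r v = 0" "EX v:verts Q. r v ~= 0" "EX v:verts Q. r v ~= d v"
    and x12: "x1 : ?Z r" "x2 : ?Z (%v. d v - r v)"
    and e: "!!ar. ar : arcs Q ==> fm (x ar) = a (head Q ar) *{r (head Q ar)} (fm (x1 ar) *{r (tail Q ar)} b (tail Q ar))
     + a' (head Q ar) *{d (head Q ar) - r (head Q ar)} (fm (x2 ar) *{d (tail Q ar) - r (tail Q ar)} b' (tail Q ar))"
    by (rule square_zero_reps_splitting[OF fin x(1) True x(2)]) (rule that)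
   have "dec x r x1 x2" unfolding dec_def
    by (intro exI[of _ a] exI[of _ b] exI[of _ a'] exI[of _ b'] conjI ballI sp e)
   moreover have "r : ?R" using r splittingD(1)[OF sp] by simp
   ultimately show ?thesis using x12 by (intro exI[of _ "(r, x1, x2)"]) simp
  qed blast
  then have "ALL x. EX k. x : ?D --> fst k : ?R & fst (snd k) : ?Z (fst k) & snd (snd k) : ?Z (%v. d v - fst k v) & dec x (fst k) (fst (snd k)) (snd (snd k))" by (rule allI)
  from choice[OF this] obtain k where k: "ALL x. x : ?D --> fst (k x) : ?R & fst (snd (k x)) : ?Z (fst (k x)) &
    snd (snd (k x)) : ?Z (%v. d v - fst (k x) v) & dec x (fst (k x)) (fst (snd (k x))) (snd (snd (k x)))" ..
  define F where "F x = (fst (k x), GL_orbit Q (fst (k x)) (fst (snd (k x))), GL_orbit Q (%v. d v - fst (k x) v) (snd (snd (k x))))" for x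
  have finR: "finite ?R"
  proof (rule finite_subset)
   show "?R \<subseteq> {r. ALL v. (v : verts Q --> r v : {..(SUM v:verts Q. d v)}) & (v \<notin> verts Q --> r v = 0)}"
   proof (intro subsetI CollectI allI conjI impI)
    fix r v assume r: "r : ?R" and v: "v : verts Q"
    have "r v \<le> d v" using r v by blast
    also have "... \<le> (SUM v:verts Q. d v)" by (rule member_le_sum[OF v]) auto
    finally show "r v : {..(SUM v:verts Q. d v)}" by simp
   qed auto
   show "finite {r. ALL v. (v : verts Q --> r v : {..(SUM v:verts Q. d v)}) & (v \<notin> verts Q --> r v = 0)}"
    by (rule finite_set_of_finite_funs) auto
  qed
  have IH: "finite (GL_orbit Q r ` ?Z r)" "finite (GL_orbit Q (%v. d v - r v) ` ?Z (%v. d v - r v))" if r: "r : ?R" for r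
  proof -
   obtain u w where u: "u : verts Q" "r u ~= d u" and w: "w : verts Q" "r w ~= 0" using r by blast
   have le: "r v \<le> d v" if "v : verts Q" for v using r that by blast
   have "(SUM v:verts Q. r v) < (SUM v:verts Q. d v)"
    by (rule sum_strict_mono_ex1) (use le u in "auto intro!: bexI[of _ u] simp: order_less_le")
   then show "finite (GL_orbit Q r ` ?Z r)" by (rule less)
   have "d w - r w < d w" using le[OF w(1)] w(2) by simp
   then have "(SUM v:verts Q. d v - r v) < (SUM v:verts Q. d v)"
    by (intro sum_strict_mono_ex1) (use w in auto)
   then show "finite (GL_orbit Q (%v. d v - r v) ` ?Z (%v. d v - r v))" by (rule less)
  qed
  have "finite (SIGMA r:?R. GL_orbit Q r ` ?Z r \<times> GL_orbit Q (%v. d v - r v) ` ?Z (%v. d v - r v))"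
   by (rule finite_SigmaI[OF finR finite_cartesian_product[OF IH]])
  moreover have "F ` ?D \<subseteq> (SIGMA r:?R. GL_orbit Q r ` ?Z r \<times> GL_orbit Q (%v. d v - r v) ` ?Z (%v. d v - r v))"
  proof (rule image_subsetI)
   fix x assume "x : ?D"
   note kx = k[rule_format, OF this]
   show "F x : (SIGMA r:?R. GL_orbit Q r ` ?Z r \<times> GL_orbit Q (%v. d v - r v) ` ?Z (%v. d v - r v))"
    unfolding F_def by (intro SigmaI imageI) (rule conjunct1[OF kx], rule conjunct1[OF conjunct2[OF kx]], rule conjunct1[OF conjunct2[OF conjunct2[OF kx]]])
  qed
  ultimately have finF: "finite (F ` ?D)" by (rule finite_subset[rotated])
  have "finite (GL_orbit Q d ` ?D)"
  proof (rule finite_image_factor[OF finF])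
   fix x y assume x: "x : ?D" and y: "y : ?D" and eq: "F x = F y"
   let ?r = "fst (k x)"
   note kx = k[rule_format, OF x] and ky = k[rule_format, OF y]
   define x1 x2 y1 y2 where e: "x1 = fst (snd (k x))" "x2 = snd (snd (k x))" "y1 = fst (snd (k y))" "y2 = snd (snd (k y))"
   have ry: "fst (k y) = ?r" using eq by (simp add: F_def)
   have x12: "x1 : ?Z ?r" "x2 : ?Z (%v. d v - ?r v)" "y1 : ?Z ?r" "y2 : ?Z (%v. d v - ?r v)"
    and dx: "dec x ?r x1 x2" and dy: "dec y ?r y1 y2"
    using kx ky unfolding e ry by blast+
   have o: "GL_orbit Q ?r x1 = GL_orbit Q ?r y1" "GL_orbit Q (%v. d v - ?r v) x2 = GL_orbit Q (%v. d v - ?r v) y2"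
    using eq unfolding F_def ry e by simp_all
   have o1: "y1 : GL_orbit Q ?r x1" unfolding o(1) by (rule GL_orbit_refl[OF wf rs[OF x12(3)]])
   have o2: "y2 : GL_orbit Q (%v. d v - ?r v) x2" unfolding o(2) by (rule GL_orbit_refl[OF wf rs[OF x12(4)]])
   have xy: "x : rep_space Q d" "y : rep_space Q d" using x y rs by auto
   obtain a b a' b' where X: "!!v. v : verts Q ==> splitting (d v) (?r v) (a v) (b v) (a' v) (b' v)"
    "!!ar. ar : arcs Q ==> fm (x ar) = a (head Q ar) *{?r (head Q ar)} (fm (x1 ar) *{?r (tail Q ar)} b (tail Q ar))
     + a' (head Q ar) *{d (head Q ar) - ?r (head Q ar)} (fm (x2 ar) *{d (tail Q ar) - ?r (tail Q ar)} b' (tail Q ar))"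
    using dx unfolding dec_def by (elim exE conjE) (rule that, erule bspec, assumption, erule bspec, assumption)
   obtain A B A' B' where Y: "!!v. v : verts Q ==> splitting (d v) (?r v) (A v) (B v) (A' v) (B' v)"
    "!!ar. ar : arcs Q ==> fm (y ar) = A (head Q ar) *{?r (head Q ar)} (fm (y1 ar) *{?r (tail Q ar)} B (tail Q ar))
     + A' (head Q ar) *{d (head Q ar) - ?r (head Q ar)} (fm (y2 ar) *{d (tail Q ar) - ?r (tail Q ar)} B' (tail Q ar))"
    using dy unfolding dec_def by (elim exE conjE) (rule that, erule bspec, assumption, erule bspec, assumption)
   have "y : GL_orbit Q d x"
    by (rule GL_orbit_splitting[OF wf xy X(1) Y(1) X(2) Y(2) rs[OF x12(1)] o1 rs[OF x12(2)] o2])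
   then show "GL_orbit Q d x = GL_orbit Q d y" by (rule GL_orbit_eq_if_mem[OF wf xy(1), symmetric])
  qed
  moreover have "?Z d = {x : ?Z d. rindec Q d x} \<union> ?D" by blast
  ultimately show ?thesis using indec[of d] by (metis (no_types, lifting) finite_Un image_Un)
 qed
qed

section \<open>The characterization\<close>

lemma bhom_cong:
 "(!!ar. ar : E ==> y ar = y' ar) ==> bhom W E src tgt T S y T S y D A \<longleftrightarrow> bhom W E src tgt T S y' T S y' D A"
 unfolding bhom_def by simp

lemma bindec_cong:
 assumes "!!ar. ar : E ==> y ar = y' ar"
 shows "bindec W E src tgt T S y \<longleftrightarrow> bindec W E src tgt T S y'"
proof -
 have "bhom W E src tgt T S y T S y = bhom W E src tgt T S y' T S y'" by (intro ext bhom_cong assms)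
 then show ?thesis unfolding bindec_def by (simp only:)
qed

context square_zero_algebra
begin

interpretation fin_digraph Q by (rule fin)

text \<open>Combines \<open>finite_dim_module_rep\<close> with \<open>block_normal_form\<close>;
  indecomposability travels along the isomorphisms.\<close>

lemma indecomposable_normal_form:
 assumes M: "finite_dim_module Q I M" and ind: "indecomposable_module (quiver_algebra Q I) M"
 obtains d s y where "!!v. v : verts Q ==> s v \<le> d v" "!!v. v \<notin> verts Q ==> d v = 0" "!!v. v \<notin> verts Q ==> s v = 0"
  "y : block_reps Q d s" "rindec Q d y" "module_iso (quiver_algebra Q I) (rep_module Q d y) M"
proof -
 have lm: "left_module (quiver_algebra Q I) M" using M by (simp add: finite_dim_module_def)
 obtain d x where x: "x : square_zero_reps Q d" and d: "!!v. v \<notin> verts Q ==> d v = 0"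
  and iso: "module_iso (quiver_algebra Q I) (rep_module Q d x) M"
  using M by (rule finite_dim_module_rep) (rule that)
 obtain s y where s: "!!v. v : verts Q ==> s v \<le> d v" "!!v. v \<notin> verts Q ==> s v = 0"
  and y: "y : block_reps Q d s" "x : GL_orbit Q d y"
  using fin x by (rule block_normal_form) (rule that)
 have ys: "y : square_zero_reps Q d" using block_reps_subset[of Q s d, OF s(1)] y(1) by blast
 have "module_iso (quiver_algebra Q I) (rep_module Q d y) (rep_module Q d x)"
  unfolding module_iso_rep_module_iff[OF ys x] by (rule y(2))
 then have iso': "module_iso (quiver_algebra Q I) (rep_module Q d y) M" by (rule module_iso_trans[OF _ iso])
 have "indecomposable_module (quiver_algebra Q I) (rep_module Q d y)"
  by (rule indecomposable_module_iso[OF lm left_module_rep_module[OF ys] module_iso_sym[OF left_module_rep_module[OF ys] iso'] ind])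
 then have "rindec Q d y" unfolding indecomposable_rep_module_iff[OF ys] .
 then show thesis using that[OF s(1) d s(2) y(1) _ iso'] by blast
qed

text \<open>The class of an indecomposable is determined by \<open>d\<close> and \<open>s\<close> in
  a normal form, because \<open>bindec_unique\<close> makes the separated representations
  isomorphic; and the vector \<open>(d - s, s)\<close> lies on the finite level 1 of the
  form.\<close>

lemma finite_representation_type_if_bpos:
 assumes pos: "bpos (verts Q) (arcs Q) (tail Q) (head Q)"
 shows "finite_representation_type Q I"
proof -
 let ?R = "quiver_algebra Q I" and ?X = "finite_dim_indecomposables Q I"
 let ?rel = "{(M, N). M : ?X & N : ?X & module_iso ?R M N}"
 note bq = bquiver_digraph[OF fin]
 \<comment> \<open>\<open>k\<close> is the pair \<open>(d, s)\<close> of a normal form of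
   \<open>M\<close>; the zeros outside the vertices make it recoverable from its values on the
   vertices.\<close>
 define nf where "nf M k \<longleftrightarrow> (ALL v:verts Q. snd k v \<le> fst k v) & (ALL v. v \<notin> verts Q --> fst k v = 0 & snd k v = 0) &
  (EX y. y : block_reps Q (fst k) (snd k) & rindec Q (fst k) y & module_iso ?R (rep_module Q (fst k) y) M)"
  for M :: "((('v, 'a) path => 'k) set, 'k vec) module" and k :: "('v => nat) \<times> ('v => nat)"
 have "EX k. M : ?X --> nf M k" for M
 proof (cases "M : ?X")
  case True
  then have M: "finite_dim_module Q I M" "indecomposable_module ?R M" by (simp_all add: finite_dim_indecomposables_def)
  obtain d s y where "!!v. v : verts Q ==> s v \<le> d v" "!!v. v \<notin> verts Q ==> d v = 0" "!!v. v \<notin> verts Q ==> s v = 0"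
   "y : block_reps Q d s" "rindec Q d y" "module_iso ?R (rep_module Q d y) M"
   using M by (rule indecomposable_normal_form) (rule that)
  then show ?thesis unfolding nf_def by (intro exI[of _ "(d, s)"]) auto
 qed blast
 then have "ALL M. EX k. M : ?X --> nf M k" by (rule allI)
 from choice[OF this] obtain k where k: "ALL M. M : ?X --> nf M (k M)" ..
 have ind: "bindec (verts Q) (arcs Q) (tail Q) (head Q) (top_index d s) (soc_index s) (%ar. fm (y ar))"
  if "!!v. v : verts Q ==> s v \<le> d v" "y : block_reps Q d s" "rindec Q d y" for d s and y :: "'a => 'k mat"
  by (rule rindec_bindec[OF fin that])
 note rep = block_reps_brep
 let ?K = "{k. EX M. nf M k}"
 let ?h = "%k. (\<lambda>v\<in>verts Q. int (fst k v - snd k v), \<lambda>v\<in>verts Q. int (snd k v))"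
 have "finite ?K"
 proof (rule finite_imageD)
  show "finite (?h ` ?K)"
  proof (rule finite_subset[OF _ finite_bform_level[OF bq pos, of 1]], rule image_subsetI)
   fix k assume "k : ?K"
   then obtain M where "nf M k" by blast
   then obtain y :: "'a => 'k mat" where s: "ALL v:verts Q. snd k v \<le> fst k v" and y: "y : block_reps Q (fst k) (snd k)" "rindec Q (fst k) y"
    unfolding nf_def by blast
   note sd = bspec[OF s]
   have "bform (verts Q) (arcs Q) (tail Q) (head Q) (%v. int (card {snd k v..<fst k v})) (%v. int (card {..<snd k v})) = 1"
    using bindec_unique[OF bq pos rep[OF y(1)] rep[OF y(1)] ind[OF sd y] ind[OF sd y]] by simp
   then have "bform (verts Q) (arcs Q) (tail Q) (head Q) (fst (?h k)) (snd (?h k)) = 1"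
    by (subst bform_cong[OF bq, of _ "%v. int (card {snd k v..<fst k v})" _ "%v. int (card {..<snd k v})"]) auto
   then show "?h k : {(t, s). t : extensional (verts Q) & s : extensional (verts Q) & bform (verts Q) (arcs Q) (tail Q) (head Q) t s = 1}"
    by simp
  qed
  show "inj_on ?h ?K"
  proof (rule inj_onI)
   fix k l assume "k : ?K" "l : ?K" and eq: "?h k = ?h l"
   then have kl: "ALL v:verts Q. snd k v \<le> fst k v" "ALL v. v \<notin> verts Q --> fst k v = 0 & snd k v = 0"
    "ALL v:verts Q. snd l v \<le> fst l v" "ALL v. v \<notin> verts Q --> fst l v = 0 & snd l v = 0"
    unfolding nf_def by blast+
   have "fst k v = fst l v & snd k v = snd l v" for v
   proof (cases "v : verts Q")
    case True
    have "fst (?h k) v = fst (?h l) v" "snd (?h k) v = snd (?h l) v" unfolding eq by (rule refl)+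
    moreover have "snd k v \<le> fst k v" "snd l v \<le> fst l v" using kl(1,3) True by blast+
    ultimately show ?thesis using True by simp
   next
    case False
    then show ?thesis using kl(2,4) by simp
   qed
   then show "k = l" by (auto simp: prod_eq_iff fun_eq_iff)
  qed
 qed
 moreover have "k ` ?X \<subseteq> ?K" using k by blast
 ultimately have fink: "finite (k ` ?X)" by (rule finite_subset[rotated])
 have "finite ((%M. ?rel `` {M}) ` ?X)"
 proof (rule finite_image_factor[OF fink])
  fix M N assume M: "M : ?X" and N: "N : ?X" and eq: "k M = k N"
  have lm: "left_module ?R M" "left_module ?R N" using M N by (simp_all add: finite_dim_indecomposables_def finite_dim_module_def)
  let ?d = "fst (k M)" and ?s = "snd (k M)"
  have nM: "nf M (k M)" by (rule k[rule_format, OF M])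
  have nN: "nf N (k M)" unfolding eq by (rule k[rule_format, OF N])
  obtain y :: "'a => 'k mat" where y: "y : block_reps Q ?d ?s" "rindec Q ?d y" "module_iso ?R (rep_module Q ?d y) M" using nM unfolding nf_def by blast
  obtain z :: "'a => 'k mat" where z: "z : block_reps Q ?d ?s" "rindec Q ?d z" "module_iso ?R (rep_module Q ?d z) N" using nN unfolding nf_def by blast
  have sd: "?s v \<le> ?d v" if "v : verts Q" for v using nM that unfolding nf_def by blast
  note biso = bindec_unique[OF bq pos rep[OF y(1)] rep[OF z(1)] ind[OF sd y(1,2)] ind[OF sd z(1,2)] conjI[OF refl refl]]
  have "z : GL_orbit Q ?d y" by (rule biso_GL_orbit[OF fin sd y(1) z(1) conjunct1[OF biso]])
  have ys: "y : square_zero_reps Q ?d" and zs: "z : square_zero_reps Q ?d"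
   using block_reps_subset[of Q ?s ?d, OF sd] y(1) z(1) by blast+
  have "module_iso ?R (rep_module Q ?d y) (rep_module Q ?d z)"
   unfolding module_iso_rep_module_iff[OF ys zs] by fact
  then have "module_iso ?R (rep_module Q ?d y) N" by (rule module_iso_trans[OF _ z(3)])
  then have MN: "module_iso ?R M N" by (rule module_iso_trans[OF module_iso_sym[OF left_module_rep_module[OF ys] y(3)]])
  then have NM: "module_iso ?R N M" by (rule module_iso_sym[OF lm(1)])
  have "module_iso ?R M L \<longleftrightarrow> module_iso ?R N L" for L :: "((('v, 'a) path => 'k) set, 'k vec) module"
   using module_iso_trans[OF MN, of L] module_iso_trans[OF NM, of L] by blast
  then show "?rel `` {M} = ?rel `` {N}" using M N by auto
 qed
 moreover have "?X // ?rel = (%M. ?rel `` {M}) ` ?X" unfolding quotient_def by blast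
 ultimately show ?thesis unfolding finite_representation_type_def by simp
qed

text \<open>Orbits correspond to isomorphism classes; each \<open>rep_module\<close> is first copied
  to a module on vectors, where the classes are counted.\<close>

lemma finite_indecomposable_orbits:
 assumes "finite_representation_type Q I"
 shows "finite (GL_orbit Q d ` {x : square_zero_reps Q d. rindec Q d (x :: 'a => 'k mat)})"
proof -
 let ?R = "quiver_algebra Q I" and ?X = "finite_dim_indecomposables Q I"
 let ?rel = "{(M, N). M : ?X & N : ?X & module_iso ?R M N}"
 let ?Z = "{x : square_zero_reps Q d. rindec Q d (x :: 'a => 'k mat)}"
 have "EX N. x : ?Z --> N : ?X & module_iso ?R (rep_module Q d x) N" for x
 proof (cases "x : ?Z")
  case True
  then have x: "x : square_zero_reps Q d" "rindec Q d x" by auto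
  note lm = left_module_rep_module[OF x(1)]
  obtain f :: "('v => 'k vec) => 'k vec" where f: "inj_on f (carrier (rep_module Q d x))" by (rule rep_module_injection)
  obtain N :: "((('v, 'a) path => 'k) set, 'k vec) module" where N: "left_module ?R N" "module_iso ?R (rep_module Q d x) N"
   using lm f by (rule module_transport) (rule that)
  have "finite_dim_module Q I N"
   by (rule finite_dim_module_iso[OF finite_dim_rep_module[OF x(1)] N quiver_algebra_scalar_carrier])
  moreover have "indecomposable_module ?R N"
   by (rule indecomposable_module_iso[OF lm N]) (use x in "simp add: indecomposable_rep_module_iff")
  ultimately show ?thesis using N(2) by (auto simp: finite_dim_indecomposables_def)
 qed blast
 then have "ALL x. EX N. x : ?Z --> N : ?X & module_iso ?R (rep_module Q d x) N" by (rule allI)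
 from choice[OF this] obtain N where N: "ALL x. x : ?Z --> N x : ?X & module_iso ?R (rep_module Q d x) (N x)" ..
 have "finite ((%x. ?rel `` {N x}) ` ?Z)"
 proof (rule finite_subset)
  show "finite (?X // ?rel)" using assms unfolding finite_representation_type_def .
  show "(%x. ?rel `` {N x}) ` ?Z \<subseteq> ?X // ?rel" using N by (intro image_subsetI quotientI) blast
 qed
 then show ?thesis
 proof (rule finite_image_factor)
  fix x y assume x: "x : ?Z" and y: "y : ?Z" and eq: "?rel `` {N x} = ?rel `` {N y}"
  have xs: "x : square_zero_reps Q d" "y : square_zero_reps Q d" using x y by auto
  have Nx: "N x : ?X" "module_iso ?R (rep_module Q d x) (N x)" and Ny: "N y : ?X" "module_iso ?R (rep_module Q d y) (N y)"
   using N x y by blast+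
  have "module_iso ?R (N y) (N y)" using Ny(1)
   by (intro module_iso_refl) (simp add: finite_dim_indecomposables_def finite_dim_module_def)
  then have "N y : ?rel `` {N y}" using Ny(1) by blast
  then have "module_iso ?R (N x) (N y)" unfolding eq[symmetric] by blast
  then have "module_iso ?R (rep_module Q d x) (N y)" by (rule module_iso_trans[OF Nx(2)])
  then have "module_iso ?R (rep_module Q d x) (rep_module Q d y)"
   by (rule module_iso_trans[OF _ module_iso_sym[OF left_module_rep_module[OF xs(2)] Ny(2)]])
  then have "y : GL_orbit Q d x" unfolding module_iso_rep_module_iff[OF xs] .
  moreover have "x : rep_space Q d" using xs by (simp add: square_zero_reps_def)
  ultimately show "GL_orbit Q d x = GL_orbit Q d y" using GL_orbit_eq_if_mem[OF wf_digraph_axioms] by blast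
 qed
qed

end

lemma dense_orbit_property_if_finite_representation_type:
 fixes Q :: "('v, 'a) pre_digraph" and I :: "(('v, 'a) path => 'k::alg_closed_field) set"
 assumes "square_zero_algebra Q I" and frt: "finite_representation_type Q I"
 shows "dense_orbit_property Q I"
 unfolding dense_orbit_property_def
proof (intro allI ballI)
 interpret square_zero_algebra Q I by fact
 interpret fin_digraph Q by (rule fin)
 have Rep: "Rep Q I d = square_zero_reps Q d" for d by (rule Rep_eq_square_zero_reps[OF fin I_eq])
 fix d C assume C: "C : irreducible_components (zariski Q I d)"
 let ?Z = "square_zero_reps Q d :: ('a => 'k mat) set"
 have finO: "finite (GL_orbit Q d ` ?Z)" by (rule finite_orbits[OF fin finite_indecomposable_orbits[OF frt]])
 let ?c = "%o'. SOME x. x : ?Z & GL_orbit Q d x = o'"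
 have c: "?c (GL_orbit Q d x) : ?Z & GL_orbit Q d (?c (GL_orbit Q d x)) = GL_orbit Q d x" if x: "x : ?Z" for x
 proof -
  have "EX y. y : ?Z & GL_orbit Q d y = GL_orbit Q d x" using x by blast
  from someI_ex[OF this] show ?thesis .
 qed
 show "has_dense_orbit Q I d C"
 proof (rule dense_orbit_if_finite_orbits[OF fin Rep finite_imageI[OF finO, of ?c] _ _ C])
  show "?c ` GL_orbit Q d ` ?Z \<subseteq> Rep Q I d" unfolding Rep using c by blast
  fix x assume "x : Rep Q I d"
  then have x: "x : ?Z" unfolding Rep .
  then have "x : GL_orbit Q d x" using GL_orbit_refl[OF wf_digraph_axioms, of x d] by (simp add: square_zero_reps_def)
  then have "x : GL_orbit Q d (?c (GL_orbit Q d x))" using conjunct2[OF c[OF x]] by (simp only:)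
  then show "EX z:?c ` GL_orbit Q d ` ?Z. x : GL_orbit Q d z" using x by blast
 qed
qed

text \<open>The induction on the total dimension amounts to a minimal vector with nonpositive form:
  smaller nonzero vectors have value at least 1, as \<open>exists_bindec\<close> requires. The
  resulting indecomposable is onto at the sinks and injective at the sources, so it lies in the
  component of its block, and \<open>block_component_no_dense_orbit\<close> contradicts the
  hypothesis \<open>dense\<close>.\<close>

lemma bpos_if_dense_orbits:
 fixes Q :: "('v, 'a) pre_digraph" and I :: "(('v, 'a) path => 'k::alg_closed_field) set"
 assumes "square_zero_algebra Q I"
  and dense: "!!d C. C : irreducible_components (zariski Q I d) ==> contains_indecomposable Q I d C ==> has_dense_orbit Q I d C"
 shows "bpos (verts Q) (arcs Q) (tail Q) (head Q)"
proof -
 interpret square_zero_algebra Q I by fact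
 interpret fin_digraph Q by (rule fin)
 have Rep: "Rep Q I d = square_zero_reps Q d" for d by (rule Rep_eq_square_zero_reps[OF fin I_eq])
 note bq = bquiver_digraph[OF fin]
 let ?q = "bform (verts Q) (arcs Q) (tail Q) (head Q)"
 have main: "1 \<le> ?q (%v. int (t v)) (%v. int (s v))" if "EX v:verts Q. t v ~= 0 \<or> s v ~= 0" for t s :: "'v => nat"
  using that
 proof (induction "SUM v:verts Q. t v + s v" arbitrary: t s rule: less_induct)
  case less
  show ?case
  proof (rule ccontr)
   assume neg: "\<not> 1 \<le> ?q (%v. int (t v)) (%v. int (s v))"
   \<comment> \<open>A vector \<open>(t, s)\<close> of the separated quiver is realised by the block
     with socle dimensions \<open>s\<close> inside the total dimensions
     \<open>t + s\<close>.\<close>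
   define d where "d v = t v + s v" for v
   have sd: "s v \<le> d v" for v by (simp add: d_def)
   have ct: "card {s v..<d v} = t v" and cs: "card {..<s v} = s v" for v by (simp_all add: d_def)
   let ?T = "top_index d s" and ?S = "soc_index s"
   have q: "?q (%v. int (card (?T v))) (%v. int (card (?S v))) \<le> 0" unfolding ct cs using neg by simp
   have ne: "EX v:verts Q. ?T v ~= {} \<or> ?S v ~= {}"
   proof -
    obtain v where v: "v : verts Q" "t v ~= 0 \<or> s v ~= 0" using less.prems by blast
    then have "card (?T v) ~= 0 \<or> card (?S v) ~= 0" unfolding ct cs by simp
    then have "?T v ~= {} \<or> ?S v ~= {}" by (metis card.empty)
    then show ?thesis using v(1) by blast
   qed
   have finTS: "ALL v:verts Q. finite (?T v) & finite (?S v)" by simp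
   have "\<exists>y :: 'a => nat => nat => 'k. brep (verts Q) (arcs Q) (tail Q) (head Q) ?T ?S y & bindec (verts Q) (arcs Q) (tail Q) (head Q) ?T ?S y"
   proof (rule exists_bindec[OF infinite_UNIV_alg_closed bq finTS ne q])
    fix T' S' assume sub: "ALL v:verts Q. T' v \<subseteq> ?T v & S' v \<subseteq> ?S v" and ne': "EX v:verts Q. T' v ~= {} \<or> S' v ~= {}"
     and proper: "EX v:verts Q. T' v ~= ?T v \<or> S' v ~= ?S v"
    have fin': "finite (T' v)" "finite (S' v)" if "v : verts Q" for v
     using sub that finite_subset[of "T' v" "?T v"] finite_subset[of "S' v" "?S v"] by auto
    have le: "card (T' v) \<le> t v" "card (S' v) \<le> s v" if "v : verts Q" for v
     using card_mono[of "?T v" "T' v"] card_mono[of "?S v" "S' v"] sub that unfolding ct cs by auto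
    obtain u where u: "u : verts Q" "T' u ~= ?T u \<or> S' u ~= ?S u" using proper by blast
    have "card (T' u) < t u \<or> card (S' u) < s u"
     using psubset_card_mono[of "?T u" "T' u"] psubset_card_mono[of "?S u" "S' u"] sub u unfolding ct cs by blast
    then have "card (T' u) + card (S' u) < t u + s u" using le[OF u(1)] by linarith
    then have "(SUM v:verts Q. card (T' v) + card (S' v)) < (SUM v:verts Q. t v + s v)"
     using u(1) le by (intro sum_strict_mono_ex1) (auto intro: add_mono)
    moreover have "EX v:verts Q. card (T' v) ~= 0 \<or> card (S' v) ~= 0" using ne' fin' by (auto simp: card_eq_0_iff)
    ultimately show "1 \<le> ?q (%v. int (card (T' v))) (%v. int (card (S' v)))" by (rule less.hyps)
   qed
   then obtain y0 :: "'a => nat => nat => 'k" where y0: "brep (verts Q) (arcs Q) (tail Q) (head Q) ?T ?S y0"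
    "bindec (verts Q) (arcs Q) (tail Q) (head Q) ?T ?S y0" by blast
   define x where "x = (\<lambda>ar\<in>arcs Q. tm (d (head Q ar)) (d (tail Q ar)) (y0 ar))"
   have fmx: "fm (x ar) = y0 ar" if ar: "ar : arcs Q" for ar
   proof -
    have "y0 ar : mats (?S (head Q ar)) (?T (tail Q ar))" using y0(1) ar by (simp add: brep_def)
    then have "y0 ar : mats {..<d (head Q ar)} {..<d (tail Q ar)}" by (rule mats_mono) (auto simp: d_def)
    then show ?thesis unfolding x_def restrict_apply'[OF ar] by (rule fm_tm)
   qed
   have xb: "x : block_reps Q d s"
    unfolding block_reps_def
   proof (intro CollectI conjI ballI)
    show "x : rep_space Q d" by (auto simp: x_def rep_space_def)
    show "fm (x ar) : mats {..<s (head Q ar)} {s (tail Q ar)..<d (tail Q ar)}" if "ar : arcs Q" for ar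
     using y0(1) that by (simp add: brep_def fmx)
   qed
   note rep = block_reps_brep[OF xb]
   have ind: "bindec (verts Q) (arcs Q) (tail Q) (head Q) ?T ?S (%ar. fm (x ar))"
    using y0(2) bindec_cong[of "arcs Q" "%ar. fm (x ar)" y0, OF fmx] by blast
   \<comment> \<open>Total dimension 1 is excluded because the form takes the value 1 there.\<close>
   have big: "2 \<le> (SUM v:verts Q. card (?T v) + card (?S v))"
   proof (rule ccontr)
    assume "\<not> ?thesis"
    then have "(SUM v:verts Q. card (?T v) + card (?S v)) \<le> 1" by simp
    from bindec_simple[OF bq rep rep ne conjI[OF refl refl] this] show False using q by simp
   qed
   note surj = bindec_surj[OF rep finite_verts ind big] and inj = bindec_inj[OF rep finite_verts ind big]
   have xs: "x : square_zero_reps Q d" using block_reps_subset[of Q s d, OF sd] xb by blast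
   have "rindec Q d x" by (rule bindec_rindec[OF fin sd xb surj ind])
   then have "indecomposable_module (quiver_algebra Q I) (rep_module Q d x)"
    unfolding indecomposable_rep_module_iff[OF xs] .
   moreover have "x : zariski Q I d closure_of block_orbits Q d s"
    by (rule block_component(2)[OF fin Rep sd xb surj inj])
   ultimately have "contains_indecomposable Q I d (zariski Q I d closure_of block_orbits Q d s)"
    unfolding contains_indecomposable_def by blast
   then have "has_dense_orbit Q I d (zariski Q I d closure_of block_orbits Q d s)"
    by (rule dense[OF block_component(1)[OF fin Rep sd xb surj inj]])
   moreover have "EX v:verts Q. d v ~= 0" using less.prems by (auto simp: d_def)
   ultimately show False
    using block_component_no_dense_orbit[OF fin Rep sd xb surj inj _ q] by blast
  qed
 qed
 show ?thesis
  unfolding bpos_def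
 proof (intro allI impI, elim conjE)
  fix t s :: "'v => int" assume nn: "ALL v:verts Q. 0 \<le> t v & 0 \<le> s v" and ne: "EX v:verts Q. t v ~= 0 \<or> s v ~= 0"
  have "EX v:verts Q. nat (t v) ~= 0 \<or> nat (s v) ~= 0"
  proof -
   obtain v where v: "v : verts Q" "t v ~= 0 \<or> s v ~= 0" using ne by blast
   then have "nat (t v) ~= 0 \<or> nat (s v) ~= 0" using nn by fastforce
   then show ?thesis using v(1) by blast
  qed
  then have "1 \<le> ?q (%v. int (nat (t v))) (%v. int (nat (s v)))" by (rule main)
  moreover have "?q (%v. int (nat (t v))) (%v. int (nat (s v))) = ?q t s"
   by (rule bform_cong[OF bq]) (use nn in auto)
  ultimately show "1 \<le> ?q t s" by simp
 qed
qed

theorem theorem7p2: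
  fixes Q :: "('v, 'a) pre_digraph"
    and I :: "(('v, 'a) path \<Rightarrow> 'k::alg_closed_field) set"
  assumes "fin_digraph Q"
    and "admissible_ideal Q I"
    and "ideal_prod (quiver_algebra Q I)
           (jacobson_radical (quiver_algebra Q I)) (jacobson_radical (quiver_algebra Q I))
         = {\<zero>\<^bsub>quiver_algebra Q I\<^esub>}"
  shows "(dense_orbit_property Q I \<longleftrightarrow>
            (\<forall>d. \<forall>C\<in>irreducible_components (zariski Q I d).
               contains_indecomposable Q I d C \<longrightarrow> has_dense_orbit Q I d C))
       \<and> (dense_orbit_property Q I \<longleftrightarrow> finite_representation_type Q I)"
proof -
 have "I = arrow_ideal_power Q 2" by (rule square_zero_ideal[OF assms])
 then have sq: "square_zero_algebra Q I"
  using assms(1,2) by (simp add: square_zero_algebra_def admissible_ideal_def)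
 interpret square_zero_algebra Q I by (rule sq)
 have 1: "has_dense_orbit Q I d C" if "dense_orbit_property Q I" "C : irreducible_components (zariski Q I d)" for d C
  using that unfolding dense_orbit_property_def by blast
 have 2: "finite_representation_type Q I"
  if "ALL d. ALL C:irreducible_components (zariski Q I d). contains_indecomposable Q I d C --> has_dense_orbit Q I d C"
  by (rule finite_representation_type_if_bpos[OF bpos_if_dense_orbits[OF sq]]) (use that in blast)
 show ?thesis using 1 2 dense_orbit_property_if_finite_representation_type[OF sq] by blast
qed

end
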